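(* (a) Every graph property $\mathcal P$ for which $\overline{\mathcal P}$ consists of (almost everywhere) $0$-$1$ valued functions is flexible. (b) If a graph property is flexible, then so are its upward closure and its downward closure. (c) If a graph property $\mathcal P$ is flexible, then so is the property obtained by complementing all graphs in $\mathcal P$. (d) Every hereditary graph property is flexible.
   Context: Graphs are finite and simple; a graph property is a class of graphs invariant under isomorphism; it is hereditary if whenever a graph has the property, so do all its induced subgraphs. The upward closure of a graph property $\mathcal P$ consists of all graphs that have a spanning subgraph in $\mathcal P$; the downward closure consists of all graphs that are spanning subgraphs of a graph in $\mathcal P$. $\mathcal W_0$ is the set of symmetric measurable functions $W:[0,1]^2\to[0,1]$. For a graph $F$ on $[k]$, $t(F,W)=\int_{[0,1]^k}\prod_{ij\in E(F)}W(x_i,x_j)\,dx$, and $t(F,G)$ is the probability that a uniformly random map $V(F)\to V(G)$ preserves adjacency. The closure $\overline{\mathcal P}\subseteq\mathcal W_0$ of a graph property $\mathcal P$ is the set of all $W\in\mathcal W_0$ for which there is a sequence of graphs $G_n\in\mathcal P$ with $|V(G_n)|\to\infty$ and $t(F,G_n)\to t(F,W)$ for every graph $F$. A function $U\in\mathcal W_0$ is a flexing of $W\in\mathcal W_0$ if $U(x,y)=W(x,y)$ for all $x,y$ with $W(x,y)\in\{0,1\}$. A function property (subset of $\mathcal W_0$) is flexible if it contains every flexing of each of its members. A graph property is flexible if its closure is flexible. *)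

theory Defs
  imports
    "Graph_Theory.Pair_Digraph"
    "Graph_Theory.Digraph_Isomorphism"
    "HOL-Probability.Probability"
begin

text \<open>
  A finite simple graph is a \<^const>\<open>pair_graph\<close>: a finite vertex set with an irreflexive
  symmetric arc relation, so that an undirected edge is a pair of opposite arcs. Vertices are
  natural numbers, which represents every finite graph up to isomorphism.
\<close>

type_synonym ngraph = "nat pair_pre_digraph"

definition graph_property :: "ngraph set \<Rightarrow> bool" where
  "graph_property P \<longleftrightarrow>
     (\<forall>G\<in>P. pair_graph G) \<and>
     (\<forall>G\<in>P. \<forall>H. pair_graph H \<and> digraph_iso (with_proj G) (with_proj H) \<longrightarrow> H \<in> P)"

definition hereditary :: "ngraph set \<Rightarrow> bool" where
  "hereditary P \<longleftrightarrow>
     (\<forall>G\<in>P. \<forall>H. pair_graph H \<and> induced_subgraph (with_proj H) (with_proj G) \<longrightarrow> H \<in> P)"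

definition upward_closure :: "ngraph set \<Rightarrow> ngraph set" where
  "upward_closure P = {G. pair_graph G \<and> (\<exists>H\<in>P. spanning (with_proj H) (with_proj G))}"

definition downward_closure :: "ngraph set \<Rightarrow> ngraph set" where
  "downward_closure P = {H. pair_graph H \<and> (\<exists>G\<in>P. spanning (with_proj H) (with_proj G))}"

definition complement_graph :: "ngraph \<Rightarrow> ngraph" where
  "complement_graph G =
     \<lparr> pverts = pverts G,
       parcs = {(u, v). u \<in> pverts G \<and> v \<in> pverts G \<and> u \<noteq> v \<and> (u, v) \<notin> parcs G} \<rparr>"

abbreviation unit_square :: "(real \<times> real) set" where
  "unit_square \<equiv> {0..1} \<times> {0..1}"

text \<open>
  ``Measurable'' means Lebesgue measurable. Functions on the unit square are rendered as
  extensional functions, i.e. they take the value \<^const>\<open>undefined\<close> elsewhere.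
\<close>

definition W0 :: "(real \<times> real \<Rightarrow> real) set" where
  "W0 = {W \<in> unit_square \<rightarrow>\<^sub>E {0..1}.
           W \<in> borel_measurable (lebesgue_on unit_square) \<and>
           (\<forall>x\<in>{0..1}. \<forall>y\<in>{0..1}. W (x, y) = W (y, x))}"

text \<open>
  The product runs over the arcs with increasing end points, so that every undirected edge
  contributes one factor. The measure is completed because for a Lebesgue measurable \<open>W\<close> the
  integrand need not be measurable with respect to the product \<open>\<sigma>\<close>-algebra.
\<close>

definition t_fun :: "ngraph \<Rightarrow> (real \<times> real \<Rightarrow> real) \<Rightarrow> real" where
  "t_fun F W =
     (\<integral>x. (\<Prod>(i, j)\<in>{(i, j). (i, j) \<in> parcs F \<and> i < j}. W (x i, x j))
        \<partial>completion (Pi\<^sub>M (pverts F) (\<lambda>_. restrict_space lborel {0..1})))"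

text \<open>Only meaningful if \<open>G\<close> has at least one vertex.\<close>

definition t_graph :: "ngraph \<Rightarrow> ngraph \<Rightarrow> real" where
  "t_graph F G =
     measure_pmf.prob (pmf_of_set (pverts F \<rightarrow>\<^sub>E pverts G))
       {h. \<forall>(u, v)\<in>parcs F. (h u, h v) \<in> parcs G}"

definition property_closure :: "ngraph set \<Rightarrow> (real \<times> real \<Rightarrow> real) set" where
  "property_closure P =
     {W \<in> W0. \<exists>G :: nat \<Rightarrow> ngraph.
        (\<forall>n. G n \<in> P) \<and>
        filterlim (\<lambda>n. card (pverts (G n))) at_top sequentially \<and>
        (\<forall>F. pair_graph F \<longrightarrow> (\<lambda>n. t_graph F (G n)) \<longlonglongrightarrow> t_fun F W)}"

definition flexing :: "(real \<times> real \<Rightarrow> real) \<Rightarrow> (real \<times> real \<Rightarrow> real) \<Rightarrow> bool" where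
  "flexing U W \<longleftrightarrow> U \<in> W0 \<and> W \<in> W0 \<and>
     (\<forall>x\<in>{0..1}. \<forall>y\<in>{0..1}. W (x, y) \<in> {0, 1} \<longrightarrow> U (x, y) = W (x, y))"

definition flexible_fun_property :: "(real \<times> real \<Rightarrow> real) set \<Rightarrow> bool" where
  "flexible_fun_property \<F> \<longleftrightarrow> (\<forall>W\<in>\<F>. \<forall>U. flexing U W \<longrightarrow> U \<in> \<F>)"

definition flexible :: "ngraph set \<Rightarrow> bool" where
  "flexible P \<longleftrightarrow> flexible_fun_property (property_closure P)"

end

theory Submission
  imports Defs
begin

text \<open>
  Convergence of graphs is convergence of all densities, which amounts to convergence in cut norm
  after labelling the vertices by points of the unit interval; graph sequences are compact for it.

  For a hereditary property, let \<open>u\<close> be a flexing of a limit \<open>w\<close>. A graph that is sampled from \<open>u\<close> with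
  positive probability is also sampled from \<open>w\<close> with positive probability, hence is an induced
  subgraph of a graph with the property, and large sampled graphs converge to \<open>u\<close>.

  For upward closures, let \<open>G n\<close> converge to \<open>w\<close> and have spanning subgraphs \<open>H n\<close> in the flexible
  property. After passing to a subsequence, both converge jointly, to graphons \<open>W' \<le> W''\<close>, where \<open>W''\<close> has
  the same densities as \<open>w\<close> and so agrees with it up to measure preserving maps. Along these maps
  the minimum of \<open>u\<close> and \<open>W'\<close> is a flexing of \<open>W'\<close>, hence a limit of graphs of the property, and adding
  random edges to these graphs yields supergraphs that converge to \<open>u\<close>. Downward closures follow
  by complementation.
\<close>

text \<open>Densities determine a limit only up to measure preserving maps, which need not be
  invertible. Two graphons with equal densities are therefore compared after pulling both back to a
  third copy of the interval, and \<open>u\<close> and \<open>W'\<close> meet there as well.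
  Closeness in cut norm is handled through \<open>C4\<close>, the four-cycle density of a
  difference: it is equivalent to the cut norm up to powers, but being an integral it has computable
  expectations over random graphs and is invariant under pullbacks. The minimum of \<open>u\<close>
  and \<open>W'\<close> flexes \<open>W'\<close>: where \<open>W' = 0\<close> it is 0, and
  \<open>W' = 1\<close> forces \<open>W'' = 1\<close>, hence \<open>w = 1\<close> and
  \<open>u = 1\<close>. Random edges have to be added without disturbing the vertices of the given
  graph. To this end every vertex draws its point from its own fibre of the labelling; a pair that
  is already an edge then gets probability one, and the other pairs a conditional probability
  computed from the two limits. Random graphs are treated as finite weighted sums over edge sets,
  with Chebyshev's inequality in place of almost sure convergence.\<close>

context prob_space
begin

section \<open>Bounded integrands over a probability space\<close>

lemma integrable_bdd:
  fixes f :: "'a \<Rightarrow> real"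
  assumes "f \<in> borel_measurable M" "\<And>x. x \<in> space M \<Longrightarrow> \<bar>f x\<bar> \<le> B"
  shows "integrable M f"
  by (rule integrable_const_bound[of _ B]) (use assms in auto)

lemma abs_integral_le:
  fixes f :: "'a \<Rightarrow> real"
  assumes "f \<in> borel_measurable M" "\<And>x. x \<in> space M \<Longrightarrow> \<bar>f x\<bar> \<le> B"
  shows "\<bar>\<integral>x. f x \<partial>M\<bar> \<le> B"
proof -
  have i: "integrable M f" by (rule integrable_bdd[OF assms])
  have "(\<integral>x. f x \<partial>M) \<le> B" 
    by (rule integral_le_const[OF i]) (use assms(2) in \<open>force simp: abs_le_iff\<close>)
  moreover have "- B \<le> (\<integral>x. f x \<partial>M)"
    by (rule integral_ge_const[OF i]) (use assms(2) in \<open>force simp: abs_le_iff\<close>)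
  ultimately show ?thesis by (auto simp: abs_le_iff)
qed

text \<open>Nonnegativity of the variance. This is the form of the Cauchy-Schwarz inequality behind
  the cut norm estimates.\<close>

lemma square_integral_le:
  fixes f :: "'a \<Rightarrow> real"
  assumes [measurable]: "f \<in> borel_measurable M" and b: "\<And>x. x \<in> space M \<Longrightarrow> \<bar>f x\<bar> \<le> B"
  shows "(\<integral>x. f x \<partial>M)\<^sup>2 \<le> (\<integral>x. (f x)\<^sup>2 \<partial>M)"
proof -
  have i: "integrable M f" by (rule integrable_bdd[OF assms])
  have i2: "integrable M (\<lambda>x. (f x)\<^sup>2)"
    by (rule integrable_bdd[where B="B\<^sup>2"]) (auto dest!: b simp: abs_le_square_iff intro: power2_le_iff_abs_le[THEN iffD2])
  have "0 \<le> variance f" by (simp)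
  then show ?thesis using variance_eq[OF i i2] by simp
qed

lemma integral_swap:
  fixes f :: "'a \<Rightarrow> 'a \<Rightarrow> real"
  assumes [measurable]: "(\<lambda>(x, y). f x y) \<in> borel_measurable (M \<Otimes>\<^sub>M M)"
    and b: "\<And>x y. x \<in> space M \<Longrightarrow> y \<in> space M \<Longrightarrow> \<bar>f x y\<bar> \<le> B"
  shows "(\<integral>x. \<integral>y. f x y \<partial>M \<partial>M) = (\<integral>y. \<integral>x. f x y \<partial>M \<partial>M)"
proof -
  interpret P: pair_prob_space M M ..
  have "integrable (M \<Otimes>\<^sub>M M) (\<lambda>(x, y). f x y)"
    by (rule P.P.integrable_bdd[where B=B]) (auto simp: space_pair_measure b)
  from P.Fubini_integral[OF this] show ?thesis by simp
qed

end

section \<open>The cut norm and the four-cycle density\<close>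

text \<open>The density of the bipartite four-cycle with sides \<open>x, x'\<close> and
  \<open>y, y'\<close> in a signed kernel; the inner square hides the second variable
  \<open>x'\<close>. It is the fourth power of the box norm of \<open>D\<close>.\<close>

definition C4 :: "'a measure \<Rightarrow> ('a \<times> 'a \<Rightarrow> real) \<Rightarrow> real" where
  "C4 M D = (\<integral>y. \<integral>y'. (\<integral>x. D (x, y) * D (x, y') \<partial>M)\<^sup>2 \<partial>M \<partial>M)"

text \<open>An upper bound for the cut norm as a predicate, so that no supremum has to be handled.
  Testing with functions bounded by 1 instead of sets changes the norm by a factor of at most 4, see
  \<open>cutf_of_sets\<close>.\<close>

definition cutf :: "'a measure \<Rightarrow> ('a \<times> 'a \<Rightarrow> real) \<Rightarrow> real \<Rightarrow> bool" where
  "cutf M D e \<longleftrightarrow> (\<forall>f\<in>borel_measurable M. \<forall>g\<in>borel_measurable M.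
     (\<forall>x\<in>space M. \<bar>f x\<bar> \<le> (1::real)) \<longrightarrow> (\<forall>x\<in>space M. \<bar>g x\<bar> \<le> (1::real)) \<longrightarrow>
     \<bar>\<integral>x. \<integral>y. D (x, y) * (f x * g y) \<partial>M \<partial>M\<bar> \<le> e)"

context prob_space
begin

text \<open>Two applications of the Cauchy-Schwarz inequality: squaring in \<open>x\<close> removes
  \<open>f\<close> and leaves the integral of the square of \<open>h\<close>; squaring in
  \<open>y\<close> and \<open>y'\<close> removes the two copies of \<open>g\<close> and leaves the
  integral of the square of \<open>K\<close>.\<close>

lemma cut_le_C4:
  assumes [measurable]: "D \<in> borel_measurable (M \<Otimes>\<^sub>M M)"
    and D: "\<And>x y. x \<in> space M \<Longrightarrow> y \<in> space M \<Longrightarrow> \<bar>D (x, y)\<bar> \<le> B"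
    and [measurable]: "f \<in> borel_measurable M" "g \<in> borel_measurable M"
    and f: "\<And>x. x \<in> space M \<Longrightarrow> \<bar>f x\<bar> \<le> 1" and g: "\<And>x. x \<in> space M \<Longrightarrow> \<bar>g x\<bar> \<le> 1"
  shows "(\<integral>x. \<integral>y. D (x, y) * (f x * g y) \<partial>M \<partial>M) ^ 4 \<le> C4 M D"
proof -
  have B: "0 \<le> B" using D not_empty by fastforce
  define h where "h x = (\<integral>y. D (x, y) * g y \<partial>M)" for x
  define K where "K y y' = (\<integral>x. D (x, y) * D (x, y') \<partial>M)" for y y'
  have [measurable]: "h \<in> borel_measurable M" unfolding h_def by measurable
  have [measurable]: "(\<lambda>(x, y). K x y) \<in> borel_measurable (M \<Otimes>\<^sub>M M)" unfolding K_def by measurable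
  have DgB: "\<bar>D (x, y) * g y\<bar> \<le> B" if "x \<in> space M" "y \<in> space M" for x y
    using mult_mono[OF D[OF that] g[OF that(2)]] B by (simp add: abs_mult)
  have hB: "\<bar>h x\<bar> \<le> B" if "x \<in> space M" for x
    unfolding h_def by (rule abs_integral_le) (use that DgB in auto)
  have KB: "\<bar>K y y'\<bar> \<le> B * B" if "y \<in> space M" "y' \<in> space M" for y y'
    unfolding K_def by (rule abs_integral_le) (use that D B in \<open>auto simp: abs_mult intro!: mult_mono\<close>)
  have fh: "\<bar>f x * h x\<bar> \<le> B" if "x \<in> space M" for x
    using mult_mono[OF f[OF that] hB[OF that]] by (simp add: abs_mult)
  have h2: "(h x)\<^sup>2 \<le> B\<^sup>2" if "x \<in> space M" for x
    using hB[OF that] B by (simp add: power2_le_iff_abs_le)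
  have "(\<integral>x. \<integral>y. D (x, y) * (f x * g y) \<partial>M \<partial>M) = (\<integral>x. f x * h x \<partial>M)"
    unfolding h_def by (simp add: ac_simps flip: integral_mult_right_zero)
  also have "\<dots>\<^sup>2 \<le> (\<integral>x. (f x * h x)\<^sup>2 \<partial>M)" by (rule square_integral_le[where B=B]) (use fh in auto)
  also have "\<dots> \<le> (\<integral>x. (h x)\<^sup>2 \<partial>M)"
  proof (rule integral_mono)
    show "integrable M (\<lambda>x. (f x * h x)\<^sup>2)"
      by (rule integrable_bdd[where B="B\<^sup>2"]) (use fh B in \<open>auto simp: power2_le_iff_abs_le\<close>)
    show "integrable M (\<lambda>x. (h x)\<^sup>2)" by (rule integrable_bdd[where B="B\<^sup>2"]) (use h2 in auto)
    show "(f x * h x)\<^sup>2 \<le> (h x)\<^sup>2" if "x \<in> space M" for x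
      using mult_mono[OF f[OF that], of "\<bar>h x\<bar>" "\<bar>h x\<bar>"] by (simp add: abs_le_square_iff[symmetric] abs_mult)
  qed
  finally have 1: "(\<integral>x. \<integral>y. D (x, y) * (f x * g y) \<partial>M \<partial>M)\<^sup>2 \<le> (\<integral>x. (h x)\<^sup>2 \<partial>M)" .
  have DDB: "\<bar>D (x, y) * g y * (D (x, y') * g y')\<bar> \<le> B * B"
    if "x \<in> space M" "y \<in> space M" "y' \<in> space M" for x y y'
    using mult_mono[OF DgB[OF that(1,2)] DgB[OF that(1,3)]] B by (simp add: abs_mult)
  \<comment> \<open>The square is expanded with a second variable \<open>y'\<close>, and
    \<open>x\<close> is moved inside so that it integrates to the kernel \<open>K\<close>.\<close>
  have "(\<integral>x. (h x)\<^sup>2 \<partial>M) = (\<integral>x. \<integral>y. \<integral>y'. D (x, y) * g y * (D (x, y') * g y') \<partial>M \<partial>M \<partial>M)"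
    unfolding h_def power2_eq_square by simp
  also have "\<dots> = (\<integral>y. \<integral>x. \<integral>y'. D (x, y) * g y * (D (x, y') * g y') \<partial>M \<partial>M \<partial>M)"
    by (rule integral_swap[where B="B * B"])
       (use DDB in \<open>auto simp del: integral_mult_right_zero integral_mult_left_zero intro!: abs_integral_le\<close>)
  also have "\<dots> = (\<integral>y. \<integral>y'. \<integral>x. D (x, y) * g y * (D (x, y') * g y') \<partial>M \<partial>M \<partial>M)"
    by (rule Bochner_Integration.integral_cong[OF refl],
        rule integral_swap[where B="B * B"])
       (use DDB in \<open>auto\<close>)
  also have "\<dots> = (\<integral>y. \<integral>y'. K y y' * (g y * g y') \<partial>M \<partial>M)"
    unfolding K_def by (simp add: ac_simps flip: integral_mult_right_zero)
  finally have 2: "(\<integral>x. (h x)\<^sup>2 \<partial>M) = (\<integral>y. \<integral>y'. K y y' * (g y * g y') \<partial>M \<partial>M)" .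
  have gg: "\<bar>g y * g y'\<bar> \<le> 1" if "y \<in> space M" "y' \<in> space M" for y y'
    using mult_mono[OF g[OF that(1)] g[OF that(2)]] by (simp add: abs_mult)
  have Kgg: "\<bar>K y y' * (g y * g y')\<bar> \<le> B * B" if "y \<in> space M" "y' \<in> space M" for y y'
    using mult_mono[OF KB[OF that] gg[OF that]] B by (simp add: abs_mult)
  have Kgg2: "(K y y' * (g y * g y'))\<^sup>2 \<le> (K y y')\<^sup>2" if "y \<in> space M" "y' \<in> space M" for y y'
    using mult_left_mono[OF gg[OF that], of "\<bar>K y y'\<bar>"] by (simp add: abs_le_square_iff[symmetric] abs_mult)
  have K2: "(K y y')\<^sup>2 \<le> (B*B)\<^sup>2" if "y \<in> space M" "y' \<in> space M" for y y'
    using KB[OF that] B by (simp add: power2_le_iff_abs_le)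
  have "(\<integral>y. \<integral>y'. K y y' * (g y * g y') \<partial>M \<partial>M)\<^sup>2 \<le> (\<integral>y. (\<integral>y'. K y y' * (g y * g y') \<partial>M)\<^sup>2 \<partial>M)"
    by (rule square_integral_le[where B="B*B"]) (auto intro!: abs_integral_le Kgg)
  also have "\<dots> \<le> (\<integral>y. (\<integral>y'. (K y y')\<^sup>2 \<partial>M) \<partial>M)"
  proof (rule integral_mono)
    show "integrable M (\<lambda>y. (\<integral>y'. K y y' * (g y * g y') \<partial>M)\<^sup>2)"
      by (rule integrable_bdd[where B="(B*B)\<^sup>2"]) 
         (use B in \<open>auto simp: power2_le_iff_abs_le intro!: abs_integral_le Kgg\<close>)
    show "integrable M (\<lambda>y. \<integral>y'. (K y y')\<^sup>2 \<partial>M)"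
      by (rule integrable_bdd[where B="(B*B)\<^sup>2"], measurable, rule abs_integral_le) (auto intro!: K2)
    show "(\<integral>y'. K y y' * (g y * g y') \<partial>M)\<^sup>2 \<le> (\<integral>y'. (K y y')\<^sup>2 \<partial>M)" if [measurable]: "y \<in> space M" for y
    proof -
      have "(\<integral>y'. K y y' * (g y * g y') \<partial>M)\<^sup>2 \<le> (\<integral>y'. (K y y' * (g y * g y'))\<^sup>2 \<partial>M)"
        by (rule square_integral_le[where B="B*B"]) (auto intro!: Kgg that)
      also have "\<dots> \<le> (\<integral>y'. (K y y')\<^sup>2 \<partial>M)"
        by (rule integral_mono; (rule integrable_bdd[where B="(B*B)\<^sup>2"])?)
           (use that K2 Kgg2 order_trans[OF Kgg2 K2] in auto)
      finally show ?thesis .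
    qed
  qed
  also have "\<dots> = C4 M D" unfolding K_def C4_def ..
  finally have 3: "(\<integral>y. \<integral>y'. K y y' * (g y * g y') \<partial>M \<partial>M)\<^sup>2 \<le> C4 M D" .
  have "(\<integral>x. \<integral>y. D (x, y) * (f x * g y) \<partial>M \<partial>M) ^ 4 = ((\<integral>x. \<integral>y. D (x, y) * (f x * g y) \<partial>M \<partial>M)\<^sup>2)\<^sup>2"
    by simp
  also have "\<dots> \<le> (\<integral>x. (h x)\<^sup>2 \<partial>M)\<^sup>2" using 1 by (intro power_mono) auto
  also have "\<dots> \<le> C4 M D" using 2 3 by simp
  finally show ?thesis .
qed

text \<open>For fixed \<open>x'\<close> and \<open>y'\<close> the three factors other than
  \<open>D (x', y')\<close> are \<open>D (x, y)\<close>, a function of \<open>x\<close> and a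
  function of \<open>y\<close>, the last two bounded by 1. They form a test of the cut norm, so the
  integral over \<open>x\<close> and \<open>y\<close> is at most \<open>e\<close>; the remaining
  factor is bounded by 1.\<close>

lemma C4_le_cutf:
  assumes [measurable]: "D \<in> borel_measurable (M \<Otimes>\<^sub>M M)"
    and D: "\<And>x y. x \<in> space M \<Longrightarrow> y \<in> space M \<Longrightarrow> \<bar>D (x, y)\<bar> \<le> 1"
    and cut: "cutf M D e"
  shows "C4 M D \<le> e"
proof -
  have D2: "\<bar>D (a,b) * D (c,d)\<bar> \<le> 1" if "a \<in> space M" "b \<in> space M" "c \<in> space M" "d \<in> space M" for a b c d
    using mult_mono[OF D[OF that(1,2)] D[OF that(3,4)]] by (simp add: abs_mult)
  have D4: "\<bar>D (x,y) * D (x,y') * (D (x',y) * D (x',y'))\<bar> \<le> 1" 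
    if "x \<in> space M" "y \<in> space M" "x' \<in> space M" "y' \<in> space M" for x y x' y'
    using mult_mono[OF D2[of x y x y'] D2[of x' y x' y']] that by (simp add: abs_mult)
  have D3: "\<bar>D (x', y') * (\<integral>x. \<integral>y. D (x, y) * (D (x, y') * D (x', y)) \<partial>M \<partial>M)\<bar> \<le> e"
    if [measurable]: "x' \<in> space M" "y' \<in> space M" for x' y'
  proof -
    have "\<bar>\<integral>x. \<integral>y. D (x, y) * (D (x, y') * D (x', y)) \<partial>M \<partial>M\<bar> \<le> e"
      using cut[unfolded cutf_def, rule_format, of "\<lambda>x. D (x, y')" "\<lambda>y. D (x', y)"] that D by simp
    from mult_mono[OF D[OF that] this] show ?thesis by (simp add: abs_mult)
  qed
  have "C4 M D = (\<integral>y. \<integral>y'. \<integral>x. \<integral>x'. D (x,y) * D (x,y') * (D (x',y) * D (x',y')) \<partial>M \<partial>M \<partial>M \<partial>M)"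
    unfolding C4_def power2_eq_square by simp
  \<comment> \<open>Adjacent integrals are exchanged until \<open>y'\<close> and \<open>x'\<close>
    stand outside.\<close>
  also have "\<dots> = (\<integral>y'. \<integral>y. \<integral>x. \<integral>x'. D (x,y) * D (x,y') * (D (x',y) * D (x',y')) \<partial>M \<partial>M \<partial>M \<partial>M)"
    by (rule integral_swap[where B=1])
       (auto simp del: integral_mult_right_zero integral_mult_left_zero intro!: abs_integral_le D4)
  also have "\<dots> = (\<integral>y'. \<integral>x. \<integral>y. \<integral>x'. D (x,y) * D (x,y') * (D (x',y) * D (x',y')) \<partial>M \<partial>M \<partial>M \<partial>M)"
    by (rule Bochner_Integration.integral_cong[OF refl],
        rule integral_swap[where B=1])
       (auto simp del: integral_mult_right_zero integral_mult_left_zero intro!: abs_integral_le D4)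
  also have "\<dots> = (\<integral>y'. \<integral>x. \<integral>x'. \<integral>y. D (x,y) * D (x,y') * (D (x',y) * D (x',y')) \<partial>M \<partial>M \<partial>M \<partial>M)"
    by (rule Bochner_Integration.integral_cong[OF refl], rule Bochner_Integration.integral_cong[OF refl],
        rule integral_swap[where B=1])
       (auto intro!: D4)
  also have "\<dots> = (\<integral>y'. \<integral>x'. \<integral>x. \<integral>y. D (x,y) * D (x,y') * (D (x',y) * D (x',y')) \<partial>M \<partial>M \<partial>M \<partial>M)"
    by (rule Bochner_Integration.integral_cong[OF refl],
        rule integral_swap[where B=1])
       (auto simp del: integral_mult_right_zero integral_mult_left_zero intro!: abs_integral_le D4)
  also have "\<dots> = (\<integral>y'. \<integral>x'. D (x', y') * (\<integral>x. \<integral>y. D (x, y) * (D (x, y') * D (x', y)) \<partial>M \<partial>M) \<partial>M \<partial>M)"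
    by (simp add: ac_simps flip: integral_mult_right_zero)
  also have "\<dots> \<le> e"
    using D3 by (intro order_trans[OF abs_ge_self abs_integral_le] abs_integral_le) auto
  finally show ?thesis .
qed

lemma cutf_of_C4:
  assumes "D \<in> borel_measurable (M \<Otimes>\<^sub>M M)"
    and "\<And>x y. x \<in> space M \<Longrightarrow> y \<in> space M \<Longrightarrow> \<bar>D (x, y)\<bar> \<le> B"
    and "C4 M D \<le> e ^ 4" "0 \<le> e"
  shows "cutf M D e"
  unfolding cutf_def
proof (intro ballI impI)
  fix f g :: "'a \<Rightarrow> real" assume "f \<in> borel_measurable M" "g \<in> borel_measurable M" "\<forall>x\<in>space M. \<bar>f x\<bar> \<le> 1" "\<forall>x\<in>space M. \<bar>g x\<bar> \<le> 1"
  then have "(\<integral>x. \<integral>y. D (x, y) * (f x * g y) \<partial>M \<partial>M) ^ 4 \<le> e ^ 4"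
    using cut_le_C4[OF assms(1,2), of f g] assms(3) by force
  then have "\<bar>\<integral>x. \<integral>y. D (x, y) * (f x * g y) \<partial>M \<partial>M\<bar> ^ 4 \<le> e ^ 4"
    by (simp add: power_even_abs)
  then show "\<bar>\<integral>x. \<integral>y. D (x, y) * (f x * g y) \<partial>M \<partial>M\<bar> \<le> e"
    using power_mono_iff[of "\<bar>\<integral>x. \<integral>y. D (x, y) * (f x * g y) \<partial>M \<partial>M\<bar>" e 4] assms(4)
    by (simp only: abs_ge_zero)
qed

lemma C4_nonneg: "0 \<le> C4 M D"
  unfolding C4_def by (intro integral_nonneg_AE AE_I2) auto

end

text \<open>The reason for using \<open>C4\<close> instead of the cut norm across labellings: the
  variables \<open>x\<close>, \<open>y'\<close> and \<open>y\<close> are substituted one at a time.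
  Test functions on \<open>M\<close>, in contrast, need not factor through
  \<open>\<phi>\<close>.\<close>

lemma C4_distr:
  assumes "prob_space M" and [measurable]: "\<phi> \<in> measurable M N" and d: "distr M N \<phi> = N"
    and [measurable]: "D \<in> borel_measurable (N \<Otimes>\<^sub>M N)"
  shows "C4 M (\<lambda>(x, y). D (\<phi> x, \<phi> y)) = C4 N D"
proof -
  interpret prob_space M by fact
  interpret N: prob_space N using prob_space_distr[of \<phi> N] d by simp
  have *: "(\<integral>x. f (\<phi> x) \<partial>M) = (\<integral>x. f x \<partial>N)" if [measurable]: "f \<in> borel_measurable N" for f :: "_ \<Rightarrow> real"
    using integral_distr[of \<phi> M N f] d by simp
  have 1: "(\<integral>x. D (\<phi> x, y) * D (\<phi> x, y') \<partial>M) = (\<integral>x. D (x, y) * D (x, y') \<partial>N)" 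
    if [measurable]: "y \<in> space N" "y' \<in> space N" for y y'
    by (rule *) measurable
  have 2: "(\<integral>y'. (\<integral>x. D (x, y) * D (x, \<phi> y') \<partial>N)\<^sup>2 \<partial>M) = (\<integral>y'. (\<integral>x. D (x, y) * D (x, y') \<partial>N)\<^sup>2 \<partial>N)"
    if [measurable]: "y \<in> space N" for y
    by (rule *) measurable
  have 3: "(\<integral>y. (\<integral>y'. (\<integral>x. D (x, \<phi> y) * D (x, y') \<partial>N)\<^sup>2 \<partial>N) \<partial>M) = (\<integral>y. (\<integral>y'. (\<integral>x. D (x, y) * D (x, y') \<partial>N)\<^sup>2 \<partial>N) \<partial>N)"
    by (rule *) measurable
  have s: "\<phi> x \<in> space N" if "x \<in> space M" for x using that measurable_space[of \<phi> M N x] by simp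
  show ?thesis
    unfolding C4_def using 1 2 3 s by (simp cong: Bochner_Integration.integral_cong)
qed

lemma integrable_times_bounded:
  fixes k F :: "'b \<Rightarrow> real"
  assumes k: "integrable N k" and F: "F \<in> borel_measurable N" "\<And>z. z \<in> space N \<Longrightarrow> \<bar>F z\<bar> \<le> 1"
  shows "integrable N (\<lambda>z. k z * F z)"
proof (rule Bochner_Integration.integrable_bound[OF k])
  show "AE z in N. norm (k z * F z) \<le> norm (k z)"
  proof (rule AE_I2)
    fix z assume "z \<in> space N"
    from mult_left_mono[OF F(2)[OF this], of "\<bar>k z\<bar>"] show "norm (k z * F z) \<le> norm (k z)"
      by (simp add: abs_mult)
  qed
qed (use k F in measurable)

context prob_space
begin

lemma pair_prob_space_self: "pair_prob_space M M" ..

lemma pair_integrable_bdd: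
  fixes f :: "'a \<times> 'a \<Rightarrow> real"
  assumes "f \<in> borel_measurable (M \<Otimes>\<^sub>M M)"
    and b: "\<And>x y. x \<in> space M \<Longrightarrow> y \<in> space M \<Longrightarrow> \<bar>f (x, y)\<bar> \<le> B"
  shows "integrable (M \<Otimes>\<^sub>M M) f"
proof -
  interpret P: pair_prob_space M M by (rule pair_prob_space_self)
  show ?thesis by (rule P.P.integrable_bdd[where B=B]) (auto simp: assms space_pair_measure)
qed

lemma pair_integrable_indicator:
  "A \<in> sets (M \<Otimes>\<^sub>M M) \<Longrightarrow> integrable (M \<Otimes>\<^sub>M M) (indicator A :: _ \<Rightarrow> real)"
  by (rule pair_integrable_bdd[where B=1]) (auto simp: indicator_def[abs_def])

lemma integral_pair_eq:
  fixes f :: "'a \<times> 'a \<Rightarrow> real"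
  assumes "f \<in> borel_measurable (M \<Otimes>\<^sub>M M)"
    and b: "\<And>x y. x \<in> space M \<Longrightarrow> y \<in> space M \<Longrightarrow> \<bar>f (x, y)\<bar> \<le> B"
  shows "(\<integral>x. \<integral>y. f (x, y) \<partial>M \<partial>M) = (\<integral>z. f z \<partial>(M \<Otimes>\<^sub>M M))"
proof -
  interpret P: pair_prob_space M M by (rule pair_prob_space_self)
  show ?thesis using P.integral_fst'[OF pair_integrable_bdd[OF assms]] .
qed

text \<open>Pointwise \<open>\<bar>h x * f x\<bar> \<le> \<bar>h x\<bar>\<close>, and the integral
  of \<open>\<bar>h\<bar>\<close> is a difference of two integrals over sets, namely where
  \<open>h\<close> is positive and where it is not. Hence the factor 2.\<close>

lemma abs_integral_mult_le_of_sets: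
  fixes h f :: "'a \<Rightarrow> real"
  assumes [measurable]: "h \<in> borel_measurable M" "f \<in> borel_measurable M"
    and hB: "\<And>x. x \<in> space M \<Longrightarrow> \<bar>h x\<bar> \<le> B"
    and sets: "\<And>A. A \<in> sets M \<Longrightarrow> \<bar>\<integral>x. h x * indicator A x \<partial>M\<bar> \<le> e"
    and f: "\<And>x. x \<in> space M \<Longrightarrow> \<bar>f x\<bar> \<le> 1"
  shows "\<bar>\<integral>x. h x * f x \<partial>M\<bar> \<le> 2 * e"
proof -
  have B: "0 \<le> B" using hB not_empty by fastforce
  define P where "P = {x\<in>space M. 0 < h x}"
  have [measurable]: "P \<in> sets M" unfolding P_def by measurable
  have ih: "integrable M (\<lambda>x. h x * indicator A x)" if [measurable]: "A \<in> sets M" for A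
    by (rule integrable_bdd[where B=B]) (use hB B in \<open>auto simp: indicator_def\<close>)
  have hf: "\<bar>h x * f x\<bar> \<le> \<bar>h x\<bar>" if "x \<in> space M" for x
    using mult_left_mono[OF f[OF that], of "\<bar>h x\<bar>"] by (simp add: abs_mult)
  have ihf: "integrable M (\<lambda>x. h x * f x)"
    by (rule integrable_bdd[where B=B]) (use hf hB order_trans in \<open>auto, blast\<close>)
  have "\<bar>\<integral>x. h x * f x \<partial>M\<bar> \<le> (\<integral>x. \<bar>h x * f x\<bar> \<partial>M)" by (rule integral_abs_bound)
  also have "\<dots> \<le> (\<integral>x. h x * indicator P x - h x * indicator (space M - P) x \<partial>M)"
  proof (rule integral_mono)
    show "integrable M (\<lambda>x. \<bar>h x * f x\<bar>)" using ihf by auto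
    show "integrable M (\<lambda>x. h x * indicator P x - h x * indicator (space M - P) x)"
      using ih[of P] ih[of "space M - P"] by auto
    show "\<bar>h x * f x\<bar> \<le> h x * indicator P x - h x * indicator (space M - P) x" if "x \<in> space M" for x
      using hf[OF that] that by (auto simp: P_def indicator_def)
  qed
  also have "\<dots> = (\<integral>x. h x * indicator P x \<partial>M) - (\<integral>x. h x * indicator (space M - P) x \<partial>M)"
    by (rule Bochner_Integration.integral_diff) (auto intro!: ih)
  also have "\<dots> \<le> 2 * e" using sets[of P] sets[of "space M - P"] by auto
  finally show ?thesis .
qed

text \<open>The passage from sets to functions is made in one variable after the other, at a cost of
  a factor 2 each.\<close>

lemma cutf_of_sets:
  assumes [measurable]: "D \<in> borel_measurable (M \<Otimes>\<^sub>M M)"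
    and DB: "\<And>x y. x \<in> space M \<Longrightarrow> y \<in> space M \<Longrightarrow> \<bar>D (x, y)\<bar> \<le> B"
    and sets: "\<And>A A'. A \<in> sets M \<Longrightarrow> A' \<in> sets M \<Longrightarrow>
      \<bar>\<integral>x. \<integral>y. D (x, y) * (indicator A x * indicator A' y) \<partial>M \<partial>M\<bar> \<le> e"
  shows "cutf M D (4 * e)"
  unfolding cutf_def
proof (intro ballI impI)
  fix f g :: "'a \<Rightarrow> real" 
  assume [measurable]: "f \<in> borel_measurable M" "g \<in> borel_measurable M" 
    and f: "\<forall>x\<in>space M. \<bar>f x\<bar> \<le> 1" and g: "\<forall>x\<in>space M. \<bar>g x\<bar> \<le> 1"
  have B: "0 \<le> B" using DB not_empty by fastforce
  have bd: "\<bar>D (x, y) * (u * v)\<bar> \<le> B" if "x \<in> space M" "y \<in> space M" "\<bar>u\<bar> \<le> 1" "\<bar>v\<bar> \<le> 1" for x y u v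
  proof -
    have "\<bar>u * v\<bar> \<le> 1" using mult_mono[OF that(3,4)] by (simp add: abs_mult)
    from mult_mono[OF DB[OF that(1,2)] this] B show ?thesis by (simp add: abs_mult)
  qed
  have bd1: "\<bar>D (x, y) * u\<bar> \<le> B" if "x \<in> space M" "y \<in> space M" "\<bar>u\<bar> \<le> 1" for x y u
    using bd[OF that, of 1] by simp
  have i1: "\<bar>indicator A x :: real\<bar> \<le> 1" for A and x :: 'a by (simp add: indicator_def)
  have 1: "\<bar>\<integral>x. (\<integral>y. D (x, y) * indicator A' y \<partial>M) * f x \<partial>M\<bar> \<le> 2 * e" if [measurable]: "A' \<in> sets M" for A'
  proof (rule abs_integral_mult_le_of_sets[where B=B])
    show "\<bar>\<integral>y. D (x, y) * indicator A' y \<partial>M\<bar> \<le> B" if "x \<in> space M" for x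
      by (rule abs_integral_le) (use that in \<open>auto intro!: bd1 i1\<close>)
    show "\<bar>\<integral>x. (\<integral>y. D (x, y) * indicator A' y \<partial>M) * indicator A x \<partial>M\<bar> \<le> e" if "A \<in> sets M" for A
      using sets[OF that \<open>A' \<in> sets M\<close>] by (simp add: ac_simps flip: integral_mult_right_zero)
  qed (use f in auto)
  have sw: "(\<integral>x. \<integral>y. D (x, y) * (f x * u y) \<partial>M \<partial>M) = (\<integral>y. \<integral>x. D (x, y) * (f x * u y) \<partial>M \<partial>M)"
    if [measurable]: "u \<in> borel_measurable M" and u: "\<And>x. x \<in> space M \<Longrightarrow> \<bar>u x\<bar> \<le> 1" for u
    by (rule integral_swap[where B=B]) (use f u in \<open>auto intro!: bd\<close>)
  have "\<bar>\<integral>y. (\<integral>x. D (x, y) * f x \<partial>M) * g y \<partial>M\<bar> \<le> 2 * (2 * e)"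
  proof (rule abs_integral_mult_le_of_sets[where B=B])
    show "\<bar>\<integral>x. D (x, y) * f x \<partial>M\<bar> \<le> B" if [measurable]: "y \<in> space M" for y
      by (rule abs_integral_le) (use that f in \<open>auto intro!: bd1\<close>)
    show "\<bar>\<integral>y. (\<integral>x. D (x, y) * f x \<partial>M) * indicator A y \<partial>M\<bar> \<le> 2 * e" if [measurable]: "A \<in> sets M" for A
      using 1[of A] sw[of "indicator A"] i1[of A] by (simp add: ac_simps flip: integral_mult_right_zero)
  qed (use g in auto)
  then show "\<bar>\<integral>x. \<integral>y. D (x, y) * (f x * g y) \<partial>M \<partial>M\<bar> \<le> 4 * e"
    using sw[of g] g by (simp add: ac_simps flip: integral_mult_right_zero)
qed

section \<open>Products with a fixed kernel in cut norm\<close>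

definition multiplier_bound :: "('a \<times> 'a \<Rightarrow> real) \<Rightarrow> real \<Rightarrow> real \<Rightarrow> bool" where
  "multiplier_bound g e K \<longleftrightarrow> 0 \<le> K \<and> (\<forall>D d f h. D \<in> borel_measurable (M \<Otimes>\<^sub>M M) \<longrightarrow>
    (\<forall>x\<in>space M. \<forall>y\<in>space M. \<bar>D (x, y)\<bar> \<le> 1) \<longrightarrow> cutf M D d \<longrightarrow>
    f\<in>borel_measurable M \<longrightarrow> h\<in>borel_measurable M \<longrightarrow>
     (\<forall>x\<in>space M. \<bar>f x\<bar> \<le> (1::real)) \<longrightarrow> (\<forall>x\<in>space M. \<bar>h x\<bar> \<le> (1::real)) \<longrightarrow>
     \<bar>\<integral>z. g z * (D z * (f (fst z) * h (snd z))) \<partial>(M \<Otimes>\<^sub>M M)\<bar> \<le> K * d + e)"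

definition multiplier :: "('a \<times> 'a \<Rightarrow> real) \<Rightarrow> bool" where
  "multiplier g \<longleftrightarrow> (\<forall>e>0. \<exists>K. multiplier_bound g e K)"

lemma multiplier_boundD:
  "multiplier_bound g e K \<Longrightarrow> D \<in> borel_measurable (M \<Otimes>\<^sub>M M) \<Longrightarrow>
    (\<forall>x\<in>space M. \<forall>y\<in>space M. \<bar>D (x, y)\<bar> \<le> 1) \<Longrightarrow> cutf M D d \<Longrightarrow> f\<in>borel_measurable M \<Longrightarrow> h\<in>borel_measurable M \<Longrightarrow>
     (\<forall>x\<in>space M. \<bar>f x\<bar> \<le> (1::real)) \<Longrightarrow> (\<forall>x\<in>space M. \<bar>h x\<bar> \<le> (1::real)) \<Longrightarrow>
     \<bar>\<integral>z. g z * (D z * (f (fst z) * h (snd z))) \<partial>(M \<Otimes>\<^sub>M M)\<bar> \<le> K * d + e"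
  unfolding multiplier_bound_def by blast

lemma abs_triple_le:
  assumes "\<bar>a\<bar> \<le> (1::real)" "\<bar>b\<bar> \<le> 1" "\<bar>c\<bar> \<le> 1" 
  shows "\<bar>a * (b * c)\<bar> \<le> 1"
  using mult_mono[OF assms(1) mult_mono[OF assms(2,3)]] by (simp add: abs_mult)

text \<open>The other factors of the integrand are bounded by 1, so replacing \<open>g\<close> by
  \<open>g'\<close> costs at most their distance in mean. Half of \<open>e\<close> pays for this and
  half for the bound of \<open>g'\<close>.\<close>

lemma multiplier_approx:
  assumes g: "integrable (M \<Otimes>\<^sub>M M) g"
    and appr: "\<And>e. 0 < e \<Longrightarrow> \<exists>g'. multiplier g' \<and> integrable (M \<Otimes>\<^sub>M M) g' \<and> (\<integral>z. \<bar>g z - g' z\<bar> \<partial>(M \<Otimes>\<^sub>M M)) \<le> e"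
  shows "multiplier g"
  unfolding multiplier_def
proof (intro allI impI)
  fix e :: real assume e: "0 < e"
  interpret P: pair_prob_space M M by (rule pair_prob_space_self)
  obtain g' where g': "multiplier g'" and g'i[measurable]: "integrable (M \<Otimes>\<^sub>M M) g'" 
    and le: "(\<integral>z. \<bar>g z - g' z\<bar> \<partial>(M \<Otimes>\<^sub>M M)) \<le> e / 2"
    using appr[of "e/2"] e by auto
  note [measurable] = g
  obtain K where K: "multiplier_bound g' (e / 2) K"
    using g'[unfolded multiplier_def, rule_format, of "e/2"] e by auto
  show "\<exists>K. multiplier_bound g e K"
    unfolding multiplier_bound_def[of g]
  proof (intro exI[of _ K] conjI allI impI)
    show "0 \<le> K" using K by (simp add: multiplier_bound_def)
    fix D d f h
    assume a: "D \<in> borel_measurable (M \<Otimes>\<^sub>M M)"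
      "\<forall>x\<in>space M. \<forall>y\<in>space M. \<bar>D (x, y)\<bar> \<le> 1" "cutf M D d" "f\<in>borel_measurable M" "h\<in>borel_measurable M"
     "\<forall>x\<in>space M. \<bar>f x\<bar> \<le> (1::real)" "\<forall>x\<in>space M. \<bar>h x\<bar> \<le> (1::real)"
    note [measurable] = a(1,4,5)
    let ?F = "\<lambda>z. D z * (f (fst z) * h (snd z))"
    have F: "\<bar>?F z\<bar> \<le> 1" if "z \<in> space (M \<Otimes>\<^sub>M M)" for z
      using that a by (cases z) (auto simp: space_pair_measure intro!: abs_triple_le)
    have iF: "integrable (M \<Otimes>\<^sub>M M) (\<lambda>z. k z * ?F z)" if [measurable]: "integrable (M \<Otimes>\<^sub>M M) k" for k
      by (rule integrable_times_bounded[OF that]) (use F in auto)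
    have "\<bar>\<integral>z. (g z - g' z) * ?F z \<partial>(M \<Otimes>\<^sub>M M)\<bar> \<le> (\<integral>z. \<bar>(g z - g' z) * ?F z\<bar> \<partial>(M \<Otimes>\<^sub>M M))"
      by (rule integral_abs_bound)
    also have "\<dots> \<le> (\<integral>z. \<bar>g z - g' z\<bar> \<partial>(M \<Otimes>\<^sub>M M))"
    proof (rule integral_mono)
      show "integrable (M \<Otimes>\<^sub>M M) (\<lambda>z. \<bar>(g z - g' z) * ?F z\<bar>)"
        by (intro integrable_abs iF) (use g g'i in auto)
      show "integrable (M \<Otimes>\<^sub>M M) (\<lambda>z. \<bar>g z - g' z\<bar>)" using g g'i by auto
      show "\<bar>(g z - g' z) * ?F z\<bar> \<le> \<bar>g z - g' z\<bar>" if "z \<in> space (M \<Otimes>\<^sub>M M)" for z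
        using mult_left_mono[OF F[OF that], of "\<bar>g z - g' z\<bar>"] by (simp add: abs_mult)
    qed
    finally have "\<bar>\<integral>z. (g z - g' z) * ?F z \<partial>(M \<Otimes>\<^sub>M M)\<bar> \<le> e / 2" using le by simp
    moreover have "(\<integral>z. (g z - g' z) * ?F z \<partial>(M \<Otimes>\<^sub>M M)) = (\<integral>z. g z * ?F z \<partial>(M \<Otimes>\<^sub>M M)) - (\<integral>z. g' z * ?F z \<partial>(M \<Otimes>\<^sub>M M))"
      unfolding left_diff_distrib by (intro Bochner_Integration.integral_diff iF) (use g g'i in auto)
    ultimately show "\<bar>\<integral>z. g z * ?F z \<partial>(M \<Otimes>\<^sub>M M)\<bar> \<le> K * d + e"
      using multiplier_boundD[OF K a] by linarith
  qed
qed

lemma multiplier_lincomb: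
  assumes "finite J" "\<And>j. j \<in> J \<Longrightarrow> multiplier (g j)" "\<And>j. j \<in> J \<Longrightarrow> integrable (M \<Otimes>\<^sub>M M) (g j)"
  shows "multiplier (\<lambda>z. \<Sum>j\<in>J. c j * g j z)"
  unfolding multiplier_def
proof (intro allI impI)
  fix e :: real assume e: "0 < e"
  interpret P: pair_prob_space M M by (rule pair_prob_space_self)
  \<comment> \<open>The errors of the terms are weighted by the coefficients; the summand 1 keeps
    the denominator positive if all coefficients vanish.\<close>
  define e' where "e' = e / (1 + (\<Sum>j\<in>J. \<bar>c j\<bar>))"
  have s: "0 \<le> (\<Sum>j\<in>J. \<bar>c j\<bar>)" by (rule sum_nonneg) auto
  have e': "0 < e'" "(\<Sum>j\<in>J. \<bar>c j\<bar>) * e' \<le> e" using e s 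
    by (auto simp: e'_def divide_simps add_pos_nonneg)
  have "\<forall>j\<in>J. \<exists>K. multiplier_bound (g j) e' K"
    using assms(2)[unfolded multiplier_def] e'(1) by simp
  then obtain K where K: "\<And>j. j \<in> J \<Longrightarrow> multiplier_bound (g j) e' (K j)"
    using bchoice[of J "\<lambda>j. multiplier_bound (g j) e'"] by blast
  show "\<exists>K. multiplier_bound (\<lambda>z. \<Sum>j\<in>J. c j * g j z) e K"
    unfolding multiplier_bound_def
  proof (intro exI[of _ "\<Sum>j\<in>J. \<bar>c j\<bar> * K j"] conjI allI impI)
    show "0 \<le> (\<Sum>j\<in>J. \<bar>c j\<bar> * K j)" using K by (auto intro!: sum_nonneg simp: multiplier_bound_def)
    fix D d f h
    assume a: "D \<in> borel_measurable (M \<Otimes>\<^sub>M M)"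
      "\<forall>x\<in>space M. \<forall>y\<in>space M. \<bar>D (x, y)\<bar> \<le> 1" "cutf M D d" "f\<in>borel_measurable M" "h\<in>borel_measurable M"
     "\<forall>x\<in>space M. \<bar>f x\<bar> \<le> (1::real)" "\<forall>x\<in>space M. \<bar>h x\<bar> \<le> (1::real)"
    note [measurable] = a(1,4,5)
    let ?F = "\<lambda>z. D z * (f (fst z) * h (snd z))"
    have F: "\<bar>?F z\<bar> \<le> 1" if "z \<in> space (M \<Otimes>\<^sub>M M)" for z
      using that a by (cases z) (auto simp: space_pair_measure intro!: abs_triple_le)
    have iF: "integrable (M \<Otimes>\<^sub>M M) (\<lambda>z. k z * ?F z)" if [measurable]: "integrable (M \<Otimes>\<^sub>M M) k" for k
      by (rule integrable_times_bounded[OF that]) (use F in auto)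
    have "(\<integral>z. (\<Sum>j\<in>J. c j * g j z) * ?F z \<partial>(M \<Otimes>\<^sub>M M)) = (\<Sum>j\<in>J. c j * (\<integral>z. g j z * ?F z \<partial>(M \<Otimes>\<^sub>M M)))"
      unfolding sum_distrib_right mult.assoc using iF[OF assms(3)] 
      by (subst Bochner_Integration.integral_sum) (auto simp: mult.assoc)
    also have "\<bar>\<dots>\<bar> \<le> (\<Sum>j\<in>J. \<bar>c j\<bar> * (K j * d + e'))"
      by (rule order_trans[OF sum_abs], rule sum_mono) (use multiplier_boundD[OF K a] in \<open>auto simp: abs_mult intro!: mult_left_mono\<close>)
    also have "\<dots> = (\<Sum>j\<in>J. \<bar>c j\<bar> * K j) * d + (\<Sum>j\<in>J. \<bar>c j\<bar>) * e'"
      by (simp add: algebra_simps sum.distrib sum_distrib_left sum_distrib_right)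
    also have "\<dots> \<le> (\<Sum>j\<in>J. \<bar>c j\<bar> * K j) * d + e" using e' by simp
    finally show "\<bar>\<integral>z. (\<Sum>j\<in>J. c j * g j z) * ?F z \<partial>(M \<Otimes>\<^sub>M M)\<bar> \<le> (\<Sum>j\<in>J. \<bar>c j\<bar> * K j) * d + e" .
  qed
qed

text \<open>The indicator of a rectangle is absorbed into the two test functions, so
  \<open>K = 1\<close> works without loss.\<close>

lemma multiplier_rect:
  assumes [measurable]: "a \<in> sets M" "b \<in> sets M"
  shows "multiplier (indicator (a \<times> b))"
  unfolding multiplier_def multiplier_bound_def
proof (intro allI impI exI[of _ 1] conjI)
  fix e :: real and D d f h
  assume e: "0 < e" and a: "D \<in> borel_measurable (M \<Otimes>\<^sub>M M)"
      "\<forall>x\<in>space M. \<forall>y\<in>space M. \<bar>D (x, y)\<bar> \<le> 1" "cutf M D d" "f\<in>borel_measurable M" "h\<in>borel_measurable M"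
     "\<forall>x\<in>space M. \<bar>f x\<bar> \<le> (1::real)" "\<forall>x\<in>space M. \<bar>h x\<bar> \<le> (1::real)"
  note [measurable] = a(1,4,5)
  let ?f = "\<lambda>x. f x * indicator a x" and ?h = "\<lambda>x. h x * indicator b x"
  have fh: "\<forall>x\<in>space M. \<bar>?f x\<bar> \<le> 1" "\<forall>x\<in>space M. \<bar>?h x\<bar> \<le> 1" using a by (auto simp: indicator_def)
  have "\<bar>\<integral>x. \<integral>y. D (x, y) * (?f x * ?h y) \<partial>M \<partial>M\<bar> \<le> d"
    by (rule a(3)[unfolded cutf_def, rule_format]) (use fh in auto)
  also have "(\<integral>x. \<integral>y. D (x, y) * (?f x * ?h y) \<partial>M \<partial>M) = (\<integral>z. D z * (?f (fst z) * ?h (snd z)) \<partial>(M \<Otimes>\<^sub>M M))"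
    by (rule integral_pair_eq[where B=1 and f="\<lambda>z. D z * (?f (fst z) * ?h (snd z))", simplified]) (use fh a in \<open>auto intro!: abs_triple_le\<close>)
  also have "\<dots> = (\<integral>z. indicator (a \<times> b) z * (D z * (f (fst z) * h (snd z))) \<partial>(M \<Otimes>\<^sub>M M))"
    by (rule Bochner_Integration.integral_cong) (auto simp: indicator_def)
  finally show "\<bar>\<integral>z. indicator (a \<times> b) z * (D z * (f (fst z) * h (snd z))) \<partial>(M \<Otimes>\<^sub>M M)\<bar> \<le> 1 * d + e"
    using e by simp
qed auto

text \<open>A Dynkin class argument from the rectangles. Complements are differences of indicators,
  and a countable disjoint union is approximated in mean by its finite partial unions.\<close>

lemma multiplier_indicator:
  assumes "A \<in> sets (M \<Otimes>\<^sub>M M)"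
  shows "multiplier (indicator A)"
  using Int_stable_pair_measure_generator pair_measure_closed assms
  unfolding sets_pair_measure
proof (induct rule: sigma_sets_induct_disjoint)
  case (basic A)
  then show ?case by (auto intro!: multiplier_rect)
next
  case empty
  show ?case using multiplier_rect[of "{}" "{}"] by (simp add: indicator_def[abs_def])
next
  case (compl A)
  then have [measurable]: "A \<in> sets (M \<Otimes>\<^sub>M M)" by (simp add: sets_pair_measure)
  interpret P: pair_prob_space M M by (rule pair_prob_space_self)
  have 1: "multiplier (indicator (space M \<times> space M))" by (rule multiplier_rect) auto
  have "multiplier (\<lambda>z. \<Sum>j\<in>UNIV. (if j then 1 else -1) * (if j then indicator (space M \<times> space M) else indicator A) z)"
    by (rule multiplier_lincomb) (use 1 compl in \<open>auto intro!: pair_integrable_indicator\<close>)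
  also have "(\<lambda>z. \<Sum>j\<in>UNIV. (if j then 1 else -1) * (if j then indicator (space M \<times> space M) else indicator A) z) 
     = (indicator (space M \<times> space M - A) :: _ \<Rightarrow> real)"
    using sets.sets_into_space[OF \<open>A \<in> sets (M \<Otimes>\<^sub>M M)\<close>]
    by (auto simp: UNIV_bool indicator_def space_pair_measure fun_eq_iff)
  finally show ?case .
next
  case (union A)
  interpret P: pair_prob_space M M by (rule pair_prob_space_self)
  have [measurable]: "A i \<in> sets (M \<Otimes>\<^sub>M M)" for i using union by (auto simp: sets_pair_measure)
  note int = pair_integrable_indicator
  show ?case
  proof (rule multiplier_approx)
    show "integrable (M \<Otimes>\<^sub>M M) (indicator (\<Union> (range A)) :: _ \<Rightarrow> real)" by (rule int) auto
    fix e :: real assume e: "0 < e"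
    have "(\<lambda>n. measure (M \<Otimes>\<^sub>M M) (\<Union>i<n. A i)) \<longlonglongrightarrow> measure (M \<Otimes>\<^sub>M M) (\<Union>n. \<Union>i<n. A i)"
      by (rule P.P.finite_Lim_measure_incseq) (auto simp: incseq_def, fastforce)
    also have "(\<Union>n. \<Union>i<n. A i) = (\<Union>i. A i)" by auto
    finally obtain n where n: "norm (measure (M \<Otimes>\<^sub>M M) (\<Union>i<n. A i) - measure (M \<Otimes>\<^sub>M M) (\<Union>i. A i)) < e"
      using e LIMSEQ_D by blast
    have m: "multiplier (\<lambda>z. \<Sum>i<n. 1 * indicator (A i) z)"
      by (rule multiplier_lincomb) (use union int in auto)
    have eq: "(\<Sum>i<n. 1 * indicator (A i) z) = (indicator (\<Union>i<n. A i) z :: real)" for z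
      using disjoint_family_on_mono[OF _ union(1), of "{..<n}"] by (simp add: indicator_UN_disjoint)
    have "(\<integral>z. \<bar>indicator (\<Union> (range A)) z - indicator (\<Union>i<n. A i) z :: real\<bar> \<partial>(M \<Otimes>\<^sub>M M)) = 
       (\<integral>z. (indicator ((\<Union>i. A i) - (\<Union>i<n. A i)) z :: real) \<partial>(M \<Otimes>\<^sub>M M))"
      by (rule Bochner_Integration.integral_cong) (auto simp: indicator_def)
    also have "\<dots> = measure (M \<Otimes>\<^sub>M M) ((\<Union>i. A i) - (\<Union>i<n. A i))"
      by (simp add: sets.sets_into_space Int_absorb2)
    also have "\<dots> = measure (M \<Otimes>\<^sub>M M) (\<Union>i. A i) - measure (M \<Otimes>\<^sub>M M) (\<Union>i<n. A i)"
      by (rule P.P.finite_measure_Diff) auto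
    also have "\<dots> \<le> e" using n by auto
    finally show "\<exists>g'. multiplier g' \<and> integrable (M \<Otimes>\<^sub>M M) g' \<and>
       (\<integral>z. \<bar>indicator (\<Union> (range A)) z - g' z\<bar> \<partial>(M \<Otimes>\<^sub>M M)) \<le> e"
      using m unfolding eq by (intro exI[of _ "indicator (\<Union>i<n. A i)"]) (auto intro!: int)
  qed
qed

lemma multiplier_integrable:
  assumes "integrable (M \<Otimes>\<^sub>M M) g"
  shows "multiplier g"
  using assms
proof (induct rule: integrable_induct)
  case (base A c)
  interpret P: pair_prob_space M M by (rule pair_prob_space_self)
  have "multiplier (\<lambda>z. \<Sum>i\<in>{()}. c * indicator A z)"
    by (rule multiplier_lincomb) (use base multiplier_indicator in \<open>auto intro!: pair_integrable_indicator\<close>)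
  then show ?case by (simp add: mult.commute)
next
  case (add f g)
  have "multiplier (\<lambda>z. \<Sum>j\<in>UNIV. 1 * (if j then f else g) z)"
    by (rule multiplier_lincomb) (use add in auto)
  then show ?case by (simp add: UNIV_bool add.commute)
next
  case (lim f s)
  note [measurable] = lim(1) lim(5)
  show ?case
  proof (rule multiplier_approx)
    show "integrable (M \<Otimes>\<^sub>M M) f" by fact
    fix e :: real assume e: "0 < e"
    have "(\<lambda>i. \<integral>z. \<bar>f z - s i z\<bar> \<partial>(M \<Otimes>\<^sub>M M)) \<longlonglongrightarrow> (\<integral>z. 0 \<partial>(M \<Otimes>\<^sub>M M))"
    proof (rule integral_dominated_convergence[where w="\<lambda>z. 3 * \<bar>f z\<bar>"])
      show "AE x in M \<Otimes>\<^sub>M M. (\<lambda>i. \<bar>f x - s i x\<bar>) \<longlonglongrightarrow> 0"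
      proof (rule AE_I2)
        fix x assume "x \<in> space (M \<Otimes>\<^sub>M M)"
        from tendsto_rabs[OF tendsto_diff[OF tendsto_const[of "f x"] lim(3)[OF this]]]
        show "(\<lambda>i. \<bar>f x - s i x\<bar>) \<longlonglongrightarrow> 0" by simp
      qed
      show "AE x in M \<Otimes>\<^sub>M M. norm \<bar>f x - s i x\<bar> \<le> 3 * \<bar>f x\<bar>" for i
        by (rule AE_I2) (use lim(4)[of _ i] in \<open>fastforce simp: real_norm_def\<close>)
    qed (use lim in auto)
    then obtain i where "norm (\<integral>z. \<bar>f z - s i z\<bar> \<partial>(M \<Otimes>\<^sub>M M)) < e"
      using e LIMSEQ_D[of _ 0 e] by fastforce
    then show "\<exists>g'. multiplier g' \<and> integrable (M \<Otimes>\<^sub>M M) g' \<and> (\<integral>z. \<bar>f z - g' z\<bar> \<partial>(M \<Otimes>\<^sub>M M)) \<le> e"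
      using lim by (intro exI[of _ "s i"]) auto
  qed
qed

text \<open>The multiplier property restated in terms of \<open>cutf\<close>. It is applied below to
  \<open>D\<close> as its own multiplier, and later to the probability with which a missing edge
  stays missing.\<close>

lemma cutf_mult:
  assumes g: "g \<in> borel_measurable (M \<Otimes>\<^sub>M M)" 
    and gB: "\<And>x y. x \<in> space M \<Longrightarrow> y \<in> space M \<Longrightarrow> \<bar>g (x, y)\<bar> \<le> B" and e: "0 < e"
  shows "\<exists>K\<ge>0. \<forall>D d. D \<in> borel_measurable (M \<Otimes>\<^sub>M M) \<longrightarrow>
    (\<forall>x\<in>space M. \<forall>y\<in>space M. \<bar>D (x, y)\<bar> \<le> 1) \<longrightarrow> cutf M D d \<longrightarrow> cutf M (\<lambda>z. D z * g z) (K * d + e)"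
proof -
  have B: "0 \<le> B" using gB not_empty by fastforce
  have "multiplier g" using multiplier_integrable[OF pair_integrable_bdd[OF g gB]] .
  from this[unfolded multiplier_def, rule_format, OF e]
  obtain K where K: "multiplier_bound g e K" by blast
  show ?thesis
  proof (intro exI[of _ K] conjI allI impI, (use K in \<open>simp add: multiplier_bound_def\<close>), unfold cutf_def, intro ballI impI)
    fix D d and f h :: "'a \<Rightarrow> real"
    assume a: "D \<in> borel_measurable (M \<Otimes>\<^sub>M M)" "\<forall>x\<in>space M. \<forall>y\<in>space M. \<bar>D (x, y)\<bar> \<le> 1"
      and c: "\<forall>f\<in>borel_measurable M. \<forall>g\<in>borel_measurable M.
     (\<forall>x\<in>space M. \<bar>f x\<bar> \<le> (1::real)) \<longrightarrow> (\<forall>x\<in>space M. \<bar>g x\<bar> \<le> (1::real)) \<longrightarrow>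
     \<bar>\<integral>x. \<integral>y. D (x, y) * (f x * g y) \<partial>M \<partial>M\<bar> \<le> d"
      and b: "f\<in>borel_measurable M" "h\<in>borel_measurable M"
      "\<forall>x\<in>space M. \<bar>f x\<bar> \<le> 1" "\<forall>x\<in>space M. \<bar>h x\<bar> \<le> 1"
    note [measurable] = a(1) b(1,2) g
    have "cutf M D d" using c unfolding cutf_def .
    note multiplier_boundD[OF K a this b]
    also have "(\<integral>z. g z * (D z * (f (fst z) * h (snd z))) \<partial>(M \<Otimes>\<^sub>M M)) = (\<integral>x. \<integral>y. g (x, y) * (D (x, y) * (f x * h y)) \<partial>M \<partial>M)"
    proof (rule integral_pair_eq[where B=B and f="\<lambda>z. g z * (D z * (f (fst z) * h (snd z)))", simplified, symmetric])
      fix x y assume xy: "x \<in> space M" "y \<in> space M"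
      have "\<bar>D (x, y) * (f x * h y)\<bar> \<le> 1" using a b xy by (intro abs_triple_le) auto
      from mult_mono[OF gB[OF xy] this] show "\<bar>g (x, y) * (D (x, y) * (f x * h y))\<bar> \<le> B" using B by (simp add: abs_mult)
    qed measurable
    finally show "\<bar>\<integral>x. \<integral>y. D (x, y) * g (x, y) * (f x * h y) \<partial>M \<partial>M\<bar> \<le> K * d + e"
      by (simp add: ac_simps)
  qed
qed

text \<open>With \<open>D\<close> itself as the multiplier, the kernel \<open>D z * D z\<close> has
  cut norm below every positive \<open>e\<close>; testing it with constants shows that its integral
  vanishes.\<close>

lemma AE_zero_of_cutf:
  assumes [measurable]: "D \<in> borel_measurable (M \<Otimes>\<^sub>M M)"
    and DB: "\<And>x y. x \<in> space M \<Longrightarrow> y \<in> space M \<Longrightarrow> \<bar>D (x, y)\<bar> \<le> 1"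
    and cut: "cutf M D 0"
  shows "AE z in M \<Otimes>\<^sub>M M. D z = 0"
proof -
  interpret P: pair_prob_space M M by (rule pair_prob_space_self)
  have D2: "D (x, y) * D (x, y) \<le> 1" if "x \<in> space M" "y \<in> space M" for x y 
    using mult_mono[OF DB[OF that] DB[OF that]] by (simp add: abs_mult)
  have i: "integrable (M \<Otimes>\<^sub>M M) (\<lambda>z. D z * D z)"
    by (rule pair_integrable_bdd[where B=1]) (use D2 in \<open>auto simp: abs_mult\<close>)
  have "(\<integral>z. D z * D z \<partial>(M \<Otimes>\<^sub>M M)) \<le> e" if e: "0 < e" for e
  proof -
    obtain K where "cutf M (\<lambda>z. D z * D z) (K * 0 + e)"
      using cutf_mult[OF assms(1) DB e] cut DB assms(1) by meson
    from this[unfolded cutf_def, rule_format, of "\<lambda>_. 1" "\<lambda>_. 1"]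
    have "(\<integral>x. \<integral>y. D (x, y) * D (x, y) \<partial>M \<partial>M) \<le> e" by simp
    also have "(\<integral>x. \<integral>y. D (x, y) * D (x, y) \<partial>M \<partial>M) = (\<integral>z. D z * D z \<partial>(M \<Otimes>\<^sub>M M))"
      by (rule integral_pair_eq[where B=1 and f="\<lambda>z. D z * D z"]) (use D2 in \<open>auto simp: abs_mult\<close>)
    finally show ?thesis .
  qed
  then have "(\<integral>z. D z * D z \<partial>(M \<Otimes>\<^sub>M M)) \<le> 0" by (rule field_le_epsilon[of _ 0, simplified])
  moreover have "0 \<le> (\<integral>z. D z * D z \<partial>(M \<Otimes>\<^sub>M M))" by (rule integral_nonneg_AE) auto
  ultimately have "(\<integral>z. D z * D z \<partial>(M \<Otimes>\<^sub>M M)) = 0" by simp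
  then have "AE z in M \<Otimes>\<^sub>M M. D z * D z = 0"
    using integral_nonneg_eq_0_iff_AE[OF i] by simp
  then show ?thesis by simp
qed

end

section \<open>Homomorphism densities and the counting lemma\<close>

text \<open>The probability space is a parameter so that one notion covers graphons, with
  \<open>M = lam\<close>, and finite graphs, with the uniform measure on the vertices; both then
  share the lemmas on products and pullbacks.\<close>

definition dens :: "'a measure \<Rightarrow> 'i set \<Rightarrow> ('i \<times> 'i) set \<Rightarrow> ('a \<times> 'a \<Rightarrow> real) \<Rightarrow> real" where
  "dens M I E w = (\<integral>x. (\<Prod>(i, j)\<in>E. w (x i, x j)) \<partial>Pi\<^sub>M I (\<lambda>_. M))"

text \<open>Every edge is listed in exactly one of its orientations, which gives one factor per
  edge. The orientation is free and the vertex type needs no order, so that disjoint copies of a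
  graph are covered too.\<close>

definition edge_set :: "'i set \<Rightarrow> ('i \<times> 'i) set \<Rightarrow> bool" where
  "edge_set I E \<longleftrightarrow> finite I \<and> E \<subseteq> I \<times> I \<and> (\<forall>(i, j)\<in>E. i \<noteq> j \<and> (j, i) \<notin> E)"

lemma edge_set_finite: "edge_set I E \<Longrightarrow> finite E"
  unfolding edge_set_def using finite_subset finite_cartesian_product by blast

lemma edge_set_mono: "edge_set I E \<Longrightarrow> E' \<subseteq> E \<Longrightarrow> edge_set I E'"
  unfolding edge_set_def by blast

lemma edge_setD: "edge_set I E \<Longrightarrow> (i, j) \<in> E \<Longrightarrow> i \<in> I \<and> j \<in> I \<and> i \<noteq> j \<and> (j, i) \<notin> E"
  unfolding edge_set_def by blast

lemma measurable_edge_prod: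
  assumes "E \<subseteq> I \<times> I" and [measurable]: "\<And>e. e \<in> E \<Longrightarrow> k e \<in> borel_measurable (M \<Otimes>\<^sub>M M)"
  shows "(\<lambda>x. \<Prod>e\<in>E. k e (x (fst e), x (snd e)) :: real) \<in> borel_measurable (Pi\<^sub>M I (\<lambda>_. M))"
proof (rule borel_measurable_prod)
  fix e assume e: "e \<in> E"
  then have [measurable]: "fst e \<in> I" "snd e \<in> I" using assms(1) by auto
  from e show "(\<lambda>x. k e (x (fst e), x (snd e))) \<in> borel_measurable (Pi\<^sub>M I (\<lambda>_. M))" by measurable
qed

lemma abs_prod_le_1:
  fixes f :: "'b \<Rightarrow> real"
  assumes "\<And>e. e \<in> E \<Longrightarrow> \<bar>f e\<bar> \<le> 1"
  shows "\<bar>\<Prod>e\<in>E. f e\<bar> \<le> 1"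
  unfolding abs_prod by (rule prod_le_1) (use assms in auto)

context prob_space
begin

lemma prob_space_PiM_self: "prob_space (Pi\<^sub>M I (\<lambda>_. M))"
  by (rule prob_space_PiM) (rule prob_space_axioms)

lemma product_prob_space_self: "product_prob_space (\<lambda>_. M)"
  by (simp add: product_prob_space_def product_prob_space_axioms_def product_sigma_finite_def
      prob_space_axioms sigma_finite_measure_axioms)

text \<open>All coordinates except \<open>i\<close> and \<open>j\<close> are frozen. No factor of
  \<open>R\<close> involves both, so the product splits into a function of \<open>x i\<close> and a
  function of \<open>x j\<close>, which are admissible in the cut norm.\<close>

lemma hybrid_step:
  assumes I: "finite I" "i \<in> I" "j \<in> I" "i \<noteq> j"
    and R: "R \<subseteq> I \<times> I" "\<And>p q. (p, q) \<in> R \<Longrightarrow> p \<noteq> q" "(i, j) \<notin> R" "(j, i) \<notin> R"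
    and [measurable]: "\<And>e. e \<in> R \<Longrightarrow> k e \<in> borel_measurable (M \<Otimes>\<^sub>M M)"
    and k: "\<And>e x y. e \<in> R \<Longrightarrow> x \<in> space M \<Longrightarrow> y \<in> space M \<Longrightarrow> \<bar>k e (x, y)\<bar> \<le> 1"
    and [measurable]: "D \<in> borel_measurable (M \<Otimes>\<^sub>M M)"
    and D: "\<And>x y. x \<in> space M \<Longrightarrow> y \<in> space M \<Longrightarrow> \<bar>D (x, y)\<bar> \<le> 1"
    and cut: "cutf M D d"
  shows "\<bar>\<integral>x. D (x i, x j) * (\<Prod>e\<in>R. k e (x (fst e), x (snd e))) \<partial>Pi\<^sub>M I (\<lambda>_. M)\<bar> \<le> d"
proof -
  interpret PP: product_prob_space "\<lambda>_. M" by (rule product_prob_space_self)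
  define J where "J = I - {i, j}"
  have J: "finite J" "i \<notin> J" "j \<notin> J" "I = insert i (insert j J)" using I by (auto simp: J_def)
  define F where "F x = D (x i, x j) * (\<Prod>e\<in>R. k e (x (fst e), x (snd e)))" for x
  have [measurable]: "i \<in> I" "j \<in> I" using I by auto
  have finR: "finite R" using R I finite_subset by blast
  have mFF[measurable]: "F \<in> borel_measurable (Pi\<^sub>M I (\<lambda>_. M))"
    unfolding F_def using measurable_edge_prod[OF R(1), of k M] by measurable
  have FB: "\<bar>F x\<bar> \<le> 1" if "x \<in> space (Pi\<^sub>M I (\<lambda>_. M))" for x
  proof -
    have x: "x p \<in> space M" if "p \<in> I" for p using \<open>x \<in> space _\<close> that by (auto simp: space_PiM)
    have "\<bar>\<Prod>e\<in>R. k e (x (fst e), x (snd e))\<bar> \<le> 1"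
      by (intro abs_prod_le_1 k x) (use R(1) in auto)
    from mult_mono[OF D[of "x i" "x j"] this] show ?thesis using x I by (simp add: F_def abs_mult)
  qed
  have upd: "x(i := a) \<in> space (Pi\<^sub>M I (\<lambda>_. M))" if "x \<in> space (Pi\<^sub>M (insert j J) (\<lambda>_. M))" "a \<in> space M" for x a
    using that J by (auto simp: space_PiM PiE_def extensional_def Pi_def)
  have upd2: "y(j := b) \<in> space (Pi\<^sub>M (insert j J) (\<lambda>_. M))" if "y \<in> space (Pi\<^sub>M J (\<lambda>_. M))" "b \<in> space M" for y b
    using that J by (auto simp: space_PiM PiE_def extensional_def Pi_def)
  have mF: "(\<lambda>(x, a). F (x(i := a))) \<in> borel_measurable (Pi\<^sub>M (insert j J) (\<lambda>_. M) \<Otimes>\<^sub>M M)"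
    using measurable_compose[OF measurable_add_dim, of F i "insert j J" "\<lambda>_. M" borel] mFF[unfolded J(4)]
    by (simp add: case_prod_beta')
  define G where "G x = (\<integral>a. F (x(i := a)) \<partial>M)" for x
  have [measurable]: "G \<in> borel_measurable (Pi\<^sub>M (insert j J) (\<lambda>_. M))" unfolding G_def using mF by measurable
  have GB: "\<bar>G x\<bar> \<le> 1" if x: "x \<in> space (Pi\<^sub>M (insert j J) (\<lambda>_. M))" for x
    unfolding G_def
  proof (rule abs_integral_le)
    show "(\<lambda>a. F (x(i := a))) \<in> borel_measurable M"
      using measurable_Pair_compose_split[OF mF, of "\<lambda>_. x" M "\<lambda>a. a"] x by simp
  qed (use FB upd x in auto)
  have iF: "integrable (Pi\<^sub>M (insert i (insert j J)) (\<lambda>_. M)) F"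
    using prob_space.integrable_bdd[OF prob_space_PiM_self mFF FB] J by simp
  have iG: "integrable (Pi\<^sub>M (insert j J) (\<lambda>_. M)) G"
    by (rule prob_space.integrable_bdd[OF prob_space_PiM_self, of G _ 1]) (use GB in auto)
  have mG: "(\<lambda>(y, b). G (y(j := b))) \<in> borel_measurable (Pi\<^sub>M J (\<lambda>_. M) \<Otimes>\<^sub>M M)"
    using measurable_compose[OF measurable_add_dim, of G j J "\<lambda>_. M" borel]
    by (simp add: case_prod_beta')
  have "(\<integral>x. F x \<partial>Pi\<^sub>M I (\<lambda>_. M)) = (\<integral>x. G x \<partial>Pi\<^sub>M (insert j J) (\<lambda>_. M))"
    unfolding G_def J(4) by (rule PP.product_integral_insert) (use J I iF in auto)
  also have "\<dots> = (\<integral>y. (\<integral>b. G (y(j := b)) \<partial>M) \<partial>Pi\<^sub>M J (\<lambda>_. M))"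
    by (rule PP.product_integral_insert) (use J iG in auto)
  also have "\<bar>\<dots>\<bar> \<le> d"
  proof (rule prob_space.abs_integral_le[OF prob_space_PiM_self])
    show "(\<lambda>y. \<integral>b. G (y(j := b)) \<partial>M) \<in> borel_measurable (Pi\<^sub>M J (\<lambda>_. M))" using mG by measurable
    fix y assume y: "y \<in> space (Pi\<^sub>M J (\<lambda>_. M))"
    then have yp: "y p \<in> space M" if "p \<in> J" for p using that by (auto simp: space_PiM)
    \<comment> \<open>The edges at \<open>i\<close>. The remaining ones may or may not touch
      \<open>j\<close>, but never \<open>i\<close>.\<close>
    define R1 where "R1 = {e\<in>R. fst e = i \<or> snd e = i}"
    define f where "f a = (\<Prod>e\<in>R1. k e ((y(i := a)) (fst e), (y(i := a)) (snd e)))" for a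
    define g where "g b = (\<Prod>e\<in>R - R1. k e ((y(j := b)) (fst e), (y(j := b)) (snd e)))" for b
    have R1: "fst e \<in> insert i J \<and> snd e \<in> insert i J \<and> fst e \<noteq> j \<and> snd e \<noteq> j" if "e \<in> R1" for e
      using that R I by (cases e) (auto simp: R1_def J_def)
    have R2: "fst e \<in> insert j J \<and> snd e \<in> insert j J \<and> fst e \<noteq> i \<and> snd e \<noteq> i" if "e \<in> R - R1" for e
      using that R I by (cases e) (auto simp: R1_def J_def)
    have mu: "(\<lambda>a. (y(p := a)) q) \<in> measurable M M" if "q \<in> insert p J" for p q
      using that yp by (cases "p = q") (auto)
    have [measurable]: "f \<in> borel_measurable M" unfolding f_def
    proof (rule borel_measurable_prod)
      fix e assume e: "e \<in> R1"
      have [measurable]: "(\<lambda>a. (y(i := a)) (fst e)) \<in> measurable M M" "(\<lambda>a. (y(i := a)) (snd e)) \<in> measurable M M"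
        "k e \<in> borel_measurable (M \<Otimes>\<^sub>M M)"
        using R1[OF e] e by (auto intro!: mu simp: R1_def assms simp del: fun_upd_apply)
      show "(\<lambda>a. k e ((y(i := a)) (fst e), (y(i := a)) (snd e))) \<in> borel_measurable M" by measurable
    qed
    have [measurable]: "g \<in> borel_measurable M" unfolding g_def
    proof (rule borel_measurable_prod)
      fix e assume e: "e \<in> R - R1"
      have [measurable]: "(\<lambda>a. (y(j := a)) (fst e)) \<in> measurable M M" "(\<lambda>a. (y(j := a)) (snd e)) \<in> measurable M M"
        "k e \<in> borel_measurable (M \<Otimes>\<^sub>M M)"
        using R2[OF e] e by (auto intro!: mu simp: R1_def assms simp del: fun_upd_apply)
      show "(\<lambda>a. k e ((y(j := a)) (fst e), (y(j := a)) (snd e))) \<in> borel_measurable M" by measurable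
    qed
    have sp: "(y(p := a)) q \<in> space M" if "q \<in> insert p J" "a \<in> space M" for p q a
      using that yp by auto
    have fB: "\<bar>f a\<bar> \<le> 1" if "a \<in> space M" for a
      unfolding f_def
    proof (rule abs_prod_le_1)
      fix e assume e: "e \<in> R1"
      show "\<bar>k e ((y(i := a)) (fst e), (y(i := a)) (snd e))\<bar> \<le> 1"
        by (rule k) (use R1[OF e] e that in \<open>auto intro!: sp simp: R1_def simp del: fun_upd_apply\<close>)
    qed
    have gB: "\<bar>g a\<bar> \<le> 1" if "a \<in> space M" for a
      unfolding g_def
    proof (rule abs_prod_le_1)
      fix e assume e: "e \<in> R - R1"
      show "\<bar>k e ((y(j := a)) (fst e), (y(j := a)) (snd e))\<bar> \<le> 1"
        by (rule k) (use R2[OF e] e that in \<open>auto intro!: sp simp del: fun_upd_apply\<close>)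
    qed
    have Feq: "F (y(j := b, i := a)) = D (a, b) * (f a * g b)" for a b
    proof -
      let ?z = "y(j := b, i := a)"
      have "(\<Prod>e\<in>R. k e (?z (fst e), ?z (snd e))) = 
        (\<Prod>e\<in>R - R1. k e (?z (fst e), ?z (snd e))) * (\<Prod>e\<in>R1. k e (?z (fst e), ?z (snd e)))"
        by (rule prod.subset_diff) (use finR in \<open>auto simp: R1_def\<close>)
      also have "(\<Prod>e\<in>R1. k e (?z (fst e), ?z (snd e))) = f a"
        unfolding f_def by (rule prod.cong) (use R1 in auto)
      also have "(\<Prod>e\<in>R - R1. k e (?z (fst e), ?z (snd e))) = g b"
        unfolding g_def by (rule prod.cong) (use R2 in auto)
      finally have "(\<Prod>e\<in>R. k e (?z (fst e), ?z (snd e))) = f a * g b" by (simp only: mult.commute)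
      moreover have "?z i = a" "?z j = b" using I by auto
      ultimately show ?thesis by (simp only: F_def)
    qed
    have "(\<integral>b. G (y(j := b)) \<partial>M) = (\<integral>b. \<integral>a. D (a, b) * (f a * g b) \<partial>M \<partial>M)"
      unfolding G_def Feq ..
    also have "\<dots> = (\<integral>a. \<integral>b. D (a, b) * (f a * g b) \<partial>M \<partial>M)"
      by (rule integral_swap[where B=1]) (use D fB gB in \<open>auto intro!: abs_triple_le\<close>)
    also have "\<bar>\<dots>\<bar> \<le> d"
      by (rule cut[unfolded cutf_def, rule_format]) (use fB gB in auto)
    finally show "\<bar>\<integral>b. G (y(j := b)) \<partial>M\<bar> \<le> d" .
  qed
  finally show ?thesis unfolding F_def .
qed

text \<open>The counting lemma: \<open>w'\<close> is exchanged for \<open>w\<close> on one edge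
  after the other, and each exchange costs at most \<open>d\<close>.\<close>

lemma dens_diff_le:
  assumes E: "edge_set I E"
    and w: "w \<in> borel_measurable (M \<Otimes>\<^sub>M M)" "\<And>x y. x \<in> space M \<Longrightarrow> y \<in> space M \<Longrightarrow> 0 \<le> w (x, y) \<and> w (x, y) \<le> 1"
    and w': "w' \<in> borel_measurable (M \<Otimes>\<^sub>M M)" "\<And>x y. x \<in> space M \<Longrightarrow> y \<in> space M \<Longrightarrow> 0 \<le> w' (x, y) \<and> w' (x, y) \<le> 1"
    and cut: "cutf M (\<lambda>z. w z - w' z) d"
  shows "\<bar>dens M I E w - dens M I E w'\<bar> \<le> real (card E) * d"
proof -
  interpret PI: prob_space "Pi\<^sub>M I (\<lambda>_. M)" by (rule prob_space_PiM_self)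
  \<comment> \<open>The hybrid density that uses \<open>w\<close> on the edges in \<open>A\<close>
    and \<open>w'\<close> on the others.\<close>
  define P where "P A = (\<integral>x. (\<Prod>e\<in>E. (if e \<in> A then w else w') (x (fst e), x (snd e))) \<partial>Pi\<^sub>M I (\<lambda>_. M))" for A
  have EI: "E \<subseteq> I \<times> I" using E by (auto simp: edge_set_def)
  have "finite A \<Longrightarrow> A \<subseteq> E \<Longrightarrow> \<bar>P A - P {}\<bar> \<le> real (card A) * d" for A
  proof (induction A rule: finite_induct)
    case (insert e A)
    obtain i j where e: "e = (i, j)" by (cases e)
    have eE: "e \<in> E" using insert by auto
    have k: "\<And>e B. (if e \<in> B then w else w') \<in> borel_measurable (M \<Otimes>\<^sub>M M)"
      "\<And>e B x y. x \<in> space M \<Longrightarrow> y \<in> space M \<Longrightarrow> \<bar>(if e \<in> B then w else w') (x, y)\<bar> \<le> 1"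
      using w w' by (auto simp: abs_le_iff)
    have sp: "x p \<in> space M" if "x \<in> space (Pi\<^sub>M I (\<lambda>_. M))" "p \<in> I" for x p
      using that by (auto simp: space_PiM)
    have int: "integrable (Pi\<^sub>M I (\<lambda>_. M)) (\<lambda>x. \<Prod>e\<in>E. (if e \<in> B then w else w') (x (fst e), x (snd e)))" for B
    proof (rule PI.integrable_bdd[where B=1])
      fix x assume "x \<in> space (Pi\<^sub>M I (\<lambda>_. M))"
      then show "\<bar>\<Prod>e\<in>E. (if e \<in> B then w else w') (x (fst e), x (snd e))\<bar> \<le> 1"
        using EI by (intro abs_prod_le_1 k sp) auto
    qed (intro measurable_edge_prod EI k)
    have "P (insert e A) - P A = (\<integral>x. (w (x i, x j) - w' (x i, x j)) * 
       (\<Prod>e\<in>E - {e}. (if e \<in> A then w else w') (x (fst e), x (snd e))) \<partial>Pi\<^sub>M I (\<lambda>_. M))"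
    proof -
      have "(\<Prod>e\<in>E. (if e \<in> insert e' A then w else w') (x (fst e), x (snd e))) 
          - (\<Prod>e\<in>E. (if e \<in> A then w else w') (x (fst e), x (snd e)))
          = (w (x (fst e'), x (snd e')) - w' (x (fst e'), x (snd e'))) * (\<Prod>e\<in>E - {e'}. (if e \<in> A then w else w') (x (fst e), x (snd e)))" 
        if "e' \<notin> A" "e' \<in> E" for x e'
      proof -
        have "(\<Prod>e\<in>E - {e'}. (if e \<in> insert e' A then w else w') (x (fst e), x (snd e))) = 
          (\<Prod>e\<in>E - {e'}. (if e \<in> A then w else w') (x (fst e), x (snd e)))"
          by (rule prod.cong) auto
        then show ?thesis
          using that edge_set_finite[OF E] by (simp add: prod.remove[of E e'] left_diff_distrib)
      qed
      note * = this[OF \<open>e \<notin> A\<close> eE, unfolded e fst_conv snd_conv]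
      show ?thesis unfolding P_def e 
        by (subst Bochner_Integration.integral_diff[OF int int, symmetric]) (simp only: *)
    qed
    also have "\<bar>\<dots>\<bar> \<le> d"
    proof (rule hybrid_step)
      show "\<bar>w (x, y) - w' (x, y)\<bar> \<le> 1" if "x \<in> space M" "y \<in> space M" for x y 
        using w(2)[OF that] w'(2)[OF that] by auto
    qed (use eE e edge_setD[OF E] EI k w w' cut E in \<open>auto simp: edge_set_def\<close>)
    finally have "\<bar>P (insert e A) - P A\<bar> \<le> d" .
    moreover have "\<bar>P A - P {}\<bar> \<le> real (card A) * d" using insert by auto
    ultimately show ?case using insert.hyps by (simp add: algebra_simps)
  qed simp
  from this[OF edge_set_finite[OF E] subset_refl] show ?thesis
    by (simp add: P_def dens_def case_prod_beta' cong: prod.cong)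
qed

lemma distr_PiM_pair:
  assumes "i \<in> I" "j \<in> I" "i \<noteq> j"
  shows "distr (Pi\<^sub>M I (\<lambda>_. M)) (M \<Otimes>\<^sub>M M) (\<lambda>x. (x i, x j)) = M \<Otimes>\<^sub>M M"
proof -
  let ?f = "\<lambda>b. if b then i else j"
  have [measurable]: "i \<in> I" "j \<in> I" using assms by auto
  have "M \<Otimes>\<^sub>M M = distr (Pi\<^sub>M UNIV (case_bool M M)) (M \<Otimes>\<^sub>M M) (\<lambda>x. (x True, x False))"
    by (rule pair_measure_eq_distr_PiM) unfold_locales
  also have "case_bool M M = (\<lambda>_. M)" by (auto split: bool.split)
  also have "Pi\<^sub>M UNIV (\<lambda>_. M) = distr (Pi\<^sub>M I (\<lambda>_. M)) (Pi\<^sub>M UNIV (\<lambda>_. M)) (\<lambda>x. \<lambda>b\<in>UNIV. x (?f b))"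
    by (rule distr_PiM_reindex[symmetric]) (use assms in \<open>auto simp: inj_on_def prob_space_axioms\<close>)
  finally show ?thesis
    by (subst (asm) distr_distr) (auto simp: o_def intro!: measurable_restrict measurable_Pair)
qed

lemma dens_cong_AE:
  assumes E: "edge_set I E"
    and [measurable]: "w \<in> borel_measurable (M \<Otimes>\<^sub>M M)" "w' \<in> borel_measurable (M \<Otimes>\<^sub>M M)"
    and ae: "AE z in M \<Otimes>\<^sub>M M. w z = w' z"
  shows "dens M I E w = dens M I E w'"
  unfolding dens_def case_prod_beta'
proof (rule integral_cong_AE)
  have EI: "E \<subseteq> I \<times> I" using E by (auto simp: edge_set_def)
  show "(\<lambda>x. \<Prod>e\<in>E. w (x (fst e), x (snd e))) \<in> borel_measurable (Pi\<^sub>M I (\<lambda>_. M))"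
    "(\<lambda>x. \<Prod>e\<in>E. w' (x (fst e), x (snd e))) \<in> borel_measurable (Pi\<^sub>M I (\<lambda>_. M))"
    using EI by (intro measurable_edge_prod; simp)+
  have "AE x in Pi\<^sub>M I (\<lambda>_. M). \<forall>e\<in>E. w (x (fst e), x (snd e)) = w' (x (fst e), x (snd e))"
  proof (rule AE_finite_allI[OF edge_set_finite[OF E]])
    fix e assume "e \<in> E"
    then have *: "fst e \<in> I" "snd e \<in> I" "fst e \<noteq> snd e" using edge_setD[OF E, of "fst e" "snd e"] by auto
    note [measurable] = *(1,2)
    from ae show "AE x in Pi\<^sub>M I (\<lambda>_. M). w (x (fst e), x (snd e)) = w' (x (fst e), x (snd e))"
      by (subst (asm) distr_PiM_pair[OF *, symmetric]) (simp add: AE_distr_iff)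
  qed
  then show "AE x in Pi\<^sub>M I (\<lambda>_. M). (\<Prod>e\<in>E. w (x (fst e), x (snd e))) = (\<Prod>e\<in>E. w' (x (fst e), x (snd e)))"
    by eventually_elim auto
qed

text \<open>Inclusion and exclusion: expanding the factors \<open>1 - w\<close> turns prescribed
  non-edges into ordinary densities. In this way densities determine the probabilities of all
  induced graphs.\<close>

lemma dens_mixed:
  assumes E: "edge_set I (E \<union> E')" "E \<inter> E' = {}"
    and w: "w \<in> borel_measurable (M \<Otimes>\<^sub>M M)" "\<And>x y. x \<in> space M \<Longrightarrow> y \<in> space M \<Longrightarrow> 0 \<le> w (x, y) \<and> w (x, y) \<le> 1"
  shows "(\<integral>x. (\<Prod>(i, j)\<in>E. w (x i, x j)) * (\<Prod>(i, j)\<in>E'. 1 - w (x i, x j)) \<partial>Pi\<^sub>M I (\<lambda>_. M)) =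
    (\<Sum>T\<in>Pow E'. (-1) ^ card T * dens M I (E \<union> T) w)"
proof -
  interpret PI: prob_space "Pi\<^sub>M I (\<lambda>_. M)" by (rule prob_space_PiM_self)
  have fin: "finite E" "finite E'" using edge_set_finite[OF E(1)] by auto
  have *: "(\<Prod>(i, j)\<in>E. w (x i, x j)) * (\<Prod>(i, j)\<in>E'. 1 - w (x i, x j)) = 
     (\<Sum>T\<in>Pow E'. (-1) ^ card T * (\<Prod>(i, j)\<in>E \<union> T. w (x i, x j)))" for x
  proof -
    have "(\<Prod>(i, j)\<in>E'. 1 - w (x i, x j)) = (\<Prod>e\<in>E'. - w (x (fst e), x (snd e)) + 1)"
      by (simp add: case_prod_beta')
    also have "\<dots> = (\<Sum>T\<in>Pow E'. (-1) ^ card T * (\<Prod>e\<in>T. w (x (fst e), x (snd e))))"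
      by (subst prod_add[OF fin(2)]) (simp add: prod_uminus)
    finally have 1: "(\<Prod>(i, j)\<in>E'. 1 - w (x i, x j)) = (\<Sum>T\<in>Pow E'. (-1) ^ card T * (\<Prod>e\<in>T. w (x (fst e), x (snd e))))" .
    show ?thesis
      unfolding 1 sum_distrib_left
    proof (rule sum.cong[OF refl])
      fix T assume "T \<in> Pow E'"
      then have "(\<Prod>e\<in>E \<union> T. w (x (fst e), x (snd e))) = (\<Prod>e\<in>E. w (x (fst e), x (snd e))) * (\<Prod>e\<in>T. w (x (fst e), x (snd e)))"
        using fin E(2) finite_subset by (intro prod.union_disjoint) auto
      then show "(\<Prod>(i, j)\<in>E. w (x i, x j)) * ((-1) ^ card T * (\<Prod>e\<in>T. w (x (fst e), x (snd e)))) =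
          (-1) ^ card T * (\<Prod>(i, j)\<in>E \<union> T. w (x i, x j))"
        by (simp add: case_prod_beta')
    qed
  qed
  have "integrable (Pi\<^sub>M I (\<lambda>_. M)) (\<lambda>x. \<Prod>(i, j)\<in>E \<union> T. w (x i, x j))" if "T \<in> Pow E'" for T
    unfolding case_prod_beta'
  proof (rule PI.integrable_bdd[where B=1])
    have ET: "E \<union> T \<subseteq> I \<times> I" using E that by (auto simp: edge_set_def)
    then show "(\<lambda>x. \<Prod>e\<in>E \<union> T. w (x (fst e), x (snd e))) \<in> borel_measurable (Pi\<^sub>M I (\<lambda>_. M))"
      by (rule measurable_edge_prod) (use w in auto)
    fix x assume x: "x \<in> space (Pi\<^sub>M I (\<lambda>_. M))"
    show "\<bar>\<Prod>e\<in>E \<union> T. w (x (fst e), x (snd e))\<bar> \<le> 1"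
    proof (rule abs_prod_le_1)
      fix e assume "e \<in> E \<union> T"
      then have "fst e \<in> I" "snd e \<in> I" using ET by auto
      then have "x (fst e) \<in> space M" "x (snd e) \<in> space M" using x by (auto simp: space_PiM)
      from w(2)[OF this] show "\<bar>w (x (fst e), x (snd e))\<bar> \<le> 1" by auto
    qed
  qed
  then show ?thesis unfolding * dens_def
    by (subst Bochner_Integration.integral_sum) auto
qed

end

lemma dens_distr:
  assumes M: "prob_space M" and [measurable]: "\<phi> \<in> measurable M N" and d: "distr M N \<phi> = N"
    and E: "edge_set I E" and w[measurable]: "w \<in> borel_measurable (N \<Otimes>\<^sub>M N)"
  shows "dens M I E (\<lambda>(x, y). w (\<phi> x, \<phi> y)) = dens N I E w"
proof -
  interpret prob_space M by fact
  interpret N: prob_space N using prob_space_distr[of \<phi> N] d by simp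
  have fin: "finite I" and EI: "E \<subseteq> I \<times> I" using E by (auto simp: edge_set_def)
  have [measurable]: "(\<lambda>x. \<Prod>e\<in>E. w (x (fst e), x (snd e))) \<in> borel_measurable (Pi\<^sub>M I (\<lambda>_. N))"
    by (rule measurable_edge_prod[OF EI]) (rule w)
  have PN: "Pi\<^sub>M I (\<lambda>_. N) = distr (Pi\<^sub>M I (\<lambda>_. M)) (Pi\<^sub>M I (\<lambda>_. N)) (compose I \<phi>)"
    using distr_PiM_finite_prob_space'[of I "\<lambda>_. M" "\<lambda>_. N" \<phi>] fin d by (simp add: prob_space_axioms N.prob_space_axioms)
  have [measurable]: "compose I \<phi> \<in> measurable (Pi\<^sub>M I (\<lambda>_. M)) (Pi\<^sub>M I (\<lambda>_. N))"
    unfolding compose_def by measurable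
  have "dens N I E w = (\<integral>x. (\<Prod>e\<in>E. w (x (fst e), x (snd e))) \<partial>distr (Pi\<^sub>M I (\<lambda>_. M)) (Pi\<^sub>M I (\<lambda>_. N)) (compose I \<phi>))"
    unfolding dens_def case_prod_beta' using PN by simp
  also have "\<dots> = (\<integral>x. (\<Prod>e\<in>E. w (compose I \<phi> x (fst e), compose I \<phi> x (snd e))) \<partial>Pi\<^sub>M I (\<lambda>_. M))"
    by (rule integral_distr) measurable
  also have "\<dots> = dens M I E (\<lambda>(x, y). w (\<phi> x, \<phi> y))"
    unfolding dens_def case_prod_beta' fst_conv snd_conv
    by (intro Bochner_Integration.integral_cong[OF refl] prod.cong[OF refl]) (use EI in \<open>auto simp: compose_def\<close>)
  finally show ?thesis by simp
qed

section \<open>Densities of finite graphs\<close>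

text \<open>Independent uniform values amount to a uniformly random map, which makes
  \<open>dens\<close> over a finite vertex set an average over all maps from \<open>I\<close> to
  \<open>V\<close>.\<close>

lemma PiM_uniform_count:
  assumes I: "finite I" and V: "finite V" "V \<noteq> {}"
  shows "Pi\<^sub>M I (\<lambda>_. uniform_count_measure V) = uniform_count_measure (I \<rightarrow>\<^sub>E V)"
proof -
  interpret product_prob_space "\<lambda>_. uniform_count_measure V"
    by (rule prob_space.product_prob_space_self[OF prob_space_uniform_count_measure[OF V]])
  have "sets (Pi\<^sub>M I (\<lambda>_. uniform_count_measure V)) = sets (Pi\<^sub>M I (\<lambda>_. count_space V))"
    by (intro sets_PiM_cong) (auto simp: sets_uniform_count_measure)
  also have "\<dots> = Pow (I \<rightarrow>\<^sub>E V)" using count_space_PiM_finite[of I "\<lambda>_. V"] I V by (simp add: countable_finite)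
  finally have s: "sets (Pi\<^sub>M I (\<lambda>_. uniform_count_measure V)) = Pow (I \<rightarrow>\<^sub>E V)" .
  show ?thesis
  proof (rule PiM_eqI[symmetric, OF I])
    show "sets (uniform_count_measure (I \<rightarrow>\<^sub>E V)) = sets (Pi\<^sub>M I (\<lambda>_. uniform_count_measure V))"
      by (simp add: s sets_uniform_count_measure)
    fix A assume "\<And>i. i \<in> I \<Longrightarrow> A i \<in> sets (uniform_count_measure V)"
    then have A: "A i \<subseteq> V" if "i \<in> I" for i using that by (auto simp: sets_uniform_count_measure)
    have "emeasure (uniform_count_measure (I \<rightarrow>\<^sub>E V)) (Pi\<^sub>E I A) = ennreal (real (card (Pi\<^sub>E I A)) / real (card (I \<rightarrow>\<^sub>E V)))"
      using A I V by (subst emeasure_uniform_count_measure) (auto intro!: finite_PiE PiE_mono simp: divide_ennreal_def ennreal_of_nat_eq_real_of_nat)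
    also have "real (card (Pi\<^sub>E I A)) / real (card (I \<rightarrow>\<^sub>E V)) = (\<Prod>i\<in>I. real (card (A i)) / real (card V))"
      using I by (simp add: card_PiE prod_dividef)
    also have "ennreal \<dots> = (\<Prod>i\<in>I. emeasure (uniform_count_measure V) (A i))"
      using A V by (subst prod_ennreal[symmetric]) (auto intro!: prod.cong simp: emeasure_uniform_count_measure)
    finally show "emeasure (uniform_count_measure (I \<rightarrow>\<^sub>E V)) (Pi\<^sub>E I A) = (\<Prod>i\<in>I. emeasure (uniform_count_measure V) (A i))" .
  qed
qed

lemma dens_uniform_count:
  assumes "finite I" "finite V" "V \<noteq> {}"
  shows "dens (uniform_count_measure V) I E a = (\<Sum>h\<in>I \<rightarrow>\<^sub>E V. \<Prod>(i, j)\<in>E. a (h i, h j)) / card V ^ card I"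
  unfolding dens_def PiM_uniform_count[OF assms]
  by (subst integral_uniform_count_measure) (use assms in \<open>auto intro!: finite_PiE simp: card_PiE\<close>)

text \<open>A union bound: there are at most the square of \<open>card I\<close> ordered pairs of
  distinct indices, and each collides with probability \<open>1 / card V\<close>. Only maps with a
  collision contribute. The errors of order \<open>1 / card V\<close> in what follows come from
  here.\<close>

lemma sum_noninj_le:
  fixes f :: "('i \<Rightarrow> 'a) \<Rightarrow> real"
  assumes I: "finite I" and V: "finite V" "V \<noteq> {}"
    and B: "\<And>h. h \<in> I \<rightarrow>\<^sub>E V \<Longrightarrow> \<bar>f h\<bar> \<le> B" and inj: "\<And>h. h \<in> I \<rightarrow>\<^sub>E V \<Longrightarrow> inj_on h I \<Longrightarrow> f h = 0"
  shows "\<bar>(\<Sum>h\<in>I \<rightarrow>\<^sub>E V. f h) / card V ^ card I\<bar> \<le> B * (card I)\<^sup>2 / card V"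
proof -
  let ?U = "uniform_count_measure V"
  interpret U: prob_space ?U by (rule prob_space_uniform_count_measure[OF V])
  interpret P: prob_space "Pi\<^sub>M I (\<lambda>_. ?U)" by (rule U.prob_space_PiM_self)
  have fin: "finite (I \<rightarrow>\<^sub>E V)" using I V by (auto intro: finite_PiE)
  have N: "0 < card V" using V by (simp add: card_gt_0_iff)
  \<comment> \<open>The probability that a random map identifies \<open>i\<close> and
    \<open>j\<close>; it is computed from the joint law of two coordinates.\<close>
  define c where "c i j = (\<Sum>h\<in>I \<rightarrow>\<^sub>E V. of_bool (h i = h j) :: real) / card V ^ card I" for i j
  have c: "c i j = 1 / card V" if ij: "i \<in> I" "j \<in> I" "i \<noteq> j" for i j
  proof -
    have sU: "sets (?U \<Otimes>\<^sub>M ?U) = Pow (V \<times> V)"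
      using pair_measure_countable[of "V" "V"] V sets_pair_measure_cong[of ?U "count_space V" ?U "count_space V"]
      by (simp only: sets_uniform_count_measure sets_count_space countable_finite)
    have m: "(\<lambda>(x, y). of_bool (x = y) :: real) \<in> borel_measurable (?U \<Otimes>\<^sub>M ?U)"
      by (rule measurableI) (auto simp: sU space_pair_measure space_uniform_count_measure)
    have mp: "(\<lambda>x. (x i, x j)) \<in> measurable (Pi\<^sub>M I (\<lambda>_. ?U)) (?U \<Otimes>\<^sub>M ?U)"
      using ij by (intro measurable_Pair measurable_component_singleton) auto
    have "c i j = (\<integral>x. of_bool (x i = x j) \<partial>Pi\<^sub>M I (\<lambda>_. ?U))"
      unfolding PiM_uniform_count[OF I V] c_def
      by (subst integral_uniform_count_measure) (use I V fin in \<open>auto simp: card_PiE\<close>)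
    also have "\<dots> = (\<integral>z. (case z of (x, y) \<Rightarrow> of_bool (x = y)) \<partial>distr (Pi\<^sub>M I (\<lambda>_. ?U)) (?U \<Otimes>\<^sub>M ?U) (\<lambda>x. (x i, x j)))"
      by (subst integral_distr[OF mp m]) simp
    also have "\<dots> = (\<integral>z. (case z of (x, y) \<Rightarrow> of_bool (x = y)) \<partial>(?U \<Otimes>\<^sub>M ?U))"
      by (subst U.distr_PiM_pair[OF ij]) simp
    also have "\<dots> = (\<integral>x. \<integral>y. of_bool (x = y) \<partial>?U \<partial>?U)"
      by (subst U.integral_pair_eq[where B=1 and f="\<lambda>(x, y). of_bool (x = y)", symmetric]) (use m in auto)
    also have "\<dots> = 1 / card V"
      using V N by (simp add: integral_uniform_count_measure of_bool_def sum.delta)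
    finally show ?thesis .
  qed
  have B0: "0 \<le> B" 
  proof -
    have "I \<rightarrow>\<^sub>E V \<noteq> {}" using V by (simp add: PiE_eq_empty_iff)
    then obtain h where "h \<in> I \<rightarrow>\<^sub>E V" by blast
    from order_trans[OF abs_ge_zero B[OF this]] show ?thesis .
  qed
  let ?Q = "{(i, j)\<in>I \<times> I. i \<noteq> j}"
  have finQ: "finite ?Q" using I by (auto intro: finite_subset[of _ "I \<times> I"])
  have "\<bar>f h\<bar> \<le> B * (\<Sum>(i, j)\<in>?Q. of_bool (h i = h j))" if h: "h \<in> I \<rightarrow>\<^sub>E V" for h
  proof (cases "inj_on h I")
    case False
    then obtain i j where ij: "(i, j) \<in> ?Q" "h i = h j" by (auto simp: inj_on_def)
    have "(1::real) = (\<Sum>e\<in>{(i, j)}. of_bool (h (fst e) = h (snd e)))" using ij(2) by simp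
    also have "\<dots> \<le> (\<Sum>e\<in>?Q. of_bool (h (fst e) = h (snd e)))"
    proof (rule sum_mono2[OF finQ])
      show "{(i, j)} \<subseteq> ?Q" using ij(1) by blast
    qed simp
    also have "\<dots> = (\<Sum>(i, j)\<in>?Q. of_bool (h i = h j))" by (simp only: case_prod_beta')
    finally have "B * 1 \<le> B * (\<Sum>(i, j)\<in>?Q. of_bool (h i = h j))" by (rule mult_left_mono[OF _ B0])
    with B[OF h] show ?thesis by linarith
  next
    case True
    have "0 \<le> B * (\<Sum>(i, j)\<in>?Q. of_bool (h i = h j))"
      by (intro mult_nonneg_nonneg B0 sum_nonneg) (simp add: case_prod_beta')
    with inj[OF h True] show ?thesis by simp
  qed
  then have "\<bar>\<Sum>h\<in>I \<rightarrow>\<^sub>E V. f h\<bar> \<le> (\<Sum>h\<in>I \<rightarrow>\<^sub>E V. B * (\<Sum>(i, j)\<in>?Q. of_bool (h i = h j)))"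
    by (intro order_trans[OF sum_abs] sum_mono)
  also have "\<dots> = B * (\<Sum>(i, j)\<in>?Q. \<Sum>h\<in>I \<rightarrow>\<^sub>E V. of_bool (h i = h j))"
    by (simp add: sum_distrib_left[symmetric] case_prod_beta') (rule disjI2, rule sum.swap)
  also have "(\<Sum>(i, j)\<in>?Q. \<Sum>h\<in>I \<rightarrow>\<^sub>E V. of_bool (h i = h j) :: real) = (\<Sum>(i, j)\<in>?Q. c i j * card V ^ card I)"
    using N by (simp add: c_def)
  also have "\<dots> = (\<Sum>(i, j)\<in>?Q. 1 / card V * card V ^ card I)"
    by (rule sum.cong) (use c in auto)
  also have "\<dots> \<le> (card I)\<^sup>2 * (1 / card V * card V ^ card I)"
  proof -
    have "card ?Q \<le> card (I \<times> I)" using I by (intro card_mono) auto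
    also have "\<dots> = (card I)\<^sup>2" by (simp add: card_cartesian_product power2_eq_square)
    finally have "real (card ?Q) \<le> real ((card I)\<^sup>2)" by linarith
    then have "real (card ?Q) * (1 / card V * card V ^ card I) \<le> real ((card I)\<^sup>2) * (1 / card V * card V ^ card I)"
      by (rule mult_right_mono) auto
    then show ?thesis by (simp add: case_prod_beta')
  qed
  finally have "\<bar>\<Sum>h\<in>I \<rightarrow>\<^sub>E V. f h\<bar> \<le> B * ((card I)\<^sup>2 * (1 / card V * card V ^ card I))"
    using B0 by (simp add: mult_left_mono)
  then show ?thesis using N by (simp add: field_simps)
qed

section \<open>The weak regularity lemma\<close>

text \<open>Signs are given by position instead of by coefficients. A decomposition is then nothing
  but four sequences of sets, and a vertex enters it through its membership bits alone, which is
  what gets coded later.\<close>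

definition rect_sum :: "(nat \<Rightarrow> 'a set) \<Rightarrow> (nat \<Rightarrow> 'a set) \<Rightarrow> (nat \<Rightarrow> 'a set) \<Rightarrow> (nat \<Rightarrow> 'a set) \<Rightarrow> nat \<Rightarrow> 'a \<times> 'a \<Rightarrow> real" where
  "rect_sum A B A' B' m z = (\<Sum>j<m. indicator (A j \<times> B j) z - indicator (A' j \<times> B' j) z)"

lemma rect_sum_Suc_upd:
  "rect_sum (A(k := S)) (B(k := T)) (A'(k := S')) (B'(k := T')) (Suc k) z =
    rect_sum A B A' B' k z + (indicator (S \<times> T) z - indicator (S' \<times> T') z)"
  by (simp add: rect_sum_def)

text \<open>The energy decrement of Frieze and Kannan. As long as some \<open>S \<times> T\<close>
  witnesses a large discrepancy, subtracting \<open>1 / sqrt m\<close> times its signed indicator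
  lowers the sum of squares by at least the square of \<open>card V\<close> divided by
  \<open>m\<close>; that sum starts at no more than the square of \<open>card V\<close>.\<close>

lemma weak_regularity:
  fixes D :: "'a \<times> 'a \<Rightarrow> real"
  assumes V: "finite V" and m: "1 \<le> m" and D: "\<And>z. z \<in> V \<times> V \<Longrightarrow> \<bar>D z\<bar> \<le> 1"
  shows "\<exists>A B A' B'. \<forall>S\<subseteq>V. \<forall>T\<subseteq>V.
    \<bar>\<Sum>z\<in>S \<times> T. D z - 1 / sqrt (real m) * rect_sum A B A' B' m z\<bar> \<le> (card V)\<^sup>2 / sqrt (real m)"
proof -
  define e where "e = 1 / sqrt (real m)"
  have e: "0 < e" "e\<^sup>2 * m = 1" using m by (auto simp: e_def power_divide)
  define N2 where "N2 = real ((card V)\<^sup>2)"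
  have N2: "0 \<le> N2" by (simp add: N2_def)
  have cVV: "real (card (V \<times> V)) = N2" by (simp add: N2_def card_cartesian_product power2_eq_square)
  define good where "good R \<longleftrightarrow> (\<forall>S\<subseteq>V. \<forall>T\<subseteq>V. \<bar>\<Sum>z\<in>S \<times> T. R z\<bar> \<le> e * N2)" for R :: "'a \<times> 'a \<Rightarrow> real"
  \<comment> \<open>After \<open>k\<close> steps either the residual passes all tests or its energy
    has dropped \<open>k\<close> times.\<close>
  have "\<exists>A B A' B'. good (\<lambda>z. D z - e * rect_sum A B A' B' k z) \<or>
     (\<Sum>z\<in>V \<times> V. (D z - e * rect_sum A B A' B' k z)\<^sup>2) \<le> N2 - k * e\<^sup>2 * N2" for k
  proof (induction k)
    case 0
    have "(\<Sum>z\<in>V \<times> V. (D z)\<^sup>2) \<le> (\<Sum>z\<in>V \<times> V. 1)"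
      by (rule sum_mono) (use D in \<open>simp add: abs_square_le_1\<close>)
    then show ?case using cVV by (auto simp: rect_sum_def)
  next
    case (Suc k)
    then obtain A B A' B' where *: "good (\<lambda>z. D z - e * rect_sum A B A' B' k z) \<or>
     (\<Sum>z\<in>V \<times> V. (D z - e * rect_sum A B A' B' k z)\<^sup>2) \<le> N2 - k * e\<^sup>2 * N2" by blast
    define R where "R z = D z - e * rect_sum A B A' B' k z" for z
    have R: "R = (\<lambda>z. D z - e * rect_sum A B A' B' k z)" by (simp add: R_def fun_eq_iff)
    show ?case
    proof (cases "good R")
      case True
      \<comment> \<open>Once the residual is good, empty rectangles pad the sum so that it has
        exactly \<open>m\<close> terms in the end.\<close>
      have "rect_sum (A(k := {})) (B(k := {})) (A'(k := {})) (B'(k := {})) (Suc k) z = rect_sum A B A' B' k z" for z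
        unfolding rect_sum_Suc_upd by simp
      then have "good (\<lambda>z. D z - e * rect_sum (A(k := {})) (B(k := {})) (A'(k := {})) (B'(k := {})) (Suc k) z)"
        using True R by simp
      then show ?thesis by blast
    next
      case False
      then obtain S T where ST: "S \<subseteq> V" "T \<subseteq> V" "\<bar>\<Sum>z\<in>S \<times> T. R z\<bar> > e * N2" by (auto simp: good_def not_le)
      \<comment> \<open>The sign of the discrepancy decides whether the new rectangle enters among
        the positive or the negative ones; its counterpart is empty.\<close>
      define s :: real where "s = (if (\<Sum>z\<in>S \<times> T. R z) > 0 then 1 else -1)"
      have s: "s * (\<Sum>z\<in>S \<times> T. R z) > e * N2" "s * s = 1" using ST(3) by (auto simp: s_def)
      let ?A = "A(k := if s = 1 then S else {})" and ?B = "B(k := if s = 1 then T else {})"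
      let ?A' = "A'(k := if s = 1 then {} else S)" and ?B' = "B'(k := if s = 1 then {} else T)"
      have new: "D z - e * rect_sum ?A ?B ?A' ?B' (Suc k) z = R z - e * s * indicator (S \<times> T) z" for z
        unfolding rect_sum_Suc_upd R_def by (auto simp: s_def algebra_simps)
      have finST: "finite (S \<times> T)" "S \<times> T \<subseteq> V \<times> V" using ST V finite_subset by blast+
      have "(\<Sum>z\<in>V \<times> V. (R z - e * s * indicator (S \<times> T) z)\<^sup>2) =
        (\<Sum>z\<in>V \<times> V. (R z)\<^sup>2 - 2 * e * s * (R z * indicator (S \<times> T) z) + e\<^sup>2 * indicator (S \<times> T) z)"
        by (rule sum.cong) (use s in \<open>auto simp: power2_eq_square algebra_simps indicator_def\<close>)
      also have "\<dots> = (\<Sum>z\<in>V \<times> V. (R z)\<^sup>2) - 2 * e * s * (\<Sum>z\<in>V \<times> V. R z * indicator (S \<times> T) z) + e\<^sup>2 * (\<Sum>z\<in>V \<times> V. indicator (S \<times> T) z)"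
        by (simp add: sum.distrib sum_subtractf sum_distrib_left)
      also have "(\<Sum>z\<in>V \<times> V. R z * indicator (S \<times> T) z) = (\<Sum>z\<in>S \<times> T. R z)"
        using finST V by (intro sum.mono_neutral_cong_right) (auto simp: indicator_def)
      also have "(\<Sum>z\<in>V \<times> V. indicator (S \<times> T) z) = real (card (S \<times> T))"
      proof -
        have "(\<Sum>z\<in>V \<times> V. indicator (S \<times> T) z) = (\<Sum>z\<in>S \<times> T. 1 :: real)"
          using finST V by (intro sum.mono_neutral_cong_right) (auto simp: indicator_def)
        then show ?thesis by simp
      qed
      also have "(\<Sum>z\<in>V \<times> V. (R z)\<^sup>2) - 2 * e * s * (\<Sum>z\<in>S \<times> T. R z) + e\<^sup>2 * real (card (S \<times> T))
        \<le> (N2 - k * e\<^sup>2 * N2) - 2 * e * (e * N2) + e\<^sup>2 * N2"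
      proof -
        have "(\<Sum>z\<in>V \<times> V. (R z)\<^sup>2) \<le> N2 - k * e\<^sup>2 * N2" using * False R by simp
        moreover have "2 * e * (e * N2) \<le> 2 * e * (s * (\<Sum>z\<in>S \<times> T. R z))" using s e by (intro mult_left_mono) auto
        moreover have "e\<^sup>2 * real (card (S \<times> T)) \<le> e\<^sup>2 * N2"
          unfolding cVV[symmetric] using finST V by (intro mult_left_mono of_nat_mono card_mono) auto
        ultimately show ?thesis by (simp add: mult.assoc)
      qed
      also have "\<dots> = N2 - Suc k * e\<^sup>2 * N2" by (simp add: power2_eq_square algebra_simps)
      finally show ?thesis unfolding new[symmetric] by blast
    qed
  qed
  from this[of m] obtain A B A' B' where *: "good (\<lambda>z. D z - e * rect_sum A B A' B' m z) \<or>
     (\<Sum>z\<in>V \<times> V. (D z - e * rect_sum A B A' B' m z)\<^sup>2) \<le> N2 - m * e\<^sup>2 * N2" by blast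
  have "good (\<lambda>z. D z - e * rect_sum A B A' B' m z)"
    using *
  proof
    assume le: "(\<Sum>z\<in>V \<times> V. (D z - e * rect_sum A B A' B' m z)\<^sup>2) \<le> N2 - m * e\<^sup>2 * N2"
    \<comment> \<open>The choice of \<open>e\<close> makes \<open>m\<close> decrements exhaust the
      whole energy, so the residual vanishes identically.\<close>
    also have "\<dots> = 0" using e by (simp add: mult.commute)
    finally have "(\<Sum>z\<in>V \<times> V. (D z - e * rect_sum A B A' B' m z)\<^sup>2) = 0" by (simp add: antisym sum_nonneg)
    then have "\<forall>z\<in>V \<times> V. D z - e * rect_sum A B A' B' m z = 0" using V by (simp add: sum_nonneg_eq_0_iff)
    then have "(\<Sum>z\<in>S \<times> T. D z - e * rect_sum A B A' B' m z) = 0" if "S \<subseteq> V" "T \<subseteq> V" for S T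
      using that by (intro sum.neutral) blast
    then show ?thesis using e N2 by (simp add: good_def)
  qed
  then show ?thesis by (auto simp: good_def e_def N2_def)
qed

section \<open>The unit interval as a probability space\<close>

text \<open>Lebesgue measure on the Borel sets, without completion, so that its powers are ordinary
  product measures and Fubini's theorem applies directly.\<close>

definition lam :: "real measure" where "lam = restrict_space lborel {0..1}"

lemma space_lam[simp]: "space lam = {0..1}" by (simp add: lam_def space_restrict_space)

lemma prob_space_lam: "prob_space lam"
  by (rule prob_spaceI) (simp add: lam_def emeasure_restrict_space space_restrict_space)

lemma measurable_lam_borel: "f \<in> measurable borel N \<Longrightarrow> f \<in> measurable lam N"
  unfolding lam_def by (rule measurable_restrict_space1) simp

lemma id_measurable_lam[measurable]: "(\<lambda>x. x) \<in> borel_measurable lam"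
  by (rule measurable_lam_borel) simp

lemma emeasure_lam: "A \<in> sets borel \<Longrightarrow> A \<subseteq> {0..1} \<Longrightarrow> emeasure lam A = emeasure lborel A"
  by (simp add: lam_def emeasure_restrict_space)

lemma sets_lam: "A \<in> sets borel \<Longrightarrow> A \<subseteq> {0..1} \<Longrightarrow> A \<in> sets lam"
  by (simp add: lam_def sets_restrict_space_iff)

subsection \<open>Coding bit sequences\<close>

text \<open>The point of the Cantor set with ternary digits 0 and 2. Unlike binary expansions this
  is injective with a quantitative gap, so convergence of codes stabilises every single bit.\<close>

definition code :: "(nat \<Rightarrow> bool) \<Rightarrow> real" where
  "code b = (\<Sum>j. of_bool (b j) * (2 / 3) * (1 / 3) ^ j)"

lemma summable_code: "summable (\<lambda>j. of_bool (b j) * (2 / 3) * (1 / 3) ^ j :: real)"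
proof (rule summable_comparison_test[of _ "\<lambda>j. (1 / 3) ^ j"])
  show "summable (\<lambda>j. (1 / 3) ^ j :: real)" by (rule summable_geometric) simp
qed (auto intro!: exI[of _ 0])

lemma suminf_code_tail: "(\<Sum>j. (2 / 3) * (1 / 3) ^ (j + k)) = ((1 / 3) ^ k :: real)"
proof -
  have "(\<lambda>j. ((1 / 3) ^ j :: real)) sums (1 / (1 - 1 / 3))" by (rule geometric_sums) simp
  from sums_mult[OF this, of "(2 / 3) * (1 / 3) ^ k"]
  have "(\<lambda>j. (2 / 3) * (1 / 3) ^ (j + k) :: real) sums (1 / 3) ^ k" by (simp add: power_add ac_simps)
  then show ?thesis by (rule sums_unique[symmetric])
qed

lemma summable_code_tail: "summable (\<lambda>j. (2 / 3) * (1 / 3) ^ (j + k) :: real)"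
  by (intro summable_mult summable_ignore_initial_segment summable_geometric) simp

lemma abs_code_le: "\<bar>code b\<bar> \<le> 1"
proof -
  have "0 \<le> code b" unfolding code_def by (rule suminf_nonneg[OF summable_code]) simp
  moreover have "code b \<le> (\<Sum>j. (2 / 3) * (1 / 3) ^ (j + 0))"
    unfolding code_def by (rule suminf_le[OF _ summable_code summable_code_tail]) simp
  ultimately show ?thesis unfolding suminf_code_tail by simp
qed

lemma code_term_ge: "0 \<le> (x :: real) \<Longrightarrow> - (2 / 3 * x) \<le> (of_bool p - of_bool q) * (2 / 3) * x"
  by (cases p; cases q) auto

text \<open>The first differing digit contributes twice the claimed gap, and all later digits
  together can cancel at most one gap.\<close>

lemma code_separates:
  assumes "\<And>i. i < k \<Longrightarrow> b i = b' i" "b k \<noteq> b' k"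
  shows "(1 / 3) ^ Suc k \<le> \<bar>code b - code b'\<bar>"
proof -
  have *: "(1 / 3) ^ Suc k \<le> code b - code b'" if b: "\<And>i. i < k \<Longrightarrow> b i = b' i" "b k" "\<not> b' k" for b b'
  proof -
    let ?t = "\<lambda>j. (of_bool (b j) - of_bool (b' j)) * (2 / 3) * (1 / 3) ^ j :: real"
    have sm: "summable ?t" unfolding left_diff_distrib by (rule summable_diff[OF summable_code summable_code])
    have "code b - code b' = (\<Sum>j. ?t j)"
      unfolding code_def left_diff_distrib by (rule suminf_diff[OF summable_code summable_code])
    also have "\<dots> = (\<Sum>j. ?t (j + Suc k)) + (\<Sum>j<Suc k. ?t j)" by (rule suminf_split_initial_segment[OF sm])
    also have "(\<Sum>j<Suc k. ?t j) = 2 * (1 / 3) ^ Suc k" using b by (simp add: sum.neutral)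
    also have "- (\<Sum>j. (2 / 3) * (1 / 3) ^ (j + Suc k)) \<le> (\<Sum>j. ?t (j + Suc k))"
    proof (subst suminf_minus[OF summable_code_tail, symmetric], rule suminf_le)
      show "- (2 / 3 * (1 / 3) ^ (n + Suc k)) \<le> ?t (n + Suc k)" for n by (rule code_term_ge) simp
      show "summable (\<lambda>n. - (2 / 3 * (1 / 3) ^ (n + Suc k)) :: real)" by (intro summable_minus summable_code_tail)
      show "summable (\<lambda>n. ?t (n + Suc k))" using summable_ignore_initial_segment[OF sm] .
    qed
    ultimately show ?thesis unfolding suminf_code_tail by simp
  qed
  show ?thesis
  proof (cases "b k")
    case True
    then have "\<not> b' k" using assms(2) by simp
    from *[of b b', OF assms(1) True this] show ?thesis by (rule order_trans[OF _ abs_ge_self])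
  next
    case False
    then have "b' k" using assms(2) by simp
    from *[of b' b, OF assms(1)[symmetric] this False] show ?thesis
      unfolding abs_minus_commute[of "code b"] by (rule order_trans[OF _ abs_ge_self])
  qed
qed

text \<open>If codes differ by less than the gap that belongs to \<open>j\<close>, their first
  difference lies beyond \<open>j\<close>.\<close>

lemma code_convergent_bits:
  assumes "convergent (\<lambda>n. code (b n))"
  shows "\<exists>l. \<forall>\<^sub>F n in sequentially. b n j = l"
proof -
  have "Cauchy (\<lambda>n. code (b n))" using assms by (rule convergent_Cauchy)
  then obtain M where M: "\<And>m n. m \<ge> M \<Longrightarrow> n \<ge> M \<Longrightarrow> dist (code (b m)) (code (b n)) < (1 / 3) ^ Suc j"
    unfolding Cauchy_def by (drule_tac x="(1 / 3) ^ Suc j" in spec) auto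
  have "b n j = b M j" if "n \<ge> M" for n
  proof (rule ccontr)
    assume ne: "b n j \<noteq> b M j"
    define k where "k = (LEAST k. b n k \<noteq> b M k)"
    have k: "b n k \<noteq> b M k" unfolding k_def by (rule LeastI[of _ j]) (rule ne)
    have kj: "k \<le> j" unfolding k_def by (rule Least_le) (rule ne)
    have "(1 / 3) ^ Suc k \<le> \<bar>code (b n) - code (b M)\<bar>"
    proof (rule code_separates[where k=k])
      show "b n i = b M i" if "i < k" for i
        using not_less_Least[of i "\<lambda>k. b n k \<noteq> b M k", folded k_def, OF that] by simp
    qed (rule k)
    moreover have "((1 / 3) ^ Suc j :: real) \<le> (1 / 3) ^ Suc k" by (rule power_decreasing) (use kj in auto)
    moreover have "\<bar>code (b n) - code (b M)\<bar> < (1 / 3) ^ Suc j"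
      using M[OF that order_refl] by (simp only: dist_real_def)
    ultimately show False using order_trans not_le by blast
  qed
  then show ?thesis by (auto simp: eventually_sequentially)
qed

text \<open>The minimum puts the end point 1 into the last interval, and \<open>nat\<close> sends
  negative numbers to 0. The function is thus monotone and right-continuous on the whole line, where
  Helly's theorem is stated.\<close>

definition step_index :: "nat \<Rightarrow> real \<Rightarrow> nat" where
  "step_index N x = min (N - 1) (nat \<lfloor>real N * x\<rfloor>)"

lemma step_index_less: "0 < N \<Longrightarrow> step_index N x < N"
  by (simp add: step_index_def min_less_iff_disj)

lemma mono_step_index: "mono (step_index N)"
proof (rule monoI)
  fix x y :: real assume "x \<le> y"
  then have "real N * x \<le> real N * y" by (rule mult_left_mono) simp
  then have "nat \<lfloor>real N * x\<rfloor> \<le> nat \<lfloor>real N * y\<rfloor>" by (intro nat_mono floor_mono)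
  then show "step_index N x \<le> step_index N y" unfolding step_index_def by (rule min.mono[OF order_refl])
qed

lemma step_index_at_right: "\<forall>\<^sub>F y in at_right x. step_index N y = step_index N x"
proof (cases "N = 0")
  case False
  then have N: "0 < real N" by simp
  show ?thesis
    unfolding eventually_at_right_field
  proof (intro exI[of _ "(of_int \<lfloor>real N * x\<rfloor> + 1) / real N"] conjI allI impI)
    show lt: "x < (of_int \<lfloor>real N * x\<rfloor> + 1) / real N" using N by (simp add: pos_less_divide_eq mult.commute)
    fix y assume y: "x < y" "y < (of_int \<lfloor>real N * x\<rfloor> + 1) / real N"
    then have "real N * x < real N * y" "real N * y < of_int \<lfloor>real N * x\<rfloor> + 1"
      using N by (auto simp: pos_less_divide_eq mult.commute)
    then have "\<lfloor>real N * y\<rfloor> = \<lfloor>real N * x\<rfloor>" by linarith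
    then show "step_index N y = step_index N x" by (simp add: step_index_def)
  qed
qed (simp add: step_index_def)

lemma step_index_vimage:
  assumes "k < N"
  shows "emeasure lam {x\<in>{0..1}. step_index N x = k} = ennreal (1 / N)" "{x\<in>{0..1}. step_index N x = k} \<in> sets lam"
proof -
  have N: "0 < real N" using assms by simp
  have nf: "nat \<lfloor>real N * x\<rfloor> = k \<longleftrightarrow> k / N \<le> x \<and> x < (k + 1) / N" if "0 \<le> x" for x
  proof -
    have "nat \<lfloor>real N * x\<rfloor> = k \<longleftrightarrow> \<lfloor>real N * x\<rfloor> = int k" using that by (auto simp: nat_eq_iff)
    also have "\<dots> \<longleftrightarrow> real k \<le> real N * x \<and> real N * x < real k + 1" by (simp add: floor_eq_iff)
    also have "\<dots> \<longleftrightarrow> k / N \<le> x \<and> x < (k + 1) / N" using N by (simp add: pos_divide_le_eq pos_less_divide_eq mult.commute add.commute)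
    finally show ?thesis .
  qed
  have Sk: "real (k + 1) / N \<le> 1" using assms N by (simp add: divide_le_eq_1)
  let ?I = "if k = N - 1 then {k / N..1} else {k / N..<(k + 1) / N}"
  have eq: "{x\<in>{0..1}. step_index N x = k} = ?I"
  proof (cases "k = N - 1")
    case True
    then have kN: "real k = real N - 1" using assms by (simp add: of_nat_diff)
    have "step_index N x = k \<longleftrightarrow> k / N \<le> x" if "0 \<le> x" "x \<le> 1" for x
    proof -
      have "step_index N x = k \<longleftrightarrow> k \<le> nat \<lfloor>real N * x\<rfloor>" unfolding step_index_def True by (auto simp: min_def)
      also have "\<dots> \<longleftrightarrow> real k \<le> real N * x" using that by (simp add: le_nat_iff le_floor_iff)
      also have "\<dots> \<longleftrightarrow> k / N \<le> x" using N by (simp add: pos_divide_le_eq mult.commute)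
      finally show ?thesis .
    qed
    note * = this
    have 0: "0 \<le> real k / N" by simp
    show ?thesis
    proof (rule set_eqI)
      fix x show "x \<in> {x\<in>{0..1}. step_index N x = k} \<longleftrightarrow> x \<in> ?I"
        using *[of x] order_trans[OF 0, of x] True by auto
    qed
  next
    case False
    then have "step_index N x = k \<longleftrightarrow> nat \<lfloor>real N * x\<rfloor> = k" for x using assms by (auto simp: step_index_def min_def)
    note * = this
    have 0: "0 \<le> real k / N" by simp
    show ?thesis
    proof (rule set_eqI)
      fix x show "x \<in> {x\<in>{0..1}. step_index N x = k} \<longleftrightarrow> x \<in> ?I"
        using *[of x] order_trans[OF 0, of x] nf[of x] order_trans[OF less_imp_le Sk, of x] False by auto
    qed
  qed
  have sub: "?I \<subseteq> {0..1}" unfolding eq[symmetric] by auto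
  show "{x\<in>{0..1}. step_index N x = k} \<in> sets lam" unfolding eq by (rule sets_lam[OF _ sub]) auto
  show "emeasure lam {x\<in>{0..1}. step_index N x = k} = ennreal (1 / N)"
  proof (cases "k = N - 1")
    case True
    then have "real k = real N - 1" using assms by (simp add: of_nat_diff)
    then show ?thesis unfolding eq using True N
      by (subst emeasure_lam[OF _ sub]) (auto simp: field_simps)
  next
    case False
    then show ?thesis unfolding eq using N
      by (subst emeasure_lam[OF _ sub]) (auto simp: field_simps)
  qed
qed

lemma step_map_uniform:
  assumes \<sigma>: "bij_betw \<sigma> {..<N} V" and N: "0 < N"
  shows "(\<lambda>x. \<sigma> (step_index N x)) \<in> measurable lam (uniform_count_measure V)"
    and "distr lam (uniform_count_measure V) (\<lambda>x. \<sigma> (step_index N x)) = uniform_count_measure V"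
proof -
  have V: "finite V" "card V = N" "V \<noteq> {}" using \<sigma> N bij_betw_finite[OF \<sigma>] bij_betw_same_card[OF \<sigma>] by auto
  have img: "\<sigma> k \<in> V" if "k < N" for k using \<sigma> that by (auto simp: bij_betw_def)
  have single: "{x\<in>{0..1}. \<sigma> (step_index N x) = v} = {x\<in>{0..1}. step_index N x = inv_into {..<N} \<sigma> v}" if "v \<in> V" for v
  proof -
    have "\<sigma> (step_index N x) = v \<longleftrightarrow> step_index N x = inv_into {..<N} \<sigma> v" for x
      using bij_betw_inv_into_left[OF \<sigma>, of "step_index N x"] bij_betw_inv_into_right[OF \<sigma> that]
        step_index_less[OF N, of x] by auto
    then show ?thesis by simp
  qed
  have inv: "inv_into {..<N} \<sigma> v < N" if "v \<in> V" for v
    using \<sigma> that inv_into_into[of v \<sigma> "{..<N}"] by (auto simp: bij_betw_def)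
  have pre: "(\<lambda>x. \<sigma> (step_index N x)) -` S \<inter> {0..1} = (\<Union>v\<in>S. {x\<in>{0..1}. \<sigma> (step_index N x) = v})" for S by auto
  show meas: "(\<lambda>x. \<sigma> (step_index N x)) \<in> measurable lam (uniform_count_measure V)"
  proof (rule measurableI)
    show "\<sigma> (step_index N x) \<in> space (uniform_count_measure V)" for x
      using img[OF step_index_less[OF N]] by (simp add: space_uniform_count_measure)
    fix S assume "S \<in> sets (uniform_count_measure V)"
    then have S: "S \<subseteq> V" "finite S" using V finite_subset by (auto simp: sets_uniform_count_measure)
    show "(\<lambda>x. \<sigma> (step_index N x)) -` S \<inter> space lam \<in> sets lam"
      unfolding space_lam pre using S single inv step_index_vimage(2) by (intro sets.finite_UN) auto
  qed
  show "distr lam (uniform_count_measure V) (\<lambda>x. \<sigma> (step_index N x)) = uniform_count_measure V"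
  proof (rule measure_eqI_finite[where A=V])
    fix v assume v: "v \<in> V"
    have "emeasure (distr lam (uniform_count_measure V) (\<lambda>x. \<sigma> (step_index N x))) {v} = emeasure lam {x\<in>{0..1}. \<sigma> (step_index N x) = v}"
      using v by (subst emeasure_distr[OF meas]) (auto simp: sets_uniform_count_measure intro!: arg_cong[where f="emeasure lam"])
    also have "\<dots> = ennreal (1 / N)" unfolding single[OF v] by (rule step_index_vimage(1)[OF inv[OF v]])
    also have "\<dots> = emeasure (uniform_count_measure V) {v}" using v V by (simp add: emeasure_uniform_count_measure)
    finally show "emeasure (distr lam (uniform_count_measure V) (\<lambda>x. \<sigma> (step_index N x))) {v} = emeasure (uniform_count_measure V) {v}" .
  qed (use V in \<open>auto simp: sets_uniform_count_measure\<close>)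
qed

lemma ex_sorting:
  fixes c :: "'a \<Rightarrow> real"
  assumes "finite V"
  shows "\<exists>\<sigma>. bij_betw \<sigma> {..<card V} V \<and> (\<forall>i j. i \<le> j \<longrightarrow> j < card V \<longrightarrow> c (\<sigma> i) \<le> c (\<sigma> j))"
proof -
  obtain xs where xs: "set xs = V" "distinct xs" using finite_distinct_list[OF assms] by blast
  define ys where "ys = sort_key c xs"
  have ys: "set ys = V" "distinct ys" "length ys = card V" "sorted (map c ys)"
    using xs distinct_card[OF xs(2)] by (auto simp: ys_def)
  have "bij_betw (\<lambda>i. ys ! i) {..<card V} V" using bij_betw_nth[OF ys(2)] ys by simp
  moreover have "\<forall>i j. i \<le> j \<longrightarrow> j < card V \<longrightarrow> c (ys ! i) \<le> c (ys ! j)"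
    using sorted_nth_mono[OF ys(4)] ys(3) by auto
  ultimately show ?thesis by blast
qed

text \<open>
  Arranging the points of each \<open>V n\<close> on the unit interval in the order of their codes turns the
  codes into monotone functions, to which Helly's selection theorem applies.
\<close>

lemma bits_converge:
  fixes V :: "nat \<Rightarrow> 'a set" and b :: "nat \<Rightarrow> 'a \<Rightarrow> nat \<Rightarrow> bool"
  assumes V: "\<And>n. finite (V n)" "\<And>n. V n \<noteq> {}"
  shows "\<exists>s \<theta>. strict_mono (s :: nat \<Rightarrow> nat) \<and>
    (\<forall>n. \<theta> n \<in> measurable lam (uniform_count_measure (V (s n))) \<and>
         distr lam (uniform_count_measure (V (s n))) (\<theta> n) = uniform_count_measure (V (s n))) \<and>
    (AE x in lam. \<forall>j. \<exists>l. \<forall>\<^sub>F n in sequentially. b (s n) (\<theta> n x) j = l)"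
proof -
  have "\<exists>\<sigma>. \<forall>n. bij_betw (\<sigma> n) {..<card (V n)} (V n) \<and>
     (\<forall>i j. i \<le> j \<longrightarrow> j < card (V n) \<longrightarrow> code (b n (\<sigma> n i)) \<le> code (b n (\<sigma> n j)))"
    using ex_sorting[OF V(1)] by (intro choice allI)
  then obtain \<sigma> where \<sigma>: "\<And>n. bij_betw (\<sigma> n) {..<card (V n)} (V n)"
    and mono: "\<And>n i j. i \<le> j \<Longrightarrow> j < card (V n) \<Longrightarrow> code (b n (\<sigma> n i)) \<le> code (b n (\<sigma> n j))" by blast
  have N: "0 < card (V n)" for n using V by (simp add: card_gt_0_iff)
  define \<theta> where "\<theta> n x = \<sigma> n (step_index (card (V n)) x)" for n x
  define q where "q n x = code (b n (\<theta> n x))" for n x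
  have "\<exists>s. strict_mono (s :: nat \<Rightarrow> nat) \<and> (\<exists>F. (\<forall>x. continuous (at_right x) F) \<and> mono F \<and> (\<forall>x. \<bar>F x\<bar> \<le> 1) \<and>
    (\<forall>x. continuous (at x) F \<longrightarrow> (\<lambda>n. q (s n) x) \<longlonglongrightarrow> F x))"
  proof (rule Helly_selection)
    show "continuous (at_right x) (q n)" for n x
      unfolding continuous_within
      by (rule tendsto_eventually, rule eventually_mono[OF step_index_at_right[of "card (V n)"]]) (simp add: q_def \<theta>_def)
    show "mono (q n)" for n
      unfolding q_def \<theta>_def
      by (rule monoI, rule mono) (auto intro: monoD[OF mono_step_index] step_index_less N)
    show "\<bar>q n x\<bar> \<le> 1" for n x unfolding q_def by (rule abs_code_le)
  qed
  then obtain s F where s: "strict_mono (s :: nat \<Rightarrow> nat)" and F: "mono F"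
    and lim: "\<And>x. continuous (at x) F \<Longrightarrow> (\<lambda>n. q (s n) x) \<longlonglongrightarrow> F x" by blast
  \<comment> \<open>The limit function is monotone, so the points at which convergence may fail are
    countably many and form a null set.\<close>
  have "countable {x. \<not> continuous (at x) F}" using mono_ctble_discont[OF F] by simp
  then have "{x. \<not> continuous (at x) F} \<in> null_sets lborel" by (rule countable_imp_null_set_lborel)
  then have "AE x in lborel. x \<notin> {x. \<not> continuous (at x) F}" by (rule AE_not_in)
  then have "AE x in lam. continuous (at x) F"
    unfolding lam_def by (subst AE_restrict_space_iff) auto
  then have "AE x in lam. \<forall>j. \<exists>l. \<forall>\<^sub>F n in sequentially. b (s n) (\<theta> (s n) x) j = l"
  proof eventually_elim
    case (elim x)
    from lim[OF this] have "convergent (\<lambda>n. code (b (s n) (\<theta> (s n) x)))" by (auto simp: q_def convergent_def)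
    from code_convergent_bits[OF this] show ?case by blast
  qed
  then show ?thesis
    using s step_map_uniform[OF \<sigma> N] by (intro exI[of _ s] exI[of _ "\<lambda>n. \<theta> (s n)"]) (simp add: \<theta>_def[abs_def])
qed

section \<open>Weak limits of bounded functions\<close>

text \<open>Tychonoff's theorem gives a cluster point in the cube. The index type is arbitrary, and
  will include all measurable sets, so a filter finer than \<open>sequentially\<close> takes the
  place of a subsequence.\<close>

lemma ex_limit_filter:
  fixes u :: "nat \<Rightarrow> 'c \<Rightarrow> real"
  assumes "\<And>n c. u n c \<in> {0..1}"
  shows "\<exists>\<G>. \<G> \<noteq> bot \<and> \<G> \<le> sequentially \<and> (\<forall>c. \<exists>l\<in>{0..1}. ((\<lambda>n. u n c) \<longlongrightarrow> l) \<G>)"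
proof -
  have "compactin (product_topology (\<lambda>_. euclidean) UNIV) (PiE UNIV (\<lambda>_::'c. {0..1::real}))"
    by (subst compactin_PiE) auto
  then have "compact (PiE UNIV (\<lambda>_::'c. {0..1::real}))" by (simp add: euclidean_product_topology)
  note this[unfolded compact_filter, rule_format, of "filtermap u sequentially"]
  moreover have "filtermap u sequentially \<noteq> bot" by (simp add: filtermap_bot_iff)
  moreover have "eventually (\<lambda>x. x \<in> PiE UNIV (\<lambda>_::'c. {0..1})) (filtermap u sequentially)"
    using assms by (auto simp: eventually_filtermap PiE_UNIV_domain)
  ultimately obtain l where l: "l \<in> PiE UNIV (\<lambda>_::'c. {0..1})" "inf (nhds l) (filtermap u sequentially) \<noteq> bot"
    by blast
  \<comment> \<open>The tails of the sequence, refined by the preimages of the neighbourhoods of the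
    cluster point \<open>l\<close>.\<close>
  define \<G> where "\<G> = inf (filtercomap u (nhds l)) sequentially"
  have "\<G> \<noteq> bot"
  proof
    assume "\<G> = bot"
    then have "eventually (\<lambda>_. False) \<G>" by simp
    then obtain P Q where PQ: "eventually P (filtercomap u (nhds l))" "eventually Q sequentially" "\<And>n. P n \<Longrightarrow> Q n \<Longrightarrow> False"
      unfolding \<G>_def eventually_inf by blast
    then obtain R where R: "eventually R (nhds l)" "\<And>n. R (u n) \<Longrightarrow> P n" unfolding eventually_filtercomap by blast
    have "eventually (\<lambda>x. \<not> R x) (filtermap u sequentially)"
      unfolding eventually_filtermap by (rule eventually_mono[OF PQ(2)]) (use PQ R in blast)
    with R(1) have "eventually (\<lambda>_. False) (inf (nhds l) (filtermap u sequentially))"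
      unfolding eventually_inf by blast
    then show False using l(2) by (simp add: trivial_limit_def)
  qed
  moreover have "\<G> \<le> sequentially" by (simp add: \<G>_def)
  moreover have "((\<lambda>n. u n c) \<longlongrightarrow> l c) \<G>" for c
  proof -
    have "filterlim u (nhds l) \<G>" unfolding \<G>_def
      by (rule filterlim_mono[OF filterlim_filtercomap order_refl inf_le1])
    moreover have "((\<lambda>f. f c) \<longlongrightarrow> l c) (nhds l)"
      using continuous_on_product_coordinates[of c, unfolded continuous_on_def, rule_format, of l]
        tendsto_at_iff_tendsto_nhds[of "\<lambda>f. f c" l] by simp
    ultimately show ?thesis by (rule filterlim_compose[rotated])
  qed
  ultimately show ?thesis using l(1) by (intro exI[of _ \<G>]) auto
qed

context prob_space
begin

text \<open>The limit \<open>l\<close> is additive and dominated by the measure \<open>M\<close>.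
  Domination yields both countable additivity and absolute continuity, and the limit function is the
  Radon-Nikodym derivative.\<close>

lemma weak_limit_density:
  fixes D :: "nat \<Rightarrow> 'a \<Rightarrow> real"
  assumes D[measurable]: "\<And>n. D n \<in> borel_measurable M" and D01: "\<And>n x. x \<in> space M \<Longrightarrow> 0 \<le> D n x \<and> D n x \<le> 1"
    and G: "\<G> \<noteq> bot" 
    and lim: "\<And>A. A \<in> sets M \<Longrightarrow> ((\<lambda>n. \<integral>x. D n x * indicator A x \<partial>M) \<longlongrightarrow> l A) \<G>"
  shows "\<exists>w\<in>borel_measurable M. (\<forall>x. 0 \<le> w x \<and> w x \<le> 1) \<and> (\<forall>A\<in>sets M. l A = (\<integral>x. w x * indicator A x \<partial>M))"
proof -
  have i: "integrable M (\<lambda>x. D n x * indicator A x)" if "A \<in> sets M" for n A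
    using that D01 by (intro integrable_bdd[where B=1]) (auto simp: indicator_def)
  have ind: "(\<integral>x. indicator A x \<partial>M) = measure M A" if "A \<in> sets M" for A
    using that sets.sets_into_space[OF that] by (simp add: Int_absorb2)
  have le: "l A \<le> measure M A" if A: "A \<in> sets M" for A
  proof (rule tendsto_upperbound[OF lim[OF A] _ G], rule always_eventually, rule allI)
    fix n
    have "(\<integral>x. D n x * indicator A x \<partial>M) \<le> (\<integral>x. indicator A x \<partial>M)"
    proof (rule integral_mono[OF i[OF A]])
      show "integrable M (indicator A :: _ \<Rightarrow> real)"
        using A by (intro integrable_bdd[where B=1]) (auto simp: indicator_def[abs_def])
    qed (use D01 in \<open>auto simp: indicator_def\<close>)
    then show "(\<integral>x. D n x * indicator A x \<partial>M) \<le> measure M A" using ind[OF A] by simp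
  qed
  have ge: "0 \<le> l A" if A: "A \<in> sets M" for A
    by (rule tendsto_lowerbound[OF lim[OF A] _ G], rule always_eventually, rule allI, rule integral_nonneg_AE)
       (use D01 in \<open>auto simp: indicator_def\<close>)
  have add: "l (A \<union> B) = l A + l B" if A: "A \<in> sets M" and B: "B \<in> sets M" and AB: "A \<inter> B = {}" for A B
  proof (rule tendsto_unique[OF G])
    show "((\<lambda>n. \<integral>x. D n x * indicator (A \<union> B) x \<partial>M) \<longlongrightarrow> l (A \<union> B)) \<G>" using A B by (intro lim) auto
    have "(\<integral>x. D n x * indicator (A \<union> B) x \<partial>M) = (\<integral>x. D n x * indicator A x \<partial>M) + (\<integral>x. D n x * indicator B x \<partial>M)" for n
      by (subst Bochner_Integration.integral_add[OF i[OF A] i[OF B], symmetric])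
         (rule Bochner_Integration.integral_cong, use AB in \<open>auto simp: indicator_def\<close>)
    then show "((\<lambda>n. \<integral>x. D n x * indicator (A \<union> B) x \<partial>M) \<longlongrightarrow> l A + l B) \<G>"
      using tendsto_add[OF lim[OF A] lim[OF B]] by simp
  qed
  define \<mu> where "\<mu> A = ennreal (l A)" for A
  have pos: "positive (sets M) \<mu>"
    using le[of "{}"] ge[of "{}"] by (simp add: positive_def \<mu>_def)
  \<comment> \<open>For a finite additive set function this reduces to continuity at the empty set,
    which \<open>l\<close> inherits from \<open>M\<close>.\<close>
  have "countably_additive (sets M) \<mu>"
  proof (rule sets.empty_continuous_imp_countably_additive[OF pos])
    show "additive (sets M) \<mu>"
      by (auto simp: additive_def \<mu>_def add ge ennreal_plus)
    show "\<forall>A\<in>sets M. \<mu> A \<noteq> \<infinity>" by (simp add: \<mu>_def)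
    fix A :: "nat \<Rightarrow> 'a set" assume A: "range A \<subseteq> sets M" "decseq A" "(\<Inter>i. A i) = {}"
    have "(\<lambda>i. measure M (A i)) \<longlonglongrightarrow> measure M (\<Inter>i. A i)" by (rule finite_Lim_measure_decseq) (use A in auto)
    then have m: "(\<lambda>i. measure M (A i)) \<longlonglongrightarrow> 0" using A(3) by simp
    have "(\<lambda>i. l (A i)) \<longlonglongrightarrow> 0"
      by (rule tendsto_sandwich[OF _ _ tendsto_const m]) (use A le ge in \<open>auto intro!: always_eventually\<close>)
    then show "(\<lambda>i. \<mu> (A i)) \<longlonglongrightarrow> 0" unfolding \<mu>_def ennreal_0[symmetric] by (rule tendsto_ennrealI)
  qed
  define N where "N = measure_of (space M) (sets M) \<mu>"
  have N[simp]: "sets N = sets M" "space N = space M" by (simp_all add: N_def)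
  have eN: "emeasure N A = ennreal (l A)" if "A \<in> sets M" for A
    unfolding N_def using emeasure_measure_of_sigma[OF sets.sigma_algebra_axioms pos \<open>countably_additive (sets M) \<mu>\<close> that]
    by (simp add: \<mu>_def)
  interpret N: finite_measure N by (rule finite_measureI) (simp add: eN)
  have "absolutely_continuous M N"
    unfolding absolutely_continuous_def
  proof
    fix A assume "A \<in> null_sets M"
    then have A: "A \<in> sets M" "measure M A = 0" by (auto simp: measure_def)
    with le[OF A(1)] ge[OF A(1)] show "A \<in> null_sets N" by (auto simp: null_sets_def eN)
  qed
  from Radon_Nikodym_finite_measure[OF N.finite_measure_axioms N(1) this]
  obtain f where [measurable]: "f \<in> borel_measurable M" and f: "density M f = N" by blast
  have fA: "(\<integral>\<^sup>+x. f x * indicator A x \<partial>M) = ennreal (l A)" if "A \<in> sets M" for A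
    using eN[OF that] that by (subst (asm) f[symmetric]) (simp add: emeasure_density)
  \<comment> \<open>Otherwise \<open>l\<close> would exceed \<open>M\<close> on the set where the
    derivative is larger than 1.\<close>
  have f1: "AE x in M. f x \<le> 1"
  proof (rule ccontr)
    assume not: "\<not> ?thesis"
    let ?A = "{x\<in>space M. 1 < f x}"
    have A: "?A \<in> sets M" by measurable
    have neq: "emeasure M ?A \<noteq> 0"
      using not A by (subst (asm) AE_iff_measurable[OF A]) (auto simp: not_le)
    have "(\<integral>\<^sup>+x. indicator ?A x \<partial>M) < (\<integral>\<^sup>+x. f x * indicator ?A x \<partial>M)"
    proof (rule nn_integral_less)
      show "(\<integral>\<^sup>+x. indicator ?A x \<partial>M) \<noteq> \<infinity>" using A by (simp add: emeasure_eq_measure)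
      show "AE x in M. indicator ?A x \<le> f x * indicator ?A x" by (auto simp: indicator_def less_imp_le)
      show "\<not> (AE x in M. f x * indicator ?A x \<le> indicator ?A x)"
      proof
        assume "AE x in M. f x * indicator ?A x \<le> indicator ?A x"
        then have "AE x in M. f x \<le> 1" using AE_space
        proof eventually_elim
          case (elim x)
          then show ?case by (cases "f x \<le> 1") (auto simp: not_le)
        qed
        with not show False by simp
      qed
    qed auto
    also have "\<dots> = ennreal (l ?A)" by (rule fA[OF A])
    also have "\<dots> \<le> (\<integral>\<^sup>+x. indicator ?A x \<partial>M)" using le[OF A] A by (simp add: emeasure_eq_measure ennreal_leI)
    finally show False by simp
  qed
  \<comment> \<open>Truncation changes nothing almost everywhere and makes the bounds hold
    everywhere.\<close>
  define w where "w x = min 1 (enn2real (f x))" for x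
  have [measurable]: "w \<in> borel_measurable M" unfolding w_def by measurable
  have w01: "0 \<le> w x \<and> w x \<le> 1" for x by (simp add: w_def)
  have "l A = (\<integral>x. w x * indicator A x \<partial>M)" if A: "A \<in> sets M" for A
  proof -
    have "(\<integral>x. w x * indicator A x \<partial>M) = enn2real (\<integral>\<^sup>+x. ennreal (w x * indicator A x) \<partial>M)"
      using A w01 by (intro integral_eq_nn_integral) auto
    also have "(\<integral>\<^sup>+x. ennreal (w x * indicator A x) \<partial>M) = (\<integral>\<^sup>+x. f x * indicator A x \<partial>M)"
    proof (rule nn_integral_cong_AE)
      from f1 show "AE x in M. ennreal (w x * indicator A x) = f x * indicator A x"
      proof eventually_elim
        case (elim x)
        then have "ennreal (enn2real (f x)) = f x" by (intro ennreal_enn2real) (auto simp: less_top[symmetric] top_unique)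
        moreover have "enn2real (f x) \<le> 1" using enn2real_mono[OF elim] by simp
        ultimately show ?case by (auto simp: w_def indicator_def)
      qed
    qed
    also have "\<dots> = ennreal (l A)" by (rule fA[OF A])
    finally show ?thesis using ge[OF A] by simp
  qed
  then show ?thesis using w01 by (intro bexI[of _ w]) auto
qed

lemma AE_le_of_integral_le:
  fixes w w' :: "'a \<Rightarrow> real"
  assumes [measurable]: "w \<in> borel_measurable M" "w' \<in> borel_measurable M"
    and b: "\<And>x. x \<in> space M \<Longrightarrow> \<bar>w x\<bar> \<le> B" "\<And>x. x \<in> space M \<Longrightarrow> \<bar>w' x\<bar> \<le> B"
    and le: "\<And>A. A \<in> sets M \<Longrightarrow> (\<integral>x. w x * indicator A x \<partial>M) \<le> (\<integral>x. w' x * indicator A x \<partial>M)"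
  shows "AE x in M. w x \<le> w' x"
proof -
  let ?A = "{x\<in>space M. w' x < w x}"
  have A[measurable]: "?A \<in> sets M" by measurable
  have B: "0 \<le> B" using b(1) not_empty by fastforce
  have iw: "integrable M (\<lambda>x. w x * indicator ?A x)" "integrable M (\<lambda>x. w' x * indicator ?A x)"
    by (rule integrable_bdd[where B=B]; use b B in \<open>auto simp: indicator_def\<close>)+
  let ?d = "\<lambda>x. (w x - w' x) * indicator ?A x"
  have i: "integrable M ?d"
    using Bochner_Integration.integrable_diff[OF iw] by (simp add: left_diff_distrib)
  have "(\<integral>x. ?d x \<partial>M) = (\<integral>x. w x * indicator ?A x \<partial>M) - (\<integral>x. w' x * indicator ?A x \<partial>M)"
    unfolding left_diff_distrib by (rule Bochner_Integration.integral_diff[OF iw])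
  also have "\<dots> \<le> 0" using le[OF A] by simp
  finally have "(\<integral>x. ?d x \<partial>M) \<le> 0" .
  moreover have nn: "AE x in M. 0 \<le> ?d x" by (auto simp: indicator_def)
  ultimately have "(\<integral>x. ?d x \<partial>M) = 0" using integral_nonneg_AE[OF nn] by simp
  then have "AE x in M. ?d x = 0" using integral_nonneg_eq_0_iff_AE[OF i nn] by simp
  then show ?thesis using AE_space by eventually_elim (auto simp: indicator_def split: if_splits)
qed

end

section \<open>Graphons and step kernels\<close>

text \<open>A Borel version of a member of \<open>W0\<close>. Bounds and symmetry are required on
  the whole plane, which spares side conditions; \<open>W0_graphon\<close> provides such a version
  for every member of \<open>W0\<close>.\<close>

definition graphon :: "(real \<times> real \<Rightarrow> real) \<Rightarrow> bool" where
  "graphon w \<longleftrightarrow> w \<in> borel_measurable (lam \<Otimes>\<^sub>M lam) \<and> (\<forall>x y. 0 \<le> w (x, y) \<and> w (x, y) \<le> 1) \<and>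
    (\<forall>x y. w (x, y) = w (y, x))"

lemma graphon_measurable: "graphon w \<Longrightarrow> w \<in> borel_measurable (lam \<Otimes>\<^sub>M lam)"
  by (simp add: graphon_def)

lemma graphon_bounds: "graphon w \<Longrightarrow> 0 \<le> w z \<and> w z \<le> 1"
  by (cases z) (auto simp: graphon_def)

lemma graphon_sym: "graphon w \<Longrightarrow> w (x, y) = w (y, x)"
  by (auto simp: graphon_def)

interpretation lam: prob_space lam by (rule prob_space_lam)
interpretation lam2: pair_prob_space lam lam ..

text \<open>From sets to fractional weights: a weighted sum is largest when the weight is
  \<open>c\<close> on the positive terms and 0 elsewhere. The negative of \<open>h\<close> gives the
  other bound.\<close>

lemma abs_sum_mult_le:
  fixes h a :: "'a \<Rightarrow> real"
  assumes V: "finite V" and h: "\<And>S. S \<subseteq> V \<Longrightarrow> \<bar>\<Sum>v\<in>S. h v\<bar> \<le> K" 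
    and a: "\<And>v. v \<in> V \<Longrightarrow> 0 \<le> a v \<and> a v \<le> c" and c: "0 \<le> c"
  shows "\<bar>\<Sum>v\<in>V. h v * a v\<bar> \<le> c * K"
proof -
  have *: "(\<Sum>v\<in>V. h v * a v) \<le> c * K" if h: "\<And>S. S \<subseteq> V \<Longrightarrow> \<bar>\<Sum>v\<in>S. h v\<bar> \<le> K" for h :: "'a \<Rightarrow> real"
  proof -
    let ?P = "{v\<in>V. 0 < h v}"
    have "(\<Sum>v\<in>V. h v * a v) \<le> (\<Sum>v\<in>V. if 0 < h v then h v * c else 0)"
      by (rule sum_mono) (use a in \<open>auto intro: mult_left_mono mult_nonpos_nonneg\<close>)
    also have "\<dots> = (\<Sum>v\<in>?P. h v * c)" using V by (simp add: sum.inter_filter)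
    also have "\<dots> = c * (\<Sum>v\<in>?P. h v)" by (simp add: sum_distrib_left mult.commute)
    also have "\<dots> \<le> c * K" using h[of ?P] c by (intro mult_left_mono) auto
    finally show ?thesis .
  qed
  from *[of h] *[of "\<lambda>v. - h v"] h show ?thesis by (auto simp: sum_negf abs_le_iff)
qed

text \<open>The measurable sets \<open>A\<close> and \<open>B\<close> meet the fibres of
  \<open>\<theta>\<close> in fractions of their mass, so they act on \<open>R\<close> as fractional
  vertex sets. The bound for genuine vertex sets is extended to weights in each of the two
  variables.\<close>

lemma step_cut_le:
  fixes R :: "'a \<times> 'a \<Rightarrow> real" and e :: real
  assumes V: "finite V" "V \<noteq> {}" and \<theta>[measurable]: "\<theta> \<in> measurable lam (uniform_count_measure V)"
    and d: "distr lam (uniform_count_measure V) \<theta> = uniform_count_measure V"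
    and R: "\<And>S T. S \<subseteq> V \<Longrightarrow> T \<subseteq> V \<Longrightarrow> \<bar>\<Sum>z\<in>S \<times> T. R z\<bar> \<le> e * (card V)\<^sup>2"
    and [measurable]: "A \<in> sets lam" "B \<in> sets lam"
  shows "\<bar>\<integral>x. \<integral>y. R (\<theta> x, \<theta> y) * (indicator A x * indicator B y) \<partial>lam \<partial>lam\<bar> \<le> e"
proof -
  define N where "N = real (card V)"
  have N: "0 < N" using V by (simp add: N_def card_gt_0_iff)
  \<comment> \<open>The mass of \<open>C\<close> in the fibre over \<open>v\<close>; it is at most
    \<open>1 / N\<close> because \<open>\<theta>\<close> is uniform.\<close>
  define a :: "real set \<Rightarrow> 'a \<Rightarrow> real" where "a C v = (\<integral>x. indicator {v} (\<theta> x) * indicator C x \<partial>lam)" for C v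
  have [measurable]: "(\<lambda>x. indicator {v} (\<theta> x) :: real) \<in> borel_measurable lam" if "v \<in> V" for v
    by (rule measurable_compose[OF \<theta>]) (use that in \<open>auto simp: sets_uniform_count_measure intro!: borel_measurable_indicator\<close>)
  have \<theta>V: "\<theta> x \<in> V" if "x \<in> {0..1}" for x
    using measurable_space[OF \<theta>, of x] that by (simp add: space_uniform_count_measure)
  have a: "0 \<le> a C v \<and> a C v \<le> 1 / N" if [measurable]: "C \<in> sets lam" and v: "v \<in> V" for C v
  proof
    show "0 \<le> a C v" unfolding a_def by (rule integral_nonneg_AE) auto
    have "a C v \<le> (\<integral>x. (indicator {v} (\<theta> x) :: real) \<partial>lam)" unfolding a_def
      by (rule integral_mono; (rule lam.integrable_bdd[where B=1])?) (use v in \<open>auto simp: indicator_def\<close>)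
    also have "\<dots> = (\<integral>u. (indicator {v} u :: real) \<partial>distr lam (uniform_count_measure V) \<theta>)"
      using v by (subst integral_distr[OF \<theta>]) (auto simp: sets_uniform_count_measure intro!: borel_measurable_indicator)
    also have "\<dots> = 1 / N" unfolding d using V v by (simp add: integral_uniform_count_measure N_def indicator_def)
    finally show "a C v \<le> 1 / N" .
  qed
  have exp: "R (\<theta> x, \<theta> y) = (\<Sum>v\<in>V. \<Sum>w\<in>V. R (v, w) * (indicator {v} (\<theta> x) * indicator {w} (\<theta> y)))"
    if "x \<in> {0..1}" "y \<in> {0..1}" for x y
  proof -
    have "(\<Sum>w\<in>V. R (v, w) * (indicator {v} (\<theta> x) * indicator {w} (\<theta> y))) = R (v, \<theta> y) * indicator {v} (\<theta> x)" for v
      using V \<theta>V[OF that(2)] by (subst sum.remove[of V "\<theta> y"]) (auto simp: indicator_def intro!: sum.neutral)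
    moreover have "(\<Sum>v\<in>V. R (v, \<theta> y) * indicator {v} (\<theta> x)) = R (\<theta> x, \<theta> y)"
      using V \<theta>V[OF that(1)] by (subst sum.remove[of V "\<theta> x"]) (auto simp: indicator_def intro!: sum.neutral)
    ultimately show ?thesis by (simp only:)
  qed
  have int1: "integrable lam (\<lambda>y. c * (indicator {w} (\<theta> y) * indicator C y) :: real)" if "C \<in> sets lam" "w \<in> V" for c w C
    by (rule integrable_mult_right, rule lam.integrable_bdd[where B=1]) (use that in \<open>auto simp: indicator_def\<close>)
  have int2: "integrable lam (\<lambda>y. indicator {w} (\<theta> y) * indicator C y :: real)" if "C \<in> sets lam" "w \<in> V" for w C
    using int1[OF that, of 1] by simp
  have "(\<integral>y. R (\<theta> x, \<theta> y) * (indicator A x * indicator B y) \<partial>lam) = 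
     (\<Sum>v\<in>V. (\<Sum>w\<in>V. R (v, w) * a B w) * (indicator {v} (\<theta> x) * indicator A x))" if x: "x \<in> {0..1}" for x
  proof -
    have "(\<integral>y. R (\<theta> x, \<theta> y) * (indicator A x * indicator B y) \<partial>lam) = 
      (\<integral>y. (\<Sum>v\<in>V. \<Sum>w\<in>V. (R (v, w) * (indicator {v} (\<theta> x) * indicator A x)) * (indicator {w} (\<theta> y) * indicator B y)) \<partial>lam)"
      by (rule Bochner_Integration.integral_cong) (use exp[OF x] in \<open>auto simp: sum_distrib_left sum_distrib_right ac_simps\<close>)
    also have "\<dots> = (\<Sum>v\<in>V. \<Sum>w\<in>V. (R (v, w) * (indicator {v} (\<theta> x) * indicator A x)) * a B w)"
      unfolding a_def by (subst Bochner_Integration.integral_sum, (intro Bochner_Integration.integrable_sum int1; simp),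
        intro sum.cong[OF refl], subst Bochner_Integration.integral_sum) (auto intro!: int1 simp: int2)
    finally show ?thesis by (simp add: sum_distrib_left sum_distrib_right ac_simps)
  qed
  then have "(\<integral>x. \<integral>y. R (\<theta> x, \<theta> y) * (indicator A x * indicator B y) \<partial>lam \<partial>lam) =
    (\<integral>x. (\<Sum>v\<in>V. (\<Sum>w\<in>V. R (v, w) * a B w) * (indicator {v} (\<theta> x) * indicator A x)) \<partial>lam)"
    by (intro Bochner_Integration.integral_cong) auto
  also have "\<dots> = (\<Sum>v\<in>V. (\<Sum>w\<in>V. R (v, w) * a B w) * a A v)"
    by (subst Bochner_Integration.integral_sum) (auto intro!: int1 sum.cong simp: a_def int2)
  also have "\<bar>\<dots>\<bar> \<le> 1 / N * (1 / N * (e * N\<^sup>2))"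
  proof (rule abs_sum_mult_le[OF V(1)])
    fix S assume S: "S \<subseteq> V"
    have "(\<Sum>v\<in>S. \<Sum>w\<in>V. R (v, w) * a B w) = (\<Sum>w\<in>V. (\<Sum>v\<in>S. R (v, w)) * a B w)"
      by (subst sum.swap) (simp add: sum_distrib_right)
    also have "\<bar>\<dots>\<bar> \<le> 1 / N * (e * N\<^sup>2)"
    proof (rule abs_sum_mult_le[OF V(1)])
      fix T assume T: "T \<subseteq> V"
      have "(\<Sum>w\<in>T. \<Sum>v\<in>S. R (v, w)) = (\<Sum>z\<in>S \<times> T. R z)"
        by (subst sum.swap) (simp add: sum.cartesian_product)
      then show "\<bar>\<Sum>w\<in>T. \<Sum>v\<in>S. R (v, w)\<bar> \<le> e * N\<^sup>2" using R[OF S T] by (simp add: N_def)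
    qed (use a N in auto)
    finally show "\<bar>\<Sum>v\<in>S. \<Sum>w\<in>V. R (v, w) * a B w\<bar> \<le> 1 / N * (e * N\<^sup>2)" .
  qed (use a N in auto)
  also have "\<dots> = e" using N by (simp add: power2_eq_square)
  finally show ?thesis .
qed

lemma AE_lam2_both:
  assumes "AE x in lam. Q x"
  shows "AE z in lam \<Otimes>\<^sub>M lam. Q (fst z) \<and> Q (snd z)"
proof -
  obtain N where N: "{x\<in>space lam. \<not> Q x} \<subseteq> N" "N \<in> null_sets lam"
    using assms unfolding eventually_ae_filter by blast
  have "N \<times> space lam \<in> null_sets (lam \<Otimes>\<^sub>M lam)" by (rule lam.times_in_null_sets1[OF N(2) sets.top])
  moreover have "space lam \<times> N \<in> null_sets (lam \<Otimes>\<^sub>M lam)" by (rule lam.times_in_null_sets2[OF sets.top N(2)])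
  ultimately have "N \<times> space lam \<union> space lam \<times> N \<in> null_sets (lam \<Otimes>\<^sub>M lam)" by (rule null_sets.Un)
  then show ?thesis by (rule AE_I') (use N(1) in \<open>auto simp: space_pair_measure\<close>)
qed

text \<open>Since \<open>D\<close> is symmetric, the kernel and its transpose are equally close to
  it: the test functions merely exchange their roles. Averaging the two estimates costs
  nothing.\<close>

lemma cutf_symmetrize:
  assumes [measurable]: "D \<in> borel_measurable (lam \<Otimes>\<^sub>M lam)" "w \<in> borel_measurable (lam \<Otimes>\<^sub>M lam)"
    and b: "\<And>x y. x \<in> {0..1} \<Longrightarrow> y \<in> {0..1} \<Longrightarrow> \<bar>D (x, y)\<bar> \<le> 1 \<and> \<bar>w (x, y)\<bar> \<le> 1"
    and sym: "\<And>x y. x \<in> {0..1} \<Longrightarrow> y \<in> {0..1} \<Longrightarrow> D (x, y) = D (y, x)"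
    and cut: "cutf lam (\<lambda>z. D z - w z) e"
  shows "cutf lam (\<lambda>z. D z - (w z + w (snd z, fst z)) / 2) e"
  unfolding cutf_def
proof (intro ballI impI)
  fix f g :: "real \<Rightarrow> real"
  assume [measurable]: "f \<in> borel_measurable lam" "g \<in> borel_measurable lam"
    and f: "\<forall>x\<in>space lam. \<bar>f x\<bar> \<le> 1" and g: "\<forall>x\<in>space lam. \<bar>g x\<bar> \<le> 1"
  let ?I = "\<lambda>f g. \<integral>x. \<integral>y. (D (x, y) - w (x, y)) * (f x * g y) \<partial>lam \<partial>lam"
  have bd: "\<bar>(D (x, y) - w (x, y)) * (u * v)\<bar> \<le> 2"
    if "x \<in> {0..1}" "y \<in> {0..1}" "\<bar>u\<bar> \<le> 1" "\<bar>v\<bar> \<le> 1" for x y and u v :: real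
  proof -
    have "\<bar>u * v\<bar> \<le> 1" using mult_mono[OF that(3,4)] by (simp add: abs_mult)
    moreover have "\<bar>D (x, y) - w (x, y)\<bar> \<le> 2" using b[OF that(1,2)] by auto
    ultimately show ?thesis using mult_mono[of "\<bar>D (x, y) - w (x, y)\<bar>" 2 "\<bar>u * v\<bar>" 1] by (simp add: abs_mult)
  qed
  have 1: "\<bar>?I f g\<bar> \<le> e" "\<bar>?I g f\<bar> \<le> e"
    using cut[unfolded cutf_def, rule_format, of f g] cut[unfolded cutf_def, rule_format, of g f] f g by auto
  have sw: "?I g f = (\<integral>x. \<integral>y. (D (y, x) - w (y, x)) * (g y * f x) \<partial>lam \<partial>lam)"
    by (rule lam.integral_swap[where B=2]) (use f g in \<open>auto intro!: bd\<close>)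
  have pt: "(D (x, y) - (w (x, y) + w (y, x)) / 2) * (f x * g y) = 
      ((D (x, y) - w (x, y)) * (f x * g y) + (D (y, x) - w (y, x)) * (g y * f x)) / 2" if "x \<in> {0..1}" "y \<in> {0..1}" for x y
    using sym[OF that] by (simp add: field_simps)
  have i: "integrable (lam \<Otimes>\<^sub>M lam) (\<lambda>z. (D z - w z) * (f (fst z) * g (snd z)))"
     "integrable (lam \<Otimes>\<^sub>M lam) (\<lambda>z. (D (snd z, fst z) - w (snd z, fst z)) * (g (snd z) * f (fst z)))"
    by (rule lam.pair_integrable_bdd[where B=2]; use f g in \<open>auto intro!: bd\<close>)+
  have "(\<integral>x. \<integral>y. (D (x, y) - (w (x, y) + w (y, x)) / 2) * (f x * g y) \<partial>lam \<partial>lam) = 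
      (\<integral>x. \<integral>y. ((D (x, y) - w (x, y)) * (f x * g y) + (D (y, x) - w (y, x)) * (g y * f x)) / 2 \<partial>lam \<partial>lam)"
    by (intro Bochner_Integration.integral_cong refl pt) auto
  also have "\<dots> = (\<integral>z. ((D z - w z) * (f (fst z) * g (snd z)) + (D (snd z, fst z) - w (snd z, fst z)) * (g (snd z) * f (fst z))) / 2 \<partial>(lam \<Otimes>\<^sub>M lam))"
    using lam2.integral_fst'[of "\<lambda>z. ((D z - w z) * (f (fst z) * g (snd z)) + (D (snd z, fst z) - w (snd z, fst z)) * (g (snd z) * f (fst z))) / 2"] i
    by simp
  also have "\<dots> = ((\<integral>z. (D z - w z) * (f (fst z) * g (snd z)) \<partial>(lam \<Otimes>\<^sub>M lam)) + 
      (\<integral>z. (D (snd z, fst z) - w (snd z, fst z)) * (g (snd z) * f (fst z)) \<partial>(lam \<Otimes>\<^sub>M lam))) / 2"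
    using Bochner_Integration.integral_add[OF i] by simp
  also have "\<dots> = (?I f g + ?I g f) / 2"
    using lam2.integral_fst'[OF i(1)] lam2.integral_fst'[OF i(2)] unfolding sw by simp
  finally have "(\<integral>x. \<integral>y. (D (x, y) - (w (x, y) + w (y, x)) / 2) * (f x * g y) \<partial>lam \<partial>lam) = (?I f g + ?I g f) / 2" .
  then show "\<bar>\<integral>x. \<integral>y. (D (x, y) - (w (x, y) + w (snd (x, y), fst (x, y))) / 2) * (f x * g y) \<partial>lam \<partial>lam\<bar> \<le> e"
    using 1 by simp
qed

text \<open>A placement of the vertices on the interval with equal masses. Pulling back along it
  turns a graph on \<open>V\<close> into a graphon with the same densities.\<close>

definition uniformly_onto :: "(real \<Rightarrow> 'a) \<Rightarrow> 'a set \<Rightarrow> bool" where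
  "uniformly_onto \<theta> V \<longleftrightarrow> \<theta> \<in> measurable lam (uniform_count_measure V) \<and>
    distr lam (uniform_count_measure V) \<theta> = uniform_count_measure V"

lemma sets_uniform_count_pair:
  assumes "finite V"
  shows "sets (uniform_count_measure V \<Otimes>\<^sub>M uniform_count_measure V) = Pow (V \<times> V)"
proof -
  have "sets (uniform_count_measure V \<Otimes>\<^sub>M uniform_count_measure V) = sets (count_space V \<Otimes>\<^sub>M count_space V)"
    by (rule sets_pair_measure_cong) (simp_all add: sets_uniform_count_measure)
  then show ?thesis using pair_measure_countable[of V V] assms by (simp only: sets_count_space countable_finite)
qed

lemma measurable_uniform_count_pair:
  assumes "finite V" "\<And>z. z \<in> V \<times> V \<Longrightarrow> f z \<in> space N"
  shows "f \<in> measurable (uniform_count_measure V \<Otimes>\<^sub>M uniform_count_measure V) N"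
  by (rule measurableI) (use assms in \<open>auto simp: sets_uniform_count_pair space_pair_measure space_uniform_count_measure\<close>)

lemma uniformly_onto_measurable2:
  assumes \<theta>: "uniformly_onto \<theta> V" and V: "finite V"
  shows "(\<lambda>z. f (\<theta> (fst z), \<theta> (snd z)) :: real) \<in> borel_measurable (lam \<Otimes>\<^sub>M lam)"
proof (rule measurable_compose[where g=f])
  show "f \<in> borel_measurable (uniform_count_measure V \<Otimes>\<^sub>M uniform_count_measure V)"
    by (rule measurable_uniform_count_pair) (use V in auto)
  have [measurable]: "\<theta> \<in> measurable lam (uniform_count_measure V)" using \<theta> by (simp add: uniformly_onto_def)
  show "(\<lambda>z. (\<theta> (fst z), \<theta> (snd z))) \<in> measurable (lam \<Otimes>\<^sub>M lam) (uniform_count_measure V \<Otimes>\<^sub>M uniform_count_measure V)"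
    by measurable
qed

lemma uniformly_onto_in: "uniformly_onto \<theta> V \<Longrightarrow> x \<in> {0..1} \<Longrightarrow> \<theta> x \<in> V"
  using measurable_space[of \<theta> lam "uniform_count_measure V" x] by (simp add: uniformly_onto_def space_uniform_count_measure)

lemma abs_rect_sum_le: "\<bar>rect_sum A B A' B' m z\<bar> \<le> m"
proof -
  have "\<bar>rect_sum A B A' B' m z\<bar> \<le> (\<Sum>j<m. \<bar>indicator (A j \<times> B j) z - indicator (A' j \<times> B' j) z :: real\<bar>)"
    unfolding rect_sum_def by (rule sum_abs)
  also have "\<dots> \<le> (\<Sum>j<m. 1)" by (rule sum_mono) (auto simp: indicator_def)
  finally show ?thesis by simp
qed

section \<open>Compactness of graph sequences in cut norm\<close>

text \<open>For every \<open>m\<close>, weak regularity approximates the kernels by sums of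
  \<open>m\<close> signed rectangles. The vertices are placed so that, almost everywhere, membership
  in all these rectangles stabilises; the rectangles then converge in mean. A weak limit of the
  kernels stays within \<open>1 / sqrt m\<close> of the limit rectangles, hence is close to the
  kernels themselves. The two sequences, indexed by \<open>bool\<close>, share one placement, so
  their order survives in the limit.\<close>

theorem graph_sequence_compact:
  fixes V :: "nat \<Rightarrow> 'a set" and D :: "bool \<Rightarrow> nat \<Rightarrow> 'a \<times> 'a \<Rightarrow> real"
  assumes V: "\<And>n. finite (V n)" "\<And>n. V n \<noteq> {}"
    and D01: "\<And>i n z. 0 \<le> D i n z \<and> D i n z \<le> 1"
    and sym: "\<And>i n x y. D i n (x, y) = D i n (y, x)"
    and le: "\<And>n z. D False n z \<le> D True n z"
  shows "\<exists>s \<theta> w. strict_mono (s :: nat \<Rightarrow> nat) \<and> (\<forall>n. uniformly_onto (\<theta> n) (V (s n))) \<and> (\<forall>i. graphon (w i)) \<and>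
    (AE z in lam \<Otimes>\<^sub>M lam. w False z \<le> w True z) \<and>
    (\<forall>i. (\<lambda>n. C4 lam (\<lambda>z. D i (s n) (\<theta> n (fst z), \<theta> n (snd z)) - w i z)) \<longlonglongrightarrow> 0)"
proof -
  define reg where "reg n i m A \<longleftrightarrow> (1 \<le> m \<longrightarrow> (\<forall>S\<subseteq>V n. \<forall>T\<subseteq>V n.
    \<bar>\<Sum>z\<in>S \<times> T. D i n z - 1 / sqrt (real m) * rect_sum (A 0) (A 1) (A 2) (A 3) m z\<bar> \<le> (card (V n))\<^sup>2 / sqrt (real m)))"
    for n i m and A :: "nat \<Rightarrow> nat \<Rightarrow> 'a set"
  have reg: "\<exists>A. reg n i m A" for n i m
  proof (cases "1 \<le> m")
    case True
    have "\<bar>D i n z\<bar> \<le> 1" for z using D01[of i n z] by auto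
    with weak_regularity[of "V n" m "D i n"] V(1) True
    have "\<exists>A B A' B'. \<forall>S\<subseteq>V n. \<forall>T\<subseteq>V n.
      \<bar>\<Sum>z\<in>S \<times> T. D i n z - 1 / sqrt (real m) * rect_sum A B A' B' m z\<bar> \<le> (card (V n))\<^sup>2 / sqrt (real m)"
      by simp
    then obtain A B A' B' where
      *: "\<forall>S\<subseteq>V n. \<forall>T\<subseteq>V n. \<bar>\<Sum>z\<in>S \<times> T. D i n z - 1 / sqrt (real m) * rect_sum A B A' B' m z\<bar> \<le> (card (V n))\<^sup>2 / sqrt (real m)"
      by (elim exE)
    show ?thesis
      by (rule exI[of _ "\<lambda>c. if c = 0 then A else if c = 1 then B else if c = 2 then A' else B'"]) (use * in \<open>simp add: reg_def\<close>)
  qed (simp add: reg_def)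
  have "\<exists>A. \<forall>n i m. reg n i m (A n i m)"
    by (rule choice, rule allI, rule choice, rule allI, rule choice, rule allI, rule reg)
  then obtain A where A0: "\<And>n i m. reg n i m (A n i m)" by blast
  have A: "\<And>n i m. 1 \<le> m \<Longrightarrow> (\<forall>S\<subseteq>V n. \<forall>T\<subseteq>V n.
    \<bar>\<Sum>z\<in>S \<times> T. D i n z - 1 / sqrt (real m) * rect_sum (A n i m 0) (A n i m 1) (A n i m 2) (A n i m 3) m z\<bar> \<le> (card (V n))\<^sup>2 / sqrt (real m))"
    using A0 unfolding reg_def by (rule mp)
  \<comment> \<open>One bit for each kernel \<open>i\<close>, level \<open>m\<close>, side
    \<open>c\<close> among the four families, and rectangle \<open>j\<close>. All of them are made
    to converge at once.\<close>
  define b where "b n v k = (case (from_nat k :: bool \<times> nat \<times> nat \<times> nat) of (i, m, c, j) \<Rightarrow> v \<in> A n i m c j)" for n v k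
  from bits_converge[where V=V and b=b, OF V] obtain s \<theta> where s: "strict_mono (s :: nat \<Rightarrow> nat)"
    and \<theta>: "\<And>n. uniformly_onto (\<theta> n) (V (s n))"
    and ae: "AE x in lam. \<forall>j. \<exists>l. \<forall>\<^sub>F n in sequentially. b (s n) (\<theta> n x) j = l"
    unfolding uniformly_onto_def by blast
  \<comment> \<open>The sides of the limit rectangles: points that eventually always lie in the
    given side.\<close>
  define Bs where "Bs i m c j = {x\<in>space lam. \<forall>\<^sub>F n in sequentially. \<theta> n x \<in> A (s n) i m c j}" for i m c j
  have \<theta>V: "\<theta> n x \<in> V (s n)" if "x \<in> {0..1}" for n x using uniformly_onto_in[OF \<theta> that] .
  have [measurable]: "{x\<in>space lam. \<theta> n x \<in> B} \<in> sets lam" for n B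
  proof -
    have "{x\<in>space lam. \<theta> n x \<in> B} = \<theta> n -` (B \<inter> V (s n)) \<inter> space lam" using \<theta>V by auto
    also have "\<dots> \<in> sets lam"
      by (rule measurable_sets[of _ _ "uniform_count_measure (V (s n))"]) (use \<theta> in \<open>auto simp: uniformly_onto_def sets_uniform_count_measure\<close>)
    finally show ?thesis .
  qed
  have Bs[measurable]: "Bs i m c j \<in> sets lam" for i m c j unfolding Bs_def by measurable
  define e where "e m = 1 / sqrt (real m)" for m
  define Mn where "Mn n i m z = rect_sum (A (s n) i m 0) (A (s n) i m 1) (A (s n) i m 2) (A (s n) i m 3) m (\<theta> n (fst z), \<theta> n (snd z))" for n i m z
  define Ml where "Ml i m z = rect_sum (Bs i m 0) (Bs i m 1) (Bs i m 2) (Bs i m 3) m z" for i m z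
  define Dn where "Dn n i z = D i (s n) (\<theta> n (fst z), \<theta> n (snd z))" for n i z
  have Mn_meas[measurable]: "Mn n i m \<in> borel_measurable (lam \<Otimes>\<^sub>M lam)" for n i m
    unfolding Mn_def[abs_def] by (rule uniformly_onto_measurable2[OF \<theta> V(1)])
  have Dn_meas[measurable]: "Dn n i \<in> borel_measurable (lam \<Otimes>\<^sub>M lam)" for n i
    unfolding Dn_def[abs_def] by (rule uniformly_onto_measurable2[OF \<theta> V(1)])
  have Ml_meas[measurable]: "Ml i m \<in> borel_measurable (lam \<Otimes>\<^sub>M lam)" for i m
    unfolding Ml_def rect_sum_def by measurable
  have MnB: "\<bar>Mn n i m z\<bar> \<le> m" for n i m z unfolding Mn_def by (rule abs_rect_sum_le)
  have MlB: "\<bar>Ml i m z\<bar> \<le> m" for i m z unfolding Ml_def by (rule abs_rect_sum_le)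
  have Dn01: "0 \<le> Dn n i z \<and> Dn n i z \<le> 1" for n i z unfolding Dn_def by (rule D01)
  have ae1: "AE x in lam. \<forall>i m c j. \<forall>\<^sub>F n in sequentially. \<theta> n x \<in> A (s n) i m c j \<longleftrightarrow> x \<in> Bs i m c j"
    using ae AE_space
  proof eventually_elim
    case (elim x)
    show ?case
    proof (intro allI)
      fix i :: bool and m c j :: nat
      from elim(1)[rule_format, of "to_nat (i, m, c, j)"]
      obtain l where l: "\<forall>\<^sub>F n in sequentially. (\<theta> n x \<in> A (s n) i m c j) = l" by (auto simp: b_def)
      have "x \<in> Bs i m c j \<longleftrightarrow> l"
      proof (cases l)
        case True
        then show ?thesis using l elim(2) by (simp add: Bs_def)
      next
        case False
        have "\<not> (\<forall>\<^sub>F n in sequentially. \<theta> n x \<in> A (s n) i m c j)"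
        proof
          assume "\<forall>\<^sub>F n in sequentially. \<theta> n x \<in> A (s n) i m c j"
          with l have "\<forall>\<^sub>F n in sequentially. False" by eventually_elim (use False in simp)
          then show False by simp
        qed
        then show ?thesis using False by (simp add: Bs_def)
      qed
      with l show "\<forall>\<^sub>F n in sequentially. \<theta> n x \<in> A (s n) i m c j \<longleftrightarrow> x \<in> Bs i m c j" by simp
    qed
  qed
  have Mconv: "AE z in lam \<Otimes>\<^sub>M lam. \<forall>\<^sub>F n in sequentially. Mn n i m z = Ml i m z" for i m
    using AE_lam2_both[OF ae1]
  proof eventually_elim
    case (elim z)
    have "\<forall>\<^sub>F n in sequentially. \<forall>c\<in>{..<4}. \<forall>j\<in>{..<m}. 
      (\<theta> n (fst z) \<in> A (s n) i m c j \<longleftrightarrow> fst z \<in> Bs i m c j) \<and> (\<theta> n (snd z) \<in> A (s n) i m c j \<longleftrightarrow> snd z \<in> Bs i m c j)"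
      by (intro eventually_ball_finite ballI eventually_conj) (use elim in auto)
    then show ?case
    proof eventually_elim
      case (elim n)
      show ?case unfolding Mn_def Ml_def rect_sum_def
        by (intro sum.cong refl arg_cong2[where f="(-)"]) (use elim in \<open>auto simp: indicator_def mem_Times_iff\<close>)
    qed
  qed
  define \<delta> where "\<delta> i m n = (\<integral>z. \<bar>Mn n i m z - Ml i m z\<bar> \<partial>(lam \<Otimes>\<^sub>M lam))" for i m n
  have \<delta>: "\<delta> i m \<longlonglongrightarrow> 0" for i m
  proof -
    have "(\<lambda>n. \<integral>z. \<bar>Mn n i m z - Ml i m z\<bar> \<partial>(lam \<Otimes>\<^sub>M lam)) \<longlonglongrightarrow> (\<integral>z. 0 \<partial>(lam \<Otimes>\<^sub>M lam))"
    proof (rule integral_dominated_convergence[where w="\<lambda>_. 2 * real m"])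
      from Mconv[of i m] show "AE z in lam \<Otimes>\<^sub>M lam. (\<lambda>n. \<bar>Mn n i m z - Ml i m z\<bar>) \<longlonglongrightarrow> 0"
      proof eventually_elim
        case (elim z)
        then show ?case by (intro tendsto_eventually) (auto elim: eventually_mono)
      qed
      show "AE z in lam \<Otimes>\<^sub>M lam. norm \<bar>Mn n i m z - Ml i m z\<bar> \<le> 2 * real m" for n
      proof (rule AE_I2)
        fix z show "norm \<bar>Mn n i m z - Ml i m z\<bar> \<le> 2 * real m" using MnB[of n i m z] MlB[of i m z] by auto
      qed
    qed auto
    then show ?thesis by (simp add: \<delta>_def[abs_def])
  qed
  \<comment> \<open>Both kernels are tested against all measurable sets of the square, to be made
    convergent along a single filter.\<close>
  define u where "u n c = (\<integral>z. Dn n (fst c) z * indicator (snd c) z \<partial>(lam \<Otimes>\<^sub>M lam))" for n and c :: "bool \<times> (real \<times> real) set"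
  have iD: "integrable (lam \<Otimes>\<^sub>M lam) (\<lambda>z. Dn n i z * indicator C z)" if [measurable]: "C \<in> sets (lam \<Otimes>\<^sub>M lam)" for n i C
    by (rule lam.pair_integrable_bdd[where B=1]) (use Dn01 in \<open>auto simp: indicator_def abs_le_iff intro: order_trans[of _ 0]\<close>)
  have u01: "(if snd c \<in> sets (lam \<Otimes>\<^sub>M lam) then u n c else 0) \<in> {0..1}" for n c
  proof -
    have "u n c \<in> {0..1}" if c[measurable]: "snd c \<in> sets (lam \<Otimes>\<^sub>M lam)"
    proof -
      have "0 \<le> u n c" unfolding u_def by (rule integral_nonneg_AE) (use Dn01 in auto)
      moreover have "\<bar>u n c\<bar> \<le> 1" unfolding u_def
        by (rule lam2.P.abs_integral_le) (use Dn01 in \<open>auto simp: indicator_def abs_le_iff intro: order_trans[of _ 0]\<close>)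
      ultimately show ?thesis by auto
    qed
    then show ?thesis by auto
  qed
  \<comment> \<open>The value 0 at non-measurable sets keeps the whole family inside the unit
    interval.\<close>
  define v where "v n c = (if snd c \<in> sets (lam \<Otimes>\<^sub>M lam) then u n c else 0)" for n c
  have "v n c \<in> {0..1}" for n c unfolding v_def by (rule u01)
  from ex_limit_filter[of v, OF this] obtain \<G> where \<G>: "\<G> \<noteq> bot" "\<G> \<le> sequentially"
    and l0: "\<forall>c. \<exists>l\<in>{0..1}. ((\<lambda>n. v n c) \<longlongrightarrow> l) \<G>" by blast
  from l0 have "\<forall>c. \<exists>l. ((\<lambda>n. v n c) \<longlongrightarrow> l) \<G>" by blast
  from choice[OF this] obtain l where l: "\<And>c. ((\<lambda>n. v n c) \<longlongrightarrow> l c) \<G>" by blast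
  have lim: "((\<lambda>n. \<integral>z. Dn n i z * indicator C z \<partial>(lam \<Otimes>\<^sub>M lam)) \<longlongrightarrow> l (i, C)) \<G>" if "C \<in> sets (lam \<Otimes>\<^sub>M lam)" for i C
    using l[of "(i, C)"] that by (simp add: v_def u_def)
  have "\<exists>w. w \<in> borel_measurable (lam \<Otimes>\<^sub>M lam) \<and> (\<forall>z. 0 \<le> w z \<and> w z \<le> 1) \<and>
     (\<forall>C\<in>sets (lam \<Otimes>\<^sub>M lam). l (i, C) = (\<integral>z. w z * indicator C z \<partial>(lam \<Otimes>\<^sub>M lam)))" for i
    using lam2.P.weak_limit_density[of "\<lambda>n. Dn n i" \<G> "\<lambda>C. l (i, C)", OF Dn_meas Dn01 \<G>(1) lim] by blast
  then have "\<forall>i. \<exists>w. w \<in> borel_measurable (lam \<Otimes>\<^sub>M lam) \<and> (\<forall>z. 0 \<le> w z \<and> w z \<le> 1) \<and>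
     (\<forall>C\<in>sets (lam \<Otimes>\<^sub>M lam). l (i, C) = (\<integral>z. w z * indicator C z \<partial>(lam \<Otimes>\<^sub>M lam)))" by blast
  from choice[OF this] obtain w where w[measurable]: "\<And>i. w i \<in> borel_measurable (lam \<Otimes>\<^sub>M lam)" and w01: "\<And>i z. 0 \<le> w i z \<and> w i z \<le> 1"
    and wl: "\<And>i C. C \<in> sets (lam \<Otimes>\<^sub>M lam) \<Longrightarrow> l (i, C) = (\<integral>z. w i z * indicator C z \<partial>(lam \<Otimes>\<^sub>M lam))"
    by blast
  have wle: "AE z in lam \<Otimes>\<^sub>M lam. w False z \<le> w True z"
  proof (rule lam2.P.AE_le_of_integral_le[where B=1])
    fix C assume C: "C \<in> sets (lam \<Otimes>\<^sub>M lam)"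
    have "l (False, C) \<le> l (True, C)"
    proof (rule tendsto_le[OF \<G>(1) lim[OF C] lim[OF C]], rule always_eventually, rule allI, rule integral_mono[OF iD[OF C] iD[OF C]])
      show "Dn n False z * indicator C z \<le> Dn n True z * indicator C z" for n z
        using le by (intro mult_right_mono) (auto simp: Dn_def)
    qed
    then show "(\<integral>z. w False z * indicator C z \<partial>(lam \<Otimes>\<^sub>M lam)) \<le> (\<integral>z. w True z * indicator C z \<partial>(lam \<Otimes>\<^sub>M lam))"
      using wl[OF C] by simp
  qed (use w01 in auto)
  have e0: "0 \<le> e m" for m by (simp add: e_def)
  have pair: "(\<integral>x. \<integral>y. f (x, y) * (indicator A x * indicator B y) \<partial>lam \<partial>lam) = (\<integral>z. f z * indicator (A \<times> B) z \<partial>(lam \<Otimes>\<^sub>M lam))"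
    if [measurable]: "f \<in> borel_measurable (lam \<Otimes>\<^sub>M lam)" "A \<in> sets lam" "B \<in> sets lam" and f: "\<And>z. \<bar>f z\<bar> \<le> K" 
    for f :: "real \<times> real \<Rightarrow> real" and A B K
  proof -
    have K: "0 \<le> K" using f[of undefined] by linarith
    have "(\<integral>x. \<integral>y. f (x, y) * indicator (A \<times> B) (x, y) \<partial>lam \<partial>lam) = (\<integral>z. f z * indicator (A \<times> B) z \<partial>(lam \<Otimes>\<^sub>M lam))"
      by (rule lam.integral_pair_eq[where f="\<lambda>z. f z * indicator (A \<times> B) z" and B=K]) (use f K in \<open>auto simp: indicator_def\<close>)
    then show ?thesis by (simp add: indicator_times)
  qed
  have int: "integrable (lam \<Otimes>\<^sub>M lam) (\<lambda>z. f z * indicator C z)"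
    if [measurable]: "f \<in> borel_measurable (lam \<Otimes>\<^sub>M lam)" "C \<in> sets (lam \<Otimes>\<^sub>M lam)" and f: "\<And>z. \<bar>f z\<bar> \<le> K" 
    for f :: "real \<times> real \<Rightarrow> real" and C K
  proof -
    have K: "0 \<le> K" using f[of undefined] by linarith
    show ?thesis by (rule lam.pair_integrable_bdd[where B=K]) (use f K in \<open>auto simp: indicator_def\<close>)
  qed
  have DnB: "\<bar>Dn n i z\<bar> \<le> 1" "\<bar>w i z\<bar> \<le> 1" for n i z using Dn01[of n i z] w01[of i z] by auto
  \<comment> \<open>Weak regularity, transported from vertex sets to measurable sets.\<close>
  have cut1: "\<bar>(\<integral>z. Dn n i z * indicator (P \<times> Q) z \<partial>(lam \<Otimes>\<^sub>M lam)) - e m * (\<integral>z. Mn n i m z * indicator (P \<times> Q) z \<partial>(lam \<Otimes>\<^sub>M lam))\<bar> \<le> e m"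
    if m: "1 \<le> m" and AB[measurable]: "P \<in> sets lam" "Q \<in> sets lam" for n i m P Q
  proof -
    have "(\<integral>z. Dn n i z * indicator (P \<times> Q) z \<partial>(lam \<Otimes>\<^sub>M lam)) - e m * (\<integral>z. Mn n i m z * indicator (P \<times> Q) z \<partial>(lam \<Otimes>\<^sub>M lam)) =
       (\<integral>z. Dn n i z * indicator (P \<times> Q) z - e m * (Mn n i m z * indicator (P \<times> Q) z) \<partial>(lam \<Otimes>\<^sub>M lam))"
      using int[OF Dn_meas _ DnB(1)] int[OF Mn_meas _ MnB] by simp
    also have "\<dots> = (\<integral>z. (Dn n i z - e m * Mn n i m z) * indicator (P \<times> Q) z \<partial>(lam \<Otimes>\<^sub>M lam))"
      by (simp add: algebra_simps)
    also have "\<dots> = (\<integral>x. \<integral>y. (Dn n i (x, y) - e m * Mn n i m (x, y)) * (indicator P x * indicator Q y) \<partial>lam \<partial>lam)"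
    proof (rule pair[symmetric, where K="1 + e m * m"])
      show "\<bar>Dn n i z - e m * Mn n i m z\<bar> \<le> 1 + e m * m" for z
      proof -
        have "\<bar>e m * Mn n i m z\<bar> \<le> e m * m"
          unfolding abs_mult abs_of_nonneg[OF e0] by (rule mult_left_mono[OF MnB e0])
        with DnB(1)[of n i z] show ?thesis by linarith
      qed
    qed auto
    also have "\<bar>\<dots>\<bar> \<le> e m"
    proof -
      let ?R = "\<lambda>z. D i (s n) z - e m * rect_sum (A (s n) i m 0) (A (s n) i m 1) (A (s n) i m 2) (A (s n) i m 3) m z"
      have "\<bar>\<integral>x. \<integral>y. ?R (\<theta> n x, \<theta> n y) * (indicator P x * indicator Q y) \<partial>lam \<partial>lam\<bar> \<le> e m"
      proof (rule step_cut_le[where V="V (s n)" and \<theta>="\<theta> n" and R="?R" and A=P and B=Q and e="e m"])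
        show "\<bar>\<Sum>z\<in>S \<times> T. ?R z\<bar> \<le> e m * (card (V (s n)))\<^sup>2" if "S \<subseteq> V (s n)" "T \<subseteq> V (s n)" for S T
          using A[OF m, of "s n" i, rule_format, OF that] by (simp add: e_def)
      qed (use \<theta>[of n] V AB in \<open>auto simp: uniformly_onto_def\<close>)
      then show ?thesis by (simp only: Dn_def Mn_def fst_conv snd_conv)
    qed
    finally show ?thesis .
  qed
  have conv1: "(\<lambda>n. \<integral>z. Mn n i m z * indicator C z \<partial>(lam \<Otimes>\<^sub>M lam)) \<longlonglongrightarrow> (\<integral>z. Ml i m z * indicator C z \<partial>(lam \<Otimes>\<^sub>M lam))"
    and dist1: "\<bar>(\<integral>z. Mn n i m z * indicator C z \<partial>(lam \<Otimes>\<^sub>M lam)) - (\<integral>z. Ml i m z * indicator C z \<partial>(lam \<Otimes>\<^sub>M lam))\<bar> \<le> \<delta> i m n"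
    if C[measurable]: "C \<in> sets (lam \<Otimes>\<^sub>M lam)" for C i m n
  proof -
    show *: "\<bar>(\<integral>z. Mn n i m z * indicator C z \<partial>(lam \<Otimes>\<^sub>M lam)) - (\<integral>z. Ml i m z * indicator C z \<partial>(lam \<Otimes>\<^sub>M lam))\<bar> \<le> \<delta> i m n" for n
    proof -
      have "(\<integral>z. Mn n i m z * indicator C z \<partial>(lam \<Otimes>\<^sub>M lam)) - (\<integral>z. Ml i m z * indicator C z \<partial>(lam \<Otimes>\<^sub>M lam)) =
         (\<integral>z. Mn n i m z * indicator C z - Ml i m z * indicator C z \<partial>(lam \<Otimes>\<^sub>M lam))"
        using int[OF Mn_meas C MnB] int[OF Ml_meas C MlB] by simp
      also have "\<bar>\<dots>\<bar> \<le> (\<integral>z. \<bar>Mn n i m z * indicator C z - Ml i m z * indicator C z\<bar> \<partial>(lam \<Otimes>\<^sub>M lam))"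
        by (rule integral_abs_bound)
      also have "\<dots> \<le> \<delta> i m n" unfolding \<delta>_def
      proof (rule integral_mono)
        have "integrable (lam \<Otimes>\<^sub>M lam) (\<lambda>z. Mn n i m z * indicator C z - Ml i m z * indicator C z)"
          using int[OF Mn_meas C MnB] int[OF Ml_meas C MlB] by (rule Bochner_Integration.integrable_diff)
        then show "integrable (lam \<Otimes>\<^sub>M lam) (\<lambda>z. \<bar>Mn n i m z * indicator C z - Ml i m z * indicator C z\<bar>)"
          by (rule integrable_abs)
        have "integrable (lam \<Otimes>\<^sub>M lam) (\<lambda>z. Mn n i m z - Ml i m z)"
          by (rule Bochner_Integration.integrable_diff; rule lam.pair_integrable_bdd[where B=m]) (use MnB MlB in auto)
        then show "integrable (lam \<Otimes>\<^sub>M lam) (\<lambda>z. \<bar>Mn n i m z - Ml i m z\<bar>)" by (rule integrable_abs)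
      qed (auto simp: indicator_def)
      finally show ?thesis .
    qed
    show "(\<lambda>n. \<integral>z. Mn n i m z * indicator C z \<partial>(lam \<Otimes>\<^sub>M lam)) \<longlonglongrightarrow> (\<integral>z. Ml i m z * indicator C z \<partial>(lam \<Otimes>\<^sub>M lam))"
      by (rule Lim_transform_bound[where g="\<delta> i m" and f="\<lambda>n. (\<integral>z. Mn n i m z * indicator C z \<partial>(lam \<Otimes>\<^sub>M lam)) - (\<integral>z. Ml i m z * indicator C z \<partial>(lam \<Otimes>\<^sub>M lam))", THEN LIM_zero_cancel])
         (use * \<delta> in \<open>auto intro!: always_eventually order_trans[OF _ abs_ge_self]\<close>)
  qed
  \<comment> \<open>The same bound passes to the limit on rectangles: the first term converges along
    the filter, the second along the sequence.\<close>
  have cut2: "\<bar>(\<integral>z. w i z * indicator (A \<times> B) z \<partial>(lam \<Otimes>\<^sub>M lam)) - e m * (\<integral>z. Ml i m z * indicator (A \<times> B) z \<partial>(lam \<Otimes>\<^sub>M lam))\<bar> \<le> e m"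
    if m: "1 \<le> m" and AB[measurable]: "A \<in> sets lam" "B \<in> sets lam" for i m A B
  proof (rule tendsto_upperbound[OF _ _ \<G>(1)])
    have AB': "A \<times> B \<in> sets (lam \<Otimes>\<^sub>M lam)" using AB by simp
    show "((\<lambda>n. \<bar>(\<integral>z. Dn n i z * indicator (A \<times> B) z \<partial>(lam \<Otimes>\<^sub>M lam)) - e m * (\<integral>z. Mn n i m z * indicator (A \<times> B) z \<partial>(lam \<Otimes>\<^sub>M lam))\<bar>) \<longlongrightarrow>
       \<bar>(\<integral>z. w i z * indicator (A \<times> B) z \<partial>(lam \<Otimes>\<^sub>M lam)) - e m * (\<integral>z. Ml i m z * indicator (A \<times> B) z \<partial>(lam \<Otimes>\<^sub>M lam))\<bar>) \<G>"
      unfolding wl[OF AB', symmetric]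
      by (intro tendsto_rabs tendsto_diff tendsto_mult tendsto_const lim[OF AB'] tendsto_mono[OF \<G>(2) conv1[OF AB']])
    show "\<forall>\<^sub>F n in \<G>. \<bar>(\<integral>z. Dn n i z * indicator (A \<times> B) z \<partial>(lam \<Otimes>\<^sub>M lam)) - e m * (\<integral>z. Mn n i m z * indicator (A \<times> B) z \<partial>(lam \<Otimes>\<^sub>M lam))\<bar> \<le> e m"
      by (intro always_eventually allI cut1 m AB)
  qed
  \<comment> \<open>A weak limit is determined only up to null sets and may fail to be symmetric
    pointwise.\<close>
  define w' where "w' i z = (w i z + w i (snd z, fst z)) / 2" for i z
  have graphon: "graphon (w' i)" for i
    unfolding graphon_def
  proof (intro conjI allI)
    show "w' i \<in> borel_measurable (lam \<Otimes>\<^sub>M lam)" unfolding w'_def[abs_def] by measurable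
    fix x y show "0 \<le> w' i (x, y)" "w' i (x, y) \<le> 1" "w' i (x, y) = w' i (y, x)"
      using w01[of i "(x, y)"] w01[of i "(y, x)"] by (auto simp: w'_def)
  qed
  \<comment> \<open>One \<open>e m\<close> comes from \<open>cut1\<close>, one from
    \<open>cut2\<close>, and the middle term from the distance of the rectangles; the factor 4
    passes from sets to functions. The bound mentions no filter, so convergence holds along the
    sequence itself.\<close>
  have C4_bound: "C4 lam (\<lambda>z. Dn n i z - w' i z) \<le> 4 * (2 * e m + e m * \<delta> i m n)" if m: "1 \<le> m" for n i m
  proof (rule lam.C4_le_cutf)
    have w'_meas[measurable]: "w' i \<in> borel_measurable (lam \<Otimes>\<^sub>M lam)" using graphon by (simp add: graphon_def)
    show "(\<lambda>z. Dn n i z - w' i z) \<in> borel_measurable (lam \<Otimes>\<^sub>M lam)" by measurable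
    show "\<bar>Dn n i (x, y) - w' i (x, y)\<bar> \<le> 1" for x y
      using Dn01[of n i "(x, y)"] graphon_bounds[OF graphon[of i], of "(x, y)"] by auto
    show "cutf lam (\<lambda>z. Dn n i z - w' i z) (4 * (2 * e m + e m * \<delta> i m n))"
      unfolding w'_def
    proof (rule cutf_symmetrize)
      show "Dn n i \<in> borel_measurable (lam \<Otimes>\<^sub>M lam)" "w i \<in> borel_measurable (lam \<Otimes>\<^sub>M lam)" by measurable
      show "cutf lam (\<lambda>z. Dn n i z - w i z) (4 * (2 * e m + e m * \<delta> i m n))"
      proof (rule lam.cutf_of_sets[where B=1])
        show "\<bar>Dn n i (x, y) - w i (x, y)\<bar> \<le> 1" for x y
          using Dn01[of n i "(x, y)"] w01[of i "(x, y)"] by auto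
        fix A B assume AB[measurable]: "A \<in> sets lam" "B \<in> sets lam"
        have AB': "A \<times> B \<in> sets (lam \<Otimes>\<^sub>M lam)" using AB by simp
        have "(\<integral>x. \<integral>y. (Dn n i (x, y) - w i (x, y)) * (indicator A x * indicator B y) \<partial>lam \<partial>lam) =
          (\<integral>z. (Dn n i z - w i z) * indicator (A \<times> B) z \<partial>(lam \<Otimes>\<^sub>M lam))"
        proof (rule pair[where f="\<lambda>z. Dn n i z - w i z" and K=1])
          show "\<bar>Dn n i z - w i z\<bar> \<le> 1" for z using Dn01[of n i z] w01[of i z] by auto
        qed auto
        also have "\<dots> = (\<integral>z. Dn n i z * indicator (A \<times> B) z \<partial>(lam \<Otimes>\<^sub>M lam)) - (\<integral>z. w i z * indicator (A \<times> B) z \<partial>(lam \<Otimes>\<^sub>M lam))"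
          using int[OF Dn_meas AB' DnB(1)] int[OF w AB' DnB(2)] by (simp add: left_diff_distrib)
        finally have eq: "(\<integral>x. \<integral>y. (Dn n i (x, y) - w i (x, y)) * (indicator A x * indicator B y) \<partial>lam \<partial>lam) = \<dots>" .
        have "\<bar>e m * (\<integral>z. Mn n i m z * indicator (A \<times> B) z \<partial>(lam \<Otimes>\<^sub>M lam)) - e m * (\<integral>z. Ml i m z * indicator (A \<times> B) z \<partial>(lam \<Otimes>\<^sub>M lam))\<bar> \<le> e m * \<delta> i m n"
          using mult_left_mono[OF dist1[OF AB'] e0[of m]] e0[of m] by (simp add: abs_mult flip: right_diff_distrib)
        with cut1[OF m AB, of n i] cut2[OF m AB, of i]
        show "\<bar>\<integral>x. \<integral>y. (Dn n i (x, y) - w i (x, y)) * (indicator A x * indicator B y) \<partial>lam \<partial>lam\<bar> \<le> 2 * e m + e m * \<delta> i m n"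
          unfolding eq by linarith
      qed measurable
    qed (use DnB sym in \<open>auto simp: Dn_def\<close>)
  qed
  have C4_lim: "(\<lambda>n. C4 lam (\<lambda>z. Dn n i z - w' i z)) \<longlonglongrightarrow> 0" for i
  proof (rule LIMSEQ_I)
    fix r :: real assume r: "0 < r"
    \<comment> \<open>This makes \<open>8 * e m\<close>, the limit of the bound, smaller than
      \<open>r / 2\<close>.\<close>
    define m where "m = nat \<lceil>(16 / r)\<^sup>2\<rceil> + 1"
    have m: "1 \<le> m" by (simp add: m_def)
    have "(16 / r)\<^sup>2 < real m" unfolding m_def by linarith
    then have "16 / r < sqrt (real m)" using r by (simp add: real_less_rsqrt)
    then have em: "8 * e m < r / 2" using r m by (simp add: e_def field_simps)
    have "(\<lambda>n. 4 * (2 * e m + e m * \<delta> i m n)) \<longlonglongrightarrow> 4 * (2 * e m + e m * 0)" by (intro tendsto_intros \<delta>)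
    then have "\<forall>\<^sub>F n in sequentially. 4 * (2 * e m + e m * \<delta> i m n) < r"
      by (rule order_tendstoD) (use em r in auto)
    then obtain n0 where n0: "\<And>n. n \<ge> n0 \<Longrightarrow> 4 * (2 * e m + e m * \<delta> i m n) < r" by (auto simp: eventually_sequentially)
    show "\<exists>n0. \<forall>n\<ge>n0. norm (C4 lam (\<lambda>z. Dn n i z - w' i z) - 0) < r"
    proof (intro exI[of _ n0] allI impI)
      fix n assume "n0 \<le> n"
      from le_less_trans[OF C4_bound[OF m] n0[OF this]] show "norm (C4 lam (\<lambda>z. Dn n i z - w' i z) - 0) < r"
        by (simp only: diff_0_right real_norm_def abs_of_nonneg[OF lam.C4_nonneg])
    qed
  qed
  have "AE z in distr (lam \<Otimes>\<^sub>M lam) (lam \<Otimes>\<^sub>M lam) (\<lambda>(x, y). (y, x)). w False z \<le> w True z"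
    using wle by (subst lam2.distr_pair_swap[symmetric])
  then have "AE z in lam \<Otimes>\<^sub>M lam. w False (snd z, fst z) \<le> w True (snd z, fst z)"
    using AE_distrD[of "\<lambda>(x, y). (y, x)" "lam \<Otimes>\<^sub>M lam" "lam \<Otimes>\<^sub>M lam" "\<lambda>z. w False z \<le> w True z"]
    by (simp add: case_prod_beta')
  with wle have "AE z in lam \<Otimes>\<^sub>M lam. w' False z \<le> w' True z" by eventually_elim (simp add: w'_def)
  then show ?thesis
    using s \<theta> graphon C4_lim unfolding Dn_def by blast
qed

section \<open>Disjoint copies and second moments\<close>

definition dup :: "bool \<Rightarrow> ('i \<times> 'i) set \<Rightarrow> (('i \<times> bool) \<times> ('i \<times> bool)) set" where
  "dup b E = (\<lambda>(i, j). ((i, b), (j, b))) ` E"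

lemma edge_set_dup:
  assumes "edge_set I E"
  shows "edge_set (I \<times> UNIV) (dup True E \<union> dup False E)"
  using assms unfolding edge_set_def dup_def by auto

lemma prod_dup:
  "finite E \<Longrightarrow> (\<Prod>e\<in>dup b E. f e) = (\<Prod>(i, j)\<in>E. f ((i, b), (j, b)))"
  unfolding dup_def by (subst prod.reindex) (auto simp: inj_on_def case_prod_beta')

text \<open>The two copies use disjoint sets of coordinates, so Fubini's theorem factors the
  integral. Estimates of mean values thereby apply to squares of densities as well.\<close>

lemma dens_double:
  fixes I :: "'i set"
  assumes M: "prob_space M" and E: "edge_set I E"
    and w[measurable]: "w \<in> borel_measurable (M \<Otimes>\<^sub>M M)"
    and wB: "\<And>x y. x \<in> space M \<Longrightarrow> y \<in> space M \<Longrightarrow> \<bar>w (x, y)\<bar> \<le> 1"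
  shows "dens M (I \<times> UNIV) (dup True E \<union> dup False E) w = (dens M I E w)\<^sup>2"
proof -
  interpret prob_space M by fact
  interpret PP: product_sigma_finite "\<lambda>_ :: 'i \<times> bool. M"
    by (simp add: product_sigma_finite_def sigma_finite_measure_axioms)
  have finI: "finite I" and EI: "E \<subseteq> I \<times> I" using E by (auto simp: edge_set_def)
  have finE: "finite E" by (rule edge_set_finite[OF E])
  define g where "g b x = (\<Prod>(i, j)\<in>E. w (x (i, b), x (j, b)))" for b and x :: "_ \<times> bool \<Rightarrow> _"
  define g0 where "g0 x = (\<Prod>(i, j)\<in>E. w (x i, x j))" for x
  have split: "(\<Prod>(i, j)\<in>dup True E \<union> dup False E. w (x i, x j)) = g True x * g False x" for x
  proof -
    have "(\<Prod>(i, j)\<in>dup True E \<union> dup False E. w (x i, x j)) = 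
      (\<Prod>(i, j)\<in>dup True E. w (x i, x j)) * (\<Prod>(i, j)\<in>dup False E. w (x i, x j))"
      by (rule prod.union_disjoint) (use finE in \<open>auto simp: dup_def\<close>)
    then show ?thesis using finE by (simp add: prod_dup g_def)
  qed
  have mg0: "g0 \<in> borel_measurable (Pi\<^sub>M I (\<lambda>_. M))"
    unfolding g0_def case_prod_beta' by (rule measurable_edge_prod[OF EI]) (rule w)
  have restr: "(\<lambda>x. \<lambda>i\<in>I. x (i, b)) \<in> measurable (Pi\<^sub>M (I \<times> {b}) (\<lambda>_. M)) (Pi\<^sub>M I (\<lambda>_. M))" for b
    by (rule measurable_restrict) (auto intro: measurable_component_singleton)
  have gg0: "g b x = g0 (\<lambda>i\<in>I. x (i, b))" for b x
    unfolding g_def g0_def by (rule prod.cong) (use EI in auto)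
  have int_g: "(\<integral>x. g b x \<partial>Pi\<^sub>M (I \<times> {b}) (\<lambda>_. M)) = dens M I E w" for b
  proof -
    have "distr (Pi\<^sub>M (I \<times> {b}) (\<lambda>_. M)) (Pi\<^sub>M I (\<lambda>_. M)) (\<lambda>x. \<lambda>i\<in>I. x (i, b)) = Pi\<^sub>M I (\<lambda>_. M)"
      by (rule distr_PiM_reindex) (auto simp: inj_on_def prob_space_axioms)
    then have "dens M I E w = (\<integral>x. g0 x \<partial>distr (Pi\<^sub>M (I \<times> {b}) (\<lambda>_. M)) (Pi\<^sub>M I (\<lambda>_. M)) (\<lambda>x. \<lambda>i\<in>I. x (i, b)))"
      by (simp add: dens_def g0_def)
    also have "\<dots> = (\<integral>x. g b x \<partial>Pi\<^sub>M (I \<times> {b}) (\<lambda>_. M))"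
      unfolding gg0 by (rule integral_distr[OF restr mg0])
    finally show ?thesis by simp
  qed
  have U: "I \<times> UNIV = I \<times> {True} \<union> I \<times> {False}" by auto
  have E2: "edge_set (I \<times> UNIV) (dup True E \<union> dup False E)" by (rule edge_set_dup[OF E])
  have int: "integrable (Pi\<^sub>M (I \<times> {True} \<union> I \<times> {False}) (\<lambda>_. M)) (\<lambda>x. g True x * g False x)"
    unfolding split[symmetric] U[symmetric] case_prod_beta'
  proof (rule prob_space.integrable_bdd[OF prob_space_PiM_self, where B=1])
    show "(\<lambda>x. \<Prod>e\<in>dup True E \<union> dup False E. w (x (fst e), x (snd e))) \<in> borel_measurable (Pi\<^sub>M (I \<times> UNIV) (\<lambda>_. M))"
      by (rule measurable_edge_prod) (use E2 w in \<open>auto simp: edge_set_def\<close>)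
    fix x assume x: "x \<in> space (Pi\<^sub>M (I \<times> (UNIV::bool set)) (\<lambda>_. M))"
    show "\<bar>\<Prod>e\<in>dup True E \<union> dup False E. w (x (fst e), x (snd e))\<bar> \<le> 1"
    proof (rule abs_prod_le_1, rule wB)
      fix e assume "e \<in> dup True E \<union> dup False E"
      then have "fst e \<in> I \<times> UNIV" "snd e \<in> I \<times> UNIV" using E2 unfolding edge_set_def by auto
      then show "x (fst e) \<in> space M" "x (snd e) \<in> space M" using x by (auto simp: space_PiM)
    qed
  qed
  have "dens M (I \<times> UNIV) (dup True E \<union> dup False E) w = (\<integral>x. g True x * g False x \<partial>Pi\<^sub>M (I \<times> {True} \<union> I \<times> {False}) (\<lambda>_. M))"
    unfolding dens_def split U ..
  also have "\<dots> = (\<integral>x. \<integral>y. g True (merge (I \<times> {True}) (I \<times> {False}) (x, y)) * g False (merge (I \<times> {True}) (I \<times> {False}) (x, y))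
      \<partial>Pi\<^sub>M (I \<times> {False}) (\<lambda>_. M) \<partial>Pi\<^sub>M (I \<times> {True}) (\<lambda>_. M))"
    by (rule PP.product_integral_fold[where f="\<lambda>x. g True x * g False x"]) (use finI int in auto)
  also have "\<dots> = (\<integral>x. \<integral>y. g True x * g False y \<partial>Pi\<^sub>M (I \<times> {False}) (\<lambda>_. M) \<partial>Pi\<^sub>M (I \<times> {True}) (\<lambda>_. M))"
  proof -
    have "g True (merge (I \<times> {True}) (I \<times> {False}) (x, y)) = g True x" for x y
      unfolding g_def by (rule prod.cong) (use EI in \<open>auto simp: merge_def\<close>)
    moreover have "g False (merge (I \<times> {True}) (I \<times> {False}) (x, y)) = g False y" for x y
      unfolding g_def by (rule prod.cong) (use EI in \<open>auto simp: merge_def\<close>)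
    ultimately show ?thesis by simp
  qed
  also have "\<dots> = (dens M I E w)\<^sup>2"
    using int_g by (simp add: power2_eq_square)
  finally show ?thesis .
qed

subsection \<open>Sampling random graphs\<close>

text \<open>Independent points, one for each element of \<open>V\<close>, whose average law is uniform.\<close>

definition sampler :: "nat set \<Rightarrow> (nat \<Rightarrow> real measure) \<Rightarrow> bool" where
  "sampler V \<mu> \<longleftrightarrow> finite V \<and> V \<noteq> {} \<and> (\<forall>v. prob_space (\<mu> v) \<and> sets (\<mu> v) = sets lam) \<and>
    (\<forall>f\<in>borel_measurable lam. (\<exists>B. \<forall>x\<in>{0..1}. \<bar>f x\<bar> \<le> B) \<longrightarrow>
      (\<Sum>v\<in>V. \<integral>x. f x \<partial>\<mu> v) = real (card V) * (\<integral>x. f x \<partial>lam))"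

lemma sampler_iid: "finite V \<Longrightarrow> V \<noteq> {} \<Longrightarrow> sampler V (\<lambda>_. lam)"
  by (simp add: sampler_def prob_space_lam)

text \<open>A uniformly random index followed by a point with the law of that index produces a point
  with law \<open>lam\<close>, and the coordinates can be integrated out one by one. Equal indices
  receive independent points here, so the identity is exact over all maps.\<close>

lemma sampler_mixture:
  assumes S: "sampler V \<mu>" and I: "finite I"
    and f: "f \<in> borel_measurable (Pi\<^sub>M I (\<lambda>_. lam))" and fB: "\<And>x. x \<in> space (Pi\<^sub>M I (\<lambda>_. lam)) \<Longrightarrow> \<bar>f x\<bar> \<le> (B :: real)"
  shows "(\<Sum>h\<in>I \<rightarrow>\<^sub>E V. \<integral>x. f x \<partial>Pi\<^sub>M I (\<lambda>i. \<mu> (h i))) = card V ^ card I * (\<integral>x. f x \<partial>Pi\<^sub>M I (\<lambda>_. lam))"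
  using I f fB
proof (induction I arbitrary: f rule: finite_induct)
  case empty
  then show ?case by (simp add: PiM_empty)
next
  case (insert i I)
  have V: "finite V" "V \<noteq> {}" and pr: "prob_space (\<mu> v)" and se: "sets (\<mu> v) = sets lam" for v
    using S by (auto simp: sampler_def)
  have mix: "\<forall>f\<in>borel_measurable lam. (\<exists>B. \<forall>x\<in>{0..1}. \<bar>f x\<bar> \<le> B) \<longrightarrow>
      (\<Sum>v\<in>V. \<integral>x. f x \<partial>\<mu> v) = real (card V) * (\<integral>x. f x \<partial>lam)"
    using S by (simp add: sampler_def)
  have sp: "space (\<mu> v) = {0..1}" for v using sets_eq_imp_space_eq[OF se] by simp
  note mf = insert.prems(1)
  interpret PP: product_prob_space "\<lambda>_. lam" by (rule lam.product_prob_space_self)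
  have upd: "x(i := y) \<in> space (Pi\<^sub>M (insert i I) (\<lambda>_. lam))" if "x \<in> space (Pi\<^sub>M I (\<lambda>_. lam))" "y \<in> {0..1}" for x y
    using that insert.hyps by (auto simp: space_PiM PiE_def extensional_def Pi_def)
  define g where "g x = (\<integral>y. f (x(i := y)) \<partial>lam)" for x
  have mf2: "(\<lambda>(x, y). f (x(i := y))) \<in> borel_measurable (Pi\<^sub>M I (\<lambda>_. lam) \<Otimes>\<^sub>M lam)"
    using measurable_compose[OF measurable_add_dim mf] by (simp only: case_prod_beta')
  have mg: "g \<in> borel_measurable (Pi\<^sub>M I (\<lambda>_. lam))" unfolding g_def using mf2 by measurable
  have sec: "(\<lambda>y. f (x(i := y))) \<in> borel_measurable lam" if "x \<in> space (Pi\<^sub>M I (\<lambda>_. lam))" for x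
    using measurable_Pair_compose_split[OF mf2, of "\<lambda>_. x" lam "\<lambda>y. y"] that by simp
  have gB: "\<bar>g x\<bar> \<le> B" if "x \<in> space (Pi\<^sub>M I (\<lambda>_. lam))" for x
    unfolding g_def by (rule lam.abs_integral_le[OF sec[OF that]]) (use insert.prems(2) upd that in auto)
  have sPi: "sets (Pi\<^sub>M J (\<lambda>i. \<mu> (h i))) = sets (Pi\<^sub>M J (\<lambda>_. lam))" for J and h :: "_ \<Rightarrow> nat"
    by (intro sets_PiM_cong) (auto simp: se)
  have "(\<Sum>h\<in>insert i I \<rightarrow>\<^sub>E V. \<integral>x. f x \<partial>Pi\<^sub>M (insert i I) (\<lambda>i. \<mu> (h i))) =
     (\<Sum>(v, h)\<in>V \<times> (I \<rightarrow>\<^sub>E V). \<integral>x. f x \<partial>Pi\<^sub>M (insert i I) (\<lambda>u. \<mu> ((h(i := v)) u)))"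
    unfolding PiE_insert_eq
    by (subst sum.reindex[OF inj_combinator[OF insert.hyps(2)]]) (auto simp: case_prod_beta')
  also have "\<dots> = (\<Sum>h\<in>I \<rightarrow>\<^sub>E V. \<Sum>v\<in>V. \<integral>x. f x \<partial>Pi\<^sub>M (insert i I) (\<lambda>u. \<mu> ((h(i := v)) u)))"
    by (subst sum.cartesian_product[symmetric]) (rule sum.swap)
  also have "\<dots> = (\<Sum>h\<in>I \<rightarrow>\<^sub>E V. card V * (\<integral>x. g x \<partial>Pi\<^sub>M I (\<lambda>u. \<mu> (h u))))"
  proof (rule sum.cong[OF refl])
    fix h assume "h \<in> I \<rightarrow>\<^sub>E V"
    let ?P = "Pi\<^sub>M I (\<lambda>u. \<mu> (h u))"
    interpret H: prob_space ?P by (rule prob_space_PiM) (rule pr)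
    have spP: "space ?P = space (Pi\<^sub>M I (\<lambda>_. lam))" by (rule sets_eq_imp_space_eq[OF sPi])
    have mv: "(\<lambda>(x, y). f (x(i := y))) \<in> borel_measurable (?P \<Otimes>\<^sub>M \<mu> v)" for v
      using mf2 measurable_cong_sets[OF sets_pair_measure_cong[OF sPi se] refl] by blast
    have one: "(\<integral>x. f x \<partial>Pi\<^sub>M (insert i I) (\<lambda>u. \<mu> ((h(i := v)) u))) = (\<integral>x. \<integral>y. f (x(i := y)) \<partial>\<mu> v \<partial>?P)" for v
    proof -
      interpret Q: product_sigma_finite "\<lambda>u. \<mu> ((h(i := v)) u)"
        unfolding product_sigma_finite_def using pr prob_space_imp_sigma_finite by blast
      have "(\<integral>x. f x \<partial>Pi\<^sub>M (insert i I) (\<lambda>u. \<mu> ((h(i := v)) u))) = 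
        (\<integral>x. (\<integral>y. f (x(i := y)) \<partial>\<mu> ((h(i := v)) i)) \<partial>Pi\<^sub>M I (\<lambda>u. \<mu> ((h(i := v)) u)))"
      proof (rule Q.product_integral_insert[OF insert.hyps])
        show "integrable (Pi\<^sub>M (insert i I) (\<lambda>u. \<mu> ((h(i := v)) u))) f"
        proof (rule prob_space.integrable_bdd[where B=B])
          show "prob_space (Pi\<^sub>M (insert i I) (\<lambda>u. \<mu> ((h(i := v)) u)))" by (rule prob_space_PiM) (rule pr)
          show "f \<in> borel_measurable (Pi\<^sub>M (insert i I) (\<lambda>u. \<mu> ((h(i := v)) u)))"
            using mf measurable_cong_sets[OF sPi refl] by blast
          show "\<bar>f x\<bar> \<le> B" if "x \<in> space (Pi\<^sub>M (insert i I) (\<lambda>u. \<mu> ((h(i := v)) u)))" for x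
            using that sets_eq_imp_space_eq[OF sPi] insert.prems(2) by blast
        qed
      qed
      also have "Pi\<^sub>M I (\<lambda>u. \<mu> ((h(i := v)) u)) = ?P"
        by (rule PiM_cong) (use insert.hyps in auto)
      finally show ?thesis by (simp only: fun_upd_same)
    qed
    have "(\<Sum>v\<in>V. \<integral>x. f x \<partial>Pi\<^sub>M (insert i I) (\<lambda>u. \<mu> ((h(i := v)) u))) = (\<integral>x. (\<Sum>v\<in>V. \<integral>y. f (x(i := y)) \<partial>\<mu> v) \<partial>?P)"
      unfolding one
    proof (rule Bochner_Integration.integral_sum[symmetric])
      fix v assume "v \<in> V"
      interpret v: prob_space "\<mu> v" by (rule pr)
      show "integrable ?P (\<lambda>x. \<integral>y. f (x(i := y)) \<partial>\<mu> v)"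
      proof (rule H.integrable_bdd[where B=B])
        show "(\<lambda>x. \<integral>y. f (x(i := y)) \<partial>\<mu> v) \<in> borel_measurable ?P" using mv by measurable
        fix x assume x: "x \<in> space ?P"
        show "\<bar>\<integral>y. f (x(i := y)) \<partial>\<mu> v\<bar> \<le> B"
        proof (rule v.abs_integral_le)
          show "(\<lambda>y. f (x(i := y))) \<in> borel_measurable (\<mu> v)"
            using sec[of x] x spP measurable_cong_sets[OF se refl] by blast
        qed (use insert.prems(2) upd x spP sp in auto)
      qed
    qed
    also have "\<dots> = (\<integral>x. card V * g x \<partial>?P)"
    proof (rule Bochner_Integration.integral_cong[OF refl])
      fix x assume "x \<in> space ?P"
      then have x: "x \<in> space (Pi\<^sub>M I (\<lambda>_. lam))" using spP by simp
      have "\<exists>B. \<forall>y\<in>{0..1}. \<bar>f (x(i := y))\<bar> \<le> B" using insert.prems(2) upd[OF x] by blast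
      then show "(\<Sum>v\<in>V. \<integral>y. f (x(i := y)) \<partial>\<mu> v) = card V * g x"
        using mix[rule_format, OF sec[OF x]] by (simp add: g_def)
    qed
    finally show "(\<Sum>v\<in>V. \<integral>x. f x \<partial>Pi\<^sub>M (insert i I) (\<lambda>u. \<mu> ((h(i := v)) u))) = card V * (\<integral>x. g x \<partial>?P)" by simp
  qed
  also have "\<dots> = card V * (card V ^ card I * (\<integral>x. g x \<partial>Pi\<^sub>M I (\<lambda>_. lam)))"
    using insert.IH[OF mg gB] by (simp add: sum_distrib_left[symmetric])
  also have "(\<integral>x. g x \<partial>Pi\<^sub>M I (\<lambda>_. lam)) = (\<integral>x. f x \<partial>Pi\<^sub>M (insert i I) (\<lambda>_. lam))"
    unfolding g_def
  proof (rule PP.product_integral_insert[OF insert.hyps, symmetric])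
    show "integrable (Pi\<^sub>M (insert i I) (\<lambda>_. lam)) f"
      by (rule prob_space.integrable_bdd[OF lam.prob_space_PiM_self mf, of B]) (rule insert.prems(2))
  qed
  finally show ?case using insert.hyps by simp
qed

lemma sampler_sets: "sampler V \<mu> \<Longrightarrow> sets (Pi\<^sub>M V \<mu>) = sets (Pi\<^sub>M V (\<lambda>_. lam))"
  by (intro sets_PiM_cong) (auto simp: sampler_def)

lemma sampler_prob: "sampler V \<mu> \<Longrightarrow> prob_space (Pi\<^sub>M V \<mu>)"
  by (rule prob_space_PiM) (auto simp: sampler_def)

text \<open>For injective \<open>h\<close> the points \<open>z (h i)\<close> are independent with
  laws \<open>\<mu> (h i)\<close>, exactly as in \<open>sampler_mixture\<close>. The other maps are
  negligible; both integrals are bounded by 1, which gives the factor 2.\<close>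

lemma sampler_dens:
  assumes S: "sampler V \<mu>" and E: "edge_set I E"
    and f: "f \<in> borel_measurable (lam \<Otimes>\<^sub>M lam)" and fB: "\<And>z. \<bar>f z\<bar> \<le> 1"
  shows "(\<lambda>z. dens (uniform_count_measure V) I E (\<lambda>(u, v). f (z u, z v))) \<in> borel_measurable (Pi\<^sub>M V \<mu>)"
    and "\<bar>(\<integral>z. dens (uniform_count_measure V) I E (\<lambda>(u, v). f (z u, z v)) \<partial>Pi\<^sub>M V \<mu>) - dens lam I E f\<bar> \<le> (2 :: real) * (card I)\<^sup>2 / card V"
proof -
  have V: "finite V" "V \<noteq> {}" and pr: "prob_space (\<mu> v)" and se: "sets (\<mu> v) = sets lam" for v
    using S by (auto simp: sampler_def)
  have finI: "finite I" and EI: "E \<subseteq> I \<times> I" using E by (auto simp: edge_set_def)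
  interpret P: prob_space "Pi\<^sub>M V \<mu>" by (rule sampler_prob[OF S])
  have N: "0 < card V" using V by (simp add: card_gt_0_iff)
  define F where "F x = (\<Prod>e\<in>E. f (x (fst e), x (snd e)))" for x
  have mF: "F \<in> borel_measurable (Pi\<^sub>M I (\<lambda>_. lam))" unfolding F_def by (rule measurable_edge_prod[OF EI]) (rule f)
  have FB: "\<bar>F x\<bar> \<le> 1" for x unfolding F_def by (rule abs_prod_le_1) (rule fB)
  have eq: "dens (uniform_count_measure V) I E (\<lambda>(u, v). f (z u, z v)) = (\<Sum>h\<in>I \<rightarrow>\<^sub>E V. F (\<lambda>i. z (h i))) / card V ^ card I" for z
    unfolding dens_uniform_count[OF finI V] by (simp add: F_def case_prod_beta')
  have Fr: "F (\<lambda>i. z (h i)) = F (\<lambda>i\<in>I. z (h i))" for z and h :: "_ \<Rightarrow> nat"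
    unfolding F_def by (rule prod.cong) (use EI in auto)
  have mFh: "(\<lambda>z. F (\<lambda>i. z (h i))) \<in> borel_measurable (Pi\<^sub>M V \<mu>)" if h: "h \<in> I \<rightarrow>\<^sub>E V" for h
  proof -
    have "(\<lambda>z. F (\<lambda>i\<in>I. z (h i))) \<in> borel_measurable (Pi\<^sub>M V (\<lambda>_. lam))"
      by (rule measurable_compose[OF _ mF], rule measurable_restrict) (use h in \<open>auto intro!: measurable_component_singleton\<close>)
    then show ?thesis unfolding Fr using measurable_cong_sets[OF sampler_sets[OF S] refl] by blast
  qed
  show "(\<lambda>z. dens (uniform_count_measure V) I E (\<lambda>(u, v). f (z u, z v))) \<in> borel_measurable (Pi\<^sub>M V \<mu>)"
    unfolding eq by (intro borel_measurable_divide borel_measurable_sum mFh) auto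
  define J where "J h = (\<integral>x. F x \<partial>Pi\<^sub>M I (\<lambda>i. \<mu> (h i)))" for h
  have "(\<integral>z. dens (uniform_count_measure V) I E (\<lambda>(u, v). f (z u, z v)) \<partial>Pi\<^sub>M V \<mu>) - dens lam I E f =
     (\<Sum>h\<in>I \<rightarrow>\<^sub>E V. (\<integral>z. F (\<lambda>i. z (h i)) \<partial>Pi\<^sub>M V \<mu>) - J h) / card V ^ card I"
  proof -
    have "(\<integral>z. dens (uniform_count_measure V) I E (\<lambda>(u, v). f (z u, z v)) \<partial>Pi\<^sub>M V \<mu>) = (\<Sum>h\<in>I \<rightarrow>\<^sub>E V. \<integral>z. F (\<lambda>i. z (h i)) \<partial>Pi\<^sub>M V \<mu>) / card V ^ card I"
      unfolding eq using P.integrable_bdd[OF mFh FB] by (simp add: Bochner_Integration.integral_sum)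
    moreover have "dens lam I E f = (\<Sum>h\<in>I \<rightarrow>\<^sub>E V. J h) / card V ^ card I"
      using sampler_mixture[OF S finI mF FB] N by (simp add: J_def dens_def F_def case_prod_beta')
    ultimately show ?thesis by (simp add: sum_subtractf diff_divide_distrib)
  qed
  also have "\<bar>\<dots>\<bar> \<le> (2 :: real) * (card I)\<^sup>2 / card V"
  proof (rule sum_noninj_le[OF finI V])
    fix h assume h: "h \<in> I \<rightarrow>\<^sub>E V"
    interpret h: prob_space "Pi\<^sub>M I (\<lambda>i. \<mu> (h i))" by (rule prob_space_PiM) (rule pr)
    have sPi: "sets (Pi\<^sub>M I (\<lambda>i. \<mu> (h i))) = sets (Pi\<^sub>M I (\<lambda>_. lam))" by (intro sets_PiM_cong) (auto simp: se)
    have mF': "F \<in> borel_measurable (Pi\<^sub>M I (\<lambda>i. \<mu> (h i)))" using mF measurable_cong_sets[OF sPi refl] by blast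
    have "\<bar>J h\<bar> \<le> 1" unfolding J_def by (rule h.abs_integral_le[OF mF' FB])
    moreover have "\<bar>\<integral>z. F (\<lambda>i. z (h i)) \<partial>Pi\<^sub>M V \<mu>\<bar> \<le> 1" by (rule P.abs_integral_le[OF mFh[OF h] FB])
    ultimately show "\<bar>(\<integral>z. F (\<lambda>i. z (h i)) \<partial>Pi\<^sub>M V \<mu>) - J h\<bar> \<le> 2" by linarith
    assume inj: "inj_on h I"
    have d: "distr (Pi\<^sub>M V \<mu>) (Pi\<^sub>M I (\<lambda>i. \<mu> (h i))) (\<lambda>z. \<lambda>i\<in>I. z (h i)) = Pi\<^sub>M I (\<lambda>i. \<mu> (h i))"
      by (rule distr_PiM_reindex) (use pr inj h in auto)
    have mr: "(\<lambda>z. \<lambda>i\<in>I. z (h i)) \<in> measurable (Pi\<^sub>M V \<mu>) (Pi\<^sub>M I (\<lambda>i. \<mu> (h i)))"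
      by (rule measurable_restrict) (use h in \<open>auto intro!: measurable_component_singleton\<close>)
    have "J h = (\<integral>x. F x \<partial>distr (Pi\<^sub>M V \<mu>) (Pi\<^sub>M I (\<lambda>i. \<mu> (h i))) (\<lambda>z. \<lambda>i\<in>I. z (h i)))"
      unfolding J_def d ..
    also have "\<dots> = (\<integral>z. F (\<lambda>i. z (h i)) \<partial>Pi\<^sub>M V \<mu>)"
      unfolding Fr by (rule integral_distr[OF mr mF'])
    finally show "(\<integral>z. F (\<lambda>i. z (h i)) \<partial>Pi\<^sub>M V \<mu>) - J h = 0" by simp
  qed
  finally show "\<bar>(\<integral>z. dens (uniform_count_measure V) I E (\<lambda>(u, v). f (z u, z v)) \<partial>Pi\<^sub>M V \<mu>) - dens lam I E f\<bar> \<le> (2 :: real) * (card I)\<^sup>2 / card V" .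
qed

definition pairs :: "nat set \<Rightarrow> (nat \<times> nat) set" where
  "pairs V = {(u, v)\<in>V \<times> V. u < v}"

text \<open>Indifferent to whether an edge is recorded once, as in subsets of
  \<open>pairs V\<close>, or twice, as in the arcs of a graph.\<close>

definition adj :: "(nat \<times> nat) set \<Rightarrow> nat \<times> nat \<Rightarrow> real" where
  "adj r = (\<lambda>(u, v). of_bool ((u, v) \<in> r \<or> (v, u) \<in> r))"

text \<open>The probability that independent edges with probabilities \<open>P\<close> produce
  exactly the edge set \<open>r\<close>. Expectations are sums over \<open>Pow (pairs V)\<close>, so
  no measure space of graphs is required.\<close>

definition graph_weight :: "nat set \<Rightarrow> (nat \<times> nat \<Rightarrow> real) \<Rightarrow> (nat \<times> nat) set \<Rightarrow> real" where
  "graph_weight V P r = (\<Prod>e\<in>r. P e) * (\<Prod>e\<in>pairs V - r. 1 - P e)"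

lemma finite_pairs: "finite V \<Longrightarrow> finite (pairs V)"
  unfolding pairs_def by (rule finite_subset[of _ "V \<times> V"]) auto

lemma graph_weight_nonneg:
  assumes "r \<subseteq> pairs V" "\<And>e. 0 \<le> P e \<and> P e \<le> 1"
  shows "0 \<le> graph_weight V P r"
  unfolding graph_weight_def by (intro mult_nonneg_nonneg prod_nonneg) (use assms in auto)

text \<open>Independence of the edges: the sum over all \<open>r\<close> is the expansion of a
  product of binomials, one for each pair, and the pairs outside \<open>S\<close> contribute
  1.\<close>

lemma sum_graph_weight_prod:
  assumes V: "finite V" and S: "S \<subseteq> pairs V"
  shows "(\<Sum>r\<in>Pow (pairs V). graph_weight V P r * (\<Prod>e\<in>S. g e (e \<in> r))) =
    (\<Prod>e\<in>S. P e * g e True + (1 - P e) * g e False)"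
proof -
  let ?Q = "pairs V"
  have fin: "finite ?Q" by (rule finite_pairs[OF V])
  let ?a = "\<lambda>e. P e * (if e \<in> S then g e True else 1)"
  let ?b = "\<lambda>e. (1 - P e) * (if e \<in> S then g e False else 1)"
  have "graph_weight V P r * (\<Prod>e\<in>S. g e (e \<in> r)) = (\<Prod>e\<in>r. ?a e) * (\<Prod>e\<in>?Q - r. ?b e)" if r: "r \<subseteq> ?Q" for r
  proof -
    have "(\<Prod>e\<in>S. g e (e \<in> r)) = (\<Prod>e\<in>?Q. if e \<in> S then g e (e \<in> r) else 1)"
      using S fin by (simp add: prod.If_cases Int_absorb1)
    also have "\<dots> = (\<Prod>e\<in>?Q - r. if e \<in> S then g e (e \<in> r) else 1) * (\<Prod>e\<in>r. if e \<in> S then g e (e \<in> r) else 1)"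
      by (rule prod.subset_diff[OF r fin])
    also have "(\<Prod>e\<in>?Q - r. if e \<in> S then g e (e \<in> r) else 1) = (\<Prod>e\<in>?Q - r. if e \<in> S then g e False else 1)"
      by (rule prod.cong) auto
    also have "(\<Prod>e\<in>r. if e \<in> S then g e (e \<in> r) else 1) = (\<Prod>e\<in>r. if e \<in> S then g e True else 1)"
      by (rule prod.cong) auto
    finally show ?thesis by (simp only: graph_weight_def prod.distrib ac_simps)
  qed
  then have "(\<Sum>r\<in>Pow ?Q. graph_weight V P r * (\<Prod>e\<in>S. g e (e \<in> r))) = (\<Sum>r\<in>Pow ?Q. (\<Prod>e\<in>r. ?a e) * (\<Prod>e\<in>?Q - r. ?b e))"
    by (intro sum.cong) auto
  also have "\<dots> = (\<Prod>e\<in>?Q. ?a e + ?b e)" by (rule prod_add[OF fin, symmetric])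
  also have "\<dots> = (\<Prod>e\<in>S. P e * g e True + (1 - P e) * g e False)"
    by (rule prod.mono_neutral_cong_right[OF fin S]) auto
  finally show ?thesis .
qed

lemma sum_graph_weight: "finite V \<Longrightarrow> (\<Sum>r\<in>Pow (pairs V). graph_weight V P r) = 1"
  using sum_graph_weight_prod[of V "{}" P] by simp

definition key :: "nat \<times> nat \<Rightarrow> nat \<times> nat" where "key = (\<lambda>(u, v). (min u v, max u v))"

lemma adj_key: "r \<subseteq> pairs V \<Longrightarrow> u \<noteq> v \<Longrightarrow> adj r (u, v) = of_bool (key (u, v) \<in> r)"
  by (auto simp: adj_def key_def pairs_def min_def max_def)

lemma key_in_pairs: "u \<in> V \<Longrightarrow> v \<in> V \<Longrightarrow> u \<noteq> v \<Longrightarrow> key (u, v) \<in> pairs V"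
  by (auto simp: key_def pairs_def min_def max_def)

lemma key_eq_iff: "key (u, v) = key (u', v') \<longleftrightarrow> (u = u' \<and> v = v') \<or> (u = v' \<and> v = u')"
  by (auto simp: key_def min_def max_def)

lemma sym_key: "(\<And>u v. P (u, v) = P (v, u)) \<Longrightarrow> P (key (u, v)) = P (u, v)"
  by (auto simp: key_def min_def max_def)

text \<open>Edges of an injective image are independent; \<open>\<phi>\<close> is the identity for densities and \<open>\<lambda>a. a - P e\<close> for centred edges.\<close>

lemma sum_graph_weight_edges:
  assumes V: "finite V" and E: "edge_set I E" and h: "h ` I \<subseteq> V" "inj_on h I" and P: "\<And>u v. P (u, v) = P (v, u)"
    and \<phi>: "\<And>u v. \<phi> (u, v) = \<phi> (v, u)"
  shows "(\<Sum>r\<in>Pow (pairs V). graph_weight V P r * (\<Prod>(i, j)\<in>E. adj r (h i, h j) - \<phi> (h i, h j))) =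
    (\<Prod>(i, j)\<in>E. P (h i, h j) - \<phi> (h i, h j))"
proof -
  let ?k = "\<lambda>(i, j). key (h i, h j)"
  have ne: "h i \<noteq> h j \<and> h i \<in> V \<and> h j \<in> V" if "(i, j) \<in> E" for i j
    using edge_setD[OF E that] h by (auto simp: inj_on_eq_iff)
  \<comment> \<open>Injectivity of \<open>h\<close>, together with the single orientation of edges
    in \<open>E\<close>, makes their images distinct as unordered pairs; otherwise a factor would
    occur twice.\<close>
  have injk: "inj_on ?k E"
  proof (rule inj_onI, clarify)
    fix i j i' j' assume a: "(i, j) \<in> E" "(i', j') \<in> E" "key (h i, h j) = key (h i', h j')"
    from a(3) have "(h i = h i' \<and> h j = h j') \<or> (h i = h j' \<and> h j = h i')" by (simp only: key_eq_iff)
    with edge_setD[OF E a(1)] edge_setD[OF E a(2)] h(2) a show "i = i' \<and> j = j'" by (auto simp: inj_on_eq_iff)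
  qed
  have kQ: "?k ` E \<subseteq> pairs V" using ne key_in_pairs by fastforce
  have "(\<Prod>(i, j)\<in>E. adj r (h i, h j) - \<phi> (h i, h j)) = (\<Prod>e\<in>?k ` E. of_bool (e \<in> r) - \<phi> e)" if r: "r \<subseteq> pairs V" for r
    by (subst prod.reindex[OF injk]) (auto intro!: prod.cong simp: adj_key[OF r] ne sym_key[of \<phi>, OF \<phi>])
  then have "(\<Sum>r\<in>Pow (pairs V). graph_weight V P r * (\<Prod>(i, j)\<in>E. adj r (h i, h j) - \<phi> (h i, h j))) =
    (\<Sum>r\<in>Pow (pairs V). graph_weight V P r * (\<Prod>e\<in>?k ` E. of_bool (e \<in> r) - \<phi> e))"
    by (intro sum.cong) auto
  also have "\<dots> = (\<Prod>e\<in>?k ` E. P e * (of_bool True - \<phi> e) + (1 - P e) * (of_bool False - \<phi> e))"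
    by (rule sum_graph_weight_prod[OF V kQ, of P "\<lambda>e b. of_bool b - \<phi> e"])
  also have "\<dots> = (\<Prod>e\<in>?k ` E. P e - \<phi> e)"
    by (rule prod.cong) (auto simp: algebra_simps)
  also have "\<dots> = (\<Prod>(i, j)\<in>E. P (h i, h j) - \<phi> (h i, h j))"
    by (subst prod.reindex[OF injk]) (auto intro!: prod.cong simp: sym_key[of \<phi>, OF \<phi>] sym_key[of P, OF P])
  finally show ?thesis .
qed

abbreviation at_points :: "(real \<times> real \<Rightarrow> real) \<Rightarrow> (nat \<Rightarrow> real) \<Rightarrow> nat \<times> nat \<Rightarrow> real" where
  "at_points p z \<equiv> (\<lambda>(u, v). p (z u, z v))"

text \<open>The law of a two-stage experiment: vertices draw points independently, with laws
  \<open>\<mu>\<close>, and then edges appear with the probabilities \<open>p\<close> prescribes at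
  these points.\<close>

definition graph_prob :: "nat set \<Rightarrow> (nat \<Rightarrow> real measure) \<Rightarrow> (real \<times> real \<Rightarrow> real) \<Rightarrow> (nat \<times> nat) set \<Rightarrow> real" where
  "graph_prob V \<mu> p r = (\<integral>z. graph_weight V (at_points p z) r \<partial>Pi\<^sub>M V \<mu>)"

lemma at_points_bounds: "graphon p \<Longrightarrow> 0 \<le> at_points p z e \<and> at_points p z e \<le> 1"
  using graphon_bounds by (cases e) auto

lemma abs_adj_le: "\<bar>adj r e\<bar> \<le> 1" and adj_nonneg: "0 \<le> adj r e" "adj r e \<le> 1"
  by (cases e; simp add: adj_def)+

lemma graph_weight_le_1:
  assumes "finite V" "r \<subseteq> pairs V" "\<And>e. 0 \<le> P e \<and> P e \<le> 1"
  shows "graph_weight V P r \<le> 1"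
proof -
  have "graph_weight V P r \<le> (\<Sum>r\<in>Pow (pairs V). graph_weight V P r)"
    by (rule member_le_sum) (use assms graph_weight_nonneg finite_pairs in auto)
  then show ?thesis using sum_graph_weight[OF assms(1)] by simp
qed

lemma measurable_graph_weight:
  assumes S: "sampler V \<mu>" and p: "graphon p" and r: "r \<subseteq> pairs V"
  shows "(\<lambda>z. graph_weight V (at_points p z) r) \<in> borel_measurable (Pi\<^sub>M V \<mu>)"
proof -
  have [measurable]: "p \<in> borel_measurable (lam \<Otimes>\<^sub>M lam)" by (rule graphon_measurable[OF p])
  have rV: "r \<subseteq> V \<times> V" "pairs V - r \<subseteq> V \<times> V" using r by (auto simp: pairs_def)
  have "(\<lambda>z. (\<Prod>e\<in>r. p (z (fst e), z (snd e))) * (\<Prod>e\<in>pairs V - r. (\<lambda>x. 1 - p x) (z (fst e), z (snd e)))) 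
      \<in> borel_measurable (Pi\<^sub>M V (\<lambda>_. lam))"
    by (intro borel_measurable_times measurable_edge_prod rV) measurable
  then show ?thesis
    unfolding graph_weight_def case_prod_beta' using measurable_cong_sets[OF sampler_sets[OF S] refl] by blast
qed

lemma graph_weight_integrable:
  assumes S: "sampler V \<mu>" and p: "graphon p" and r: "r \<subseteq> pairs V"
  shows "integrable (Pi\<^sub>M V \<mu>) (\<lambda>z. graph_weight V (at_points p z) r)"
proof -
  have V: "finite V" using S by (simp add: sampler_def)
  show ?thesis
  proof (rule prob_space.integrable_bdd[OF sampler_prob[OF S], where B=1])
    show "\<bar>graph_weight V (at_points p z) r\<bar> \<le> 1" for z
      using graph_weight_nonneg[OF r, of "at_points p z"] graph_weight_le_1[OF V r, of "at_points p z"] at_points_bounds[OF p]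
      by (simp add: abs_le_iff)
  qed (rule measurable_graph_weight[OF assms])
qed

lemma graph_prob_nonneg:
  assumes S: "sampler V \<mu>" and p: "graphon p" and r: "r \<subseteq> pairs V"
  shows "0 \<le> graph_prob V \<mu> p r"
  unfolding graph_prob_def
  by (intro integral_nonneg_AE AE_I2 graph_weight_nonneg[OF r] at_points_bounds[OF p])

lemma sum_graph_prob:
  assumes S: "sampler V \<mu>" and p: "graphon p"
  shows "(\<Sum>r\<in>Pow (pairs V). graph_prob V \<mu> p r) = 1"
proof -
  have V: "finite V" using S by (simp add: sampler_def)
  interpret P: prob_space "Pi\<^sub>M V \<mu>" by (rule sampler_prob[OF S])
  have "(\<Sum>r\<in>Pow (pairs V). graph_prob V \<mu> p r) = (\<integral>z. (\<Sum>r\<in>Pow (pairs V). graph_weight V (at_points p z) r) \<partial>Pi\<^sub>M V \<mu>)"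
    unfolding graph_prob_def by (rule Bochner_Integration.integral_sum[symmetric]) (auto intro: graph_weight_integrable[OF S p])
  then show ?thesis by (simp add: sum_graph_weight[OF V] P.prob_space)
qed

lemma sum_graph_prob_mult:
  assumes S: "sampler V \<mu>" and p: "graphon p"
  shows "(\<Sum>r\<in>Pow (pairs V). graph_prob V \<mu> p r * d r) = (\<integral>z. (\<Sum>r\<in>Pow (pairs V). graph_weight V (at_points p z) r * d r) \<partial>Pi\<^sub>M V \<mu>)"
  unfolding graph_prob_def
  by (subst Bochner_Integration.integral_sum) (auto intro!: integrable_mult_left graph_weight_integrable[OF S p])

lemma dens_uniform_abs_le:
  assumes "finite I" "finite V" "V \<noteq> {}" "\<And>e. \<bar>a e\<bar> \<le> 1"
  shows "\<bar>dens (uniform_count_measure V) I E a\<bar> \<le> 1"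
proof -
  have N: "0 < card V ^ card I" using assms by (simp add: card_gt_0_iff)
  have "\<bar>\<Sum>h\<in>I \<rightarrow>\<^sub>E V. \<Prod>(i, j)\<in>E. a (h i, h j)\<bar> \<le> (\<Sum>h\<in>I \<rightarrow>\<^sub>E V. 1)"
    by (rule order_trans[OF sum_abs], rule sum_mono, rule abs_prod_le_1) (use assms in auto)
  also have "\<dots> = card V ^ card I" using assms by (simp add: card_PiE)
  finally show ?thesis unfolding dens_uniform_count[OF assms(1-3)] using N by (simp add: divide_le_eq)
qed

text \<open>Passing from the random edges to the weights at the points costs one collision term, and
  passing from the points to the graphon costs two more by \<open>sampler_dens\<close>.\<close>

lemma random_graph_mean:
  assumes S: "sampler V \<mu>" and p: "graphon p" and E: "edge_set I E"
  shows "\<bar>(\<Sum>r\<in>Pow (pairs V). graph_prob V \<mu> p r * dens (uniform_count_measure V) I E (adj r)) - dens lam I E p\<bar>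
     \<le> (3 :: real) * (card I)\<^sup>2 / card V"
proof -
  let ?U = "uniform_count_measure V" and ?Q = "Pow (pairs V)"
  have V: "finite V" "V \<noteq> {}" using S by (auto simp: sampler_def)
  have finI: "finite I" using E by (auto simp: edge_set_def)
  interpret P: prob_space "Pi\<^sub>M V \<mu>" by (rule sampler_prob[OF S])
  let ?G = "\<lambda>z. \<Sum>r\<in>?Q. graph_weight V (at_points p z) r * dens ?U I E (adj r)"
  let ?d = "\<lambda>z. dens ?U I E (at_points p z)"
  note sd = sampler_dens[OF S E graphon_measurable[OF p]]
  have pB: "\<bar>p z\<bar> \<le> 1" for z using graphon_bounds[OF p, of z] by auto
  have gw: "0 \<le> graph_weight V (at_points p z) r" if "r \<in> ?Q" for z r
    using that at_points_bounds[OF p] by (intro graph_weight_nonneg) auto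
  have close: "\<bar>?G z - ?d z\<bar> \<le> (1::real) * (card I)\<^sup>2 / card V" for z
  proof -
    let ?f = "\<lambda>h. (\<Sum>r\<in>?Q. graph_weight V (at_points p z) r * (\<Prod>(i, j)\<in>E. adj r (h i, h j))) - (\<Prod>(i, j)\<in>E. at_points p z (h i, h j))"
    have "?G z = (\<Sum>h\<in>I \<rightarrow>\<^sub>E V. \<Sum>r\<in>?Q. graph_weight V (at_points p z) r * (\<Prod>(i, j)\<in>E. adj r (h i, h j))) / card V ^ card I"
      unfolding dens_uniform_count[OF finI V] by (subst sum.swap) (simp add: sum_distrib_left sum_divide_distrib)
    then have "?G z - ?d z = (\<Sum>h\<in>I \<rightarrow>\<^sub>E V. ?f h) / card V ^ card I"
      unfolding dens_uniform_count[OF finI V] by (simp add: sum_subtractf diff_divide_distrib)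
    also have "\<bar>\<dots>\<bar> \<le> (1::real) * (card I)\<^sup>2 / card V"
    proof (rule sum_noninj_le[OF finI V])
      fix h assume h: "h \<in> I \<rightarrow>\<^sub>E V"
      have "0 \<le> (\<Prod>(i, j)\<in>E. at_points p z (h i, h j))" "(\<Prod>(i, j)\<in>E. at_points p z (h i, h j)) \<le> 1"
        using at_points_bounds[OF p] by (auto intro!: prod_nonneg prod_le_1 simp del: case_prod_conv split del: if_split)
      moreover have "0 \<le> (\<Sum>r\<in>?Q. graph_weight V (at_points p z) r * (\<Prod>(i, j)\<in>E. adj r (h i, h j)))"
        by (intro sum_nonneg mult_nonneg_nonneg gw prod_nonneg) (auto simp: adj_nonneg)
      moreover have "(\<Sum>r\<in>?Q. graph_weight V (at_points p z) r * (\<Prod>(i, j)\<in>E. adj r (h i, h j))) \<le> (\<Sum>r\<in>?Q. graph_weight V (at_points p z) r * 1)"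
        by (intro sum_mono mult_left_mono gw prod_le_1) (auto simp: adj_nonneg)
      ultimately show "\<bar>?f h\<bar> \<le> 1" using sum_graph_weight[OF V(1)] by (simp add: abs_le_iff)
      assume "inj_on h I"
      with sum_graph_weight_edges[OF V(1) E, of h "at_points p z" "\<lambda>_. 0"] h graphon_sym[OF p]
      show "?f h = 0" by (simp add: image_subset_iff PiE_iff case_prod_beta')
    qed
    finally show ?thesis .
  qed
  have iG: "integrable (Pi\<^sub>M V \<mu>) ?G"
    by (intro Bochner_Integration.integrable_sum integrable_mult_left graph_weight_integrable[OF S p]) auto
  have id: "integrable (Pi\<^sub>M V \<mu>) ?d"
    by (rule P.integrable_bdd[where B=1]) (use sd(1)[OF pB] pB dens_uniform_abs_le[OF finI V] in auto)
  have "\<bar>(\<integral>z. ?G z - ?d z \<partial>Pi\<^sub>M V \<mu>)\<bar> \<le> (1::real) * (card I)\<^sup>2 / card V"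
    by (rule P.abs_integral_le) (use iG id close in auto)
  then have "\<bar>(\<integral>z. ?G z \<partial>Pi\<^sub>M V \<mu>) - (\<integral>z. ?d z \<partial>Pi\<^sub>M V \<mu>)\<bar> \<le> (1::real) * (card I)\<^sup>2 / card V"
    using iG id by simp
  with sd(2)[OF pB] show ?thesis unfolding sum_graph_prob_mult[OF S p] by (simp add: add_divide_distrib)
qed

lemma card_double: "finite I \<Longrightarrow> real ((card (I \<times> (UNIV :: bool set)))\<^sup>2) = 4 * real ((card I)\<^sup>2)"
  by (simp add: card_cartesian_product power2_eq_square)

lemma dens_lam_bounds:
  assumes p: "graphon p" and E: "edge_set I E"
  shows "0 \<le> dens lam I E p" "dens lam I E p \<le> 1"
proof -
  interpret P: prob_space "Pi\<^sub>M I (\<lambda>_. lam)" by (rule lam.prob_space_PiM_self)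
  have EI: "E \<subseteq> I \<times> I" using E by (auto simp: edge_set_def)
  show "0 \<le> dens lam I E p" unfolding dens_def
    by (intro integral_nonneg_AE AE_I2 prod_nonneg) (use graphon_bounds[OF p] in auto)
  have "\<bar>dens lam I E p\<bar> \<le> 1"
    unfolding dens_def case_prod_beta'
  proof (rule P.abs_integral_le)
    show "(\<lambda>x. \<Prod>e\<in>E. p (x (fst e), x (snd e))) \<in> borel_measurable (Pi\<^sub>M I (\<lambda>_. lam))"
      by (rule measurable_edge_prod[OF EI]) (rule graphon_measurable[OF p])
    show "\<bar>\<Prod>e\<in>E. p (x (fst e), x (snd e))\<bar> \<le> 1" for x
      by (rule abs_prod_le_1) (use graphon_bounds[OF p] in \<open>simp add: abs_le_iff order_trans[of _ 0]\<close>)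
  qed
  then show "dens lam I E p \<le> 1" by simp
qed

text \<open>The second moment is the mean density of two disjoint copies, a graph with twice as many
  vertices. Its error is \<open>3 * 4\<close>, the cross term adds \<open>2 * 3\<close>, and
  together they give 18.\<close>

lemma random_graph_variance:
  assumes S: "sampler V \<mu>" and p: "graphon p" and E: "edge_set I E"
  shows "(\<Sum>r\<in>Pow (pairs V). graph_prob V \<mu> p r * (dens (uniform_count_measure V) I E (adj r) - dens lam I E p)\<^sup>2)
     \<le> (18 :: real) * (card I)\<^sup>2 / card V"
proof -
  let ?U = "uniform_count_measure V" and ?Q = "Pow (pairs V)"
  have V: "finite V" "V \<noteq> {}" using S by (auto simp: sampler_def)
  interpret U: prob_space ?U by (rule prob_space_uniform_count_measure[OF V])
  have finI: "finite I" using E by (auto simp: edge_set_def)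
  let ?E2 = "dup True E \<union> dup False E"
  let ?d = "\<lambda>r. dens ?U I E (adj r)" and ?c = "dens lam I E p" and ?P = "graph_prob V \<mu> p"
  have pB: "\<bar>p z\<bar> \<le> 1" for z using graphon_bounds[OF p, of z] by auto
  have sq: "(?d r)\<^sup>2 = dens ?U (I \<times> UNIV) ?E2 (adj r)" for r
    by (rule dens_double[OF U.prob_space_axioms E, symmetric])
       (use V abs_adj_le in \<open>auto intro: measurable_uniform_count_pair\<close>)
  have cq: "?c\<^sup>2 = dens lam (I \<times> UNIV) ?E2 p"
    by (rule dens_double[OF lam.prob_space_axioms E graphon_measurable[OF p], symmetric]) (rule pB)
  note m2 = random_graph_mean[OF S p edge_set_dup[OF E], folded sq cq, unfolded card_double[OF finI]]
  note m1 = random_graph_mean[OF S p E]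
  note c = dens_lam_bounds[OF p E]
  have "(\<Sum>r\<in>?Q. ?P r * (?d r - ?c)\<^sup>2) = (\<Sum>r\<in>?Q. ?P r * (?d r)\<^sup>2 - 2 * ?c * (?P r * ?d r) + ?c\<^sup>2 * ?P r)"
    by (rule sum.cong) (auto simp: power2_eq_square algebra_simps)
  also have "\<dots> = (\<Sum>r\<in>?Q. ?P r * (?d r)\<^sup>2) - 2 * ?c * (\<Sum>r\<in>?Q. ?P r * ?d r) + ?c\<^sup>2"
    using sum_graph_prob[OF S p] by (simp add: sum.distrib sum_subtractf flip: sum_distrib_left)
  also have "\<dots> = ((\<Sum>r\<in>?Q. ?P r * (?d r)\<^sup>2) - ?c\<^sup>2) - 2 * ?c * ((\<Sum>r\<in>?Q. ?P r * ?d r) - ?c)"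
    by (simp add: power2_eq_square algebra_simps)
  also have "\<dots> \<le> 3 * (4 * real ((card I)\<^sup>2)) / card V + 2 * (3 * real ((card I)\<^sup>2) / card V)"
  proof -
    have "\<bar>2 * ?c * ((\<Sum>r\<in>?Q. ?P r * ?d r) - ?c)\<bar> \<le> 2 * (3 * real ((card I)\<^sup>2) / card V)"
      using mult_mono[OF c(2) m1] c(1) by (simp add: abs_mult)
    with m2 show ?thesis by linarith
  qed
  also have "\<dots> = (18 :: real) * (card I)\<^sup>2 / card V" by (simp add: add_divide_distrib[symmetric])
  finally show ?thesis .
qed

text \<open>As in \<open>random_graph_variance\<close>, but for the points alone:
  \<open>2 * 4 + 2 * 2 = 12\<close>.\<close>

lemma sampler_variance:
  assumes S: "sampler V \<mu>" and E: "edge_set I E"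
    and f: "f \<in> borel_measurable (lam \<Otimes>\<^sub>M lam)" and f01: "\<And>z. 0 \<le> f z \<and> f z \<le> 1"
  shows "(\<integral>z. (dens (uniform_count_measure V) I E (at_points f z) - dens lam I E f)\<^sup>2 \<partial>Pi\<^sub>M V \<mu>) \<le> (12 :: real) * (card I)\<^sup>2 / card V"
proof -
  let ?U = "uniform_count_measure V"
  have V: "finite V" "V \<noteq> {}" using S by (auto simp: sampler_def)
  interpret U: prob_space ?U by (rule prob_space_uniform_count_measure[OF V])
  interpret P: prob_space "Pi\<^sub>M V \<mu>" by (rule sampler_prob[OF S])
  have finI: "finite I" and EI: "E \<subseteq> I \<times> I" using E by (auto simp: edge_set_def)
  have fB: "\<bar>f z\<bar> \<le> 1" for z using f01[of z] by auto
  let ?E2 = "dup True E \<union> dup False E"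
  let ?d = "\<lambda>z. dens ?U I E (at_points f z)" and ?c = "dens lam I E f"
  have sq: "(?d z)\<^sup>2 = dens ?U (I \<times> UNIV) ?E2 (at_points f z)" for z
    by (rule dens_double[OF U.prob_space_axioms E, symmetric])
       (use V fB in \<open>auto intro: measurable_uniform_count_pair\<close>)
  have cq: "?c\<^sup>2 = dens lam (I \<times> UNIV) ?E2 f"
    by (rule dens_double[OF lam.prob_space_axioms E f, symmetric]) (rule fB)
  have f1: "\<bar>f z\<bar> \<le> 1" for z by (rule fB)
  note m2 = sampler_dens[OF S edge_set_dup[OF E] f f1, folded sq cq, unfolded card_double[OF finI]]
  note m1 = sampler_dens[OF S E f f1]
  have dB: "\<bar>?d z\<bar> \<le> 1" for z by (rule dens_uniform_abs_le[OF finI V]) (use fB in auto)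
  have i1: "integrable (Pi\<^sub>M V \<mu>) ?d" by (rule P.integrable_bdd[OF m1(1) dB])
  have i2: "integrable (Pi\<^sub>M V \<mu>) (\<lambda>z. (?d z)\<^sup>2)" by (rule P.integrable_bdd[OF m2(1), of 1]) (use dB in \<open>simp add: abs_square_le_1\<close>)
  have c: "\<bar>?c\<bar> \<le> 1"
    unfolding dens_def case_prod_beta'
    by (rule prob_space.abs_integral_le[OF lam.prob_space_PiM_self], rule measurable_edge_prod[OF EI])
       (use f fB in \<open>auto intro: abs_prod_le_1\<close>)
  have "(\<integral>z. (?d z - ?c)\<^sup>2 \<partial>Pi\<^sub>M V \<mu>) = (\<integral>z. (?d z)\<^sup>2 - 2 * ?c * ?d z + ?c\<^sup>2 \<partial>Pi\<^sub>M V \<mu>)"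
    by (rule Bochner_Integration.integral_cong) (auto simp: power2_eq_square algebra_simps)
  also have "\<dots> = (\<integral>z. (?d z)\<^sup>2 \<partial>Pi\<^sub>M V \<mu>) - 2 * ?c * (\<integral>z. ?d z \<partial>Pi\<^sub>M V \<mu>) + ?c\<^sup>2"
    using i1 i2 by (simp add: P.prob_space)
  also have "\<dots> = ((\<integral>z. (?d z)\<^sup>2 \<partial>Pi\<^sub>M V \<mu>) - ?c\<^sup>2) - 2 * ?c * ((\<integral>z. ?d z \<partial>Pi\<^sub>M V \<mu>) - ?c)"
    by (simp add: power2_eq_square algebra_simps)
  also have "\<dots> \<le> 2 * (4 * real ((card I)\<^sup>2)) / card V + 2 * (2 * real ((card I)\<^sup>2) / card V)"
  proof -
    have "\<bar>2 * ?c * ((\<integral>z. ?d z \<partial>Pi\<^sub>M V \<mu>) - ?c)\<bar> \<le> 2 * (2 * real ((card I)\<^sup>2) / card V)"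
      using mult_mono[OF c m1(2)] by (simp add: abs_mult)
    with m2(2) show ?thesis by linarith
  qed
  also have "\<dots> = (12 :: real) * (card I)\<^sup>2 / card V" by (simp add: add_divide_distrib[symmetric])
  finally show ?thesis .
qed

section \<open>Typical samples and their labellings\<close>

text \<open>Chebyshev's inequality for the sum of the variances over \<open>F\<close>. Positive
  probability of the graph is part of the conclusion because structural facts about samples hold
  only almost surely.\<close>

lemma ex_typical_graph:
  assumes S: "sampler V \<mu>" and p: "graphon p" and F: "finite F" "\<And>I E. (I, E) \<in> F \<Longrightarrow> edge_set I E"
    and e: "0 < e" and N: "(\<Sum>(I, E)\<in>F. 18 * real ((card I)\<^sup>2)) / card V < e\<^sup>2"
  shows "\<exists>r\<subseteq>pairs V. 0 < graph_prob V \<mu> p r \<and>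
    (\<forall>(I, E)\<in>F. \<bar>dens (uniform_count_measure V) I E (adj r) - dens lam I E p\<bar> < e)"
proof (rule ccontr)
  assume neg: "\<not> ?thesis"
  let ?U = "uniform_count_measure V" and ?Q = "Pow (pairs V)"
  let ?X = "\<lambda>r. \<Sum>(I, E)\<in>F. (dens ?U I E (adj r) - dens lam I E p)\<^sup>2"
  have V: "finite V" "V \<noteq> {}" using S by (auto simp: sampler_def)
  have X0: "0 \<le> ?X r" for r by (intro sum_nonneg) auto
  have "graph_prob V \<mu> p r * e\<^sup>2 \<le> graph_prob V \<mu> p r * ?X r" if r: "r \<in> ?Q" for r
  proof (cases "0 < graph_prob V \<mu> p r")
    case True
    have "\<not> (\<forall>(I, E)\<in>F. \<bar>dens ?U I E (adj r) - dens lam I E p\<bar> < e)" using neg True r by blast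
    then obtain I E where IE: "(I, E) \<in> F" "e \<le> \<bar>dens ?U I E (adj r) - dens lam I E p\<bar>" by (auto simp: not_less)
    have "e\<^sup>2 \<le> \<bar>dens ?U I E (adj r) - dens lam I E p\<bar>\<^sup>2" using IE(2) e by (intro power_mono) auto
    also have "\<dots> = (\<lambda>(I, E). (dens ?U I E (adj r) - dens lam I E p)\<^sup>2) (I, E)" by simp
    also have "\<dots> \<le> ?X r" by (rule member_le_sum[OF IE(1)]) (use F in auto)
    finally show ?thesis using True by (intro mult_left_mono) auto
  next
    case False
    then have "graph_prob V \<mu> p r = 0" using graph_prob_nonneg[OF S p, of r] r by auto
    then show ?thesis by simp
  qed
  then have "(\<Sum>r\<in>?Q. graph_prob V \<mu> p r * e\<^sup>2) \<le> (\<Sum>r\<in>?Q. graph_prob V \<mu> p r * ?X r)" by (rule sum_mono)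
  also have "\<dots> = (\<Sum>(I, E)\<in>F. \<Sum>r\<in>?Q. graph_prob V \<mu> p r * (dens ?U I E (adj r) - dens lam I E p)\<^sup>2)"
    unfolding case_prod_beta' sum_distrib_left by (rule sum.swap)
  also have "\<dots> \<le> (\<Sum>(I, E)\<in>F. 18 * real ((card I)\<^sup>2) / card V)"
    by (intro sum_mono) (use random_graph_variance[OF S p F(2)] in auto)
  also have "\<dots> = (\<Sum>(I, E)\<in>F. 18 * real ((card I)\<^sup>2)) / card V" by (simp add: sum_divide_distrib case_prod_beta')
  finally show False using N sum_graph_prob[OF S p] by (simp flip: sum_distrib_right)
qed

lemma sum_PiE_insert:
  assumes "i \<notin> I"
  shows "(\<Sum>h\<in>insert i I \<rightarrow>\<^sub>E V. F h) = (\<Sum>v\<in>V. \<Sum>h\<in>I \<rightarrow>\<^sub>E V. F (h(i := v)))"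
  unfolding PiE_insert_eq
  by (subst sum.reindex[OF inj_combinator[OF assms]]) (simp add: sum.cartesian_product case_prod_beta')

definition C4_edges :: "(nat \<times> nat) set" where
  "C4_edges = {(0, 2), (0, 3), (1, 2), (1, 3)}"

lemma edge_set_C4: "edge_set {2, 3, 0, 1} C4_edges"
  by (auto simp: edge_set_def C4_edges_def)

text \<open>Writing the vertices in the order 2, 3, 0, 1 makes the sum unfold in the order of the
  integrals of \<open>C4\<close>: \<open>y\<close>, \<open>y'\<close>, and then the two copies of
  \<open>x\<close>.\<close>

lemma C4_uniform_count:
  assumes V: "finite V" "V \<noteq> {}"
  shows "C4 (uniform_count_measure V) D = dens (uniform_count_measure V) {2, 3, 0, 1} C4_edges D"
proof -
  let ?N = "real (card V)"
  have N: "0 < ?N" using V by (simp add: card_gt_0_iff)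
  have "(\<Sum>h\<in>{2, 3, 0, 1 :: nat} \<rightarrow>\<^sub>E V. \<Prod>(i, j)\<in>C4_edges. D (h i, h j)) = 
    (\<Sum>c\<in>V. \<Sum>d\<in>V. \<Sum>a\<in>V. \<Sum>b\<in>V. (D (a, c) * D (a, d)) * (D (b, c) * D (b, d)))"
    by (simp add: sum_PiE_insert C4_edges_def mult.assoc)
  also have "\<dots> = (\<Sum>c\<in>V. \<Sum>d\<in>V. (\<Sum>a\<in>V. D (a, c) * D (a, d))\<^sup>2)"
    by (simp add: power2_eq_square sum_product)
  finally have 1: "(\<Sum>h\<in>{2, 3, 0, 1 :: nat} \<rightarrow>\<^sub>E V. \<Prod>(i, j)\<in>C4_edges. D (h i, h j)) = \<dots>" .
  have "C4 (uniform_count_measure V) D = (\<Sum>c\<in>V. \<Sum>d\<in>V. (\<Sum>a\<in>V. D (a, c) * D (a, d))\<^sup>2) / ?N ^ 4"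
    unfolding C4_def using V N
    by (simp add: integral_uniform_count_measure power_divide flip: sum_divide_distrib) (simp add: field_simps power2_eq_square power4_eq_xxxx)
  moreover have c4: "card {2, 3, 0, 1 :: nat} = 4" by simp
  moreover have "dens (uniform_count_measure V) {2, 3, 0, 1} C4_edges D =
      (\<Sum>h\<in>{2, 3, 0, 1 :: nat} \<rightarrow>\<^sub>E V. \<Prod>(i, j)\<in>C4_edges. D (h i, h j)) / card V ^ card {2, 3, 0, 1 :: nat}"
    by (rule dens_uniform_count) (use V in auto)
  ultimately show ?thesis unfolding 1 c4 by (simp only: of_nat_power)
qed

text \<open>Under an injective map the four centred edges are independent with mean 0, so their
  product has expectation 0. Only collisions remain, and 16 is the square of the number of vertices
  of the four-cycle. Hence a random graph is close in cut norm to the weights from which it is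
  drawn.\<close>

lemma C4_mean:
  assumes V: "finite V" "V \<noteq> {}" and P: "\<And>e. 0 \<le> P e \<and> P e \<le> 1" and sym: "\<And>u v. P (u, v) = P (v, u)"
  shows "(\<Sum>r\<in>Pow (pairs V). graph_weight V P r * C4 (uniform_count_measure V) (\<lambda>e. adj r e - P e)) \<le> 16 / card V"
proof -
  let ?I = "{2, 3, 0, 1 :: nat}"
  let ?f = "\<lambda>h. \<Sum>r\<in>Pow (pairs V). graph_weight V P r * (\<Prod>(i, j)\<in>C4_edges. adj r (h i, h j) - P (h i, h j))"
  have "(\<Sum>r\<in>Pow (pairs V). graph_weight V P r * C4 (uniform_count_measure V) (\<lambda>e. adj r e - P e)) = (\<Sum>h\<in>?I \<rightarrow>\<^sub>E V. ?f h) / card V ^ card ?I"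
    unfolding C4_uniform_count[OF V]
    by (subst dens_uniform_count, use V in \<open>simp_all\<close>) 
       (subst sum.swap, simp add: sum_distrib_left sum_divide_distrib)
  also have "\<bar>\<dots>\<bar> \<le> (1::real) * (card ?I)\<^sup>2 / card V"
  proof (rule sum_noninj_le)
    fix h assume h: "h \<in> ?I \<rightarrow>\<^sub>E V"
    have gw: "0 \<le> graph_weight V P r" if "r \<in> Pow (pairs V)" for r using that P by (intro graph_weight_nonneg) auto
    have D: "\<bar>adj r e - P e\<bar> \<le> 1" for r e using P[of e] adj_nonneg[where r=r and e=e] by auto
    have "\<bar>?f h\<bar> \<le> (\<Sum>r\<in>Pow (pairs V). graph_weight V P r * 1)"
    proof (rule order_trans[OF sum_abs], rule sum_mono)
      fix r assume r: "r \<in> Pow (pairs V)"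
      have "\<bar>\<Prod>(i, j)\<in>C4_edges. adj r (h i, h j) - P (h i, h j)\<bar> \<le> 1"
        by (rule abs_prod_le_1) (auto simp: D)
      then show "\<bar>graph_weight V P r * (\<Prod>(i, j)\<in>C4_edges. adj r (h i, h j) - P (h i, h j))\<bar> \<le> graph_weight V P r * 1"
        unfolding abs_mult abs_of_nonneg[OF gw[OF r]] by (rule mult_left_mono[OF _ gw[OF r]])
    qed
    then show "\<bar>?f h\<bar> \<le> 1" using sum_graph_weight[OF V(1)] by simp
    assume "inj_on h ?I"
    with sum_graph_weight_edges[OF V(1) edge_set_C4, of h P P] h sym
    have "?f h = (\<Prod>(i, j)\<in>C4_edges. P (h i, h j) - P (h i, h j))" by (simp add: image_subset_iff PiE_iff)
    then show "?f h = 0" by (simp add: C4_edges_def)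
  qed (use V in auto)
  finally show ?thesis by simp
qed

lemma measurable_at_points:
  assumes "w \<in> borel_measurable (lam \<Otimes>\<^sub>M lam)" "u \<in> V" "v \<in> V"
  shows "(\<lambda>z. w (z u, z v)) \<in> borel_measurable (Pi\<^sub>M V (\<lambda>_. lam))"
  using assms by (intro measurable_compose[OF _ assms(1)] measurable_Pair measurable_component_singleton) auto

text \<open>The labels \<open>z\<close> recover the graphon from the graph: the graph is close to
  \<open>w\<close> read off at the labels, and the labels have nearly the right average for the
  first \<open>K\<close> test functions. The one-edge density is simply the average of a test
  function over pairs.\<close>

definition well_labelled :: "nat set \<Rightarrow> (real \<times> real \<Rightarrow> real) \<Rightarrow> (nat \<Rightarrow> real \<times> real \<Rightarrow> real) \<Rightarrow> nat \<Rightarrow> real \<Rightarrow> (nat \<times> nat) set \<Rightarrow> (nat \<Rightarrow> real) \<Rightarrow> bool" where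
  "well_labelled V w f K \<delta> r z \<longleftrightarrow> z \<in> V \<rightarrow>\<^sub>E {0..1} \<and>
    C4 (uniform_count_measure V) (\<lambda>e. adj r e - at_points w z e) \<le> \<delta> \<and>
    (\<forall>k<K. \<bar>dens (uniform_count_measure V) {0, 1 :: nat} {(0, 1)} (at_points (f k) z) - dens lam {0, 1 :: nat} {(0, 1)} (f k)\<bar> \<le> \<delta>)"

text \<open>The sampled points are themselves good labels on average. By Markov's inequality the
  graphs without any good labelling have total probability below one half.\<close>

lemma prob_well_labelled:
  assumes V: "finite V" "V \<noteq> {}" and w: "graphon w"
    and f: "\<And>k. f k \<in> borel_measurable (lam \<Otimes>\<^sub>M lam)" and f01: "\<And>k z. 0 \<le> f k z \<and> f k z \<le> 1"
    and \<delta>: "0 < \<delta>" "\<delta> \<le> 1" and N: "(16 + 48 * real K) / card V < \<delta>\<^sup>2 / 2"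
  shows "(\<Sum>r\<in>{r\<in>Pow (pairs V). \<exists>z. well_labelled V w f K \<delta> r z}. graph_prob V (\<lambda>_. lam) w r) > 1 / 2"
proof -
  let ?U = "uniform_count_measure V" and ?Q = "Pow (pairs V)" and ?M = "Pi\<^sub>M V (\<lambda>_. lam)" and ?I = "{0, 1 :: nat}"
  let ?good = "\<lambda>r. \<exists>z. well_labelled V w f K \<delta> r z"
  have S: "sampler V (\<lambda>_. lam)" by (rule sampler_iid[OF V])
  interpret P: prob_space ?M by (rule sampler_prob[OF S])
  interpret U: prob_space ?U by (rule prob_space_uniform_count_measure[OF V])
  have E: "edge_set ?I {(0, 1)}" by (simp add: edge_set_def)
  define c4 where "c4 z r = C4 ?U (\<lambda>e. adj r e - at_points w z e)" for z r
  define dv where "dv z k = (dens ?U ?I {(0, 1)} (at_points (f k) z) - dens lam ?I {(0, 1)} (f k))\<^sup>2" for z k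
  define Y where "Y z = (\<Sum>k<K. dv z k)" for z
  have c40: "0 \<le> c4 z r" for z r unfolding c4_def by (rule U.C4_nonneg)
  have dv0: "0 \<le> dv z k" for z k by (simp add: dv_def)
  have Y0: "0 \<le> Y z" for z unfolding Y_def by (intro sum_nonneg dv0)
  have wB: "\<bar>adj r e - at_points w z e\<bar> \<le> 1" for r e z
    using at_points_bounds[OF w, of z e] adj_nonneg[where r=r and e=e] by auto
  have c41: "c4 z r \<le> 1" for z r
  proof -
    have "\<bar>dens ?U {2, 3, 0, 1} C4_edges (\<lambda>e. adj r e - at_points w z e)\<bar> \<le> 1"
      by (rule dens_uniform_abs_le[OF _ V wB]) simp
    then show ?thesis unfolding c4_def C4_uniform_count[OF V] by (rule order_trans[OF abs_ge_self])
  qed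
  have mc4: "(\<lambda>z. c4 z r) \<in> borel_measurable ?M" for r
  proof -
    have fin4: "finite {2, 3, 0, 1 :: nat}" by simp
    have *: "c4 z r = (\<Sum>h\<in>{2, 3, 0, 1 :: nat} \<rightarrow>\<^sub>E V. \<Prod>e\<in>C4_edges. adj r (h (fst e), h (snd e)) - w (z (h (fst e)), z (h (snd e)))) / card V ^ card {2, 3, 0, 1 :: nat}" for z
      unfolding c4_def C4_uniform_count[OF V] dens_uniform_count[OF fin4 V] by (intro arg_cong2[where f="(/)"] sum.cong prod.cong refl) (simp add: case_prod_beta')
    show ?thesis unfolding *
    proof (intro borel_measurable_divide borel_measurable_sum borel_measurable_const borel_measurable_prod borel_measurable_diff)
      fix h e assume h: "h \<in> {2, 3, 0, 1 :: nat} \<rightarrow>\<^sub>E V" and e: "e \<in> C4_edges"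
      from e have e': "fst e \<in> {2, 3, 0, 1}" "snd e \<in> {2, 3, 0, 1}" by (auto simp: C4_edges_def)
      have "h (fst e) \<in> V" "h (snd e) \<in> V" using PiE_mem[OF h e'(1)] PiE_mem[OF h e'(2)] .
      then show "(\<lambda>z. w (z (h (fst e)), z (h (snd e)))) \<in> borel_measurable ?M"
        by (rule measurable_at_points[OF graphon_measurable[OF w]])
    qed
  qed
  have fB: "\<bar>f k z\<bar> \<le> 1" for k z using f01[of k z] by auto
  note sd = sampler_dens(1)[OF S E f fB] sampler_variance[OF S E f f01]
  have dB: "\<bar>dens ?U ?I {(0, 1)} (at_points (f k) z)\<bar> \<le> 1" for k z
    by (rule dens_uniform_abs_le) (use V fB in auto)
  have iv: "integrable ?M (\<lambda>z. dv z k)" for k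
  proof -
    have "integrable ?M (\<lambda>z. dens ?U ?I {(0, 1)} (at_points (f k) z))" by (rule P.integrable_bdd[OF sd(1) dB])
    moreover have "integrable ?M (\<lambda>z. (dens ?U ?I {(0, 1)} (at_points (f k) z))\<^sup>2)"
      by (rule P.integrable_bdd[where B=1]) (use sd(1)[of k] dB in \<open>auto simp: abs_square_le_1\<close>)
    ultimately show ?thesis unfolding dv_def power2_diff by simp
  qed
  have iw: "integrable ?M (\<lambda>z. graph_weight V (at_points w z) r)" if "r \<in> ?Q" for r
    using graph_weight_integrable[OF S w] that by auto
  have ic4: "integrable ?M (\<lambda>z. graph_weight V (at_points w z) r * c4 z r)" if "r \<in> ?Q" for r
    by (rule integrable_times_bounded[OF iw[OF that] mc4]) (use c40 c41 in auto)
  have iY: "integrable ?M Y" unfolding Y_def by (intro Bochner_Integration.integrable_sum iv)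
  have gw: "0 \<le> graph_weight V (at_points w z) r" if "r \<in> ?Q" for z r
    using that at_points_bounds[OF w] by (intro graph_weight_nonneg) auto
  \<comment> \<open>If no labelling of \<open>r\<close> is good, every \<open>z\<close> violates
    some condition. A violated \<open>C4\<close> bound already exceeds the square of
    \<open>\<delta>\<close> because \<open>\<delta> \<le> 1\<close>.\<close>
  have bad: "\<delta>\<^sup>2 \<le> c4 z r + Y z" if r: "\<not> ?good r" and z: "z \<in> space ?M" for z r
  proof (rule ccontr)
    assume "\<not> \<delta>\<^sup>2 \<le> c4 z r + Y z"
    then have less: "c4 z r < \<delta>\<^sup>2" "Y z < \<delta>\<^sup>2" using c40[of z r] Y0[of z] by auto
    have "\<delta>\<^sup>2 \<le> \<delta>" using \<delta> by (simp add: power2_eq_square mult_left_le)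
    then have "c4 z r \<le> \<delta>" using less by simp
    moreover have "\<bar>dens ?U ?I {(0, 1)} (at_points (f k) z) - dens lam ?I {(0, 1)} (f k)\<bar> \<le> \<delta>" if "k < K" for k
    proof -
      have "dv z k \<le> Y z" unfolding Y_def by (rule member_le_sum) (use that dv0 in auto)
      then have "(dens ?U ?I {(0, 1)} (at_points (f k) z) - dens lam ?I {(0, 1)} (f k))\<^sup>2 \<le> \<delta>\<^sup>2" using less by (simp add: dv_def)
      then show ?thesis using \<delta> by (simp add: abs_le_square_iff[symmetric])
    qed
    moreover have "z \<in> V \<rightarrow>\<^sub>E {0..1}" using z by (simp add: space_PiM)
    ultimately have "well_labelled V w f K \<delta> r z" by (simp add: well_labelled_def c4_def)
    with r show False by blast
  qed
  have fin: "finite ?Q" using finite_pairs[OF V(1)] by simp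
  have "\<delta>\<^sup>2 * (\<Sum>r\<in>{r\<in>?Q. \<not> ?good r}. graph_prob V (\<lambda>_. lam) w r) = 
      (\<Sum>r\<in>{r\<in>?Q. \<not> ?good r}. \<integral>z. graph_weight V (at_points w z) r * \<delta>\<^sup>2 \<partial>?M)"
    unfolding graph_prob_def sum_distrib_left by (simp add: mult.commute)
  also have "\<dots> \<le> (\<Sum>r\<in>{r\<in>?Q. \<not> ?good r}. \<integral>z. graph_weight V (at_points w z) r * c4 z r + graph_weight V (at_points w z) r * Y z \<partial>?M)"
  proof (rule sum_mono, rule integral_mono)
    fix r assume r: "r \<in> {r\<in>?Q. \<not> ?good r}"
    show "integrable ?M (\<lambda>z. graph_weight V (at_points w z) r * \<delta>\<^sup>2)" using iw[of r] r by auto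
    have gB: "\<bar>graph_weight V (at_points w z) r\<bar> \<le> 1" for z
      using gw[of r z] r graph_weight_le_1[OF V(1), of r "at_points w z"] at_points_bounds[OF w] by auto
    have "integrable ?M (\<lambda>z. Y z * graph_weight V (at_points w z) r)"
      by (rule integrable_times_bounded[OF iY measurable_graph_weight[OF S w]]) (use r gB in auto)
    then show "integrable ?M (\<lambda>z. graph_weight V (at_points w z) r * c4 z r + graph_weight V (at_points w z) r * Y z)"
      using ic4[of r] r by (simp add: mult.commute[of "Y _"])
    fix z assume z: "z \<in> space ?M"
    show "graph_weight V (at_points w z) r * \<delta>\<^sup>2 \<le> graph_weight V (at_points w z) r * c4 z r + graph_weight V (at_points w z) r * Y z"
      unfolding distrib_left[symmetric] using bad[OF _ z, of r] gw[of r z] r by (intro mult_left_mono) auto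
  qed
  also have "\<dots> \<le> (\<Sum>r\<in>?Q. \<integral>z. graph_weight V (at_points w z) r * c4 z r + graph_weight V (at_points w z) r * Y z \<partial>?M)"
    by (rule sum_mono2[OF fin]) (use gw c40 Y0 in \<open>auto intro!: integral_nonneg_AE AE_I2 add_nonneg_nonneg mult_nonneg_nonneg\<close>)
  also have "\<dots> = (\<integral>z. (\<Sum>r\<in>?Q. graph_weight V (at_points w z) r * c4 z r) + Y z \<partial>?M)"
  proof -
    have gB: "\<bar>graph_weight V (at_points w z) r\<bar> \<le> 1" if "r \<in> ?Q" for z r
      using gw[OF that, of z] that graph_weight_le_1[OF V(1), of r "at_points w z"] at_points_bounds[OF w] by auto
    have "integrable ?M (\<lambda>z. Y z * graph_weight V (at_points w z) r)" if "r \<in> ?Q" for r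
      by (rule integrable_times_bounded[OF iY measurable_graph_weight[OF S w]]) (use that gB in auto)
    then have "integrable ?M (\<lambda>z. graph_weight V (at_points w z) r * c4 z r + graph_weight V (at_points w z) r * Y z)" if "r \<in> ?Q" for r
      using ic4[of r] that by (simp add: mult.commute[of "Y _"])
    then have "(\<Sum>r\<in>?Q. \<integral>z. graph_weight V (at_points w z) r * c4 z r + graph_weight V (at_points w z) r * Y z \<partial>?M) =
       (\<integral>z. (\<Sum>r\<in>?Q. graph_weight V (at_points w z) r * c4 z r + graph_weight V (at_points w z) r * Y z) \<partial>?M)"
      by (rule Bochner_Integration.integral_sum[symmetric])
    then show ?thesis by (simp add: sum.distrib sum_graph_weight[OF V(1)] flip: sum_distrib_right)
  qed
  also have "\<dots> = (\<integral>z. (\<Sum>r\<in>?Q. graph_weight V (at_points w z) r * c4 z r) \<partial>?M) + (\<Sum>k<K. \<integral>z. dv z k \<partial>?M)"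
  proof -
    have "(\<integral>z. (\<Sum>r\<in>?Q. graph_weight V (at_points w z) r * c4 z r) + Y z \<partial>?M) =
        (\<integral>z. (\<Sum>r\<in>?Q. graph_weight V (at_points w z) r * c4 z r) \<partial>?M) + (\<integral>z. Y z \<partial>?M)"
      by (intro Bochner_Integration.integral_add Bochner_Integration.integrable_sum ic4 iY)
    moreover have "(\<integral>z. Y z \<partial>?M) = (\<Sum>k<K. \<integral>z. dv z k \<partial>?M)"
      unfolding Y_def by (rule Bochner_Integration.integral_sum) (rule iv)
    ultimately show ?thesis by simp
  qed
  \<comment> \<open>16 is the constant of \<open>C4_mean\<close>, and 48 is the constant 12 of
    \<open>sampler_variance\<close> times the square of 2 for a single edge.\<close>
  also have "\<dots> \<le> 16 / card V + (\<Sum>k<K. 48 / card V)"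
  proof (rule add_mono)
    have "(\<integral>z. (\<Sum>r\<in>?Q. graph_weight V (at_points w z) r * c4 z r) \<partial>?M) \<le> (\<integral>z. 16 / card V \<partial>?M)"
      by (rule integral_mono) 
         (use ic4 C4_mean[OF V at_points_bounds[OF w]] graphon_sym[OF w] in \<open>auto simp: c4_def\<close>)
    then show "(\<integral>z. (\<Sum>r\<in>?Q. graph_weight V (at_points w z) r * c4 z r) \<partial>?M) \<le> 16 / card V" by (simp add: P.prob_space)
    show "(\<Sum>k<K. \<integral>z. dv z k \<partial>?M) \<le> (\<Sum>k<K. 48 / card V)"
      by (rule sum_mono) (use sd(2) in \<open>simp add: dv_def\<close>)
  qed
  also have "\<dots> < \<delta>\<^sup>2 * (1 / 2)" using N by (simp add: add_divide_distrib mult.commute)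
  finally have "(\<Sum>r\<in>{r\<in>?Q. \<not> ?good r}. graph_prob V (\<lambda>_. lam) w r) < 1 / 2"
    by (rule mult_left_less_imp_less) (use \<delta> in auto)
  moreover have "(\<Sum>r\<in>{r\<in>?Q. ?good r}. graph_prob V (\<lambda>_. lam) w r) + (\<Sum>r\<in>{r\<in>?Q. \<not> ?good r}. graph_prob V (\<lambda>_. lam) w r) = 1"
    using sum_graph_prob[OF S w] fin by (subst sum.union_disjoint[symmetric]) (auto intro!: arg_cong2[where f=sum] elim: trans[rotated])
  ultimately show ?thesis by simp
qed

text \<open>By inclusion and exclusion the probability of each sample is a signed sum of densities
  on \<open>V\<close>.\<close>

lemma graph_prob_eq:
  assumes V: "finite V" and w: "graphon w" and w': "graphon w'"
    and eq: "\<And>E. edge_set V E \<Longrightarrow> dens lam V E w = dens lam V E w'" and r: "r \<subseteq> pairs V"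
  shows "graph_prob V (\<lambda>_. lam) w r = graph_prob V (\<lambda>_. lam) w' r"
proof -
  have E: "edge_set V (r \<union> (pairs V - r))" using r V unfolding Un_Diff_cancel Un_absorb1[OF r] by (auto simp: edge_set_def pairs_def)
  have *: "graph_prob V (\<lambda>_. lam) w r = (\<Sum>T\<in>Pow (pairs V - r). (-1) ^ card T * dens lam V (r \<union> T) w)" if w: "graphon w" for w
  proof -
    have "graph_prob V (\<lambda>_. lam) w r = (\<integral>x. (\<Prod>(i, j)\<in>r. w (x i, x j)) * (\<Prod>(i, j)\<in>pairs V - r. 1 - w (x i, x j)) \<partial>Pi\<^sub>M V (\<lambda>_. lam))"
      by (simp add: graph_prob_def graph_weight_def case_prod_beta')
    also have "\<dots> = (\<Sum>T\<in>Pow (pairs V - r). (-1) ^ card T * dens lam V (r \<union> T) w)"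
      by (rule lam.dens_mixed[OF E]) (use graphon_bounds[OF w] graphon_measurable[OF w] in auto)
    finally show ?thesis .
  qed
  show ?thesis unfolding *[OF w] *[OF w']
  proof (rule sum.cong[OF refl])
    fix T assume "T \<in> Pow (pairs V - r)"
    then have "edge_set V (r \<union> T)" by (intro edge_set_mono[OF E]) auto
    from eq[OF this] show "(-1) ^ card T * dens lam V (r \<union> T) w = (-1) ^ card T * dens lam V (r \<union> T) w'" by simp
  qed
qed

text \<open>Both graphons give samples with the same law, and two sets of graphs of probability
  above one half must intersect.\<close>

lemma common_well_labelled:
  assumes V: "finite V" "V \<noteq> {}" and w: "graphon w" and w': "graphon w'"
    and eq: "\<And>E. edge_set V E \<Longrightarrow> dens lam V E w = dens lam V E w'"
    and f: "\<And>k. f k \<in> borel_measurable (lam \<Otimes>\<^sub>M lam)" and f01: "\<And>k z. 0 \<le> f k z \<and> f k z \<le> 1"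
    and f': "\<And>k. f' k \<in> borel_measurable (lam \<Otimes>\<^sub>M lam)" and f01': "\<And>k z. 0 \<le> f' k z \<and> f' k z \<le> 1"
    and \<delta>: "0 < \<delta>" "\<delta> \<le> 1" and N: "(16 + 48 * real K) / card V < \<delta>\<^sup>2 / 2"
  shows "\<exists>r z z'. well_labelled V w f K \<delta> r z \<and> well_labelled V w' f' K \<delta> r z'"
proof (rule ccontr)
  assume neg: "\<not> ?thesis"
  let ?G = "{r\<in>Pow (pairs V). \<exists>z. well_labelled V w f K \<delta> r z}"
  let ?G' = "{r\<in>Pow (pairs V). \<exists>z. well_labelled V w' f' K \<delta> r z}"
  let ?P = "graph_prob V (\<lambda>_. lam) w"
  have fin: "finite (Pow (pairs V))" using finite_pairs[OF V(1)] by simp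
  have S: "sampler V (\<lambda>_. lam)" by (rule sampler_iid[OF V])
  have "(\<Sum>r\<in>?G'. ?P r) = (\<Sum>r\<in>?G'. graph_prob V (\<lambda>_. lam) w' r)"
    by (rule sum.cong) (use graph_prob_eq[OF V(1) w w' eq] in auto)
  then have "(\<Sum>r\<in>?G. ?P r) + (\<Sum>r\<in>?G'. ?P r) > 1"
    using prob_well_labelled[where f=f, OF V w f f01 \<delta> N] prob_well_labelled[where f=f', OF V w' f' f01' \<delta> N] by simp
  also have "(\<Sum>r\<in>?G. ?P r) + (\<Sum>r\<in>?G'. ?P r) = (\<Sum>r\<in>?G \<union> ?G'. ?P r)"
    by (rule sum.union_disjoint[symmetric]) (use fin neg in auto)
  also have "\<dots> \<le> (\<Sum>r\<in>Pow (pairs V). ?P r)"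
    by (rule sum_mono2[OF fin]) (use graph_prob_nonneg[OF S w] in auto)
  finally show False using sum_graph_prob[OF S w] by simp
qed

section \<open>Continuous approximation on the unit square\<close>

lemma sets_lam_borel: "A \<in> sets lam \<Longrightarrow> A \<in> sets borel"
  by (auto simp: lam_def sets_restrict_space)

lemma lam2_eq: "lam \<Otimes>\<^sub>M lam = restrict_space lborel ({0..1} \<times> {0..1})"
proof (rule pair_measure_eqI)
  show "sigma_finite_measure lam" "sigma_finite_measure lam" by unfold_locales
  have sq: "{0..1} \<times> {0..1} \<in> sets (borel :: (real \<times> real) measure)" by (intro borel_closed closed_Times) auto
  show "sets (lam \<Otimes>\<^sub>M lam) = sets (restrict_space lborel ({0..1} \<times> {0..1}))"
  proof (rule antisym)
    show "sets (lam \<Otimes>\<^sub>M lam) \<subseteq> sets (restrict_space lborel ({0..1} \<times> {0..1}))"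
      unfolding sets_pair_measure
    proof (rule sets.sigma_sets_subset')
      show "{a \<times> b |a b. a \<in> sets lam \<and> b \<in> sets lam} \<subseteq> sets (restrict_space lborel ({0..1} \<times> {0..1}))"
      proof clarify
        fix a b assume ab: "a \<in> sets lam" "b \<in> sets lam"
        have "a \<times> b \<in> sets (borel \<Otimes>\<^sub>M borel)" using ab by (intro pair_measureI sets_lam_borel)
        then have "a \<times> b \<in> sets borel" unfolding borel_prod .
        moreover have "a \<times> b \<subseteq> {0..1} \<times> {0..1}" using ab[THEN sets.sets_into_space] by auto
        ultimately show "a \<times> b \<in> sets (restrict_space lborel ({0..1} \<times> {0..1}))"
          using sq by (subst sets_restrict_space_iff) auto
      qed
      show "space lam \<times> space lam \<in> sets (restrict_space lborel ({0..1} \<times> {0..1}))"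
        using sq by (subst sets_restrict_space_iff) auto
    qed
    show "sets (restrict_space lborel ({0..1} \<times> {0..1})) \<subseteq> sets (lam \<Otimes>\<^sub>M lam)"
    proof
      fix C :: "(real \<times> real) set" assume C: "C \<in> sets (restrict_space lborel ({0..1} \<times> {0..1}))"
      then have C0: "C \<in> sets borel" "C \<subseteq> {0..1} \<times> {0..1}" using sq by (auto simp: sets_restrict_space_iff)
      have C': "C \<in> sets (borel \<Otimes>\<^sub>M borel)" "C \<subseteq> {0..1} \<times> {0..1}" unfolding borel_prod by (rule C0)+
      have "(\<lambda>z. (fst z, snd z)) \<in> measurable (lam \<Otimes>\<^sub>M lam) (borel \<Otimes>\<^sub>M borel)" by measurable
      from measurable_sets[OF this C'(1)] have "C \<inter> space (lam \<Otimes>\<^sub>M lam) \<in> sets (lam \<Otimes>\<^sub>M lam)" by simp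
      also have "C \<inter> space (lam \<Otimes>\<^sub>M lam) = C" using C'(2) by (auto simp: space_pair_measure)
      finally show "C \<in> sets (lam \<Otimes>\<^sub>M lam)" .
    qed
  qed
  fix A B assume AB: "A \<in> sets lam" "B \<in> sets lam"
  have sub: "A \<subseteq> {0..1}" "B \<subseteq> {0..1}" using AB[THEN sets.sets_into_space] by auto
  have "emeasure (restrict_space lborel ({0..1} \<times> {0..1})) (A \<times> B) = emeasure (lborel \<Otimes>\<^sub>M lborel) (A \<times> B)"
    using sub sq by (subst emeasure_restrict_space) (auto simp: lborel_prod)
  also have "\<dots> = emeasure lborel A * emeasure lborel B"
    using sets_lam_borel[OF AB(1)] sets_lam_borel[OF AB(2)] by (intro lborel.emeasure_pair_measure_Times) auto
  finally show "emeasure lam A * emeasure lam B = emeasure (restrict_space lborel ({0..1} \<times> {0..1})) (A \<times> B)"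
    using sets_lam_borel[OF AB(1)] sets_lam_borel[OF AB(2)] sub by (simp add: emeasure_lam)
qed

lemma lam2_integrable_bdd:
  fixes f :: "real \<times> real \<Rightarrow> real"
  assumes "f \<in> borel_measurable (lam \<Otimes>\<^sub>M lam)" "\<And>z. \<bar>f z\<bar> \<le> B"
  shows "integrable (lam \<Otimes>\<^sub>M lam) f"
  by (rule lam.pair_integrable_bdd[where B=B]) (use assms in auto)

lemma continuous_measurable_lam2:
  fixes g :: "real \<times> real \<Rightarrow> real"
  shows "continuous_on UNIV g \<Longrightarrow> g \<in> borel_measurable (lam \<Otimes>\<^sub>M lam)"
  unfolding lam2_eq by (rule measurable_restrict_space1) (simp add: borel_measurable_continuous_onI)

text \<open>A Lebesgue measurable function is a limit of continuous ones outside a negligible set;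
  after truncation dominated convergence gives convergence in mean. Continuity is what allows limits
  of labels to be inserted into a function.\<close>

lemma graphon_continuous_approx:
  assumes w: "graphon w"
  shows "\<exists>g :: nat \<Rightarrow> real \<times> real \<Rightarrow> real. (\<forall>m. continuous_on UNIV (g m)) \<and> (\<forall>m z. 0 \<le> g m z \<and> g m z \<le> 1) \<and>
    (\<lambda>m. \<integral>z. \<bar>w z - g m z\<bar> \<partial>(lam \<Otimes>\<^sub>M lam)) \<longlonglongrightarrow> 0"
proof -
  let ?S = "{0..1} \<times> {0..1} :: (real \<times> real) set"
  have S: "?S \<in> sets borel" by (intro borel_closed closed_Times) auto
  have mw[measurable]: "w \<in> borel_measurable (lam \<Otimes>\<^sub>M lam)" by (rule graphon_measurable[OF w])
  have "(\<lambda>z. indicator ?S z *\<^sub>R w z) \<in> borel_measurable lborel"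
    using mw unfolding lam2_eq by (subst (asm) borel_measurable_restrict_space_iff) (use S in auto)
  then have "(\<lambda>z. indicator ?S z *\<^sub>R w z) \<in> borel_measurable lebesgue" by (rule measurable_completion)
  then have "(\<lambda>z. indicator ?S z *\<^sub>R w z) measurable_on UNIV"
    by (rule lebesgue_measurable_imp_measurable_on_real) simp
  then obtain N h where N: "negligible N" and h: "\<And>n. continuous_on UNIV (h n)"
    and lim: "\<And>x. x \<notin> N \<Longrightarrow> (\<lambda>n. h n x) \<longlonglongrightarrow> indicator ?S x *\<^sub>R w x"
    unfolding measurable_on_def by auto
  define g where "g n z = max 0 (min 1 (h n z))" for n z
  have g: "continuous_on UNIV (g n)" for n unfolding g_def[abs_def] by (intro continuous_intros h)
  have g01: "0 \<le> g n z \<and> g n z \<le> 1" for n z by (simp add: g_def)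
  have [measurable]: "g n \<in> borel_measurable (lam \<Otimes>\<^sub>M lam)" for n by (rule continuous_measurable_lam2[OF g])
  have "AE z in lebesgue. z \<notin> N" using N by (auto simp: negligible_iff_null_sets intro: AE_not_in)
  then have "AE z in lborel. z \<notin> N" by (simp add: AE_completion_iff)
  then have "AE z in lam \<Otimes>\<^sub>M lam. z \<notin> N"
    unfolding lam2_eq using S by (subst AE_restrict_space_iff) auto
  then have ae: "AE z in lam \<Otimes>\<^sub>M lam. (\<lambda>n. \<bar>w z - g n z\<bar>) \<longlonglongrightarrow> 0" using AE_space
  proof eventually_elim
    case (elim z)
    then have "(\<lambda>n. h n z) \<longlonglongrightarrow> w z" using lim[of z] by (auto simp: space_pair_measure)
    then have "(\<lambda>n. g n z) \<longlonglongrightarrow> max 0 (min 1 (w z))" unfolding g_def by (intro tendsto_intros)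
    moreover have "max 0 (min 1 (w z)) = w z" using graphon_bounds[OF w, of z] by auto
    ultimately have "(\<lambda>n. g n z) \<longlonglongrightarrow> w z" by (simp only:)
    from tendsto_rabs[OF tendsto_diff[OF tendsto_const[of "w z"] this]] show ?case by simp
  qed
  have "(\<lambda>n. \<integral>z. \<bar>w z - g n z\<bar> \<partial>(lam \<Otimes>\<^sub>M lam)) \<longlonglongrightarrow> (\<integral>z. 0 \<partial>(lam \<Otimes>\<^sub>M lam))"
  proof (rule integral_dominated_convergence[where w="\<lambda>_. 1"])
    show "AE z in lam \<Otimes>\<^sub>M lam. norm \<bar>w z - g n z\<bar> \<le> 1" for n
    proof (rule AE_I2)
      fix z show "norm \<bar>w z - g n z\<bar> \<le> 1" using graphon_bounds[OF w, of z] g01[of n z] by auto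
    qed
  qed (use ae in auto)
  then show ?thesis using g g01 by auto
qed

lemma dens_single_edge:
  assumes "prob_space M" and a: "a \<in> borel_measurable (M \<Otimes>\<^sub>M M)"
  shows "dens M {0, 1 :: nat} {(0, 1)} a = (\<integral>z. a z \<partial>(M \<Otimes>\<^sub>M M))"
proof -
  interpret prob_space M by fact
  have d: "distr (Pi\<^sub>M {0, 1 :: nat} (\<lambda>_. M)) (M \<Otimes>\<^sub>M M) (\<lambda>x. (x 0, x 1)) = M \<Otimes>\<^sub>M M" by (rule distr_PiM_pair) auto
  have m: "(\<lambda>x. (x 0, x 1)) \<in> measurable (Pi\<^sub>M {0, 1 :: nat} (\<lambda>_. M)) (M \<Otimes>\<^sub>M M)"
    by (intro measurable_Pair measurable_component_singleton) auto
  show ?thesis using integral_distr[OF m a] unfolding d by (simp add: dens_def)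
qed

lemma dens_labels:
  assumes \<theta>: "uniformly_onto \<theta> V" and V: "finite V"
  shows "dens (uniform_count_measure V) {0, 1 :: nat} {(0, 1)} a = (\<integral>z. a (\<theta> (fst z), \<theta> (snd z)) \<partial>(lam \<Otimes>\<^sub>M lam))"
proof -
  have E: "edge_set {0, 1 :: nat} {(0, 1)}" by (simp add: edge_set_def)
  have "dens (uniform_count_measure V) {0, 1 :: nat} {(0, 1)} a = dens lam {0, 1 :: nat} {(0, 1)} (\<lambda>(x, y). a (\<theta> x, \<theta> y))"
    by (rule dens_distr[OF prob_space_lam _ _ E, symmetric])
       (use \<theta> V in \<open>auto simp: uniformly_onto_def intro: measurable_uniform_count_pair\<close>)
  also have "\<dots> = (\<integral>z. a (\<theta> (fst z), \<theta> (snd z)) \<partial>(lam \<Otimes>\<^sub>M lam))"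
    using dens_single_edge[OF prob_space_lam uniformly_onto_measurable2[OF \<theta> V, of a]] by (simp add: case_prod_beta')
  finally show ?thesis .
qed

section \<open>Limits of labellings\<close>

text \<open>Countably many continuous tests that determine a law on the line: as \<open>m\<close>
  grows they decrease to the indicator of the half-line up to \<open>q\<close>.\<close>

definition ramp :: "rat \<Rightarrow> nat \<Rightarrow> real \<Rightarrow> real" where
  "ramp q m x = max 0 (min 1 (real m * (of_rat q - x) + 1))"

lemma continuous_ramp: "continuous_on UNIV (ramp q m)"
  unfolding ramp_def[abs_def] by (intro continuous_intros)

lemma ramp_bounds: "0 \<le> ramp q m x \<and> ramp q m x \<le> 1"
  by (simp add: ramp_def)

lemma ramp_tendsto: "(\<lambda>m. ramp q m x) \<longlonglongrightarrow> indicator {..of_rat q} x"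
proof (cases "x \<le> of_rat q")
  case True
  then have "ramp q m x = 1" for m by (simp add: ramp_def min_def max_def)
  then show ?thesis using True by simp
next
  case False
  then have d: "0 < x - of_rat q" by simp
  have "\<forall>\<^sub>F m in sequentially. ramp q m x = 0"
  proof (rule eventually_sequentiallyI)
    fix m assume m: "nat \<lceil>1 / (x - of_rat q)\<rceil> \<le> m"
    then have "1 / (x - of_rat q) \<le> real m" by linarith
    then have "1 \<le> real m * (x - of_rat q)" using d by (simp add: pos_divide_le_eq)
    then show "ramp q m x = 0" unfolding ramp_def by (simp add: algebra_simps)
  qed
  then show ?thesis using False by (simp add: tendsto_eventually)
qed

text \<open>The tests determine the distribution function at rational points, right continuity
  extends this to all points, and the distribution function determines the law.\<close>

lemma law_eq_lam:
  assumes \<psi>: "\<psi> \<in> measurable lam lam"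
    and eq: "\<And>q m. (\<integral>x. ramp q m (\<psi> x) \<partial>lam) = (\<integral>x. ramp q m x \<partial>lam)"
  shows "distr lam lam \<psi> = lam"
proof -
  have m\<psi>[measurable]: "\<psi> \<in> borel_measurable lam"
    using measurable_compose[OF \<psi> id_measurable_lam] by simp
  have ramp[measurable]: "ramp q m \<in> borel_measurable borel" for q m by (rule borel_measurable_continuous_onI[OF continuous_ramp])
  have cdf_lim: "(\<lambda>m. \<integral>x. ramp q m (\<phi> x) \<partial>lam) \<longlonglongrightarrow> measure (distr lam borel \<phi>) {..of_rat q}"
    if [measurable]: "\<phi> \<in> borel_measurable lam" for q and \<phi> :: "real \<Rightarrow> real"
  proof -
    have "(\<lambda>m. \<integral>x. ramp q m (\<phi> x) \<partial>lam) \<longlonglongrightarrow> (\<integral>x. indicator {..of_rat q} (\<phi> x) \<partial>lam)"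
      by (rule integral_dominated_convergence[where w="\<lambda>_. 1"]) (use ramp_tendsto ramp_bounds in auto)
    also have "(\<integral>x. indicator {..of_rat q} (\<phi> x) \<partial>lam) = (\<integral>x. (indicator {..of_rat q} x :: real) \<partial>distr lam borel \<phi>)"
      by (rule integral_distr[symmetric]) auto
    finally show ?thesis by simp
  qed
  have rat: "measure (distr lam borel \<psi>) {..of_rat q} = measure (distr lam borel (\<lambda>x. x)) {..of_rat q}" for q
    using LIMSEQ_unique[OF cdf_lim[OF m\<psi>, of q, unfolded eq] cdf_lim[OF id_measurable_lam, of q]] .
  interpret d1: real_distribution "distr lam borel \<psi>" by (rule lam.real_distribution_distr) simp
  interpret d2: real_distribution "distr lam borel (\<lambda>x. x)" by (rule lam.real_distribution_distr) simp
  have "cdf (distr lam borel \<psi>) a = cdf (distr lam borel (\<lambda>x. x)) a" for a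
  proof -
    have "\<exists>q. a < of_rat q \<and> of_rat q < a + 1 / real (Suc n)" for n
      using of_rat_dense[of a "a + 1 / real (Suc n)"] by simp
    then have "\<forall>n. \<exists>q. a < of_rat q \<and> of_rat q < a + 1 / real (Suc n)" by blast
    from choice[OF this] obtain q where q: "\<And>n. a < of_rat (q n) \<and> of_rat (q n) < a + 1 / real (Suc n)" by blast
    have "(\<lambda>n. a + 1 / real (Suc n)) \<longlonglongrightarrow> a + 0"
      by (intro tendsto_intros LIMSEQ_inverse_real_of_nat[unfolded inverse_eq_divide])
    then have "(\<lambda>n. of_rat (q n)) \<longlonglongrightarrow> a"
      unfolding add_0_right
      by (rule tendsto_sandwich[OF _ _ tendsto_const, rotated 2]) (use q in \<open>auto intro!: always_eventually less_imp_le simp del: of_nat_Suc\<close>)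
    then have fl: "filterlim (\<lambda>n. of_rat (q n)) (at_right a) sequentially"
    proof -
      have "a < of_rat (q n)" "of_rat (q n) \<noteq> a" for n using q[of n] by auto
      then show ?thesis using \<open>(\<lambda>n. of_rat (q n)) \<longlonglongrightarrow> a\<close> unfolding filterlim_at by simp
    qed
    have "(\<lambda>n. cdf (distr lam borel \<psi>) (of_rat (q n))) \<longlonglongrightarrow> cdf (distr lam borel \<psi>) a"
      by (rule filterlim_compose[OF _ fl]) (use d1.cdf_is_right_cont[of a] in \<open>simp add: continuous_within\<close>)
    moreover have "(\<lambda>n. cdf (distr lam borel (\<lambda>x. x)) (of_rat (q n))) \<longlonglongrightarrow> cdf (distr lam borel (\<lambda>x. x)) a"
      by (rule filterlim_compose[OF _ fl]) (use d2.cdf_is_right_cont[of a] in \<open>simp add: continuous_within\<close>)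
    ultimately show ?thesis unfolding cdf_def rat by (rule LIMSEQ_unique)
  qed
  then have deq: "distr lam borel \<psi> = distr lam borel (\<lambda>x. x)"
    by (intro cdf_unique) (auto simp: d1.real_distribution_axioms d2.real_distribution_axioms)
  show ?thesis
  proof (rule measure_eqI)
    fix A assume "A \<in> sets (distr lam lam \<psi>)"
    then have A: "A \<in> sets lam" by simp
    then have A': "A \<in> sets borel" "A \<subseteq> {0..1}" using sets_lam_borel[OF A] sets.sets_into_space[OF A] by auto
    have "emeasure (distr lam lam \<psi>) A = emeasure lam (\<psi> -` A \<inter> space lam)" by (rule emeasure_distr[OF \<psi> A])
    also have "\<dots> = emeasure (distr lam borel \<psi>) A" using A' by (simp add: emeasure_distr)
    also have "\<dots> = emeasure lam (A \<inter> space lam)" unfolding deq using A' by (simp add: emeasure_distr)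
    also have "A \<inter> space lam = A" using A' by auto
    finally show "emeasure (distr lam lam \<psi>) A = emeasure lam A" .
  qed simp
qed

lemma measure_preserving_integral2:
  assumes \<psi>: "\<psi> \<in> measurable lam lam" and d: "distr lam lam \<psi> = lam" and a: "a \<in> borel_measurable (lam \<Otimes>\<^sub>M lam)"
  shows "(\<integral>z. a (\<psi> (fst z), \<psi> (snd z)) \<partial>(lam \<Otimes>\<^sub>M lam)) = (\<integral>z. (a z :: real) \<partial>(lam \<Otimes>\<^sub>M lam))"
proof -
  have E: "edge_set {0, 1 :: nat} {(0, 1)}" by (simp add: edge_set_def)
  have m: "(\<lambda>z. a (\<psi> (fst z), \<psi> (snd z))) \<in> borel_measurable (lam \<Otimes>\<^sub>M lam)"
    using \<psi> a by measurable
  from dens_distr[OF prob_space_lam \<psi> d E a] show ?thesis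
    unfolding dens_single_edge[OF prob_space_lam a] using dens_single_edge[OF prob_space_lam m]
    by (simp add: case_prod_beta')
qed

text \<open>As \<open>w\<close> is not continuous, convergence of labels says nothing about
  \<open>w\<close> directly. It is replaced by \<open>g m\<close>: the error of the replacement is
  controlled along the labels by \<open>T1\<close>, and in the limit because \<open>\<psi>\<close>
  preserves \<open>lam\<close> by \<open>T2\<close>.\<close>

lemma label_limit:
  assumes w: "graphon w" and g: "\<And>m. continuous_on UNIV (g m)" and g01: "\<And>m z. 0 \<le> g m z \<and> g m z \<le> 1"
    and appr: "(\<lambda>m. \<integral>z. \<bar>w z - g m z\<bar> \<partial>(lam \<Otimes>\<^sub>M lam)) \<longlonglongrightarrow> 0"
    and \<psi>n[measurable]: "\<And>n. \<psi>n n \<in> measurable lam lam" and \<psi>[measurable]: "\<psi> \<in> measurable lam lam"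
    and conv: "AE x in lam. (\<lambda>n. \<psi>n n x) \<longlonglongrightarrow> \<psi> x"
    and T1: "\<And>m. (\<lambda>n. \<integral>z. \<bar>w (\<psi>n n (fst z), \<psi>n n (snd z)) - g m (\<psi>n n (fst z), \<psi>n n (snd z))\<bar> \<partial>(lam \<Otimes>\<^sub>M lam))
       \<longlonglongrightarrow> (\<integral>z. \<bar>w z - g m z\<bar> \<partial>(lam \<Otimes>\<^sub>M lam))"
    and T2: "\<And>q m. (\<lambda>n. \<integral>x. ramp q m (\<psi>n n x) \<partial>lam) \<longlonglongrightarrow> (\<integral>x. ramp q m x \<partial>lam)"
  shows "distr lam lam \<psi> = lam"
    and "(\<lambda>n. \<integral>z. \<bar>w (\<psi>n n (fst z), \<psi>n n (snd z)) - w (\<psi> (fst z), \<psi> (snd z))\<bar> \<partial>(lam \<Otimes>\<^sub>M lam)) \<longlonglongrightarrow> 0"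
proof -
  have [measurable]: "w \<in> borel_measurable (lam \<Otimes>\<^sub>M lam)" "g m \<in> borel_measurable (lam \<Otimes>\<^sub>M lam)" for m
    by (rule graphon_measurable[OF w], rule continuous_measurable_lam2[OF g])
  have [measurable]: "\<psi> \<in> borel_measurable lam" "\<psi>n n \<in> borel_measurable lam" for n
    using measurable_compose[OF _ id_measurable_lam] \<psi> \<psi>n by auto
  have [measurable]: "ramp q m \<in> borel_measurable borel" for q m by (rule borel_measurable_continuous_onI[OF continuous_ramp])
  show d: "distr lam lam \<psi> = lam"
  proof (rule law_eq_lam[OF \<psi>])
    fix q m
    have "(\<lambda>n. \<integral>x. ramp q m (\<psi>n n x) \<partial>lam) \<longlonglongrightarrow> (\<integral>x. ramp q m (\<psi> x) \<partial>lam)"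
    proof (rule integral_dominated_convergence[where w="\<lambda>_. 1"])
      from conv show "AE x in lam. (\<lambda>n. ramp q m (\<psi>n n x)) \<longlonglongrightarrow> ramp q m (\<psi> x)"
      proof eventually_elim
        case (elim x)
        have "isCont (ramp q m) (\<psi> x)" using continuous_ramp[of q m] by (simp add: continuous_on_eq_continuous_at)
        from isCont_tendsto_compose[OF this elim] show ?case .
      qed
    qed (use ramp_bounds in auto)
    from LIMSEQ_unique[OF this T2] show "(\<integral>x. ramp q m (\<psi> x) \<partial>lam) = (\<integral>x. ramp q m x \<partial>lam)" .
  qed
  define wn where "wn n z = w (\<psi>n n (fst z), \<psi>n n (snd z))" for n z
  define gn where "gn n m z = g m (\<psi>n n (fst z), \<psi>n n (snd z))" for n m z
  define wl where "wl z = w (\<psi> (fst z), \<psi> (snd z))" for z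
  define gl where "gl m z = g m (\<psi> (fst z), \<psi> (snd z))" for m z
  have [measurable]: "wn n \<in> borel_measurable (lam \<Otimes>\<^sub>M lam)" "gn n m \<in> borel_measurable (lam \<Otimes>\<^sub>M lam)"
    "wl \<in> borel_measurable (lam \<Otimes>\<^sub>M lam)" "gl m \<in> borel_measurable (lam \<Otimes>\<^sub>M lam)" for n m
    unfolding wn_def[abs_def] gn_def[abs_def] wl_def[abs_def] gl_def[abs_def] by measurable
  have b: "0 \<le> wn n z \<and> wn n z \<le> 1" "0 \<le> gn n m z \<and> gn n m z \<le> 1" "0 \<le> wl z \<and> wl z \<le> 1" "0 \<le> gl m z \<and> gl m z \<le> 1" for n m z
    using graphon_bounds[OF w] g01 by (auto simp: wn_def gn_def wl_def gl_def)
  have d01: "\<bar>\<bar>a - b\<bar>\<bar> \<le> (1 :: real)" if "0 \<le> a \<and> a \<le> 1" "0 \<le> b \<and> b \<le> 1" for a b using that by auto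
  have ib: "integrable (lam \<Otimes>\<^sub>M lam) (\<lambda>z. \<bar>a z - c z\<bar>)"
    if "a \<in> borel_measurable (lam \<Otimes>\<^sub>M lam)" "c \<in> borel_measurable (lam \<Otimes>\<^sub>M lam)"
      "\<And>z. 0 \<le> a z \<and> a z \<le> 1" "\<And>z. 0 \<le> c z \<and> c z \<le> 1" for a c :: "real \<times> real \<Rightarrow> real"
    by (rule lam2_integrable_bdd[where B=1], use that(1,2) in measurable, rule d01[OF that(3,4)])
  have int: "integrable (lam \<Otimes>\<^sub>M lam) (\<lambda>z. \<bar>wn n z - gn n m z\<bar>)" "integrable (lam \<Otimes>\<^sub>M lam) (\<lambda>z. \<bar>gn n m z - gl m z\<bar>)"
    "integrable (lam \<Otimes>\<^sub>M lam) (\<lambda>z. \<bar>wl z - gl m z\<bar>)" "integrable (lam \<Otimes>\<^sub>M lam) (\<lambda>z. \<bar>wn n z - wl z\<bar>)" for n m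
    by (rule ib[OF _ _ b(1) b(2)], measurable) (rule ib[OF _ _ b(2) b(4)], measurable, rule ib[OF _ _ b(3) b(4)], measurable, rule ib[OF _ _ b(1) b(3)], measurable)
  have G: "(\<lambda>n. \<integral>z. \<bar>gn n m z - gl m z\<bar> \<partial>(lam \<Otimes>\<^sub>M lam)) \<longlonglongrightarrow> (\<integral>z. 0 \<partial>(lam \<Otimes>\<^sub>M lam))" for m
  proof (rule integral_dominated_convergence[where w="\<lambda>_. 1"])
    from AE_lam2_both[OF conv] show "AE z in lam \<Otimes>\<^sub>M lam. (\<lambda>n. \<bar>gn n m z - gl m z\<bar>) \<longlonglongrightarrow> 0"
    proof eventually_elim
      case (elim z)
      have c: "isCont (g m) (\<psi> (fst z), \<psi> (snd z))" using g[of m] by (simp add: continuous_on_eq_continuous_at)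
      have "(\<lambda>n. gn n m z) \<longlonglongrightarrow> gl m z" unfolding gn_def gl_def
        by (rule isCont_tendsto_compose[OF c]) (intro tendsto_Pair; use elim in simp)
      from tendsto_rabs[OF tendsto_diff[OF this tendsto_const[of "gl m z"]]] show ?case by simp
    qed
    show "AE z in lam \<Otimes>\<^sub>M lam. norm \<bar>gn n m z - gl m z\<bar> \<le> 1" for n
      by (rule AE_I2) (use b d01 in auto)
  qed auto
  have L: "(\<integral>z. \<bar>wl z - gl m z\<bar> \<partial>(lam \<Otimes>\<^sub>M lam)) = (\<integral>z. \<bar>w z - g m z\<bar> \<partial>(lam \<Otimes>\<^sub>M lam))" for m
    unfolding wl_def gl_def by (rule measure_preserving_integral2[OF \<psi> d, of "\<lambda>z. \<bar>w z - g m z\<bar>"]) measurable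
  let ?a = "\<lambda>n. \<integral>z. \<bar>wn n z - wl z\<bar> \<partial>(lam \<Otimes>\<^sub>M lam)" and ?e = "\<lambda>m. \<integral>z. \<bar>w z - g m z\<bar> \<partial>(lam \<Otimes>\<^sub>M lam)"
  \<comment> \<open>The triangle inequality through \<open>g m\<close> at the approximate and at the
    limit labels; by \<open>L\<close> the last term does not depend on
    \<open>\<psi>\<close>.\<close>
  have bound: "?a n \<le> (\<integral>z. \<bar>wn n z - gn n m z\<bar> \<partial>(lam \<Otimes>\<^sub>M lam)) + (\<integral>z. \<bar>gn n m z - gl m z\<bar> \<partial>(lam \<Otimes>\<^sub>M lam)) + ?e m" for n m
  proof -
    have "?a n \<le> (\<integral>z. \<bar>wn n z - gn n m z\<bar> + \<bar>gn n m z - gl m z\<bar> + \<bar>wl z - gl m z\<bar> \<partial>(lam \<Otimes>\<^sub>M lam))"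
      by (rule integral_mono) (use int in auto)
    then show ?thesis using int by (simp add: L)
  qed
  have "?a \<longlonglongrightarrow> 0"
  proof (rule LIMSEQ_I)
    fix e :: real assume e: "0 < e"
    then have "\<forall>\<^sub>F m in sequentially. ?e m < e / 4" using appr by (intro order_tendstoD) auto
    \<comment> \<open>The approximation error enters twice, once along the labels and once in the
      limit. Together with two further quarters this stays below \<open>e\<close>.\<close>
    then obtain m where m: "?e m < e / 4" by (auto simp: eventually_sequentially)
    have "\<forall>\<^sub>F n in sequentially. (\<integral>z. \<bar>wn n z - gn n m z\<bar> \<partial>(lam \<Otimes>\<^sub>M lam)) < ?e m + e / 4"
      by (rule order_tendstoD(2)[OF T1[of m, folded wn_def gn_def]]) (use e in simp)
    moreover have "\<forall>\<^sub>F n in sequentially. (\<integral>z. \<bar>gn n m z - gl m z\<bar> \<partial>(lam \<Otimes>\<^sub>M lam)) < e / 4"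
      by (rule order_tendstoD(2)[OF G[of m]]) (use e in simp)
    ultimately have "\<forall>\<^sub>F n in sequentially. norm (?a n - 0) < e"
    proof eventually_elim
      case (elim n)
      have "0 \<le> ?a n" by (rule integral_nonneg_AE) auto
      with elim bound[of n m] m show ?case by simp
    qed
    then show "\<exists>no. \<forall>n\<ge>no. norm (?a n - 0) < e" by (simp add: eventually_sequentially)
  qed
  then show "(\<lambda>n. \<integral>z. \<bar>w (\<psi>n n (fst z), \<psi>n n (snd z)) - w (\<psi> (fst z), \<psi> (snd z))\<bar> \<partial>(lam \<Otimes>\<^sub>M lam)) \<longlonglongrightarrow> 0"
    by (simp add: wn_def wl_def)
qed

subsection \<open>Weakly isomorphic graphons\<close>

text \<open>The greedy expansion; the number 1 receives the digit 1 throughout.\<close>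

lemma ex_binary_expansion:
  assumes "0 \<le> x" "x \<le> (1 :: real)"
  shows "\<exists>b :: nat \<Rightarrow> bool. \<forall>J. (\<Sum>j<J. of_bool (b j) / 2 ^ Suc j) \<le> x \<and> x \<le> (\<Sum>j<J. of_bool (b j) / 2 ^ Suc j) + 1 / 2 ^ J"
proof -
  define S where "S = rec_nat (0 :: real) (\<lambda>j s. if s + 1 / 2 ^ Suc j \<le> x then s + 1 / 2 ^ Suc j else s)"
  define b where "b j \<longleftrightarrow> S j + 1 / 2 ^ Suc j \<le> x" for j
  have S0: "S 0 = 0" and SS: "S (Suc j) = S j + of_bool (b j) / 2 ^ Suc j" for j
    by (simp_all add: S_def b_def)
  have S: "S J = (\<Sum>j<J. of_bool (b j) / 2 ^ Suc j)" for J by (induction J) (simp_all add: S0 SS)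
  have "S J \<le> x \<and> x \<le> S J + 1 / 2 ^ J" for J
  proof (induction J)
    case 0
    then show ?case using assms S0 by simp
  next
    case (Suc J)
    have h: "1 / 2 ^ J = 2 * (1 / 2 ^ Suc J :: real)" by simp
    show ?case
    proof (cases "b J")
      case True
      then show ?thesis using Suc h by (simp add: SS b_def del: power_Suc)
    next
      case False
      then show ?thesis using Suc h by (simp add: SS b_def not_le del: power_Suc)
    qed
  qed
  then show ?thesis unfolding S by blast
qed

definition binary_digits :: "real \<Rightarrow> nat \<Rightarrow> bool" where
  "binary_digits x = (SOME b. \<forall>J. (\<Sum>j<J. of_bool (b j) / 2 ^ Suc j) \<le> x \<and> x \<le> (\<Sum>j<J. of_bool (b j) / 2 ^ Suc j) + 1 / 2 ^ J)"

lemma binary_digits: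
  assumes "x \<in> {0..1}"
  shows "(\<Sum>j<J. of_bool (binary_digits x j) / 2 ^ Suc j) \<le> x" "x \<le> (\<Sum>j<J. of_bool (binary_digits x j) / 2 ^ Suc j) + 1 / 2 ^ J"
  using someI_ex[OF ex_binary_expansion[of x]] assms unfolding binary_digits_def by auto

text \<open>Once the first \<open>J\<close> digits are constant, all later terms lie in a common
  interval of length \<open>1 / 2 ^ J\<close>.\<close>

lemma convergent_of_digits:
  assumes x: "\<And>n. x n \<in> {0..1}" and ev: "\<And>j. \<exists>l. \<forall>\<^sub>F n in sequentially. binary_digits (x n) j = l"
  shows "convergent x"
proof (rule Cauchy_convergent, rule metric_CauchyI)
  fix e :: real assume "0 < e"
  then obtain J where J: "(1 / 2) ^ J < e" using real_arch_pow_inv[of e "1 / 2"] by auto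
  have "\<forall>j. \<exists>l. \<forall>\<^sub>F n in sequentially. binary_digits (x n) j = l" using ev by blast
  from choice[OF this] obtain l where "\<And>j. \<forall>\<^sub>F n in sequentially. binary_digits (x n) j = l j" by blast
  then have "\<forall>\<^sub>F n in sequentially. \<forall>j\<in>{..<J}. binary_digits (x n) j = l j" by (intro eventually_ball_finite) auto
  then obtain M where M: "\<And>n j. M \<le> n \<Longrightarrow> j < J \<Longrightarrow> binary_digits (x n) j = l j" by (auto simp: eventually_sequentially)
  let ?s = "\<Sum>j<J. of_bool (l j) / 2 ^ Suc j :: real"
  have bnd: "?s \<le> x n \<and> x n \<le> ?s + 1 / 2 ^ J" if "M \<le> n" for n
  proof -
    have "(\<Sum>j<J. of_bool (binary_digits (x n) j) / 2 ^ Suc j) = ?s" by (rule sum.cong) (use M[OF that] in auto)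
    with binary_digits[OF x[of n], of J] show ?thesis by simp
  qed
  have "dist (x m) (x n) < e" if "M \<le> m" "M \<le> n" for m n
    using bnd[OF that(1)] bnd[OF that(2)] J by (simp only: dist_real_def power_one_over) linarith
  then show "\<exists>M. \<forall>m\<ge>M. \<forall>n\<ge>M. dist (x m) (x n) < e" by blast
qed

text \<open>The binary digits of both labels serve as bits in \<open>bits_converge\<close>, so one
  arrangement of the vertices makes both labellings converge.\<close>

lemma labels_converge:
  fixes V :: "nat \<Rightarrow> 'a set" and y :: "bool \<Rightarrow> nat \<Rightarrow> 'a \<Rightarrow> real"
  assumes V: "\<And>n. finite (V n)" "\<And>n. V n \<noteq> {}" and y: "\<And>i n v. v \<in> V n \<Longrightarrow> y i n v \<in> {0..1}"
  shows "\<exists>s \<theta> \<psi>. strict_mono (s :: nat \<Rightarrow> nat) \<and> (\<forall>n. uniformly_onto (\<theta> n) (V (s n))) \<and>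
    (\<forall>i. \<psi> i \<in> measurable lam lam) \<and> (\<forall>i. AE x in lam. (\<lambda>n. y i (s n) (\<theta> n x)) \<longlonglongrightarrow> \<psi> i x)"
proof -
  define b where "b n v k = (case (from_nat k :: bool \<times> nat) of (i, j) \<Rightarrow> binary_digits (y i n v) j)" for n v k
  from bits_converge[where V=V and b=b, OF V] obtain s \<theta> where s: "strict_mono (s :: nat \<Rightarrow> nat)"
    and \<theta>: "\<And>n. uniformly_onto (\<theta> n) (V (s n))"
    and ae: "AE x in lam. \<forall>j. \<exists>l. \<forall>\<^sub>F n in sequentially. b (s n) (\<theta> n x) j = l"
    unfolding uniformly_onto_def by blast
  have \<theta>V: "\<theta> n x \<in> V (s n)" if "x \<in> {0..1}" for n x using uniformly_onto_in[OF \<theta> that] .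
  have my[measurable]: "(\<lambda>x. y i (s n) (\<theta> n x)) \<in> borel_measurable lam" for i n
  proof (rule measurable_compose[where f="\<theta> n" and g="y i (s n)"])
    show "\<theta> n \<in> measurable lam (uniform_count_measure (V (s n)))" using \<theta>[of n] by (simp add: uniformly_onto_def)
    show "y i (s n) \<in> borel_measurable (uniform_count_measure (V (s n)))"
      by (rule measurableI) (auto simp: sets_uniform_count_measure space_uniform_count_measure)
  qed
  \<comment> \<open>Clipping keeps the values in the interval also at the exceptional points where
    \<open>lim\<close> is arbitrary.\<close>
  define \<psi> where "\<psi> i x = max 0 (min 1 (lim (\<lambda>n. y i (s n) (\<theta> n x))))" for i x
  have "\<psi> i \<in> measurable lam lam" for i
  proof -
    have "\<psi> i \<in> borel_measurable lam" unfolding \<psi>_def[abs_def]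
      by (intro borel_measurable_max borel_measurable_min borel_measurable_const borel_measurable_lim_metric my)
    then have "\<psi> i \<in> measurable lam lborel" by simp
    then have "\<psi> i \<in> measurable lam (restrict_space lborel {0..1})"
      by (intro measurable_restrict_space2) (auto simp: \<psi>_def)
    then show "\<psi> i \<in> measurable lam lam" by (simp only: lam_def[symmetric])
  qed
  moreover have "AE x in lam. (\<lambda>n. y i (s n) (\<theta> n x)) \<longlonglongrightarrow> \<psi> i x" for i
    using ae AE_space
  proof eventually_elim
    case (elim x)
    have y01: "y i (s n) (\<theta> n x) \<in> {0..1}" for n using elim(2) by (intro y \<theta>V) simp
    have "\<exists>l. \<forall>\<^sub>F n in sequentially. binary_digits (y i (s n) (\<theta> n x)) j = l" for j
      using elim(1)[rule_format, of "to_nat (i, j)"] by (simp add: b_def)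
    with y01 have "convergent (\<lambda>n. y i (s n) (\<theta> n x))" by (rule convergent_of_digits)
    then have L: "(\<lambda>n. y i (s n) (\<theta> n x)) \<longlonglongrightarrow> lim (\<lambda>n. y i (s n) (\<theta> n x))" by (simp add: convergent_LIMSEQ_iff)
    have "0 \<le> lim (\<lambda>n. y i (s n) (\<theta> n x))" "lim (\<lambda>n. y i (s n) (\<theta> n x)) \<le> 1"
      by (rule LIMSEQ_le_const[OF L], use y01 in auto) (rule LIMSEQ_le_const2[OF L], use y01 in auto)
    then have "\<psi> i x = lim (\<lambda>n. y i (s n) (\<theta> n x))" by (simp add: \<psi>_def)
    with L show ?case by simp
  qed
  ultimately show ?thesis using s \<theta> by blast
qed

lemma cutf_diff:
  assumes "prob_space M" and [measurable]: "a \<in> borel_measurable (M \<Otimes>\<^sub>M M)" "c \<in> borel_measurable (M \<Otimes>\<^sub>M M)"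
    and B: "\<And>z. \<bar>a z\<bar> \<le> 1" "\<And>z. \<bar>c z\<bar> \<le> 1" and cut: "cutf M a d" "cutf M c e"
  shows "cutf M (\<lambda>z. a z - c z) (d + e)"
  unfolding cutf_def
proof (intro ballI impI)
  interpret prob_space M by fact
  fix f g :: "'a \<Rightarrow> real"
  assume [measurable]: "f \<in> borel_measurable M" "g \<in> borel_measurable M"
    and f: "\<forall>x\<in>space M. \<bar>f x\<bar> \<le> 1" and g: "\<forall>x\<in>space M. \<bar>g x\<bar> \<le> 1"
  have eq: "(\<integral>x. \<integral>y. k (x, y) * (f x * g y) \<partial>M \<partial>M) = (\<integral>z. k z * (f (fst z) * g (snd z)) \<partial>(M \<Otimes>\<^sub>M M))"
    and int: "integrable (M \<Otimes>\<^sub>M M) (\<lambda>z. k z * (f (fst z) * g (snd z)))"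
    if [measurable]: "k \<in> borel_measurable (M \<Otimes>\<^sub>M M)" and k: "\<And>z. \<bar>k z\<bar> \<le> 2" for k
  proof -
    have b: "\<bar>k (x, y) * (f x * g y)\<bar> \<le> 2" if "x \<in> space M" "y \<in> space M" for x y
    proof -
      have "\<bar>f x * g y\<bar> \<le> 1" using mult_mono[of "\<bar>f x\<bar>" 1 "\<bar>g y\<bar>" 1] f g that by (simp add: abs_mult)
      from mult_mono[OF k this] show ?thesis by (simp add: abs_mult)
    qed
    show "(\<integral>x. \<integral>y. k (x, y) * (f x * g y) \<partial>M \<partial>M) = (\<integral>z. k z * (f (fst z) * g (snd z)) \<partial>(M \<Otimes>\<^sub>M M))"
      using integral_pair_eq[where B=2 and f="\<lambda>z. k z * (f (fst z) * g (snd z))"] b by simp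
    show "integrable (M \<Otimes>\<^sub>M M) (\<lambda>z. k z * (f (fst z) * g (snd z)))"
      by (rule pair_integrable_bdd[where B=2]) (use b in auto)
  qed
  have ac: "\<bar>a z - c z\<bar> \<le> 2" "\<bar>a z\<bar> \<le> 2" "\<bar>c z\<bar> \<le> 2" for z using B[of z] by auto
  have "(\<integral>x. \<integral>y. (a (x, y) - c (x, y)) * (f x * g y) \<partial>M \<partial>M) = (\<integral>z. (a z - c z) * (f (fst z) * g (snd z)) \<partial>(M \<Otimes>\<^sub>M M))"
    using eq[of "\<lambda>z. a z - c z"] ac by simp
  also have "\<dots> = (\<integral>z. a z * (f (fst z) * g (snd z)) \<partial>(M \<Otimes>\<^sub>M M)) - (\<integral>z. c z * (f (fst z) * g (snd z)) \<partial>(M \<Otimes>\<^sub>M M))"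
    using int[of a] int[of c] ac by (simp add: left_diff_distrib)
  also have "\<dots> = (\<integral>x. \<integral>y. a (x, y) * (f x * g y) \<partial>M \<partial>M) - (\<integral>x. \<integral>y. c (x, y) * (f x * g y) \<partial>M \<partial>M)"
    using eq[of a] eq[of c] ac by simp
  finally show "\<bar>\<integral>x. \<integral>y. (a (x, y) - c (x, y)) * (f x * g y) \<partial>M \<partial>M\<bar> \<le> d + e"
    using cut(1)[unfolded cutf_def, rule_format, of f g] cut(2)[unfolded cutf_def, rule_format, of f g] f g by fastforce
qed

lemma cutf_le_L1:
  assumes [measurable]: "a \<in> borel_measurable (lam \<Otimes>\<^sub>M lam)" and B: "\<And>z. \<bar>a z\<bar> \<le> 1"
  shows "cutf lam a (\<integral>z. \<bar>a z\<bar> \<partial>(lam \<Otimes>\<^sub>M lam))"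
  unfolding cutf_def
proof (intro ballI impI)
  fix f g :: "real \<Rightarrow> real"
  assume [measurable]: "f \<in> borel_measurable lam" "g \<in> borel_measurable lam"
    and f: "\<forall>x\<in>space lam. \<bar>f x\<bar> \<le> 1" and g: "\<forall>x\<in>space lam. \<bar>g x\<bar> \<le> 1"
  have fg: "\<bar>f x * g y\<bar> \<le> 1" if "x \<in> {0..1}" "y \<in> {0..1}" for x y
    using mult_mono[of "\<bar>f x\<bar>" 1 "\<bar>g y\<bar>" 1] f g that by (simp add: abs_mult)
  have b: "\<bar>a (x, y) * (f x * g y)\<bar> \<le> \<bar>a (x, y)\<bar>" if "x \<in> {0..1}" "y \<in> {0..1}" for x y
    using mult_left_mono[OF fg[OF that], of "\<bar>a (x, y)\<bar>"] by (simp add: abs_mult)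
  have b1: "\<bar>a (x, y) * (f x * g y)\<bar> \<le> 1" if "x \<in> {0..1}" "y \<in> {0..1}" for x y
    using b[OF that] B[of "(x, y)"] by linarith
  have i: "integrable (lam \<Otimes>\<^sub>M lam) (\<lambda>z. a z * (f (fst z) * g (snd z)))"
    by (rule lam.pair_integrable_bdd[where B=1]) (use b1 in auto)
  have "(\<integral>x. \<integral>y. a (x, y) * (f x * g y) \<partial>lam \<partial>lam) = (\<integral>z. a z * (f (fst z) * g (snd z)) \<partial>(lam \<Otimes>\<^sub>M lam))"
    using lam.integral_pair_eq[where B=1 and f="\<lambda>z. a z * (f (fst z) * g (snd z))"] b1 by simp
  also have "\<bar>\<dots>\<bar> \<le> (\<integral>z. \<bar>a z * (f (fst z) * g (snd z))\<bar> \<partial>(lam \<Otimes>\<^sub>M lam))" by (rule integral_abs_bound)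
  also have "\<dots> \<le> (\<integral>z. \<bar>a z\<bar> \<partial>(lam \<Otimes>\<^sub>M lam))"
  proof (rule integral_mono)
    show "integrable (lam \<Otimes>\<^sub>M lam) (\<lambda>z. \<bar>a z * (f (fst z) * g (snd z))\<bar>)" using i by (rule integrable_abs)
    show "integrable (lam \<Otimes>\<^sub>M lam) (\<lambda>z. \<bar>a z\<bar>)" by (rule lam2_integrable_bdd[where B=1]) (use B in auto)
    show "\<bar>a z * (f (fst z) * g (snd z))\<bar> \<le> \<bar>a z\<bar>" if "z \<in> space (lam \<Otimes>\<^sub>M lam)" for z
      using that b[of "fst z" "snd z"] by (cases z) (simp add: space_pair_measure)
  qed
  finally show "\<bar>\<integral>x. \<integral>y. a (x, y) * (f x * g y) \<partial>lam \<partial>lam\<bar> \<le> (\<integral>z. \<bar>a z\<bar> \<partial>(lam \<Otimes>\<^sub>M lam))" .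
qed

text \<open>
  The random graphs sampled from the two graphons have the same law, so for every large \<open>n\<close> some graph
  on \<open>n\<close> vertices is typical for both; it carries two labellings, one for each graphon, and
  a limit of these labellings is the desired coupling.
\<close>

theorem weak_isomorphism:
  assumes W: "\<And>i. graphon (W i)" 
    and eq: "\<And>I E. edge_set (I :: nat set) E \<Longrightarrow> dens lam I E (W False) = dens lam I E (W True)"
  shows "\<exists>\<psi> :: bool \<Rightarrow> real \<Rightarrow> real. (\<forall>i. \<psi> i \<in> measurable lam lam \<and> distr lam lam (\<psi> i) = lam) \<and>
    (AE z in lam \<Otimes>\<^sub>M lam. W False (\<psi> False (fst z), \<psi> False (snd z)) = W True (\<psi> True (fst z), \<psi> True (snd z)))"
proof -
  have "\<forall>i. \<exists>g :: nat \<Rightarrow> real \<times> real \<Rightarrow> real. (\<forall>m. continuous_on UNIV (g m)) \<and> (\<forall>m z. 0 \<le> g m z \<and> g m z \<le> 1) \<and>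
    (\<lambda>m. \<integral>z. \<bar>W i z - g m z\<bar> \<partial>(lam \<Otimes>\<^sub>M lam)) \<longlonglongrightarrow> 0"
    using graphon_continuous_approx[OF W] by blast
  from choice[OF this] obtain g :: "bool \<Rightarrow> nat \<Rightarrow> real \<times> real \<Rightarrow> real" where
    g: "\<And>i m. continuous_on UNIV (g i m)" and g01: "\<And>i m z. 0 \<le> g i m z \<and> g i m z \<le> 1"
    and appr: "\<And>i. (\<lambda>m. \<integral>z. \<bar>W i z - g i m z\<bar> \<partial>(lam \<Otimes>\<^sub>M lam)) \<longlonglongrightarrow> 0" by blast
  have mW[measurable]: "W i \<in> borel_measurable (lam \<Otimes>\<^sub>M lam)" for i by (rule graphon_measurable[OF W])
  have mg[measurable]: "g i m \<in> borel_measurable (lam \<Otimes>\<^sub>M lam)" for i m by (rule continuous_measurable_lam2[OF g])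
  have mramp[measurable]: "ramp q m \<in> borel_measurable borel" for q m by (rule borel_measurable_continuous_onI[OF continuous_ramp])
  \<comment> \<open>Two kinds of tests are interleaved: even indices measure the distance from
    \<open>W i\<close> to its continuous approximations, odd indices test the law of the
    labels.\<close>
  define f where "f i k z = (if even k then \<bar>W i z - g i (k div 2) z\<bar>
      else case from_nat (k div 2) of (q, m) \<Rightarrow> ramp q m (fst z))" for i k z
  have mf: "f i k \<in> borel_measurable (lam \<Otimes>\<^sub>M lam)" for i k
    unfolding f_def[abs_def] by (cases "even k"; cases "from_nat (k div 2) :: rat \<times> nat") simp_all
  have f01: "0 \<le> f i k z \<and> f i k z \<le> 1" for i k z
    using graphon_bounds[OF W, of i z] g01[of i "k div 2" z] ramp_bounds by (auto simp: f_def split: prod.split)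
  define \<eta> where "\<eta> n = 1 / real (Suc n)" for n
  \<comment> \<open>Chosen backwards: a fourth root turns the \<open>C4\<close> bound of each
    labelling into the cut norm bound \<open>\<eta> n ^ 4 / 2\<close>, the two labellings add up to
    \<open>\<eta> n ^ 4\<close>, and a second fourth root leaves \<open>\<eta> n\<close>.\<close>
  define \<delta> where "\<delta> n = (\<eta> n ^ 4 / 2) ^ 4" for n
  have \<eta>: "0 < \<eta> n" "\<eta> n \<le> 1" for n by (auto simp: \<eta>_def)
  have \<delta>: "0 < \<delta> n" "\<delta> n \<le> 1" for n
  proof -
    have "\<eta> n ^ 4 / 2 \<le> 1" using \<eta>[of n] power_le_one[of "\<eta> n" 4] by simp
    then show "\<delta> n \<le> 1" using \<eta>[of n] unfolding \<delta>_def by (intro power_le_one) auto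
  qed (use \<eta>[of n] in \<open>simp add: \<delta>_def\<close>)
  \<comment> \<open>Large enough for the hypothesis of \<open>common_well_labelled\<close> with
    \<open>n\<close> tests.\<close>
  define N where "N n = nat \<lceil>2 * (16 + 48 * real n) / (\<delta> n)\<^sup>2\<rceil> + 1" for n
  have N: "(16 + 48 * real n) / card {..<N n} < (\<delta> n)\<^sup>2 / 2" for n
  proof -
    have d2: "0 < (\<delta> n)\<^sup>2" using \<delta>[of n] by simp
    have "2 * (16 + 48 * real n) / (\<delta> n)\<^sup>2 < real (N n)" unfolding N_def by linarith
    then have "2 * (16 + 48 * real n) < real (N n) * (\<delta> n)\<^sup>2" using d2 by (simp add: pos_divide_less_eq)
    then show ?thesis by (simp add: N_def divide_simps del: of_nat_Suc) (simp add: algebra_simps)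
  qed
  have V: "finite {..<N n}" "{..<N n} \<noteq> {}" for n by (auto simp: N_def)
  have "\<forall>n. \<exists>r z z'. well_labelled {..<N n} (W False) (f False) n (\<delta> n) r z \<and> well_labelled {..<N n} (W True) (f True) n (\<delta> n) r z'"
  proof
    fix n show "\<exists>r z z'. well_labelled {..<N n} (W False) (f False) n (\<delta> n) r z \<and> well_labelled {..<N n} (W True) (f True) n (\<delta> n) r z'"
      by (rule common_well_labelled[OF V W W eq mf f01 mf f01 \<delta> N])
  qed
  then have "\<forall>n. \<exists>p. well_labelled {..<N n} (W False) (f False) n (\<delta> n) (fst p) (snd p False) \<and> well_labelled {..<N n} (W True) (f True) n (\<delta> n) (fst p) (snd p True)"
  proof (intro allI)
    fix n
    assume "\<forall>n. \<exists>r z z'. well_labelled {..<N n} (W False) (f False) n (\<delta> n) r z \<and> well_labelled {..<N n} (W True) (f True) n (\<delta> n) r z'"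
    then obtain r z z' where "well_labelled {..<N n} (W False) (f False) n (\<delta> n) r z" "well_labelled {..<N n} (W True) (f True) n (\<delta> n) r z'" by blast
    then show "\<exists>p. well_labelled {..<N n} (W False) (f False) n (\<delta> n) (fst p) (snd p False) \<and> well_labelled {..<N n} (W True) (f True) n (\<delta> n) (fst p) (snd p True)"
      by (intro exI[of _ "(r, \<lambda>i. if i then z' else z)"]) simp
  qed
  from choice[OF this] obtain p where p: "\<And>n. well_labelled {..<N n} (W False) (f False) n (\<delta> n) (fst (p n)) (snd (p n) False)"
     "\<And>n. well_labelled {..<N n} (W True) (f True) n (\<delta> n) (fst (p n)) (snd (p n) True)" by blast
  define r where "r n = fst (p n)" for n
  define y where "y i n = snd (p n) i" for i n
  have wl: "well_labelled {..<N n} (W i) (f i) n (\<delta> n) (r n) (y i n)" for i n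
    using p by (cases i) (auto simp: r_def y_def)
  have y01: "y i n v \<in> {0..1}" if "v \<in> {..<N n}" for i n v
    using wl[of n i] that by (auto simp: well_labelled_def)
  from labels_converge[where V="\<lambda>n. {..<N n}" and y=y, OF V y01]
  obtain s \<theta> \<psi> where s: "strict_mono (s :: nat \<Rightarrow> nat)" and \<theta>: "\<And>n. uniformly_onto (\<theta> n) {..<N (s n)}"
    and \<psi>[measurable]: "\<And>i. \<psi> i \<in> measurable lam lam" and conv: "\<And>i. AE x in lam. (\<lambda>n. y i (s n) (\<theta> n x)) \<longlonglongrightarrow> \<psi> i x" by blast
  define \<psi>n where "\<psi>n i n x = y i (s n) (\<theta> n x)" for i n x
  have m\<psi>n[measurable]: "\<psi>n i n \<in> measurable lam lam" for i n
  proof -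
    have "\<psi>n i n \<in> borel_measurable lam" unfolding \<psi>n_def[abs_def]
    proof (rule measurable_compose[where f="\<theta> n" and g="y i (s n)"])
      show "\<theta> n \<in> measurable lam (uniform_count_measure {..<N (s n)})" using \<theta>[of n] by (simp add: uniformly_onto_def)
      show "y i (s n) \<in> borel_measurable (uniform_count_measure {..<N (s n)})"
        by (rule measurableI) (auto simp: sets_uniform_count_measure space_uniform_count_measure)
    qed
    then have "\<psi>n i n \<in> measurable lam lborel" by simp
    then have "\<psi>n i n \<in> measurable lam (restrict_space lborel {0..1})"
      using y01[OF uniformly_onto_in[OF \<theta>]]
      by (intro measurable_restrict_space2) (auto simp: \<psi>n_def)
    then show "\<psi>n i n \<in> measurable lam lam" by (simp only: lam_def[symmetric])
  qed
  have \<delta>\<eta>: "\<delta> n \<le> \<eta> n" for n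
  proof -
    have "\<delta> n \<le> \<eta> n ^ 4 / 2"
      unfolding \<delta>_def using \<eta>[of n] power_le_one[of "\<eta> n" 4] power_decreasing[of 1 4 "\<eta> n ^ 4 / 2"] by auto
    also have "\<dots> \<le> \<eta> n" using \<eta>[of n] power_decreasing[of 1 4 "\<eta> n"] by auto
    finally show ?thesis .
  qed
  have \<eta>s: "(\<lambda>n. \<eta> (s n)) \<longlonglongrightarrow> 0"
    using LIMSEQ_subseq_LIMSEQ[OF LIMSEQ_inverse_real_of_nat s] by (simp add: \<eta>_def o_def inverse_eq_divide)
  \<comment> \<open>The \<open>n\<close>-th labelling passes the first \<open>n\<close> tests, so
    each fixed test is eventually passed, with an error that tends to 0.\<close>
  have test: "(\<lambda>n. \<integral>z. f i k (\<psi>n i n (fst z), \<psi>n i n (snd z)) \<partial>(lam \<Otimes>\<^sub>M lam)) \<longlonglongrightarrow> (\<integral>z. f i k z \<partial>(lam \<Otimes>\<^sub>M lam))" for i k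
  proof (rule LIM_zero_cancel, rule Lim_null_comparison[OF _ \<eta>s])
    show "\<forall>\<^sub>F n in sequentially. norm ((\<integral>z. f i k (\<psi>n i n (fst z), \<psi>n i n (snd z)) \<partial>(lam \<Otimes>\<^sub>M lam)) - (\<integral>z. f i k z \<partial>(lam \<Otimes>\<^sub>M lam))) \<le> \<eta> (s n)"
    proof (rule eventually_sequentiallyI)
      fix n assume "Suc k \<le> n"
      also have "n \<le> s n" by (rule seq_suble[OF s])
      finally have k: "k < s n" by simp
      have "dens (uniform_count_measure {..<N (s n)}) {0, 1 :: nat} {(0, 1)} (at_points (f i k) (y i (s n))) =
          (\<integral>z. f i k (\<psi>n i n (fst z), \<psi>n i n (snd z)) \<partial>(lam \<Otimes>\<^sub>M lam))"
        by (subst dens_labels[OF \<theta> V(1)]) (simp add: \<psi>n_def)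
      moreover have "\<bar>dens (uniform_count_measure {..<N (s n)}) {0, 1 :: nat} {(0, 1)} (at_points (f i k) (y i (s n))) - dens lam {0, 1 :: nat} {(0, 1)} (f i k)\<bar> \<le> \<delta> (s n)"
        using wl[of "s n" i] k by (simp only: well_labelled_def)
      moreover have "dens lam {0, 1 :: nat} {(0, 1)} (f i k) = (\<integral>z. f i k z \<partial>(lam \<Otimes>\<^sub>M lam))"
        by (rule dens_single_edge[OF prob_space_lam mf])
      ultimately show "norm ((\<integral>z. f i k (\<psi>n i n (fst z), \<psi>n i n (snd z)) \<partial>(lam \<Otimes>\<^sub>M lam)) - (\<integral>z. f i k z \<partial>(lam \<Otimes>\<^sub>M lam))) \<le> \<eta> (s n)"
        using \<delta>\<eta>[of "s n"] by simp
    qed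
  qed
  have fst_int: "(\<integral>z. h (fst z) \<partial>(lam \<Otimes>\<^sub>M lam)) = (\<integral>x. h x \<partial>lam)" if [measurable]: "h \<in> borel_measurable lam" and "\<And>x. \<bar>h x\<bar> \<le> 1" for h :: "real \<Rightarrow> real"
    using lam.integral_pair_eq[where B=1 and f="\<lambda>z. h (fst z)"] that by (simp add: lam.prob_space[unfolded space_lam])
  have rB: "\<bar>ramp q m x\<bar> \<le> 1" for q m x using ramp_bounds[of q m x] by auto
  have [measurable]: "\<psi> i \<in> borel_measurable lam" "\<psi>n i n \<in> borel_measurable lam" for i n
    using measurable_compose[OF _ id_measurable_lam] \<psi> m\<psi>n by auto
  have T1: "(\<lambda>n. \<integral>z. \<bar>W i (\<psi>n i n (fst z), \<psi>n i n (snd z)) - g i m (\<psi>n i n (fst z), \<psi>n i n (snd z))\<bar> \<partial>(lam \<Otimes>\<^sub>M lam))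
       \<longlonglongrightarrow> (\<integral>z. \<bar>W i z - g i m z\<bar> \<partial>(lam \<Otimes>\<^sub>M lam))" for i m
    using test[of i "2 * m"] by (simp add: f_def)
  have T2: "(\<lambda>n. \<integral>x. ramp q m (\<psi>n i n x) \<partial>lam) \<longlonglongrightarrow> (\<integral>x. ramp q m x \<partial>lam)" for i q m
  proof -
    have "(\<lambda>n. \<integral>z. ramp q m (\<psi>n i n (fst z)) \<partial>(lam \<Otimes>\<^sub>M lam)) \<longlonglongrightarrow> (\<integral>z. ramp q m (fst z) \<partial>(lam \<Otimes>\<^sub>M lam))"
      using test[of i "2 * to_nat (q, m) + 1"] by (simp add: f_def)
    then show ?thesis
      using fst_int[of "\<lambda>x. ramp q m (\<psi>n i _ x)"] fst_int[of "ramp q m"] rB by simp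
  qed
  note ll = label_limit[OF W g g01 appr m\<psi>n \<psi> conv[folded \<psi>n_def] T1 T2]
  define \<Delta> where "\<Delta> z = W False (\<psi> False (fst z), \<psi> False (snd z)) - W True (\<psi> True (fst z), \<psi> True (snd z))" for z
  define L where "L i n = (\<integral>z. \<bar>W i (\<psi>n i n (fst z), \<psi>n i n (snd z)) - W i (\<psi> i (fst z), \<psi> i (snd z))\<bar> \<partial>(lam \<Otimes>\<^sub>M lam))" for i n
  have m1[measurable]: "(\<lambda>z. W i (\<psi>n i n (fst z), \<psi>n i n (snd z))) \<in> borel_measurable (lam \<Otimes>\<^sub>M lam)"
    "(\<lambda>z. W i (\<psi> i (fst z), \<psi> i (snd z))) \<in> borel_measurable (lam \<Otimes>\<^sub>M lam)" for i n by measurable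
  have d1: "\<bar>W i u - W j v\<bar> \<le> 1" for i j u v using graphon_bounds[OF W, of i u] graphon_bounds[OF W, of j v] by auto
  \<comment> \<open>On the finite vertex set both labelled graphons are close to the same graph,
    hence to each other. The detour through \<open>C4\<close> carries this to the interval.\<close>
  have cutD: "cutf lam (\<lambda>z. W True (\<psi>n True n (fst z), \<psi>n True n (snd z)) - W False (\<psi>n False n (fst z), \<psi>n False n (snd z))) (\<eta> (s n))" for n
  proof (rule lam.cutf_of_C4[where B=1])
    let ?V = "{..<N (s n)}" let ?U = "uniform_count_measure ?V"
    let ?a = "\<lambda>i e. adj (r (s n)) e - at_points (W i) (y i (s n)) e"
    interpret U: prob_space ?U by (rule prob_space_uniform_count_measure[OF V])
    have mU: "h \<in> borel_measurable (?U \<Otimes>\<^sub>M ?U)" for h :: "nat \<times> nat \<Rightarrow> real"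
      by (rule measurable_uniform_count_pair) auto
    have aB: "\<bar>?a i e\<bar> \<le> 1" for i e
      using at_points_bounds[OF W, of i "y i (s n)" e] adj_nonneg[where r="r (s n)" and e=e] by auto
    have "cutf ?U (?a i) (\<eta> (s n) ^ 4 / 2)" for i
      by (rule U.cutf_of_C4[OF mU aB]) (use wl[of "s n" i] \<eta>[of "s n"] in \<open>auto simp: well_labelled_def \<delta>_def less_imp_le\<close>)
    from cutf_diff[OF U.prob_space_axioms mU mU aB aB this[of False] this[of True]]
    have "cutf ?U (\<lambda>e. ?a False e - ?a True e) (\<eta> (s n) ^ 4)" by simp
    moreover have "?a False e - ?a True e = at_points (W True) (y True (s n)) e - at_points (W False) (y False (s n)) e" for e by simp
    ultimately have "cutf ?U (\<lambda>e. at_points (W True) (y True (s n)) e - at_points (W False) (y False (s n)) e) (\<eta> (s n) ^ 4)" by (simp only:)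
    then have "C4 ?U (\<lambda>e. at_points (W True) (y True (s n)) e - at_points (W False) (y False (s n)) e) \<le> \<eta> (s n) ^ 4"
      by (rule U.C4_le_cutf[OF mU, rotated]) (simp add: d1)
    moreover have "C4 lam (\<lambda>(x, x'). (\<lambda>e. at_points (W True) (y True (s n)) e - at_points (W False) (y False (s n)) e) (\<theta> n x, \<theta> n x')) =
        C4 ?U (\<lambda>e. at_points (W True) (y True (s n)) e - at_points (W False) (y False (s n)) e)"
      by (rule C4_distr[OF prob_space_lam _ _ mU]) (use \<theta>[of n] in \<open>auto simp: uniformly_onto_def\<close>)
    ultimately show "C4 lam (\<lambda>z. W True (\<psi>n True n (fst z), \<psi>n True n (snd z)) - W False (\<psi>n False n (fst z), \<psi>n False n (snd z))) \<le> \<eta> (s n) ^ 4"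
      by (simp add: \<psi>n_def case_prod_beta')
  qed (use \<eta>[of "s n"] d1 in \<open>auto simp: less_imp_le\<close>)
  have cut\<Delta>: "cutf lam \<Delta> ((L False n + \<eta> (s n)) + L True n)" for n
  proof -
    let ?A = "\<lambda>i z. W i (\<psi> i (fst z), \<psi> i (snd z)) - W i (\<psi>n i n (fst z), \<psi>n i n (snd z))"
    let ?D = "\<lambda>z. W True (\<psi>n True n (fst z), \<psi>n True n (snd z)) - W False (\<psi>n False n (fst z), \<psi>n False n (snd z))"
    have A: "cutf lam (?A i) (L i n)" for i
      using cutf_le_L1[of "?A i"] d1 unfolding L_def abs_minus_commute[of "W i (\<psi>n i n (fst _), _)"] by simp
    have "cutf lam (\<lambda>z. ?A False z - ?D z) (L False n + \<eta> (s n))"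
      by (rule cutf_diff[OF prob_space_lam _ _ _ _ A cutD]) (use d1 in auto)
    moreover have "\<bar>?A False z - ?D z\<bar> \<le> 1" for z
      using d1[of False "(\<psi> False (fst z), \<psi> False (snd z))" True "(\<psi>n True n (fst z), \<psi>n True n (snd z))"] by simp
    ultimately have "cutf lam (\<lambda>z. (?A False z - ?D z) - ?A True z) ((L False n + \<eta> (s n)) + L True n)"
      by (intro cutf_diff[OF prob_space_lam _ _ _ _ _ A]) (use d1 in auto)
    then show ?thesis by (simp add: \<Delta>_def[abs_def])
  qed
  have "(\<lambda>n. (L False n + \<eta> (s n)) + L True n) \<longlonglongrightarrow> (0 + 0) + 0"
    by (intro tendsto_add \<eta>s ll(2)[folded L_def])
  then have lim0: "(\<lambda>n. (L False n + \<eta> (s n)) + L True n) \<longlonglongrightarrow> 0" by simp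
  have "cutf lam \<Delta> 0"
    unfolding cutf_def
  proof (intro ballI impI)
    fix h k :: "real \<Rightarrow> real"
    assume hk: "h \<in> borel_measurable lam" "k \<in> borel_measurable lam" "\<forall>x\<in>space lam. \<bar>h x\<bar> \<le> 1" "\<forall>x\<in>space lam. \<bar>k x\<bar> \<le> 1"
    have "\<bar>\<integral>x. \<integral>y. \<Delta> (x, y) * (h x * k y) \<partial>lam \<partial>lam\<bar> \<le> (L False n + \<eta> (s n)) + L True n" for n
      using cut\<Delta>[of n, unfolded cutf_def] hk by blast
    then show "\<bar>\<integral>x. \<integral>y. \<Delta> (x, y) * (h x * k y) \<partial>lam \<partial>lam\<bar> \<le> 0"
      by (intro LIMSEQ_le_const[OF lim0]) auto
  qed
  then have "AE z in lam \<Otimes>\<^sub>M lam. \<Delta> z = 0"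
    by (intro lam.AE_zero_of_cutf) (auto simp: \<Delta>_def[abs_def] d1)
  then have "AE z in lam \<Otimes>\<^sub>M lam. W False (\<psi> False (fst z), \<psi> False (snd z)) = W True (\<psi> True (fst z), \<psi> True (snd z))"
    by eventually_elim (simp add: \<Delta>_def)
  then show ?thesis using \<psi> ll(1) by blast
qed

subsection \<open>Graph limits\<close>

lemma pair_graph_iff:
  "pair_graph G \<longleftrightarrow> finite (pverts G) \<and> parcs G \<subseteq> pverts G \<times> pverts G \<and>
    (\<forall>u v. (u, v) \<in> parcs G \<longrightarrow> u \<noteq> v \<and> (v, u) \<in> parcs G)"
proof
  assume "pair_graph G"
  then interpret pair_graph G .
  show "finite (pverts G) \<and> parcs G \<subseteq> pverts G \<times> pverts G \<and> (\<forall>u v. (u, v) \<in> parcs G \<longrightarrow> u \<noteq> v \<and> (v, u) \<in> parcs G)"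
    using pair_finite_verts arc_fst_in_verts arc_snd_in_verts no_loops' arcs_symmetric by fastforce
next
  assume *: "finite (pverts G) \<and> parcs G \<subseteq> pverts G \<times> pverts G \<and> (\<forall>u v. (u, v) \<in> parcs G \<longrightarrow> u \<noteq> v \<and> (v, u) \<in> parcs G)"
  then have "finite (parcs G)" by (meson finite_SigmaI finite_subset)
  with * show "pair_graph G"
    by unfold_locales (auto simp: symmetric_def sym_def arcs_ends_def arc_to_ends_def)
qed

definition graph_of :: "nat set \<Rightarrow> (nat \<times> nat) set \<Rightarrow> ngraph" where
  "graph_of V r = \<lparr> pverts = V, parcs = {(u, v). (u, v) \<in> r \<or> (v, u) \<in> r} \<rparr>"

lemma pverts_graph_of[simp]: "pverts (graph_of V r) = V"
  and parcs_graph_of: "parcs (graph_of V r) = {(u, v). (u, v) \<in> r \<or> (v, u) \<in> r}"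
  and adj_graph_of[simp]: "adj (parcs (graph_of V r)) = adj r"
  by (auto simp: graph_of_def adj_def fun_eq_iff)

lemma pair_graph_graph_of:
  assumes "finite V" "r \<subseteq> V \<times> V" "\<And>u v. (u, v) \<in> r \<Longrightarrow> u \<noteq> v"
  shows "pair_graph (graph_of V r)"
  using assms unfolding pair_graph_iff by (auto simp: parcs_graph_of)

definition edges :: "ngraph \<Rightarrow> (nat \<times> nat) set" where
  "edges F = {(i, j). (i, j) \<in> parcs F \<and> i < j}"

lemma edge_set_edges: "pair_graph F \<Longrightarrow> edge_set (pverts F) (edges F)"
  unfolding pair_graph_iff edge_set_def edges_def by auto

text \<open>A symmetric kernel does not see orientations. This reconciles arbitrary edge sets with
  the increasing arcs used for graphs.\<close>

lemma dens_reorient: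
  assumes E: "edge_set I E" and w: "\<And>x y. w (x, y) = (w (y, x) :: real)"
  shows "dens M I (edges (graph_of I E)) w = dens M I E w"
proof -
  let ?o = "\<lambda>(i :: nat, j). (min i j, max i j)"
  have im: "edges (graph_of I E) = ?o ` E"
  proof (intro equalityI subsetI)
    fix z assume "z \<in> edges (graph_of I E)"
    then obtain i j where z: "z = (i, j)" "i < j" "(i, j) \<in> E \<or> (j, i) \<in> E" by (auto simp: edges_def parcs_graph_of)
    then have "z = ?o (i, j)" "z = ?o (j, i)" by auto
    with z(3) show "z \<in> ?o ` E" by blast
  next
    fix z assume "z \<in> ?o ` E"
    then obtain i j where z: "z = ?o (i, j)" "(i, j) \<in> E" by auto
    then have "i \<noteq> j" using edge_setD[OF E] by blast
    with z show "z \<in> edges (graph_of I E)" by (cases "i < j") (auto simp: edges_def parcs_graph_of)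
  qed
  have inj: "inj_on ?o E"
  proof (rule inj_onI)
    fix a b assume ab: "a \<in> E" "b \<in> E" "?o a = ?o b"
    obtain i j i' j' where z: "a = (i, j)" "b = (i', j')" by (cases a, cases b)
    then have "(i = i' \<and> j = j') \<or> (i = j' \<and> j = i')" using ab(3) by (auto simp: min_def max_def split: if_splits)
    moreover have "\<not> (i = j' \<and> j = i')" using edge_setD[OF E] ab z by blast
    ultimately show "a = b" using z by blast
  qed
  have "(\<Prod>(i, j)\<in>?o ` E. w (x i, x j)) = (\<Prod>(i, j)\<in>E. w (x i, x j))" for x
    unfolding prod.reindex[OF inj] o_def
    by (rule prod.cong) (auto simp: min_def max_def w)
  then show ?thesis unfolding dens_def im by simp
qed

abbreviation graph_dens :: "nat set \<Rightarrow> (nat \<times> nat) set \<Rightarrow> ngraph \<Rightarrow> real" where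
  "graph_dens I E G \<equiv> dens (uniform_count_measure (pverts G)) I E (adj (parcs G))"

lemma t_graph_eq:
  assumes F: "pair_graph F" and G: "pair_graph G" "pverts G \<noteq> {}"
  shows "t_graph F G = graph_dens (pverts F) (edges F) G"
proof -
  let ?A = "pverts F \<rightarrow>\<^sub>E pverts G"
  have fin: "finite (pverts F)" "finite (pverts G)" using F G by (auto simp: pair_graph_iff)
  have A: "finite ?A" "?A \<noteq> {}" using fin G(2) by (auto intro: finite_PiE simp: PiE_eq_empty_iff)
  have fE: "finite (edges F)" using edge_set_finite[OF edge_set_edges[OF F]] by blast
  have eq: "(\<Prod>(i, j)\<in>edges F. adj (parcs G) (h i, h j)) = of_bool (\<forall>(u, v)\<in>parcs F. (h u, h v) \<in> parcs G)" for h :: "nat \<Rightarrow> nat"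
  proof -
    have "(\<Prod>(i, j)\<in>edges F. adj (parcs G) (h i, h j)) = (\<Prod>e\<in>edges F. of_bool (case e of (i, j) \<Rightarrow> (h i, h j) \<in> parcs G) :: real)"
      by (rule prod.cong) (use G in \<open>auto simp: adj_def pair_graph_iff\<close>)
    also have "\<dots> = of_bool (\<forall>e\<in>edges F. case e of (i, j) \<Rightarrow> (h i, h j) \<in> parcs G)"
      using fE by (induction rule: finite_induct) auto
    also have "(\<forall>e\<in>edges F. case e of (i, j) \<Rightarrow> (h i, h j) \<in> parcs G) \<longleftrightarrow> (\<forall>(u, v)\<in>parcs F. (h u, h v) \<in> parcs G)"
    proof
      assume L: "\<forall>e\<in>edges F. case e of (i, j) \<Rightarrow> (h i, h j) \<in> parcs G"
      have "(h u, h v) \<in> parcs G" if uv: "(u, v) \<in> parcs F" for u v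
      proof (cases "u < v")
        case True
        then show ?thesis using L uv by (auto simp: edges_def)
      next
        case False
        then have "(v, u) \<in> edges F" using uv F by (auto simp: edges_def pair_graph_iff) (metis linorder_neqE_nat)
        then have "(h v, h u) \<in> parcs G" using L by auto
        then show ?thesis using G by (auto simp: pair_graph_iff)
      qed
      then show "\<forall>(u, v)\<in>parcs F. (h u, h v) \<in> parcs G" by blast
    qed (auto simp: edges_def)
    finally show ?thesis .
  qed
  have "graph_dens (pverts F) (edges F) G = (\<Sum>h\<in>?A. of_bool (\<forall>(u, v)\<in>parcs F. (h u, h v) \<in> parcs G)) / real (card (pverts G)) ^ card (pverts F)"
    unfolding dens_uniform_count[OF fin G(2)] eq by simp
  also have "\<dots> = real (card (?A \<inter> {h. \<forall>(u, v)\<in>parcs F. (h u, h v) \<in> parcs G})) / real (card ?A)"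
    using A(1) fin by (simp add: card_PiE del: PiE_iff)
  also have "\<dots> = t_graph F G" unfolding t_graph_def using A by (simp add: measure_pmf_of_set)
  finally show ?thesis by simp
qed

text \<open>The closure of a property expressed through \<open>dens\<close> for both graphs and
  graphons. It depends on \<open>w\<close> only through its densities, so it is blind to null sets
  and to measure preserving maps.\<close>

definition graph_limit :: "ngraph set \<Rightarrow> (real \<times> real \<Rightarrow> real) \<Rightarrow> bool" where
  "graph_limit P w \<longleftrightarrow> (\<exists>G :: nat \<Rightarrow> ngraph. (\<forall>n. G n \<in> P) \<and>
    filterlim (\<lambda>n. card (pverts (G n))) at_top sequentially \<and>
    (\<forall>I E. edge_set I E \<longrightarrow> (\<lambda>n. graph_dens I E (G n)) \<longlonglongrightarrow> dens lam I E w))"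

text \<open>There are only countably many pairs of finite sets \<open>(I, E)\<close> of natural
  numbers, so a diagonal choice builds the sequence. To verify a limit it then suffices to construct
  one large graph for finitely many densities and one precision.\<close>

lemma graph_limit_iff:
  "graph_limit P w \<longleftrightarrow> (\<forall>F e k. finite F \<longrightarrow> (\<forall>(I, E)\<in>F. edge_set I E) \<longrightarrow> 0 < e \<longrightarrow>
    (\<exists>G\<in>P. k \<le> card (pverts G) \<and> (\<forall>(I, E)\<in>F. \<bar>graph_dens I E G - dens lam I E w\<bar> < e)))"
    (is "_ \<longleftrightarrow> ?R")
proof
  assume "graph_limit P w"
  then obtain G where G: "\<And>n. G n \<in> P" "filterlim (\<lambda>n. card (pverts (G n))) at_top sequentially"
    "\<And>I E. edge_set I E \<Longrightarrow> (\<lambda>n. graph_dens I E (G n)) \<longlonglongrightarrow> dens lam I E w"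
    unfolding graph_limit_def by blast
  show ?R
  proof (intro allI impI)
    fix F :: "(nat set \<times> (nat \<times> nat) set) set" and e :: real and k :: nat
    assume F: "finite F" "\<forall>(I, E)\<in>F. edge_set I E" and e: "0 < e"
    have "\<forall>\<^sub>F n in sequentially. \<forall>q\<in>F. \<bar>graph_dens (fst q) (snd q) (G n) - dens lam (fst q) (snd q) w\<bar> < e"
      using F(1)
    proof (rule eventually_ball_finite)
      show "\<forall>q\<in>F. \<forall>\<^sub>F n in sequentially. \<bar>graph_dens (fst q) (snd q) (G n) - dens lam (fst q) (snd q) w\<bar> < e"
      proof
        fix q assume "q \<in> F"
        then have "edge_set (fst q) (snd q)" using F(2) by auto
        from tendstoD[OF G(3)[OF this] e] show "\<forall>\<^sub>F n in sequentially. \<bar>graph_dens (fst q) (snd q) (G n) - dens lam (fst q) (snd q) w\<bar> < e"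
          by (simp add: dist_real_def)
      qed
    qed
    moreover have "\<forall>\<^sub>F n in sequentially. k \<le> card (pverts (G n))" using G(2) unfolding filterlim_at_top by blast
    ultimately have "\<forall>\<^sub>F n in sequentially. k \<le> card (pverts (G n)) \<and> (\<forall>q\<in>F. \<bar>graph_dens (fst q) (snd q) (G n) - dens lam (fst q) (snd q) w\<bar> < e)"
      by eventually_elim blast
    then obtain n where "k \<le> card (pverts (G n))" "\<forall>q\<in>F. \<bar>graph_dens (fst q) (snd q) (G n) - dens lam (fst q) (snd q) w\<bar> < e"
      unfolding eventually_sequentially by blast
    with G(1)[of n] show "\<exists>G\<in>P. k \<le> card (pverts G) \<and> (\<forall>(I, E)\<in>F. \<bar>graph_dens I E G - dens lam I E w\<bar> < e)"
      by (intro bexI[of _ "G n"]) auto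
  qed
next
  assume R: ?R
  let ?C = "{q :: nat set \<times> (nat \<times> nat) set. edge_set (fst q) (snd q)}"
  have "?C \<subseteq> Collect finite \<times> Collect finite" using edge_set_finite[where ?'a=nat] by (auto simp: edge_set_def[abs_def] intro: finite_subset[OF _ finite_SigmaI])
  then have C: "countable ?C" by (rule countable_subset) (intro countable_SIGMA countable_Collect_finite)
  have "edge_set {} {}" by (simp add: edge_set_def)
  then have ne: "?C \<noteq> {}" by (metis (mono_tags, lifting) empty_iff fst_conv mem_Collect_eq snd_conv)
  \<comment> \<open>An enumeration of all edge sets; the \<open>n\<close>-th graph serves the
    members up to \<open>n\<close> with precision \<open>1 / Suc n\<close>.\<close>
  define q where "q = from_nat_into ?C"
  have q: "edge_set (fst (q n)) (snd (q n))" for n using from_nat_into[OF ne, of n] by (simp add: q_def)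
  have "\<exists>G\<in>P. n \<le> card (pverts G) \<and> (\<forall>(I, E)\<in>q ` {..n}. \<bar>graph_dens I E G - dens lam I E w\<bar> < 1 / real (Suc n))" for n
  proof -
    have "finite (q ` {..n})" "\<forall>(I, E)\<in>q ` {..n}. edge_set I E" "0 < 1 / real (Suc n)"
      using q by (auto simp: case_prod_beta')
    with R show ?thesis by blast
  qed
  then have "\<forall>n. \<exists>G. G \<in> P \<and> n \<le> card (pverts G) \<and> (\<forall>(I, E)\<in>q ` {..n}. \<bar>graph_dens I E G - dens lam I E w\<bar> < 1 / real (Suc n))" by blast
  from choice[OF this] obtain G where G: "\<And>n. G n \<in> P" "\<And>n. n \<le> card (pverts (G n))"
    "\<And>n. \<forall>(I, E)\<in>q ` {..n}. \<bar>graph_dens I E (G n) - dens lam I E w\<bar> < 1 / real (Suc n)" by blast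
  have "filterlim (\<lambda>n. card (pverts (G n))) at_top sequentially"
    by (rule filterlim_at_top_mono[OF filterlim_ident]) (simp add: G(2))
  moreover have "(\<lambda>n. graph_dens I E (G n)) \<longlonglongrightarrow> dens lam I E w" if E: "edge_set I E" for I E
  proof -
    obtain m where m: "q m = (I, E)" using from_nat_into_surj[OF C, of "(I, E)"] E by (auto simp: q_def)
    have "\<forall>\<^sub>F n in sequentially. \<bar>graph_dens I E (G n) - dens lam I E w\<bar> \<le> 1 / real (Suc n)"
      using eventually_ge_at_top[of m]
    proof eventually_elim
      case (elim n)
      then have "(I, E) \<in> q ` {..n}" using m by (metis atMost_iff imageI)
      from bspec[OF G(3)[of n] this] show ?case by simp
    qed
    then have "(\<lambda>n. graph_dens I E (G n) - dens lam I E w) \<longlonglongrightarrow> 0"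
      by (intro Lim_null_comparison[OF _ LIMSEQ_inverse_real_of_nat]) (simp add: inverse_eq_divide)
    then show ?thesis by (rule LIM_zero_cancel)
  qed
  ultimately show "graph_limit P w" unfolding graph_limit_def using G(1) by blast
qed

lemma graph_limit_cong:
  assumes "graph_limit P w" "\<And>(I :: nat set) E. edge_set I E \<Longrightarrow> dens lam I E w = dens lam I E u"
  shows "graph_limit P u"
  using assms(1) unfolding graph_limit_def by (simp add: assms(2) cong: imp_cong)

text \<open>The densities agree with \<open>t_graph\<close> only for graphs with a vertex, which
  covers all but finitely many terms because the orders tend to infinity.\<close>

lemma graph_limit_dens_converge:
  assumes "\<And>n. G n \<in> P" "\<And>n. pair_graph (G n)"
    and "filterlim (\<lambda>n. card (pverts (G n))) at_top sequentially" and w: "graphon w"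
  shows "(\<forall>I E. edge_set I E \<longrightarrow> (\<lambda>n. graph_dens I E (G n)) \<longlonglongrightarrow> dens lam I E w) \<longleftrightarrow>
    (\<forall>F. pair_graph F \<longrightarrow> (\<lambda>n. t_graph F (G n)) \<longlonglongrightarrow> dens lam (pverts F) (edges F) w)"
proof -
  have ev: "\<forall>\<^sub>F n in sequentially. pverts (G n) \<noteq> {}"
  proof -
    have "\<forall>\<^sub>F n in sequentially. 1 \<le> card (pverts (G n))" using assms(3) unfolding filterlim_at_top by blast
    then show ?thesis by eventually_elim auto
  qed
  have t: "(\<lambda>n. t_graph F (G n)) \<longlonglongrightarrow> l \<longleftrightarrow> (\<lambda>n. graph_dens (pverts F) (edges F) (G n)) \<longlonglongrightarrow> l" if F: "pair_graph F" for F l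
    by (rule tendsto_cong, use ev in eventually_elim) (simp add: t_graph_eq[OF F assms(2)])
  show ?thesis
  proof (intro iffI allI impI)
    fix F :: ngraph assume "\<forall>I E. edge_set I E \<longrightarrow> (\<lambda>n. graph_dens I E (G n)) \<longlonglongrightarrow> dens lam I E w" "pair_graph F"
    then show "(\<lambda>n. t_graph F (G n)) \<longlonglongrightarrow> dens lam (pverts F) (edges F) w" using t edge_set_edges by blast
  next
    fix I :: "nat set" and E assume R: "\<forall>F. pair_graph F \<longrightarrow> (\<lambda>n. t_graph F (G n)) \<longlonglongrightarrow> dens lam (pverts F) (edges F) w" and E: "edge_set I E"
    have "pair_graph (graph_of I E)" using E by (intro pair_graph_graph_of) (auto simp: edge_set_def)
    from R[rule_format, OF this] have "(\<lambda>n. graph_dens I (edges (graph_of I E)) (G n)) \<longlonglongrightarrow> dens lam I (edges (graph_of I E)) w"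
      using t[OF \<open>pair_graph (graph_of I E)\<close>] by simp
    moreover have "graph_dens I (edges (graph_of I E)) (G n) = graph_dens I E (G n)" for n
      by (rule dens_reorient[OF E]) (auto simp: adj_def)
    moreover have "dens lam I (edges (graph_of I E)) w = dens lam I E w"
      by (rule dens_reorient[OF E]) (rule graphon_sym[OF w])
    ultimately show "(\<lambda>n. graph_dens I E (G n)) \<longlonglongrightarrow> dens lam I E w" by simp
  qed
qed


section \<open>From Lebesgue measurable functions to graphons\<close>

lemma AE_edges:
  assumes "prob_space M" and E: "edge_set I E" and ae: "AE z in M \<Otimes>\<^sub>M M. Q z"
  shows "AE x in Pi\<^sub>M I (\<lambda>_. M). \<forall>e\<in>E. Q (x (fst e), x (snd e))"
proof (rule AE_finite_allI[OF edge_set_finite[OF E]])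
  interpret prob_space M by fact
  fix e assume "e \<in> E"
  then have *: "fst e \<in> I" "snd e \<in> I" "fst e \<noteq> snd e" using edge_setD[OF E, of "fst e" "snd e"] by auto
  have m: "(\<lambda>x. (x (fst e), x (snd e))) \<in> measurable (Pi\<^sub>M I (\<lambda>_. M)) (M \<Otimes>\<^sub>M M)"
    using *(1,2) by (intro measurable_Pair measurable_component_singleton)
  from ae show "AE x in Pi\<^sub>M I (\<lambda>_. M). Q (x (fst e), x (snd e))"
    by (subst (asm) distr_PiM_pair[OF *, symmetric]) (rule AE_distrD[OF m])
qed

text \<open>The function \<open>f\<close> inherits measurability from \<open>g\<close> because the
  completed measure contains all subsets of null sets. The integrand of \<open>t_fun\<close> has
  exactly this form.\<close>

lemma integral_completion_AE:
  fixes f g :: "'a \<Rightarrow> real"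
  assumes g: "g \<in> borel_measurable M" and ae: "AE x in M. f x = g x"
  shows "(\<integral>x. f x \<partial>completion M) = (\<integral>x. g x \<partial>M)"
proof -
  have g': "g \<in> borel_measurable (completion M)" by (rule measurable_completion[OF g])
  have ae': "AE x in completion M. f x = g x" by (rule AE_completion[OF ae])
  have f': "f \<in> borel_measurable (completion M)"
  proof (rule measurableI)
    fix A :: "real set" assume A: "A \<in> sets borel"
    show "f -` A \<inter> space (completion M) \<in> sets (completion M)"
    proof (rule complete_measure.in_sets_AE)
      show "complete_measure (completion M)" ..
      show "g -` A \<inter> space (completion M) \<in> sets (completion M)" by (rule measurable_sets[OF g' A])
      show "AE x in completion M. x \<in> g -` A \<inter> space (completion M) \<longleftrightarrow> x \<in> f -` A \<inter> space (completion M)"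
        using ae' by eventually_elim simp
    qed simp
  qed simp
  have "(\<integral>x. f x \<partial>completion M) = (\<integral>x. g x \<partial>completion M)" by (rule integral_cong_AE[OF f' g' ae'])
  then show ?thesis using integral_completion[OF g] by simp
qed

lemma unit_square_borel: "unit_square \<in> sets (borel :: (real \<times> real) measure)"
  by (intro borel_closed closed_Times) auto

lemma AE_lebesgue_on_unit_square: "(AE z in lebesgue_on unit_square. Q z) \<longleftrightarrow> (AE z in lam \<Otimes>\<^sub>M lam. Q z)"
proof -
  have "unit_square \<inter> space lebesgue \<in> sets (lebesgue :: (real \<times> real) measure)"
    using unit_square_borel by (intro sets_completionI_sets) simp
  then have "(AE z in lebesgue_on unit_square. Q z) \<longleftrightarrow> (AE z in lebesgue. z \<in> unit_square \<longrightarrow> Q z)"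
    by (rule AE_restrict_space_iff)
  also have "\<dots> \<longleftrightarrow> (AE z in lborel. z \<in> unit_square \<longrightarrow> Q z)" by (rule AE_completion_iff)
  also have "\<dots> \<longleftrightarrow> (AE z in lam \<Otimes>\<^sub>M lam. Q z)" unfolding lam2_eq
    by (rule AE_restrict_space_iff[symmetric]) (use unit_square_borel in simp)
  finally show ?thesis .
qed

lemma sets_lam2_lebesgue_on: "sets (lam \<Otimes>\<^sub>M lam) \<subseteq> sets (lebesgue_on unit_square)"
  unfolding lam2_eq sets_restrict_space using sets_completionI_sets[of _ lborel] by auto

lemma AE_lam2_space: "AE z in lam \<Otimes>\<^sub>M lam. z \<in> unit_square"
  by (rule AE_I2) (simp add: space_pair_measure)

lemma restrict_graphon_W0:
  assumes w: "graphon w"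
  shows "restrict w unit_square \<in> W0"
proof -
  have "w \<in> borel_measurable (lebesgue_on unit_square)"
  proof (rule measurableI)
    fix A :: "real set" assume "A \<in> sets borel"
    from measurable_sets[OF graphon_measurable[OF w] this]
    show "w -` A \<inter> space (lebesgue_on unit_square) \<in> sets (lebesgue_on unit_square)"
      using sets_lam2_lebesgue_on by (auto simp: space_pair_measure space_restrict_space)
  qed simp
  then have "restrict w unit_square \<in> borel_measurable (lebesgue_on unit_square)"
    by (subst measurable_cong[where g=w]) (auto simp: space_restrict_space)
  then show ?thesis unfolding W0_def using graphon_bounds[OF w] graphon_sym[OF w] by auto
qed

text \<open>A Borel function agreeing almost everywhere with \<open>W\<close> exists by completion;
  averaging it with its transpose and clipping makes symmetry and bounds hold everywhere, and
  neither operation alters the almost everywhere class.\<close>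

lemma W0_graphon:
  assumes W: "W \<in> W0"
  shows "\<exists>w. graphon w \<and> (AE z in lam \<Otimes>\<^sub>M lam. W z = w z)"
proof -
  have Wm: "W \<in> borel_measurable (lebesgue_on unit_square)" and W01: "\<And>z. z \<in> unit_square \<Longrightarrow> 0 \<le> W z \<and> W z \<le> 1"
    and Ws: "\<And>x y. x \<in> {0..1} \<Longrightarrow> y \<in> {0..1} \<Longrightarrow> W (x, y) = W (y, x)"
    using W unfolding W0_def by (auto simp: PiE_iff)
  have "unit_square \<inter> space lebesgue \<in> sets (lebesgue :: (real \<times> real) measure)"
    using unit_square_borel by (intro sets_completionI_sets) simp
  then have "(\<lambda>z. indicator unit_square z *\<^sub>R W z) \<in> borel_measurable (completion lborel)"
    using Wm by (subst (asm) borel_measurable_restrict_space_iff) auto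
  from completion_ex_borel_measurable_real[OF this] obtain g where g: "g \<in> borel_measurable lborel"
    and ae: "AE z in lborel. indicator unit_square z *\<^sub>R W z = g z" by blast
  have gm[measurable]: "g \<in> borel_measurable (lam \<Otimes>\<^sub>M lam)"
    unfolding lam2_eq by (rule measurable_restrict_space1[OF g])
  have ae1: "AE z in lam \<Otimes>\<^sub>M lam. W z = g z"
    unfolding lam2_eq by (subst AE_restrict_space_iff) (use unit_square_borel ae in \<open>auto elim: eventually_mono\<close>)
  have ae2: "AE z in lam \<Otimes>\<^sub>M lam. W (snd z, fst z) = g (snd z, fst z)"
  proof -
    have "AE z in distr (lam \<Otimes>\<^sub>M lam) (lam \<Otimes>\<^sub>M lam) (\<lambda>(x, y). (y, x)). W z = g z"
      using ae1 by (subst lam2.distr_pair_swap[symmetric])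
    from AE_distrD[OF _ this] show ?thesis by (simp add: case_prod_beta')
  qed
  define w where "w z = max 0 (min 1 ((g z + g (snd z, fst z)) / 2))" for z
  have "w \<in> borel_measurable (lam \<Otimes>\<^sub>M lam)" unfolding w_def[abs_def] by measurable
  then have "graphon w" by (auto simp: graphon_def w_def add.commute)
  moreover have "AE z in lam \<Otimes>\<^sub>M lam. W z = w z" using ae1 ae2 AE_lam2_space
  proof eventually_elim
    case (elim z)
    have "W (snd z, fst z) = W z" using Ws[of "fst z" "snd z"] elim(3) by (cases z) auto
    with elim(1,2) W01[OF elim(3)] show ?case by (simp add: w_def)
  qed
  ultimately show ?thesis by blast
qed

lemma t_fun_eq:
  assumes F: "pair_graph F" and w: "graphon w" and ae: "AE z in lam \<Otimes>\<^sub>M lam. W z = w z"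
  shows "t_fun F W = dens lam (pverts F) (edges F) w"
  unfolding t_fun_def dens_def edges_def[symmetric] lam_def[symmetric]
proof (rule integral_completion_AE)
  have E: "edge_set (pverts F) (edges F)" by (rule edge_set_edges[OF F])
  show "(\<lambda>x. \<Prod>(i, j)\<in>edges F. w (x i, x j)) \<in> borel_measurable (Pi\<^sub>M (pverts F) (\<lambda>_. lam))"
    unfolding case_prod_beta' using E graphon_measurable[OF w] by (intro measurable_edge_prod) (auto simp: edge_set_def)
  show "AE x in Pi\<^sub>M (pverts F) (\<lambda>_. lam). (\<Prod>(i, j)\<in>edges F. W (x i, x j)) = (\<Prod>(i, j)\<in>edges F. w (x i, x j))"
    using AE_edges[OF prob_space_lam E ae] by eventually_elim (auto intro!: prod.cong)
qed

lemma property_closure_iff: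
  assumes P: "\<And>G. G \<in> P \<Longrightarrow> pair_graph G" and W: "W \<in> W0" and w: "graphon w"
    and ae: "AE z in lam \<Otimes>\<^sub>M lam. W z = w z"
  shows "W \<in> property_closure P \<longleftrightarrow> graph_limit P w"
proof -
  have "((\<forall>n. G n \<in> P) \<and> filterlim (\<lambda>n. card (pverts (G n))) at_top sequentially \<and>
      (\<forall>F. pair_graph F \<longrightarrow> (\<lambda>n. t_graph F (G n)) \<longlonglongrightarrow> t_fun F W)) \<longleftrightarrow>
    ((\<forall>n. G n \<in> P) \<and> filterlim (\<lambda>n. card (pverts (G n))) at_top sequentially \<and>
      (\<forall>I E. edge_set I E \<longrightarrow> (\<lambda>n. graph_dens I E (G n)) \<longlonglongrightarrow> dens lam I E w))" for G
    using graph_limit_dens_converge[of G P w] P w t_fun_eq[OF _ w ae] by (auto cong: conj_cong)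
  with W show ?thesis unfolding property_closure_def graph_limit_def by simp
qed

section \<open>Flexibility in terms of graph limits\<close>

text \<open>The definition of a flexing is pointwise, but the closure ignores null sets, so the
  condition may be weakened to hold almost everywhere. All later arguments use this form.\<close>

lemma flexible_iff:
  assumes P: "\<And>G. G \<in> P \<Longrightarrow> pair_graph G"
  shows "flexible P \<longleftrightarrow> (\<forall>w u. graphon w \<longrightarrow> graphon u \<longrightarrow> graph_limit P w \<longrightarrow>
    (AE z in lam \<Otimes>\<^sub>M lam. w z \<in> {0, 1} \<longrightarrow> u z = w z) \<longrightarrow> graph_limit P u)"
proof (intro iffI allI impI)
  fix w u
  assume fl: "flexible P" and w: "graphon w" and u: "graphon u" and lim: "graph_limit P w"
    and ae: "AE z in lam \<Otimes>\<^sub>M lam. w z \<in> {0, 1} \<longrightarrow> u z = w z"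
  \<comment> \<open>A modification of \<open>u\<close> on a null set that satisfies the flexing
    condition at every point.\<close>
  define v where "v z = (if w z \<in> {0, 1} then w z else u z)" for z
  have [measurable]: "w \<in> borel_measurable (lam \<Otimes>\<^sub>M lam)" "u \<in> borel_measurable (lam \<Otimes>\<^sub>M lam)"
    using w u by (auto intro: graphon_measurable)
  have "v \<in> borel_measurable (lam \<Otimes>\<^sub>M lam)" unfolding v_def[abs_def] by measurable
  moreover have "v (x, y) = v (y, x)" for x y
    using graphon_sym[OF w, of x y] graphon_sym[OF u, of x y] by (simp add: v_def)
  moreover have "0 \<le> v z \<and> v z \<le> 1" for z
    using graphon_bounds[OF w, of z] graphon_bounds[OF u, of z] by (simp add: v_def)
  ultimately have v: "graphon v" by (simp add: graphon_def)
  have r: "AE z in lam \<Otimes>\<^sub>M lam. restrict f unit_square z = f z" for f :: "real \<times> real \<Rightarrow> real"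
    using AE_lam2_space by eventually_elim simp
  have "restrict w unit_square \<in> property_closure P"
    using property_closure_iff[where P=P, OF P restrict_graphon_W0[OF w] w r] lim by blast
  moreover have "flexing (restrict v unit_square) (restrict w unit_square)"
    using restrict_graphon_W0[OF w] restrict_graphon_W0[OF v] by (simp add: flexing_def v_def)
  ultimately have "restrict v unit_square \<in> property_closure P"
    using fl unfolding flexible_def flexible_fun_property_def by blast
  then have "graph_limit P v" using property_closure_iff[where P=P, OF P restrict_graphon_W0[OF v] v r] by blast
  moreover have "AE z in lam \<Otimes>\<^sub>M lam. v z = u z" using ae by eventually_elim (simp add: v_def)
  ultimately show "graph_limit P u"
    using graph_limit_cong lam.dens_cong_AE[OF _ graphon_measurable[OF v] graphon_measurable[OF u]] by blast
next
  assume *: "\<forall>w u. graphon w \<longrightarrow> graphon u \<longrightarrow> graph_limit P w \<longrightarrow>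
    (AE z in lam \<Otimes>\<^sub>M lam. w z \<in> {0, 1} \<longrightarrow> u z = w z) \<longrightarrow> graph_limit P u"
  show "flexible P" unfolding flexible_def flexible_fun_property_def
  proof (intro ballI allI impI)
    fix W U assume W: "W \<in> property_closure P" and f: "flexing U W"
    then have "W \<in> W0" "U \<in> W0" by (auto simp: flexing_def)
    then obtain w u where w: "graphon w" "AE z in lam \<Otimes>\<^sub>M lam. W z = w z" and u: "graphon u" "AE z in lam \<Otimes>\<^sub>M lam. U z = u z"
      using W0_graphon by blast
    have "AE z in lam \<Otimes>\<^sub>M lam. w z \<in> {0, 1} \<longrightarrow> u z = w z" using w(2) u(2) AE_lam2_space
    proof eventually_elim
      case (elim z)
      have "W z \<in> {0, 1} \<longrightarrow> U z = W z" using f elim(3) by (cases z) (auto simp: flexing_def)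
      with elim show ?case by simp
    qed
    with * w(1) u(1) property_closure_iff[where P=P, OF P \<open>W \<in> W0\<close> w] W have "graph_limit P u" by blast
    then show "U \<in> property_closure P" using property_closure_iff[where P=P, OF P \<open>U \<in> W0\<close> u] by blast
  qed
qed

text \<open>A flexing of such a function agrees with it almost everywhere, hence shares its Borel
  version and its densities.\<close>

lemma flexible_of_01_valued:
  assumes P: "\<And>G. G \<in> P \<Longrightarrow> pair_graph G"
    and 01: "\<And>W. W \<in> property_closure P \<Longrightarrow> AE z in lebesgue_on unit_square. W z \<in> {0, 1}"
  shows "flexible P"
  unfolding flexible_def flexible_fun_property_def
proof (intro ballI allI impI)
  fix W U assume W: "W \<in> property_closure P" and f: "flexing U W"
  then have W0: "W \<in> W0" "U \<in> W0" by (auto simp: flexing_def)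
  then obtain w where w: "graphon w" "AE z in lam \<Otimes>\<^sub>M lam. W z = w z" using W0_graphon by blast
  have "AE z in lam \<Otimes>\<^sub>M lam. U z = w z"
    using 01[OF W, unfolded AE_lebesgue_on_unit_square] w(2) AE_lam2_space
  proof eventually_elim
    case (elim z)
    have "W z \<in> {0, 1} \<longrightarrow> U z = W z" using f elim(3) by (cases z) (auto simp: flexing_def)
    with elim show ?case by simp
  qed
  with property_closure_iff[where P=P, OF P W0(1) w] property_closure_iff[where P=P, OF P W0(2) w(1)] W
  show "U \<in> property_closure P" by blast
qed

lemma flexibleI:
  assumes P: "\<And>G. G \<in> P \<Longrightarrow> pair_graph G"
    and "\<And>w u. graphon w \<Longrightarrow> graphon u \<Longrightarrow> graph_limit P w \<Longrightarrow>
      AE z in lam \<Otimes>\<^sub>M lam. w z \<in> {0, 1} \<longrightarrow> u z = w z \<Longrightarrow> graph_limit P u"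
  shows "flexible P"
proof -
  have "flexible P \<longleftrightarrow> (\<forall>w u. graphon w \<longrightarrow> graphon u \<longrightarrow> graph_limit P w \<longrightarrow>
    (AE z in lam \<Otimes>\<^sub>M lam. w z \<in> {0, 1} \<longrightarrow> u z = w z) \<longrightarrow> graph_limit P u)"
    by (rule flexible_iff) (rule P)
  then show ?thesis using assms(2) by blast
qed

lemma flexibleD:
  assumes "flexible P" and P: "\<And>G. G \<in> P \<Longrightarrow> pair_graph G" and "graphon w" "graphon u" "graph_limit P w"
    "AE z in lam \<Otimes>\<^sub>M lam. w z \<in> {0, 1} \<longrightarrow> u z = w z"
  shows "graph_limit P u"
proof -
  have "flexible P \<longleftrightarrow> (\<forall>w u. graphon w \<longrightarrow> graphon u \<longrightarrow> graph_limit P w \<longrightarrow>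
    (AE z in lam \<Otimes>\<^sub>M lam. w z \<in> {0, 1} \<longrightarrow> u z = w z) \<longrightarrow> graph_limit P u)"
    by (rule flexible_iff) (rule P)
  then show ?thesis using assms by blast
qed

subsection \<open>Complements\<close>

lemma integral_PiM_uniform_count:
  fixes f :: "('i \<Rightarrow> 'a) \<Rightarrow> real"
  assumes "finite I" "finite V" "V \<noteq> {}"
  shows "(\<integral>x. f x \<partial>Pi\<^sub>M I (\<lambda>_. uniform_count_measure V)) = (\<Sum>h\<in>I \<rightarrow>\<^sub>E V. f h) / card V ^ card I"
  unfolding PiM_uniform_count[OF assms]
  by (subst integral_uniform_count_measure) (use assms in \<open>auto intro!: finite_PiE simp: card_PiE\<close>)

lemma dens_mixed_uniform_count:
  assumes E: "edge_set I (E \<union> E')" "E \<inter> E' = {}" and V: "finite V" "V \<noteq> {}"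
    and a: "\<And>z. 0 \<le> a z \<and> a z \<le> (1 :: real)"
  shows "(\<Sum>h\<in>I \<rightarrow>\<^sub>E V. (\<Prod>(i, j)\<in>E. a (h i, h j)) * (\<Prod>(i, j)\<in>E'. 1 - a (h i, h j))) / card V ^ card I =
    (\<Sum>T\<in>Pow E'. (-1) ^ card T * dens (uniform_count_measure V) I (E \<union> T) a)"
proof -
  have I: "finite I" using E(1) by (simp add: edge_set_def)
  show ?thesis
    unfolding integral_PiM_uniform_count[OF I V, symmetric]
    by (rule prob_space.dens_mixed[OF prob_space_uniform_count_measure[OF V] E])
      (use a in \<open>auto intro!: measurable_uniform_count_pair V(1)\<close>)
qed

lemma (in prob_space) dens_one_minus:
  assumes E: "edge_set I E" and w: "w \<in> borel_measurable (M \<Otimes>\<^sub>M M)"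
    "\<And>x y. x \<in> space M \<Longrightarrow> y \<in> space M \<Longrightarrow> 0 \<le> w (x, y) \<and> w (x, y) \<le> 1"
  shows "dens M I E (\<lambda>z. 1 - w z) = (\<Sum>T\<in>Pow E. (-1) ^ card T * dens M I T w)"
  using dens_mixed[of I "{}" E w] assms by (simp add: dens_def)

lemma pverts_complement_graph[simp]: "pverts (complement_graph G) = pverts G"
  and parcs_complement_graph: "parcs (complement_graph G) = {(u, v). u \<in> pverts G \<and> v \<in> pverts G \<and> u \<noteq> v \<and> (u, v) \<notin> parcs G}"
  by (simp_all add: complement_graph_def)

lemma pair_graph_complement_graph: "pair_graph G \<Longrightarrow> pair_graph (complement_graph G)"
  unfolding pair_graph_iff by (auto simp: parcs_complement_graph)

lemma complement_complement_graph: "pair_graph G \<Longrightarrow> complement_graph (complement_graph G) = G"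
  by (rule pair_pre_digraph.equality) (auto simp: parcs_complement_graph pair_graph_iff)

text \<open>The complement has no loops, whereas \<open>1 - adj\<close> equals 1 on the diagonal.
  The two agree on injective maps, so the difference is a collision term.\<close>

lemma graph_dens_complement:
  assumes G: "pair_graph G" "pverts G \<noteq> {}" and E: "edge_set I E"
  shows "\<bar>graph_dens I E (complement_graph G) - (\<Sum>T\<in>Pow E. (-1) ^ card T * graph_dens I T G)\<bar> \<le> (1 :: real) * (card I)\<^sup>2 / card (pverts G)"
proof -
  let ?V = "pverts G" and ?a = "adj (parcs G)" and ?b = "adj (parcs (complement_graph G))"
  have I: "finite I" and V: "finite ?V" "?V \<noteq> {}" using E G by (auto simp: edge_set_def pair_graph_iff)
  have 1: "(\<Sum>T\<in>Pow E. (-1) ^ card T * graph_dens I T G) = (\<Sum>h\<in>I \<rightarrow>\<^sub>E ?V. \<Prod>(i, j)\<in>E. 1 - ?a (h i, h j)) / card ?V ^ card I"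
    using dens_mixed_uniform_count[of I "{}" E ?V ?a] E V adj_nonneg by simp
  have 2: "graph_dens I E (complement_graph G) = (\<Sum>h\<in>I \<rightarrow>\<^sub>E ?V. \<Prod>(i, j)\<in>E. ?b (h i, h j)) / card ?V ^ card I"
    using dens_uniform_count[OF I V] by simp
  have "\<bar>(\<Sum>h\<in>I \<rightarrow>\<^sub>E ?V. (\<Prod>(i, j)\<in>E. ?b (h i, h j)) - (\<Prod>(i, j)\<in>E. 1 - ?a (h i, h j))) / card ?V ^ card I\<bar> \<le> (1 :: real) * (card I)\<^sup>2 / card ?V"
  proof (rule sum_noninj_le[OF I V])
    fix h assume h: "h \<in> I \<rightarrow>\<^sub>E ?V"
    have "0 \<le> (\<Prod>(i, j)\<in>E. ?b (h i, h j))" "0 \<le> (\<Prod>(i, j)\<in>E. 1 - ?a (h i, h j))"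
      by (auto intro!: prod_nonneg simp: adj_nonneg)
    moreover have "(\<Prod>(i, j)\<in>E. ?b (h i, h j)) \<le> 1" "(\<Prod>(i, j)\<in>E. 1 - ?a (h i, h j)) \<le> 1"
      by (auto intro!: prod_le_1 simp: adj_nonneg)
    ultimately show "\<bar>(\<Prod>(i, j)\<in>E. ?b (h i, h j)) - (\<Prod>(i, j)\<in>E. 1 - ?a (h i, h j))\<bar> \<le> 1" by linarith
    assume inj: "inj_on h I"
    have "(\<Prod>(i, j)\<in>E. ?b (h i, h j)) = (\<Prod>(i, j)\<in>E. 1 - ?a (h i, h j))"
    proof (rule prod.cong[OF refl], clarify)
      fix i j assume "(i, j) \<in> E"
      then have ij: "i \<in> I" "j \<in> I" "i \<noteq> j" using edge_setD[OF E] by blast+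
      then have "h i \<noteq> h j" "h i \<in> ?V" "h j \<in> ?V" using inj h by (auto simp: inj_on_def)
      then show "?b (h i, h j) = 1 - ?a (h i, h j)"
        using G(1) by (auto simp: adj_def parcs_complement_graph pair_graph_iff)
    qed
    then show "(\<Prod>(i, j)\<in>E. ?b (h i, h j)) - (\<Prod>(i, j)\<in>E. 1 - ?a (h i, h j)) = 0" by simp
  qed
  then show ?thesis unfolding 1 2 by (simp only: sum_subtractf diff_divide_distrib)
qed

lemma graphon_one_minus: "graphon w \<Longrightarrow> graphon (\<lambda>z. 1 - w z)"
  unfolding graphon_def by auto

lemma inverse_card_tendsto_0:
  assumes "filterlim (\<lambda>n. card (V n)) at_top sequentially"
  shows "(\<lambda>n. c / real (card (V n))) \<longlonglongrightarrow> 0"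
  by (rule real_tendsto_divide_at_top[OF tendsto_const])
    (rule filterlim_compose[OF filterlim_real_sequentially assms])

lemma eventually_pverts_nonempty:
  assumes "filterlim (\<lambda>n. card (pverts (G n))) at_top sequentially"
  shows "\<forall>\<^sub>F n in sequentially. pverts (G n) \<noteq> {}"
proof -
  have "\<forall>\<^sub>F n in sequentially. 1 \<le> card (pverts (G n))" using assms unfolding filterlim_at_top by blast
  then show ?thesis by eventually_elim auto
qed

lemma graph_limit_complement:
  assumes P: "\<And>G. G \<in> P \<Longrightarrow> pair_graph G" and w: "graphon w" and lim: "graph_limit P w"
  shows "graph_limit (complement_graph ` P) (\<lambda>z. 1 - w z)"
proof -
  obtain G where G: "\<And>n. G n \<in> P" "filterlim (\<lambda>n. card (pverts (G n))) at_top sequentially"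
    "\<And>I E. edge_set I E \<Longrightarrow> (\<lambda>n. graph_dens I E (G n)) \<longlonglongrightarrow> dens lam I E w"
    using lim unfolding graph_limit_def by blast
  have "(\<lambda>n. graph_dens I E (complement_graph (G n))) \<longlonglongrightarrow> dens lam I E (\<lambda>z. 1 - w z)" if E: "edge_set I E" for I :: "nat set" and E
  proof -
    let ?s = "\<lambda>n. \<Sum>T\<in>Pow E. (-1) ^ card T * graph_dens I T (G n)"
    have "(\<lambda>n. graph_dens I E (complement_graph (G n)) - ?s n) \<longlonglongrightarrow> 0"
    proof (rule Lim_null_comparison)
      show "\<forall>\<^sub>F n in sequentially. norm (graph_dens I E (complement_graph (G n)) - ?s n) \<le> (1 :: real) * (card I)\<^sup>2 / card (pverts (G n))"
        using eventually_pverts_nonempty[OF G(2)]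
      proof eventually_elim
        case (elim n)
        from graph_dens_complement[OF P[OF G(1)] elim E] show ?case by (simp only: real_norm_def)
      qed
      show "(\<lambda>n. (1 :: real) * (card I)\<^sup>2 / card (pverts (G n))) \<longlonglongrightarrow> 0" by (rule inverse_card_tendsto_0[OF G(2)])
    qed
    moreover have "?s \<longlonglongrightarrow> (\<Sum>T\<in>Pow E. (-1) ^ card T * dens lam I T w)"
      by (intro tendsto_sum tendsto_mult tendsto_const G(3)) (use edge_set_mono[OF E] in auto)
    ultimately have "(\<lambda>n. (graph_dens I E (complement_graph (G n)) - ?s n) + ?s n) \<longlonglongrightarrow> 0 + (\<Sum>T\<in>Pow E. (-1) ^ card T * dens lam I T w)"
      by (rule tendsto_add)
    moreover have "dens lam I E (\<lambda>z. 1 - w z) = (\<Sum>T\<in>Pow E. (-1) ^ card T * dens lam I T w)"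
      by (rule lam.dens_one_minus[OF E graphon_measurable[OF w] graphon_bounds[OF w]])
    ultimately show ?thesis by simp
  qed
  then show ?thesis unfolding graph_limit_def using G(1,2) by (intro exI[of _ "\<lambda>n. complement_graph (G n)"]) auto
qed

lemma complement_graph_image_twice:
  assumes P: "\<And>G. G \<in> P \<Longrightarrow> pair_graph G"
  shows "complement_graph ` complement_graph ` P = P"
  unfolding image_image using P complement_complement_graph by (simp cong: image_cong)

text \<open>The map \<open>w \<mapsto> 1 - w\<close> preserves the condition of taking a value in
  \<open>{0, 1}\<close>, hence flexings, and complementation of graphs is an involution.\<close>

lemma flexible_complement:
  assumes P: "\<And>G. G \<in> P \<Longrightarrow> pair_graph G" and fl: "flexible P"
  shows "flexible (complement_graph ` P)"
proof -
  have P': "pair_graph G" if "G \<in> complement_graph ` P" for G using that P pair_graph_complement_graph by auto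
  have "graph_limit (complement_graph ` P) u"
    if w: "graphon w" and u: "graphon u" and lim: "graph_limit (complement_graph ` P) w"
      and ae: "AE z in lam \<Otimes>\<^sub>M lam. w z \<in> {0, 1} \<longrightarrow> u z = w z" for w u
  proof -
    have "graph_limit P (\<lambda>z. 1 - w z)"
      using graph_limit_complement[where P="complement_graph ` P", OF P' w lim] complement_graph_image_twice[where P=P, OF P] by simp
    moreover have "AE z in lam \<Otimes>\<^sub>M lam. 1 - w z \<in> {0, 1} \<longrightarrow> 1 - u z = 1 - w z"
      using ae by eventually_elim auto
    ultimately have "graph_limit P (\<lambda>z. 1 - u z)"
      by (intro flexibleD[OF fl P graphon_one_minus[OF w] graphon_one_minus[OF u]])
    from graph_limit_complement[where P=P, OF P graphon_one_minus[OF u] this] show ?thesis by simp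
  qed
  with P' show ?thesis by (rule flexibleI)
qed

lemma spanning_iff:
  assumes "pair_graph H" "pair_graph G"
  shows "spanning (with_proj H) (with_proj G) \<longleftrightarrow> pverts H = pverts G \<and> parcs H \<subseteq> parcs G"
proof -
  interpret H: pair_graph H by fact
  interpret G: pair_graph G by fact
  show ?thesis unfolding spanning_def subgraph_def
    using H.wf_digraph_axioms G.wf_digraph_axioms by (auto simp: compatible_def)
qed

text \<open>Complementation fixes the vertex set and reverses inclusion of arcs.\<close>

lemma downward_closure_eq:
  assumes P: "\<And>G. G \<in> P \<Longrightarrow> pair_graph G"
  shows "downward_closure P = complement_graph ` upward_closure (complement_graph ` P)"
proof (intro equalityI subsetI)
  fix H assume "H \<in> downward_closure P"
  then obtain G where H: "pair_graph H" and G: "G \<in> P" "spanning (with_proj H) (with_proj G)" by (auto simp: downward_closure_def)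
  have sub: "pverts H = pverts G" "parcs H \<subseteq> parcs G" using spanning_iff[OF H P[OF G(1)]] G(2) by auto
  have "spanning (with_proj (complement_graph G)) (with_proj (complement_graph H))"
    using sub by (subst spanning_iff) (auto simp: P G H pair_graph_complement_graph parcs_complement_graph)
  then have "complement_graph H \<in> upward_closure (complement_graph ` P)"
    using G(1) pair_graph_complement_graph[OF H] by (auto simp: upward_closure_def)
  then show "H \<in> complement_graph ` upward_closure (complement_graph ` P)"
    using complement_complement_graph[OF H] by (metis imageI)
next
  fix H assume "H \<in> complement_graph ` upward_closure (complement_graph ` P)"
  then obtain K G where K: "H = complement_graph K" "pair_graph K" and G: "G \<in> P" "spanning (with_proj (complement_graph G)) (with_proj K)"
    by (auto simp: upward_closure_def)
  have PG: "pair_graph G" by (rule P[OF G(1)])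
  have sub: "pverts G = pverts K" "parcs (complement_graph G) \<subseteq> parcs K"
    using G(2) unfolding spanning_iff[OF pair_graph_complement_graph[OF PG] K(2)] by auto
  have pH: "pair_graph H" using K pair_graph_complement_graph by simp
  have "parcs H \<subseteq> parcs G" unfolding K(1) using sub by (auto simp: parcs_complement_graph)
  then have "spanning (with_proj H) (with_proj G)" unfolding spanning_iff[OF pH PG] using sub K(1) by simp
  then show "H \<in> downward_closure P" unfolding downward_closure_def using pH G(1) by blast
qed

subsection \<open>Hereditary properties\<close>

lemma edge_set_pairs: "finite V \<Longrightarrow> edge_set V (pairs V)"
  by (auto simp: edge_set_def pairs_def)

text \<open>If \<open>r\<close> has probability 0 under \<open>w\<close>, then almost surely some
  edge has weight 0 or some non-edge has weight 1. There \<open>w\<close> takes a value in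
  \<open>{0, 1}\<close>, so \<open>u\<close> agrees with it and the same factor vanishes.\<close>

lemma graph_prob_pos_flexing:
  assumes V: "finite V" "V \<noteq> {}" and w: "graphon w" and u: "graphon u"
    and ae: "AE z in lam \<Otimes>\<^sub>M lam. w z \<in> {0, 1} \<longrightarrow> u z = w z" and r: "r \<subseteq> pairs V"
    and pos: "0 < graph_prob V (\<lambda>_. lam) u r"
  shows "0 < graph_prob V (\<lambda>_. lam) w r"
proof (rule ccontr)
  let ?M = "Pi\<^sub>M V (\<lambda>_. lam)"
  have S: "sampler V (\<lambda>_. lam)" by (rule sampler_iid[OF V])
  assume "\<not> 0 < graph_prob V (\<lambda>_. lam) w r"
  then have "(\<integral>z. graph_weight V (at_points w z) r \<partial>?M) = 0"
    using graph_prob_nonneg[OF S w r] by (simp add: graph_prob_def)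
  then have z: "AE z in ?M. graph_weight V (at_points w z) r = 0"
    by (subst (asm) integral_nonneg_eq_0_iff_AE)
      (auto intro!: graph_weight_integrable[OF S w r] graph_weight_nonneg[OF r] at_points_bounds[OF w])
  have fin: "finite r" "finite (pairs V - r)" using finite_pairs[OF V(1)] r finite_subset by auto
  have "AE z in ?M. graph_weight V (at_points u z) r = 0"
    using z AE_edges[OF prob_space_lam edge_set_pairs[OF V(1)] ae]
  proof eventually_elim
    case (elim z)
    from elim(1) fin have "(\<exists>e\<in>r. at_points w z e = 0) \<or> (\<exists>e\<in>pairs V - r. at_points w z e = 1)"
      by (auto simp: graph_weight_def)
    then have "(\<exists>e\<in>r. at_points u z e = 0) \<or> (\<exists>e\<in>pairs V - r. at_points u z e = 1)"
    proof
      assume "\<exists>e\<in>r. at_points w z e = 0"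
      then obtain e where "e \<in> r" "at_points w z e = 0" by blast
      with elim(2) r show ?thesis by (intro disjI1 bexI[of _ e]) (auto simp: case_prod_beta')
    next
      assume "\<exists>e\<in>pairs V - r. at_points w z e = 1"
      then obtain e where "e \<in> pairs V - r" "at_points w z e = 1" by blast
      with elim(2) show ?thesis by (intro disjI2 bexI[of _ e]) (auto simp: case_prod_beta')
    qed
    then show ?case using fin by (auto simp: graph_weight_def)
  qed
  then have "graph_prob V (\<lambda>_. lam) u r = 0" unfolding graph_prob_def by (rule integral_eq_zero_AE)
  with pos show False by simp
qed

text \<open>The induced density of \<open>r\<close> in \<open>G n\<close> tends to its probability
  under \<open>w\<close>, which is positive. Without an injective copy only maps with a collision
  would contribute, and these are negligible.\<close>

lemma ex_induced_copy:
  assumes V: "finite V" and w: "graphon w" and r: "r \<subseteq> pairs V"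
    and G: "\<And>n. pair_graph (G n)" "filterlim (\<lambda>n. card (pverts (G n))) at_top sequentially"
    and lim: "\<And>E. edge_set V E \<Longrightarrow> (\<lambda>n. graph_dens V E (G n)) \<longlonglongrightarrow> dens lam V E w"
    and pos: "0 < graph_prob V (\<lambda>_. lam) w r"
  shows "\<exists>n h. inj_on h V \<and> h ` V \<subseteq> pverts (G n) \<and> (\<forall>(u, v)\<in>pairs V. (h u, h v) \<in> parcs (G n) \<longleftrightarrow> (u, v) \<in> r)"
proof (rule ccontr)
  assume neg: "\<not> ?thesis"
  let ?f = "\<lambda>n h. (\<Prod>(i, j)\<in>r. adj (parcs (G n)) (h i, h j)) * (\<Prod>(i, j)\<in>pairs V - r. 1 - adj (parcs (G n)) (h i, h j))"
  let ?q = "\<lambda>n. \<Sum>T\<in>Pow (pairs V - r). (-1) ^ card T * graph_dens V (r \<union> T) (G n)"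
  have E: "edge_set V (r \<union> (pairs V - r))" using edge_set_pairs[OF V] r by (simp add: Un_absorb1)
  have "graph_prob V (\<lambda>_. lam) w r = (\<integral>x. (\<Prod>(i, j)\<in>r. w (x i, x j)) * (\<Prod>(i, j)\<in>pairs V - r. 1 - w (x i, x j)) \<partial>Pi\<^sub>M V (\<lambda>_. lam))"
    by (simp add: graph_prob_def graph_weight_def case_prod_beta')
  also have "\<dots> = (\<Sum>T\<in>Pow (pairs V - r). (-1) ^ card T * dens lam V (r \<union> T) w)"
    by (rule lam.dens_mixed[OF E]) (use graphon_bounds[OF w] graphon_measurable[OF w] in auto)
  finally have "?q \<longlonglongrightarrow> graph_prob V (\<lambda>_. lam) w r"
    by (simp only:) (intro tendsto_sum tendsto_mult tendsto_const lim edge_set_mono[OF E], auto)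
  moreover have "?q \<longlonglongrightarrow> 0"
  proof (rule Lim_null_comparison)
    show "(\<lambda>n. (1 :: real) * (card V)\<^sup>2 / card (pverts (G n))) \<longlonglongrightarrow> 0" by (rule inverse_card_tendsto_0[OF G(2)])
    show "\<forall>\<^sub>F n in sequentially. norm (?q n) \<le> (1 :: real) * (card V)\<^sup>2 / card (pverts (G n))"
      using eventually_pverts_nonempty[OF G(2)]
    proof eventually_elim
      case (elim n)
      have fV: "finite (pverts (G n))" using G(1) by (simp add: pair_graph_iff)
      have "?q n = (\<Sum>h\<in>V \<rightarrow>\<^sub>E pverts (G n). ?f n h) / card (pverts (G n)) ^ card V"
        by (rule dens_mixed_uniform_count[OF E _ fV elim, symmetric]) (auto simp: adj_nonneg)
      also have "\<bar>\<dots>\<bar> \<le> (1 :: real) * (card V)\<^sup>2 / card (pverts (G n))"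
      proof (rule sum_noninj_le[OF V fV elim])
        fix h assume h: "h \<in> V \<rightarrow>\<^sub>E pverts (G n)"
        have "\<bar>\<Prod>(i, j)\<in>r. adj (parcs (G n)) (h i, h j)\<bar> \<le> 1" "\<bar>\<Prod>(i, j)\<in>pairs V - r. 1 - adj (parcs (G n)) (h i, h j)\<bar> \<le> 1"
          by (auto intro!: abs_prod_le_1 simp: adj_nonneg)
        then show "\<bar>?f n h\<bar> \<le> 1" by (simp add: abs_mult mult_le_one)
        assume inj: "inj_on h V"
        moreover have "h ` V \<subseteq> pverts (G n)" using h by auto
        ultimately obtain u v where uv: "(u, v) \<in> pairs V" "\<not> ((h u, h v) \<in> parcs (G n) \<longleftrightarrow> (u, v) \<in> r)"
          using neg by blast
        have a: "adj (parcs (G n)) (h u, h v) = of_bool ((h u, h v) \<in> parcs (G n))"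
          using G(1)[of n] by (auto simp: adj_def pair_graph_iff)
        have fin: "finite r" "finite (pairs V - r)" using finite_pairs[OF V] r finite_subset by auto
        show "?f n h = 0"
        proof (cases "(u, v) \<in> r")
          case True
          then have "(\<Prod>(i, j)\<in>r. adj (parcs (G n)) (h i, h j)) = 0"
            using uv a by (intro prod_zero fin bexI[of _ "(u, v)"]) auto
          then show ?thesis by simp
        next
          case False
          then have "(\<Prod>(i, j)\<in>pairs V - r. 1 - adj (parcs (G n)) (h i, h j)) = 0"
            using uv a by (intro prod_zero fin bexI[of _ "(u, v)"]) auto
          then show ?thesis by simp
        qed
      qed
      finally show ?case by (simp only: real_norm_def)
    qed
  qed
  ultimately have "graph_prob V (\<lambda>_. lam) w r = 0" by (rule LIMSEQ_unique)
  with pos show False by simp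
qed

text \<open>The image of \<open>h\<close> spans an induced subgraph \<open>H\<close>, which belongs
  to \<open>P\<close> by heredity; the inverse of \<open>h\<close> is an isomorphism from it onto
  \<open>graph_of V r\<close>.\<close>

lemma hereditary_graph_of:
  assumes P: "graph_property P" "hereditary P" and G: "G \<in> P" and V: "finite V" and r: "r \<subseteq> pairs V"
    and h: "inj_on h V" "h ` V \<subseteq> pverts G" "\<And>u v. (u, v) \<in> pairs V \<Longrightarrow> (h u, h v) \<in> parcs G \<longleftrightarrow> (u, v) \<in> r"
  shows "graph_of V r \<in> P"
proof -
  have pG: "pair_graph G" using P(1) G by (simp add: graph_property_def)
  define H :: ngraph where "H = \<lparr>pverts = h ` V, parcs = parcs G \<inter> (h ` V \<times> h ` V)\<rparr>"
  have pH: "pair_graph H" using pG V unfolding pair_graph_iff H_def by auto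
  interpret H: pair_graph H by fact
  interpret G: pair_graph G by fact
  have "induced_subgraph (with_proj H) (with_proj G)"
    unfolding induced_subgraph_def subgraph_def using H.wf_digraph_axioms G.wf_digraph_axioms h(2)
    by (auto simp: H_def compatible_def)
  then have HP: "H \<in> P" using P(2) G pH unfolding hereditary_def by blast
  define \<phi> where "\<phi> = the_inv_into V h"
  have \<phi>: "\<phi> (h v) = v" if "v \<in> V" for v unfolding \<phi>_def by (rule the_inv_into_f_f[OF h(1) that])
  let ?f = "\<lparr>iso_verts = \<phi>, iso_arcs = map_prod \<phi> \<phi>, iso_head = snd, iso_tail = fst\<rparr>"
  have arc: "(h u, h v) \<in> parcs G \<longleftrightarrow> (u, v) \<in> r \<or> (v, u) \<in> r" if "u \<in> V" "v \<in> V" for u v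
  proof (cases u v rule: linorder_cases)
    case less
    then show ?thesis using h(3)[of u v] that r by (auto simp: pairs_def)
  next
    case equal
    then show ?thesis using pG r by (auto simp: pairs_def pair_graph_iff)
  next
    case greater
    then have "(h v, h u) \<in> parcs G \<longleftrightarrow> (v, u) \<in> r" "(u, v) \<notin> r" using h(3)[of v u] that r by (auto simp: pairs_def)
    then show ?thesis using pG by (auto simp: pair_graph_iff)
  qed
  have "\<phi> ` h ` V = V" using \<phi> by (force simp: image_image)
  moreover have "map_prod \<phi> \<phi> ` parcs H = parcs (graph_of V r)"
  proof (intro equalityI subsetI)
    fix e assume "e \<in> map_prod \<phi> \<phi> ` parcs H"
    then obtain u v where "u \<in> V" "v \<in> V" "(h u, h v) \<in> parcs G" "e = (\<phi> (h u), \<phi> (h v))" by (auto simp: H_def)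
    then show "e \<in> parcs (graph_of V r)" using \<phi> arc by (simp add: parcs_graph_of)
  next
    fix e assume "e \<in> parcs (graph_of V r)"
    then obtain u v where e: "e = (u, v)" "(u, v) \<in> r \<or> (v, u) \<in> r" by (auto simp: parcs_graph_of)
    then have uv: "u \<in> V" "v \<in> V" using r by (auto simp: pairs_def)
    then have "(h u, h v) \<in> parcs H" using arc[OF uv] e by (auto simp: H_def)
    moreover have "e = map_prod \<phi> \<phi> (h u, h v)" using e \<phi> uv by simp
    ultimately show "e \<in> map_prod \<phi> \<phi> ` parcs H" by blast
  qed
  ultimately have "with_proj (graph_of V r) = app_iso ?f (with_proj H)"
    by (simp add: app_iso_def with_proj_def H_def)
  moreover have "H.digraph_isomorphism ?f"
  proof -
    have "inj_on \<phi> (h ` V)" by (rule inj_onI) (use \<phi> in auto)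
    then have "inj_on \<phi> (pverts H)" "inj_on (map_prod \<phi> \<phi>) (parcs H)"
      by (auto simp: H_def intro: inj_on_subset[OF map_prod_inj_on])
    then show ?thesis unfolding H.digraph_isomorphism_def using H.wf_digraph_axioms by auto
  qed
  ultimately have "digraph_iso (with_proj H) (with_proj (graph_of V r))"
    unfolding digraph_iso_def by blast
  moreover have "pair_graph (graph_of V r)"
    by (rule pair_graph_graph_of[OF V]) (use r in \<open>auto simp: pairs_def\<close>)
  ultimately show ?thesis using P(1) HP unfolding graph_property_def by blast
qed

lemma flexible_hereditary:
  assumes P: "graph_property P" "hereditary P"
  shows "flexible P"
proof -
  have pg: "pair_graph G" if "G \<in> P" for G using P(1) that by (simp add: graph_property_def)
  have "graph_limit P u"
    if w: "graphon w" and u: "graphon u" and lim: "graph_limit P w"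
      and ae: "AE z in lam \<Otimes>\<^sub>M lam. w z \<in> {0, 1} \<longrightarrow> u z = w z" for w u
    unfolding graph_limit_iff
  proof (intro allI impI)
    fix F :: "(nat set \<times> (nat \<times> nat) set) set" and e :: real and k :: nat
    assume F: "finite F" "\<forall>(I, E)\<in>F. edge_set I E" and e: "0 < e"
    obtain G where G: "\<And>n. G n \<in> P" "filterlim (\<lambda>n. card (pverts (G n))) at_top sequentially"
      "\<And>I E. edge_set I E \<Longrightarrow> (\<lambda>n. graph_dens I E (G n)) \<longlonglongrightarrow> dens lam I E w"
      using lim unfolding graph_limit_def by blast
    let ?S = "\<Sum>(I, E)\<in>F. 18 * real ((card I)\<^sup>2)"
    \<comment> \<open>Any vertex set larger than \<open>m\<close> meets the hypothesis of
      \<open>ex_typical_graph\<close>, and \<open>k\<close> is added below for the required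
      order.\<close>
    obtain m where m: "?S / e\<^sup>2 < real m" using reals_Archimedean2 by blast
    define V where "V = {..<m + k + 1}"
    have V: "finite V" "V \<noteq> {}" and c: "k \<le> card V" "m < card V" by (auto simp: V_def)
    have "?S < e\<^sup>2 * real m" using m e by (simp add: divide_less_eq mult.commute)
    also have "\<dots> \<le> e\<^sup>2 * real (card V)" using c(2) by (intro mult_left_mono) auto
    finally have "?S / card V < e\<^sup>2" using c(2) by (simp add: divide_less_eq)
    from ex_typical_graph[OF sampler_iid[OF V] u F(1) _ e this] F(2) obtain r
      where r: "r \<subseteq> pairs V" "0 < graph_prob V (\<lambda>_. lam) u r"
        "\<forall>(I, E)\<in>F. \<bar>dens (uniform_count_measure V) I E (adj r) - dens lam I E u\<bar> < e" by blast
    have "0 < graph_prob V (\<lambda>_. lam) w r" by (rule graph_prob_pos_flexing[OF V w u ae r(1,2)])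
    from ex_induced_copy[where G=G, OF V(1) w r(1) pg[OF G(1)] G(2) G(3) this] obtain n h
      where h: "inj_on h V" "h ` V \<subseteq> pverts (G n)" "\<forall>(u, v)\<in>pairs V. (h u, h v) \<in> parcs (G n) \<longleftrightarrow> (u, v) \<in> r"
      by blast
    have "graph_of V r \<in> P" by (rule hereditary_graph_of[OF P G(1)[of n] V(1) r(1) h(1,2)]) (use h(3) in auto)
    with r(3) c(1) show "\<exists>G\<in>P. k \<le> card (pverts G) \<and> (\<forall>(I, E)\<in>F. \<bar>graph_dens I E G - dens lam I E u\<bar> < e)"
      by (intro bexI[of _ "graph_of V r"]) (simp_all only: pverts_graph_of adj_graph_of simp_thms)
  qed
  with pg show ?thesis by (rule flexibleI)
qed

subsection \<open>Upward closures\<close>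

lemma eventually_cutf_of_C4:
  assumes D: "\<And>n. D n \<in> borel_measurable (lam \<Otimes>\<^sub>M lam)" "\<And>n z. \<bar>D n z\<bar> \<le> 1"
    and lim: "(\<lambda>n. C4 lam (D n)) \<longlonglongrightarrow> 0" and e: "0 < e"
  shows "\<forall>\<^sub>F n in sequentially. cutf lam (D n) e"
proof -
  have "0 < e ^ 4" using e by simp
  from order_tendstoD(2)[OF lim this] show ?thesis
  proof eventually_elim
    case (elim n)
    show ?case by (rule lam.cutf_of_C4[where B=1, OF D(1)]) (use elim e D(2) in auto)
  qed
qed

lemma dens_tendsto_of_cutf:
  assumes p: "\<And>n. graphon (p n)" and w: "graphon w" and E: "edge_set I E"
    and cut: "\<And>e. 0 < e \<Longrightarrow> \<forall>\<^sub>F n in sequentially. cutf lam (\<lambda>z. p n z - w z) e"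
  shows "(\<lambda>n. dens lam I E (p n)) \<longlonglongrightarrow> dens lam I E w"
proof (rule tendstoI)
  fix e :: real assume e: "0 < e"
  \<comment> \<open>The summand 1 covers graphs without edges.\<close>
  let ?d = "e / (real (card E) + 1)"
  have d: "0 < ?d" "card E * ?d < e" using e by (simp_all add: field_simps)
  from cut[OF d(1)] show "\<forall>\<^sub>F n in sequentially. dist (dens lam I E (p n)) (dens lam I E w) < e"
  proof eventually_elim
    case (elim n)
    have "\<bar>dens lam I E (p n) - dens lam I E w\<bar> \<le> card E * ?d"
      by (rule lam.dens_diff_le[OF E graphon_measurable[OF p] graphon_bounds[OF p] graphon_measurable[OF w] graphon_bounds[OF w] elim])
    with d(2) show ?case by (simp add: dist_real_def)
  qed
qed

lemma adj_sym: "adj r (u, v) = adj r (v, u)"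
  by (auto simp: adj_def)

lemma graphon_adj:
  assumes "uniformly_onto \<theta> V" "finite V"
  shows "graphon (\<lambda>z. adj r (\<theta> (fst z), \<theta> (snd z)))"
  using uniformly_onto_measurable2[OF assms, of "adj r"] adj_nonneg adj_sym[of r] by (auto simp: graphon_def)

lemma abs_graphon_diff_le: "graphon p \<Longrightarrow> graphon w \<Longrightarrow> \<bar>p z - w z\<bar> \<le> 1"
  using graphon_bounds[of p z] graphon_bounds[of w z] by linarith

text \<open>Compactness combined with the counting lemma. Placing the vertices on the interval
  leaves the densities of the graphs unchanged, so closeness in \<open>C4\<close> gives convergence
  of densities.\<close>

lemma graph_sequence_limit:
  fixes G :: "bool \<Rightarrow> nat \<Rightarrow> ngraph"
  assumes V: "\<And>i n. pverts (G i n) = V n" "\<And>n. finite (V n)" "\<And>n. V n \<noteq> {}"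
    and sub: "\<And>n. parcs (G False n) \<subseteq> parcs (G True n)"
  shows "\<exists>s \<theta> w. strict_mono (s :: nat \<Rightarrow> nat) \<and> (\<forall>n. uniformly_onto (\<theta> n) (V (s n))) \<and> (\<forall>i. graphon (w i)) \<and>
    (AE z in lam \<Otimes>\<^sub>M lam. w False z \<le> w True z) \<and>
    (\<forall>i. (\<lambda>n. C4 lam (\<lambda>z. adj (parcs (G i (s n))) (\<theta> n (fst z), \<theta> n (snd z)) - w i z)) \<longlonglongrightarrow> 0) \<and>
    (\<forall>i I E. edge_set I E \<longrightarrow> (\<lambda>n. graph_dens I E (G i (s n))) \<longlonglongrightarrow> dens lam I E (w i))"
proof -
  have "adj (parcs (G False n)) z \<le> adj (parcs (G True n)) z" for n z
    using sub[of n] by (cases z) (auto simp: adj_def)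
  then have "\<exists>s \<theta> w. strict_mono (s :: nat \<Rightarrow> nat) \<and> (\<forall>n. uniformly_onto (\<theta> n) (V (s n))) \<and> (\<forall>i. graphon (w i)) \<and>
    (AE z in lam \<Otimes>\<^sub>M lam. w False z \<le> w True z) \<and>
    (\<forall>i. (\<lambda>n. C4 lam (\<lambda>z. adj (parcs (G i (s n))) (\<theta> n (fst z), \<theta> n (snd z)) - w i z)) \<longlonglongrightarrow> 0)"
    by (intro graph_sequence_compact[where D="\<lambda>i n. adj (parcs (G i n))"] V adj_sym) (auto simp: adj_nonneg)
  then obtain s \<theta> w where s: "strict_mono (s :: nat \<Rightarrow> nat)" and \<theta>: "\<And>n. uniformly_onto (\<theta> n) (V (s n))"
    and w: "\<And>i. graphon (w i)" and le: "AE z in lam \<Otimes>\<^sub>M lam. w False z \<le> w True z"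
    and lim: "\<And>i. (\<lambda>n. C4 lam (\<lambda>z. adj (parcs (G i (s n))) (\<theta> n (fst z), \<theta> n (snd z)) - w i z)) \<longlonglongrightarrow> 0" by blast
  have "(\<lambda>n. graph_dens I E (G i (s n))) \<longlonglongrightarrow> dens lam I E (w i)" if E: "edge_set I E" for i I and E :: "(nat \<times> nat) set"
  proof -
    let ?a = "\<lambda>n z. adj (parcs (G i (s n))) (\<theta> n (fst z), \<theta> n (snd z))"
    have a: "graphon (?a n)" for n by (rule graphon_adj[OF \<theta> V(2)])
    have "(\<lambda>n. dens lam I E (?a n)) \<longlonglongrightarrow> dens lam I E (w i)"
    proof (rule dens_tendsto_of_cutf[where p="?a", OF a w E])
      fix e :: real assume e: "0 < e"
      show "\<forall>\<^sub>F n in sequentially. cutf lam (\<lambda>z. ?a n z - w i z) e"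
        by (rule eventually_cutf_of_C4[OF _ _ lim e])
          (use abs_graphon_diff_le[OF a w] borel_measurable_diff[OF graphon_measurable[OF a] graphon_measurable[OF w]] in auto)
    qed
    moreover have "dens lam I E (?a n) = graph_dens I E (G i (s n))" for n
    proof -
      have m: "adj (parcs (G i (s n))) \<in> borel_measurable (uniform_count_measure (V (s n)) \<Otimes>\<^sub>M uniform_count_measure (V (s n)))"
        by (rule measurable_uniform_count_pair) (use V(2) in auto)
      show ?thesis using dens_distr[OF prob_space_lam _ _ E m, of "\<theta> n"] \<theta>[of n]
        by (simp add: uniformly_onto_def V(1) case_prod_beta')
    qed
    ultimately show ?thesis by simp
  qed
  with s \<theta> w le lim show ?thesis by blast
qed

lemma measurable_pullback:
  assumes "\<psi> \<in> measurable lam lam" "w \<in> borel_measurable (lam \<Otimes>\<^sub>M lam)"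
  shows "(\<lambda>z. w (\<psi> (fst z), \<psi> (snd z))) \<in> borel_measurable (lam \<Otimes>\<^sub>M lam)"
  using assms by measurable

lemma graphon_pullback:
  assumes "\<psi> \<in> measurable lam lam" "graphon w"
  shows "graphon (\<lambda>z. w (\<psi> (fst z), \<psi> (snd z)))"
  using measurable_pullback[OF assms(1) graphon_measurable[OF assms(2)]] graphon_bounds[OF assms(2)] graphon_sym[OF assms(2)]
  by (auto simp: graphon_def)

lemma dens_pullback:
  assumes "\<psi> \<in> measurable lam lam" "distr lam lam \<psi> = lam" "graphon w" "edge_set I E"
  shows "dens lam I E (\<lambda>z. w (\<psi> (fst z), \<psi> (snd z))) = dens lam I E w"
  using dens_distr[OF prob_space_lam assms(1,2,4) graphon_measurable[OF assms(3)]] by (simp add: case_prod_beta')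

lemma AE_pullback:
  assumes \<psi>: "\<psi> \<in> measurable lam lam" "distr lam lam \<psi> = lam" and ae: "AE z in lam \<Otimes>\<^sub>M lam. Q z"
  shows "AE z in lam \<Otimes>\<^sub>M lam. Q (\<psi> (fst z), \<psi> (snd z))"
proof -
  have pm: "lam \<Otimes>\<^sub>M lam = distr (lam \<Otimes>\<^sub>M lam) (lam \<Otimes>\<^sub>M lam) (\<lambda>(x, y). (\<psi> x, \<psi> y))"
    using pair_measure_distr[OF \<psi>(1) \<psi>(1)] \<psi>(2) lam.sigma_finite_measure_axioms by simp
  have "AE z in distr (lam \<Otimes>\<^sub>M lam) (lam \<Otimes>\<^sub>M lam) (\<lambda>(x, y). (\<psi> x, \<psi> y)). Q z"
    by (subst pm[symmetric]) (rule ae)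
  from AE_distrD[OF _ this] \<psi>(1) show ?thesis by (simp add: case_prod_beta')
qed

text \<open>The law of a uniform point conditioned on its label being \<open>v\<close>. Indices
  outside \<open>V\<close> get \<open>lam\<close>, so that a probability measure is assigned to
  every index.\<close>

definition fibre_measure :: "(real \<Rightarrow> nat) \<Rightarrow> nat set \<Rightarrow> nat \<Rightarrow> real measure" where
  "fibre_measure \<eta> V v = (if v \<in> V then density lam (\<lambda>x. ennreal (real (card V) * of_bool (\<eta> x = v))) else lam)"

lemma uniformly_onto_fibre:
  assumes "uniformly_onto \<eta> V"
  shows "{x \<in> space lam. \<eta> x = v} \<in> sets lam"
proof (cases "v \<in> V")
  case True
  have m: "\<eta> \<in> measurable lam (uniform_count_measure V)" using assms by (simp add: uniformly_onto_def)
  have "\<eta> -` {v} \<inter> space lam \<in> sets lam"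
    by (rule measurable_sets[OF m]) (use True in \<open>simp add: sets_uniform_count_measure\<close>)
  then show ?thesis by (simp add: vimage_def Int_def conj_commute)
next
  case False
  then have "{x \<in> space lam. \<eta> x = v} = {}" using uniformly_onto_in[OF assms] by auto
  then show ?thesis by (simp only: sets.empty_sets)
qed

lemma fibre_density_measurable:
  assumes "uniformly_onto \<eta> V"
  shows "(\<lambda>x. c * of_bool (\<eta> x = v) :: real) \<in> borel_measurable lam"
proof -
  have "(\<lambda>x. c * indicator {x \<in> space lam. \<eta> x = v} x) \<in> borel_measurable lam"
    by (intro borel_measurable_times borel_measurable_const borel_measurable_indicator uniformly_onto_fibre[OF assms])
  then show ?thesis by (rule measurable_cong[THEN iffD1, rotated]) (simp add: indicator_def)
qed

lemma AE_fibre_measure: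
  assumes \<eta>: "uniformly_onto \<eta> V" and "v \<in> V"
  shows "AE x in fibre_measure \<eta> V v. \<eta> x = v"
proof -
  have m: "(\<lambda>x. ennreal (real (card V) * of_bool (\<eta> x = v))) \<in> borel_measurable lam"
    by (rule measurable_compose[OF fibre_density_measurable[OF \<eta>] measurable_ennreal])
  show ?thesis unfolding fibre_measure_def using assms(2) by (simp add: AE_density[OF m] of_bool_def)
qed

text \<open>The fibres partition the interval into sets of mass \<open>1 / card V\<close>, so the
  conditional laws average to \<open>lam\<close>.\<close>

lemma sampler_fibre_measure:
  assumes \<eta>: "uniformly_onto \<eta> V" and V: "finite V" "V \<noteq> {}"
  shows "sampler V (fibre_measure \<eta> V)"
proof -
  have mE: "(\<lambda>x. ennreal (real (card V) * of_bool (\<eta> x = v))) \<in> borel_measurable lam" for v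
    by (rule measurable_compose[OF fibre_density_measurable[OF \<eta>] measurable_ennreal])
  have N: "0 < real (card V)" using V by (simp add: card_gt_0_iff)
  have "prob_space (fibre_measure \<eta> V v)" for v
  proof (cases "v \<in> V")
    case True
    have em: "emeasure lam {x \<in> space lam. \<eta> x = v} = ennreal (1 / card V)"
    proof -
      have "emeasure lam {x \<in> space lam. \<eta> x = v} = emeasure (distr lam (uniform_count_measure V) \<eta>) {v}"
        using \<eta> True by (subst emeasure_distr) (auto simp: uniformly_onto_def sets_uniform_count_measure intro!: arg_cong[where f="emeasure lam"])
      also have "\<dots> = ennreal (1 / card V)"
        using \<eta> True V by (simp add: uniformly_onto_def emeasure_uniform_count_measure)
      finally show ?thesis .
    qed
    have "emeasure (fibre_measure \<eta> V v) (space lam) = (\<integral>\<^sup>+x. ennreal (card V) * indicator {x \<in> space lam. \<eta> x = v} x \<partial>lam)"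
      using True by (simp add: fibre_measure_def emeasure_density[OF mE] del: space_lam) (auto intro!: nn_integral_cong simp: indicator_def)
    also have "\<dots> = ennreal (card V) * ennreal (1 / card V)"
      using uniformly_onto_fibre[OF \<eta>, of v] by (simp add: nn_integral_cmult_indicator em del: space_lam)
    also have "\<dots> = 1" using N by (simp flip: ennreal_mult')
    finally show ?thesis by (intro prob_spaceI) (use True in \<open>simp add: fibre_measure_def\<close>)
  qed (simp add: fibre_measure_def prob_space_lam)
  moreover have "(\<Sum>v\<in>V. \<integral>x. f x \<partial>fibre_measure \<eta> V v) = real (card V) * (\<integral>x. f x \<partial>lam)"
    if f[measurable]: "f \<in> borel_measurable lam" and B: "\<forall>x\<in>{0..1}. \<bar>f x\<bar> \<le> B" for f B
  proof -
    have "(\<integral>x. f x \<partial>fibre_measure \<eta> V v) = (\<integral>x. (real (card V) * of_bool (\<eta> x = v)) * f x \<partial>lam)" if "v \<in> V" for v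
      using that by (simp add: fibre_measure_def integral_density[OF f fibre_density_measurable[OF \<eta>]])
    then have "(\<Sum>v\<in>V. \<integral>x. f x \<partial>fibre_measure \<eta> V v) = (\<Sum>v\<in>V. \<integral>x. (real (card V) * of_bool (\<eta> x = v)) * f x \<partial>lam)" by simp
    also have "\<dots> = (\<integral>x. (\<Sum>v\<in>V. (real (card V) * of_bool (\<eta> x = v)) * f x) \<partial>lam)"
    proof (rule Bochner_Integration.integral_sum[symmetric])
      fix v
      show "integrable lam (\<lambda>x. (real (card V) * of_bool (\<eta> x = v)) * f x)"
      proof (rule lam.integrable_bdd[where B="real (card V) * B"])
        fix x assume "x \<in> space lam"
        then have "\<bar>f x\<bar> \<le> B" using B by simp
        then show "\<bar>(real (card V) * of_bool (\<eta> x = v)) * f x\<bar> \<le> real (card V) * B"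
          using N by (cases "\<eta> x = v") (auto simp: abs_mult mult_left_mono intro: order_trans[OF abs_ge_zero])
      qed (intro borel_measurable_times fibre_density_measurable[OF \<eta>] f)
    qed
    also have "\<dots> = (\<integral>x. real (card V) * f x \<partial>lam)"
    proof (rule Bochner_Integration.integral_cong[OF refl])
      fix x assume "x \<in> space lam"
      then have "\<eta> x \<in> V" using uniformly_onto_in[OF \<eta>] by simp
      then have "(\<Sum>v\<in>V. of_bool (\<eta> x = v) :: real) = 1" using V(1) by (simp add: of_bool_def sum.delta')
      then show "(\<Sum>v\<in>V. (real (card V) * of_bool (\<eta> x = v)) * f x) = real (card V) * f x"
        by (simp flip: sum_distrib_right sum_distrib_left)
    qed
    finally show ?thesis by simp
  qed
  ultimately show ?thesis unfolding sampler_def using V by (auto simp: fibre_measure_def)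
qed

text \<open>The point of a vertex lies almost surely in the fibre of that vertex. A pair in
  \<open>k\<close> therefore has edge probability 1, and every sample that omits it has probability
  0.\<close>

lemma graph_prob_contains_edges:
  assumes \<eta>: "uniformly_onto \<eta> V" and V: "finite V" "V \<noteq> {}" and r: "r \<subseteq> pairs V"
    and one: "\<And>x y. (\<eta> x, \<eta> y) \<in> k \<Longrightarrow> p (x, y) = 1"
    and pos: "0 < graph_prob V (fibre_measure \<eta> V) p r" and e: "(u, v) \<in> pairs V" "(u, v) \<in> k"
  shows "(u, v) \<in> r"
proof (rule ccontr)
  assume nr: "(u, v) \<notin> r"
  let ?M = "Pi\<^sub>M V (fibre_measure \<eta> V)"
  have prob: "prob_space (fibre_measure \<eta> V i)" for i
    using sampler_fibre_measure[OF \<eta> V] by (simp add: sampler_def)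
  have uv: "u \<in> V" "v \<in> V" using e by (auto simp: pairs_def)
  have "AE z in ?M. \<eta> (z u) = u" "AE z in ?M. \<eta> (z v) = v"
    using uv by (auto intro!: AE_PiM_component prob AE_fibre_measure[OF \<eta>])
  then have "AE z in ?M. graph_weight V (at_points p z) r = 0"
  proof eventually_elim
    case (elim z)
    have "finite (pairs V - r)" using finite_pairs[OF V(1)] by simp
    then have "(\<Prod>e\<in>pairs V - r. 1 - at_points p z e) = 0"
      by (rule prod_zero) (use nr e one[of "z u" "z v"] elim in \<open>auto intro!: bexI[of _ "(u, v)"]\<close>)
    then show ?case by (simp add: graph_weight_def)
  qed
  then have "graph_prob V (fibre_measure \<eta> V) p r = 0" unfolding graph_prob_def by (rule integral_eq_zero_AE)
  with pos show False by simp
qed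

lemma graph_limit_nonempty:
  assumes "graph_limit P w"
  shows "\<exists>G. (\<forall>n. G n \<in> P \<and> pverts (G n) \<noteq> {}) \<and> filterlim (\<lambda>n. card (pverts (G n))) at_top sequentially \<and>
    (\<forall>I E. edge_set I E \<longrightarrow> (\<lambda>n. graph_dens I E (G n)) \<longlonglongrightarrow> dens lam I E w)"
proof -
  obtain G where G: "\<And>n. G n \<in> P" "filterlim (\<lambda>n. card (pverts (G n))) at_top sequentially"
    "\<And>I E. edge_set I E \<Longrightarrow> (\<lambda>n. graph_dens I E (G n)) \<longlonglongrightarrow> dens lam I E w"
    using assms unfolding graph_limit_def by blast
  from eventually_pverts_nonempty[OF G(2)] obtain m where m: "\<And>n. m \<le> n \<Longrightarrow> pverts (G n) \<noteq> {}"
    unfolding eventually_sequentially by blast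
  have f: "filterlim (\<lambda>n. n + m) at_top sequentially" by (rule filterlim_add_const_nat_at_top)
  show ?thesis
  proof (intro exI[of _ "\<lambda>n. G (n + m)"] conjI allI impI)
    show "filterlim (\<lambda>n. card (pverts (G (n + m)))) at_top sequentially" by (rule filterlim_compose[OF G(2) f])
    show "(\<lambda>n. graph_dens I E (G (n + m))) \<longlonglongrightarrow> dens lam I E w" if "edge_set I E" for I E
      by (rule filterlim_compose[OF G(3)[OF that] f])
  qed (use G(1) m in auto)
qed

text \<open>
  If \<open>P\<close> has the graph limit \<open>m \<le> v\<close>, then adding random edges to the graphs of \<open>P\<close> with the
  right probabilities produces graphs that converge to \<open>v\<close>.
\<close>

lemma graph_limit_upward_closure:
  assumes P: "\<And>G. G \<in> P \<Longrightarrow> pair_graph G" and lim: "graph_limit P m"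
    and m: "graphon m" and a: "graphon a" and le: "\<And>z. m z \<le> a z"
  shows "graph_limit (upward_closure P) a"
proof -
  obtain K where K: "\<And>n. K n \<in> P" "\<And>n. pverts (K n) \<noteq> {}" "filterlim (\<lambda>n. card (pverts (K n))) at_top sequentially"
    "\<And>I E. edge_set I E \<Longrightarrow> (\<lambda>n. graph_dens I E (K n)) \<longlonglongrightarrow> dens lam I E m"
    using graph_limit_nonempty[OF lim] by blast
  have pK: "pair_graph (K n)" for n by (rule P[OF K(1)])
  have fK: "finite (pverts (K n))" for n using pK by (simp add: pair_graph_iff)
  \<comment> \<open>The same sequence is used for both indices; a single placement and its limit are
    wanted.\<close>
  have "\<exists>s \<theta> w. strict_mono (s :: nat \<Rightarrow> nat) \<and> (\<forall>n. uniformly_onto (\<theta> n) (pverts (K (s n)))) \<and> (\<forall>i. graphon (w i)) \<and>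
    (AE z in lam \<Otimes>\<^sub>M lam. w False z \<le> w True z) \<and>
    (\<forall>i :: bool. (\<lambda>n. C4 lam (\<lambda>z. adj (parcs (K (s n))) (\<theta> n (fst z), \<theta> n (snd z)) - w i z)) \<longlonglongrightarrow> 0) \<and>
    (\<forall>i I E. edge_set I E \<longrightarrow> (\<lambda>n. graph_dens I E (K (s n))) \<longlonglongrightarrow> dens lam I E (w i))"
    by (rule graph_sequence_limit[where G="\<lambda>_. K"]) (use K(2) fK in auto)
  then obtain s \<theta> Y where s: "strict_mono (s :: nat \<Rightarrow> nat)" and \<theta>: "\<And>n. uniformly_onto (\<theta> n) (pverts (K (s n)))"
    and Y: "\<And>i :: bool. graphon (Y i)"
    and C4: "\<And>i. (\<lambda>n. C4 lam (\<lambda>z. adj (parcs (K (s n))) (\<theta> n (fst z), \<theta> n (snd z)) - Y i z)) \<longlonglongrightarrow> 0"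
    and dY: "\<And>i I E. edge_set I E \<Longrightarrow> (\<lambda>n. graph_dens I E (K (s n))) \<longlonglongrightarrow> dens lam I E (Y i)"
    by blast
  define y where "y = Y True"
  have y: "graphon y" using Y by (simp add: y_def)
  have dmy: "dens lam I E m = dens lam I E y" if E: "edge_set I E" for I :: "nat set" and E
    unfolding y_def by (rule LIMSEQ_unique[OF LIMSEQ_subseq_LIMSEQ[OF K(4)[OF E] s, unfolded o_def] dY[OF E]])
  \<comment> \<open>The limit \<open>y\<close> has the densities of \<open>m\<close> but lives on
    another copy of the interval. On a common copy, \<open>v\<close> and \<open>b\<close> below are
    the pullbacks of \<open>a\<close> and \<open>y\<close>.\<close>
  have "\<exists>\<psi>. (\<forall>i. \<psi> i \<in> measurable lam lam \<and> distr lam lam (\<psi> i) = lam) \<and>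
    (AE z in lam \<Otimes>\<^sub>M lam. m (\<psi> False (fst z), \<psi> False (snd z)) = y (\<psi> True (fst z), \<psi> True (snd z)))"
    using weak_isomorphism[where W="\<lambda>i. if i then y else m"] m y dmy by simp
  then obtain \<psi> where \<psi>: "\<And>i :: bool. \<psi> i \<in> measurable lam lam" "\<And>i. distr lam lam (\<psi> i) = lam"
    and my: "AE z in lam \<Otimes>\<^sub>M lam. m (\<psi> False (fst z), \<psi> False (snd z)) = y (\<psi> True (fst z), \<psi> True (snd z))" by blast
  define v where "v z = a (\<psi> False (fst z), \<psi> False (snd z))" for z
  define b where "b z = y (\<psi> True (fst z), \<psi> True (snd z))" for z
  \<comment> \<open>The conditional probability of adding a missing edge, which solves
    \<open>b + (1 - b) * \<rho> = v\<close>. Where \<open>b\<close> is 1 nothing is left to add.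
    Clipping is needed because \<open>b \<le> v\<close> holds only almost everywhere.\<close>
  define \<rho> where "\<rho> z = (if b z = 1 then 0 else max 0 (min 1 ((v z - b z) / (1 - b z))))" for z
  define \<eta> where "\<eta> n x = \<theta> n (\<psi> True x)" for n x
  define k where "k n z = adj (parcs (K (s n))) (\<eta> n (fst z), \<eta> n (snd z))" for n and z :: "real \<times> real"
  define p where "p n z = k n z + (1 - k n z) * \<rho> z" for n z
  define v' where "v' z = b z + (1 - b z) * \<rho> z" for z
  have v: "graphon v" and b: "graphon b" unfolding v_def[abs_def] b_def[abs_def]
    using graphon_pullback[OF \<psi>(1)] a y by blast+
  have [measurable]: "v \<in> borel_measurable (lam \<Otimes>\<^sub>M lam)" "b \<in> borel_measurable (lam \<Otimes>\<^sub>M lam)"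
    using v b by (auto intro: graphon_measurable)
  have \<rho>m[measurable]: "\<rho> \<in> borel_measurable (lam \<Otimes>\<^sub>M lam)" unfolding \<rho>_def[abs_def] by measurable
  have \<rho>01: "0 \<le> \<rho> z \<and> \<rho> z \<le> 1" for z by (simp add: \<rho>_def)
  have \<rho>s: "\<rho> (x, x') = \<rho> (x', x)" for x x' by (simp add: \<rho>_def graphon_sym[OF v, of x x'] graphon_sym[OF b, of x x'])
  have mix: "graphon (\<lambda>z. c z + (1 - c z) * \<rho> z)" if c: "graphon c" for c
  proof -
    have [measurable]: "c \<in> borel_measurable (lam \<Otimes>\<^sub>M lam)" by (rule graphon_measurable[OF c])
    have "0 \<le> c z + (1 - c z) * \<rho> z \<and> c z + (1 - c z) * \<rho> z \<le> 1" for z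
    proof -
      have "0 \<le> (1 - c z) * \<rho> z" "(1 - c z) * \<rho> z \<le> 1 - c z"
        using graphon_bounds[OF c, of z] \<rho>01[of z] by (auto intro!: mult_left_le)
      then show ?thesis using graphon_bounds[OF c, of z] by linarith
    qed
    moreover have "(\<lambda>z. c z + (1 - c z) * \<rho> z) \<in> borel_measurable (lam \<Otimes>\<^sub>M lam)" by measurable
    moreover have "c (x, x') + (1 - c (x, x')) * \<rho> (x, x') = c (x', x) + (1 - c (x', x)) * \<rho> (x', x)" for x x'
      by (simp only: graphon_sym[OF c, of x x'] \<rho>s[of x x'])
    ultimately show ?thesis unfolding graphon_def by blast
  qed
  have \<eta>: "uniformly_onto (\<eta> n) (pverts (K (s n)))" for n
  proof -
    let ?U = "uniform_count_measure (pverts (K (s n)))"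
    have t: "\<theta> n \<in> measurable lam ?U" "distr lam ?U (\<theta> n) = ?U" using \<theta>[of n] by (auto simp: uniformly_onto_def)
    have "\<eta> n \<in> measurable lam ?U" unfolding \<eta>_def[abs_def] by (rule measurable_compose[OF \<psi>(1) t(1)])
    moreover have "distr lam ?U (\<eta> n) = ?U"
      using distr_distr[OF t(1) \<psi>(1)[of True]] by (simp add: \<psi>(2) t(2) o_def \<eta>_def[abs_def])
    ultimately show ?thesis by (simp add: uniformly_onto_def)
  qed
  have k: "graphon (k n)" for n unfolding k_def[abs_def] by (rule graphon_adj[OF \<eta> fK])
  have p: "graphon (p n)" for n unfolding p_def[abs_def] by (rule mix[OF k])
  have v': "graphon v'" unfolding v'_def[abs_def] by (rule mix[OF b])
  have kb: "(\<lambda>z. k n z - b z) \<in> borel_measurable (lam \<Otimes>\<^sub>M lam)" "\<bar>k n z - b z\<bar> \<le> 1" for n z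
    using borel_measurable_diff[OF graphon_measurable[OF k[of n]] graphon_measurable[OF b]] abs_graphon_diff_le[OF k b] by auto
  have C4b: "(\<lambda>n. C4 lam (\<lambda>z. k n z - b z)) \<longlonglongrightarrow> 0"
  proof -
    have "C4 lam (\<lambda>z. k n z - b z) = C4 lam (\<lambda>z. adj (parcs (K (s n))) (\<theta> n (fst z), \<theta> n (snd z)) - y z)" for n
    proof -
      have "(\<lambda>z. adj (parcs (K (s n))) (\<theta> n (fst z), \<theta> n (snd z)) - y z) \<in> borel_measurable (lam \<Otimes>\<^sub>M lam)"
        by (intro borel_measurable_diff graphon_measurable[OF y] graphon_measurable[OF graphon_adj[OF \<theta> fK]])
      from C4_distr[OF prob_space_lam \<psi>(1)[of True] \<psi>(2)[of True] this] show ?thesis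
        by (simp add: k_def \<eta>_def b_def case_prod_beta')
    qed
    with C4[of True] show ?thesis by (simp add: y_def)
  qed
  have cut: "\<forall>\<^sub>F n in sequentially. cutf lam (\<lambda>z. p n z - v' z) e" if e: "0 < e" for e
  proof -
    \<comment> \<open>Since \<open>p n - v'\<close> equals \<open>(k n - b) * (1 - \<rho>)\<close>,
      closeness of the graphs to \<open>b\<close> passes to the edge probabilities through the fixed
      multiplier \<open>1 - \<rho>\<close>.\<close>
    have "\<exists>K\<ge>0. \<forall>D d. D \<in> borel_measurable (lam \<Otimes>\<^sub>M lam) \<longrightarrow> (\<forall>x\<in>space lam. \<forall>y\<in>space lam. \<bar>D (x, y)\<bar> \<le> 1) \<longrightarrow>
      cutf lam D d \<longrightarrow> cutf lam (\<lambda>z. D z * (1 - \<rho> z)) (K * d + e / 2)"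
      by (rule lam.cutf_mult[where B=1]) (use e \<rho>01 in auto)
    then obtain c where c: "0 \<le> c" "\<And>D d. D \<in> borel_measurable (lam \<Otimes>\<^sub>M lam) \<Longrightarrow> (\<forall>x\<in>space lam. \<forall>y\<in>space lam. \<bar>D (x, y)\<bar> \<le> 1) \<Longrightarrow>
      cutf lam D d \<Longrightarrow> cutf lam (\<lambda>z. D z * (1 - \<rho> z)) (c * d + e / 2)" by blast
    let ?d = "e / 2 / (c + 1)"
    have d: "0 < ?d" using e c(1) by simp
    have "c * ?d \<le> (c + 1) * ?d" using d by (intro mult_right_mono) auto
    then have "c * ?d + e / 2 \<le> (c + 1) * ?d + e / 2" by (rule add_right_mono)
    moreover have "(c + 1) * ?d = e / 2"
      by (subst times_divide_eq_right, rule nonzero_mult_div_cancel_left) (use c(1) in linarith)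
    ultimately have ce: "c * ?d + e / 2 \<le> e" by (simp only: field_sum_of_halves)
    from eventually_cutf_of_C4[OF kb C4b d] show ?thesis
    proof eventually_elim
      case (elim n)
      have "cutf lam (\<lambda>z. (k n z - b z) * (1 - \<rho> z)) (c * ?d + e / 2)" by (rule c(2)[OF kb(1) _ elim]) (use kb(2) in auto)
      also have "(\<lambda>z. (k n z - b z) * (1 - \<rho> z)) = (\<lambda>z. p n z - v' z)"
        by (simp add: fun_eq_iff p_def v'_def algebra_simps)
      finally show ?case using ce unfolding cutf_def by (meson order_trans)
    qed
  qed
  have "AE z in lam \<Otimes>\<^sub>M lam. v' z = v z" using my
  proof eventually_elim
    case (elim z)
    have bv: "b z \<le> v z" using elim le[of "(\<psi> False (fst z), \<psi> False (snd z))"] by (simp add: b_def v_def)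
    show ?case
    proof (cases "b z = 1")
      case True
      with bv graphon_bounds[OF v, of z] show ?thesis by (simp add: v'_def)
    next
      case False
      then have "b z < 1" using graphon_bounds[OF b, of z] by simp
      then have "\<rho> z = (v z - b z) / (1 - b z)" using bv graphon_bounds[OF v, of z] by (simp add: \<rho>_def divide_le_eq)
      with \<open>b z < 1\<close> show ?thesis by (simp add: v'_def)
    qed
  qed
  then have dv: "dens lam I E v' = dens lam I E a" if E: "edge_set I E" for I :: "nat set" and E
    using lam.dens_cong_AE[OF E graphon_measurable[OF v'] graphon_measurable[OF v]] dens_pullback[OF \<psi>(1,2) a E, of False]
    by (simp add: v_def[abs_def])
  show ?thesis unfolding graph_limit_iff
  proof (intro allI impI)
    fix F :: "(nat set \<times> (nat \<times> nat) set) set" and e :: real and N :: nat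
    assume F: "finite F" "\<forall>(I, E)\<in>F. edge_set I E" and e: "0 < e"
    let ?S = "\<Sum>(I, E)\<in>F. 18 * real ((card I)\<^sup>2)"
    have cs: "filterlim (\<lambda>n. card (pverts (K (s n)))) at_top sequentially"
      by (rule filterlim_compose[OF K(3) filterlim_subseq[OF s]])
    have "\<forall>\<^sub>F n in sequentially. N \<le> card (pverts (K (s n)))" using cs unfolding filterlim_at_top by blast
    moreover have "\<forall>\<^sub>F n in sequentially. ?S / card (pverts (K (s n))) < (e / 2)\<^sup>2"
      by (rule order_tendstoD(2)[OF inverse_card_tendsto_0[OF cs]]) (use e in simp)
    moreover have "\<forall>\<^sub>F n in sequentially. \<forall>q\<in>F. \<bar>dens lam (fst q) (snd q) (p n) - dens lam (fst q) (snd q) v'\<bar> < e / 2"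
      using F(1)
    proof (rule eventually_ball_finite, intro ballI)
      fix q assume "q \<in> F"
      then have E: "edge_set (fst q) (snd q)" using F(2) by auto
      from tendstoD[OF dens_tendsto_of_cutf[where p=p, OF p v' E cut], of "e / 2"] e
      show "\<forall>\<^sub>F n in sequentially. \<bar>dens lam (fst q) (snd q) (p n) - dens lam (fst q) (snd q) v'\<bar> < e / 2"
        by (simp add: dist_real_def)
    qed
    ultimately have "\<forall>\<^sub>F n in sequentially. N \<le> card (pverts (K (s n))) \<and> ?S / card (pverts (K (s n))) < (e / 2)\<^sup>2 \<and>
      (\<forall>q\<in>F. \<bar>dens lam (fst q) (snd q) (p n) - dens lam (fst q) (snd q) v'\<bar> < e / 2)"
      by eventually_elim blast
    then obtain n where n: "N \<le> card (pverts (K (s n)))" "?S / card (pverts (K (s n))) < (e / 2)\<^sup>2"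
      "\<forall>q\<in>F. \<bar>dens lam (fst q) (snd q) (p n) - dens lam (fst q) (snd q) v'\<bar> < e / 2"
      unfolding eventually_sequentially by blast
    let ?V = "pverts (K (s n))"
    have e2: "0 < e / 2" using e by simp
    \<comment> \<open>Sampling from the fibres keeps the vertex set of \<open>K (s n)\<close>, and
      positive probability forces all of its edges into the sample \<open>r\<close>.\<close>
    from ex_typical_graph[OF sampler_fibre_measure[OF \<eta> fK K(2)] p F(1) _ e2 n(2)] F(2) obtain r
      where r: "r \<subseteq> pairs ?V" "0 < graph_prob ?V (fibre_measure (\<eta> n) ?V) (p n) r"
        "\<forall>(I, E)\<in>F. \<bar>dens (uniform_count_measure ?V) I E (adj r) - dens lam I E (p n)\<bar> < e / 2" by blast
    have "p n (x, x') = 1" if "(\<eta> n x, \<eta> n x') \<in> parcs (K (s n))" for x x'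
      using that by (simp add: p_def k_def adj_def)
    from graph_prob_contains_edges[OF \<eta> fK K(2) r(1) this r(2)]
    have kr: "(i, j) \<in> r" if "(i, j) \<in> pairs ?V" "(i, j) \<in> parcs (K (s n))" for i j using that by blast
    have "parcs (K (s n)) \<subseteq> parcs (graph_of ?V r)"
    proof clarify
      fix i j assume ij: "(i, j) \<in> parcs (K (s n))"
      then have ji: "(j, i) \<in> parcs (K (s n))" "i \<noteq> j" "i \<in> ?V" "j \<in> ?V" using pK[of "s n"] by (auto simp: pair_graph_iff)
      then have "(i, j) \<in> pairs ?V \<or> (j, i) \<in> pairs ?V" by (auto simp: pairs_def)
      with kr ij ji(1) show "(i, j) \<in> parcs (graph_of ?V r)" by (auto simp: parcs_graph_of)
    qed
    moreover have gr: "pair_graph (graph_of ?V r)"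
      by (rule pair_graph_graph_of[OF fK]) (use r(1) in \<open>auto simp: pairs_def\<close>)
    ultimately have "spanning (with_proj (K (s n))) (with_proj (graph_of ?V r))"
      by (simp add: spanning_iff[OF pK gr])
    then have up: "graph_of ?V r \<in> upward_closure P" unfolding upward_closure_def using gr K(1) by blast
    have close: "\<bar>graph_dens I E (graph_of ?V r) - dens lam I E a\<bar> < e" if "(I, E) \<in> F" for I E
    proof -
      have "\<bar>dens (uniform_count_measure ?V) I E (adj r) - dens lam I E (p n)\<bar> < e / 2" using r(3) that by auto
      moreover have "\<bar>dens lam I E (p n) - dens lam I E v'\<bar> < e / 2" using bspec[OF n(3) that] by simp
      moreover have "dens lam I E v' = dens lam I E a" using F(2) that by (intro dv) auto
      ultimately show ?thesis unfolding pverts_graph_of adj_graph_of by linarith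
    qed
    show "\<exists>G\<in>upward_closure P. N \<le> card (pverts G) \<and> (\<forall>(I, E)\<in>F. \<bar>graph_dens I E G - dens lam I E a\<bar> < e)"
      by (rule bexI[OF _ up]) (use n(1) close in \<open>auto\<close>)
  qed
qed

lemma flexible_upward_closure:
  assumes P: "\<And>G. G \<in> P \<Longrightarrow> pair_graph G" and fl: "flexible P"
  shows "flexible (upward_closure P)"
proof (rule flexibleI)
  show "pair_graph G" if "G \<in> upward_closure P" for G using that by (simp add: upward_closure_def)
  fix w u assume w: "graphon w" and u: "graphon u" and lim: "graph_limit (upward_closure P) w"
    and ae: "AE z in lam \<Otimes>\<^sub>M lam. w z \<in> {0, 1} \<longrightarrow> u z = w z"
  obtain G where G: "\<And>n. G n \<in> upward_closure P" "\<And>n. pverts (G n) \<noteq> {}"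
    "filterlim (\<lambda>n. card (pverts (G n))) at_top sequentially"
    "\<And>I E. edge_set I E \<Longrightarrow> (\<lambda>n. graph_dens I E (G n)) \<longlonglongrightarrow> dens lam I E w"
    using graph_limit_nonempty[OF lim] by blast
  have "\<forall>n. \<exists>H. H \<in> P \<and> pverts H = pverts (G n) \<and> parcs H \<subseteq> parcs (G n)"
  proof
    fix n
    obtain H where "H \<in> P" "spanning (with_proj H) (with_proj (G n))" "pair_graph (G n)"
      using G(1)[of n] unfolding upward_closure_def by blast
    then show "\<exists>H. H \<in> P \<and> pverts H = pverts (G n) \<and> parcs H \<subseteq> parcs (G n)"
      using spanning_iff[OF P] by blast
  qed
  from choice[OF this] obtain H where H: "\<And>n. H n \<in> P" "\<And>n. pverts (H n) = pverts (G n)" "\<And>n. parcs (H n) \<subseteq> parcs (G n)"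
    by blast
  have fG: "finite (pverts (G n))" for n using G(1)[of n] by (simp add: upward_closure_def pair_graph_iff)
  have "\<exists>s \<theta> W. strict_mono (s :: nat \<Rightarrow> nat) \<and> (\<forall>n. uniformly_onto (\<theta> n) (pverts (G (s n)))) \<and> (\<forall>i. graphon (W i)) \<and>
    (AE z in lam \<Otimes>\<^sub>M lam. W False z \<le> W True z) \<and>
    (\<forall>i. (\<lambda>n. C4 lam (\<lambda>z. adj (parcs ((if i then G else H) (s n))) (\<theta> n (fst z), \<theta> n (snd z)) - W i z)) \<longlonglongrightarrow> 0) \<and>
    (\<forall>i I E. edge_set I E \<longrightarrow> (\<lambda>n. graph_dens I E ((if i then G else H) (s n))) \<longlonglongrightarrow> dens lam I E (W i))"
    by (rule graph_sequence_limit[where G="\<lambda>i. if i then G else H"]) (use G(2) H fG in auto)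
  then obtain s W where s: "strict_mono (s :: nat \<Rightarrow> nat)" and W: "\<And>i. graphon (W i)"
    and le: "AE z in lam \<Otimes>\<^sub>M lam. W False z \<le> W True z"
    and d: "\<And>i I E. edge_set I E \<Longrightarrow> (\<lambda>n. graph_dens I E ((if i then G else H) (s n))) \<longlonglongrightarrow> dens lam I E (W i)"
    by blast
  \<comment> \<open>The spanning subgraphs \<open>H\<close> have the same numbers of vertices as the
    graphs \<open>G\<close>, so they form a witnessing sequence of their own.\<close>
  have limF: "graph_limit P (W False)" unfolding graph_limit_def
  proof (intro exI[of _ "\<lambda>n. H (s n)"] conjI allI impI)
    show "filterlim (\<lambda>n. card (pverts (H (s n)))) at_top sequentially"
      unfolding H(2) by (rule filterlim_compose[OF G(3) filterlim_subseq[OF s]])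
  qed (use H(1) d[where i=False] in auto)
  have eq: "dens lam I E w = dens lam I E (W True)" if E: "edge_set I E" for I :: "nat set" and E
    using LIMSEQ_unique[OF LIMSEQ_subseq_LIMSEQ[OF G(4)[OF E] s, unfolded o_def]] d[OF E, of True] by simp
  have "\<exists>\<psi>. (\<forall>i. \<psi> i \<in> measurable lam lam \<and> distr lam lam (\<psi> i) = lam) \<and>
    (AE z in lam \<Otimes>\<^sub>M lam. w (\<psi> False (fst z), \<psi> False (snd z)) = W True (\<psi> True (fst z), \<psi> True (snd z)))"
    using weak_isomorphism[where W="\<lambda>i. if i then W True else w"] w W eq by simp
  then obtain \<psi> where \<psi>: "\<And>i :: bool. \<psi> i \<in> measurable lam lam" "\<And>i. distr lam lam (\<psi> i) = lam"
    and wW: "AE z in lam \<Otimes>\<^sub>M lam. w (\<psi> False (fst z), \<psi> False (snd z)) = W True (\<psi> True (fst z), \<psi> True (snd z))" by blast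
  \<comment> \<open>On the common copy, \<open>a\<close> is the pullback of \<open>u\<close> and
    \<open>b\<close> that of the limit of the subgraphs; their minimum lies below \<open>a\<close>
    at every point, as the next construction requires.\<close>
  define a where "a z = u (\<psi> False (fst z), \<psi> False (snd z))" for z
  define b where "b z = W False (\<psi> True (fst z), \<psi> True (snd z))" for z
  define m where "m z = min (a z) (b z)" for z
  have a: "graphon a" and b: "graphon b" unfolding a_def[abs_def] b_def[abs_def]
    using graphon_pullback[OF \<psi>(1)] u W by blast+
  have [measurable]: "a \<in> borel_measurable (lam \<Otimes>\<^sub>M lam)" "b \<in> borel_measurable (lam \<Otimes>\<^sub>M lam)"
    using a b by (auto intro: graphon_measurable)
  have m: "graphon m"
  proof -
    have "m \<in> borel_measurable (lam \<Otimes>\<^sub>M lam)" unfolding m_def[abs_def] by measurable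
    moreover have "m (x, y) = m (y, x)" for x y by (simp add: m_def graphon_sym[OF a, of x y] graphon_sym[OF b, of x y])
    moreover have "0 \<le> m z \<and> m z \<le> 1" for z using graphon_bounds[OF a, of z] graphon_bounds[OF b, of z] by (auto simp: m_def)
    ultimately show ?thesis unfolding graphon_def by blast
  qed
  have "dens lam I E (W False) = dens lam I E b" if "edge_set I E" for I :: "nat set" and E
    using dens_pullback[OF \<psi>(1)[of True] \<psi>(2)[of True] W[of False] that] by (simp add: b_def[abs_def])
  from graph_limit_cong[OF limF this] have limb: "graph_limit P b" .
  have "AE z in lam \<Otimes>\<^sub>M lam. b z \<in> {0, 1} \<longrightarrow> m z = b z"
    using wW AE_pullback[OF \<psi>(1,2) le, of True] AE_pullback[OF \<psi>(1,2) ae, of False]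
  proof eventually_elim
    case (elim z)
    show ?case
    proof
      assume "b z \<in> {0, 1}"
      then consider "b z = 0" | "b z = 1" by auto
      then show "m z = b z"
      proof cases
        case 1
        then show ?thesis using graphon_bounds[OF a, of z] by (simp add: m_def)
      next
        case 2
        then have "W True (\<psi> True (fst z), \<psi> True (snd z)) = 1"
          using elim(2) graphon_bounds[OF W, of True "(\<psi> True (fst z), \<psi> True (snd z))"] by (simp add: b_def)
        then have "a z = 1" using elim(1,3) by (simp add: a_def)
        with 2 show ?thesis by (simp add: m_def)
      qed
    qed
  qed
  from flexibleD[OF fl P b m limb this] have "graph_limit P m" .
  from graph_limit_upward_closure[where P=P, OF P this m a] have "graph_limit (upward_closure P) a" by (simp add: m_def)
  then show "graph_limit (upward_closure P) u"
    by (rule graph_limit_cong) (use dens_pullback[OF \<psi>(1,2) u, of _ _ False] in \<open>simp add: a_def[abs_def]\<close>)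
qed

theorem proposition3p29:
  shows "(\<forall>P. graph_property P \<and>
            (\<forall>W\<in>property_closure P. AE z in lebesgue_on unit_square. W z \<in> {0, 1})
          \<longrightarrow> flexible P) \<and>
         (\<forall>P. graph_property P \<and> flexible P
          \<longrightarrow> flexible (upward_closure P) \<and> flexible (downward_closure P)) \<and>
         (\<forall>P. graph_property P \<and> flexible P \<longrightarrow> flexible (complement_graph ` P)) \<and>
         (\<forall>P. graph_property P \<and> hereditary P \<longrightarrow> flexible P)"
proof (intro conjI allI impI)
  fix P assume P: "graph_property P \<and> (\<forall>W\<in>property_closure P. AE z in lebesgue_on unit_square. W z \<in> {0, 1})"
  show "flexible P"
    by (rule flexible_of_01_valued) (use P in \<open>auto simp: graph_property_def\<close>)
next
  fix P assume P: "graph_property P \<and> flexible P"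
  then have pg: "pair_graph G" if "G \<in> P" for G using that by (simp add: graph_property_def)
  have cg: "pair_graph G" if "G \<in> complement_graph ` P" for G using that pg pair_graph_complement_graph by auto
  have fl: "flexible P" using P by blast
  show "flexible (upward_closure P)" using pg fl by (rule flexible_upward_closure)
  show fc: "flexible (complement_graph ` P)" using pg fl by (rule flexible_complement)
  have "flexible (upward_closure (complement_graph ` P))" using cg fc by (rule flexible_upward_closure)
  then have "flexible (complement_graph ` upward_closure (complement_graph ` P))"
    by (intro flexible_complement) (simp_all add: upward_closure_def)
  then show "flexible (downward_closure P)" using downward_closure_eq[of P] pg by simp
next
  fix P assume "graph_property P \<and> hereditary P"
  then show "flexible P" using flexible_hereditary by blast
qed

end
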